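(* (i) If $\frac{\kappa}{s},\frac{\lambda}{s},\frac{\upsilon}{s},\frac{\varsigma}{s}\in\frac{1}{2}\mathbb{Z}$ with an even number of them being integers, then $c(x,z)=c^d(z,x)$. Moreover, if $(\kappa,\lambda,\upsilon,\varsigma)$ is any four-tuple of real parameters such that $c(x,z)=c^d(z,x)$ (as meromorphic functions in $(x,z)\in\mathbb{C}\times\mathbb{C}$), then, as meromorphic functions in $(x,z)$: (ii) $\widetilde{\Phi}(x,z)=\widetilde{\Phi}^d(z,x)$. (iii) $\widetilde{\Phi}(-x,z)=\widetilde{\Phi}(x,-z)$. (iv) $\mathcal{E}(x,z)=\widetilde{\Phi}(x,z)+\widetilde{\Phi}(-x,z)$.
   Context: Fix $\tau\in\sqrt{-1}\,\mathbb{R}_{>0}$, put $q^x:=e^{2\pi\sqrt{-1}\tau x}$ for $x\in\mathbb{C}$, so $0<q=e^{2\pi\sqrt{-1}\tau}<1$. Fix a step-size $s\in\mathbb{Q}_{>0}$ and real Hecke parameters $\kappa,\lambda,\upsilon,\varsigma$. Askey--Wilson parameters: $a_s=q^{\kappa+\lambda}$, $b_s=-q^{\kappa-\lambda}$, $c_s=q^{\frac{s}{2}+\upsilon+\varsigma}$, $d_s=-q^{\frac{s}{2}+\upsilon-\varsigma}$. Dual Askey--Wilson parameters ($\lambda$ and $\upsilon$ interchanged): $\widetilde a_s=q^{\kappa+\upsilon}$, $\widetilde b_s=-q^{\kappa-\upsilon}$, $\widetilde c_s=q^{\frac{s}{2}+\lambda+\varsigma}$, $\widetilde d_s=-q^{\frac{s}{2}+\lambda-\varsigma}$.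 $q$-shifted factorials: $(a_1,\ldots,a_m;p)_j=\prod_{r=1}^m\prod_{i=0}^{j-1}(1-a_rp^i)$ for $j\in\mathbb{Z}_{\geq 0}\cup\{\infty\}$. Theta functions: $\theta(u;p)=(u,p/u;p)_\infty$, $\theta(u_1,\ldots,u_r;p)=\prod_{i=1}^r\theta(u_i;p)$. $W(x,z)=q^{(\kappa+\lambda+x)(\kappa+\upsilon+z)/s}$, $\ \mathrm{St}(x)=\bigl(q^{s+x}/a_s,q^{s+x}/b_s,q^{s+x}/c_s,q^{s+x}/d_s;q^s\bigr)_\infty$, $\ \mathrm{St}^d(z)=\bigl(q^{s+z}/\widetilde a_s,q^{s+z}/\widetilde b_s,q^{s+z}/\widetilde c_s,q^{s+z}/\widetilde d_s;q^s\bigr)_\infty$. Very-well-poised series in base $p$ ($0<p<1$): ${}_8W_7(\alpha_0;\alpha_1,\ldots,\alpha_5;p,u)=\sum_{r=0}^\infty\frac{1-\alpha_0p^{2r}}{1-\alpha_0}u^r\prod_{j=0}^5\frac{(\alpha_j;p)_r}{(p\alpha_0/\alpha_j;p)_r}$ for $|u|<1$. $\Psi(x,z)$ is the holomorphic function on $\mathbb{C}\times\mathbb{C}$ which for $|d_sq^x|<1$ is given by $$\Psi(x,z)=\frac{\Bigl(\frac{q^{s+x+z}a_s}{\widetilde{a}_s},\frac{q^{s+x+z}b_s}{\widetilde{a}_s},\frac{q^{s+x+z}c_s}{\widetilde{a}_s},\frac{q^{s+x+z}\widetilde{a}_s}{d_s},q^{s+2z},d_sq^x;q^s\Bigr)_{\infty}}{\Bigl(\frac{q^{2s+x+2z}}{d_s};q^s\Bigr)_{\infty}}\;{}_8W_7\Bigl(\frac{q^{s+x+2z}}{d_s};\frac{q^{s+z}}{\widetilde{a}_s},\frac{q^{s+z}}{\widetilde{d}_s},\widetilde{b}_sq^z,\widetilde{c}_sq^z,\frac{q^{s+x}}{d_s};q^s,d_sq^x\Bigr).$$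 The asymptotically free eigenfunction is the meromorphic function $\Phi(x,z)=\frac{W(x,z)}{\mathrm{St}(x)\mathrm{St}^d(z)}\Psi(x,z)$. The normalized $c$-function is $$c(x,z)=c(x,z;\kappa,\lambda,\upsilon,\varsigma;q,s)=\frac{\theta\bigl(\widetilde a_sq^{-z},\widetilde b_sq^{-z},\widetilde c_sq^{-z},\frac{d_sq^{x-z}}{\widetilde a_s};q^s\bigr)}{W(x,z)\,\theta\bigl(q^{-2z},d_sq^x;q^s\bigr)},$$ and $c^d(x,z)=c(x,z;\kappa,\upsilon,\lambda,\varsigma;q,s)$. The renormalized eigenfunction is $\widetilde\Phi(x,z)=\widetilde\Phi(x,z;\kappa,\lambda,\upsilon,\varsigma;q,s):=c(x,z)\Phi(x,z)$, and $\widetilde\Phi^d(z,x):=\widetilde\Phi(z,x;\kappa,\upsilon,\lambda,\varsigma;q,s)$, i.e. the function $\widetilde\Phi$ for the parameters with $\lambda$ and $\upsilon$ interchanged, evaluated at first argument $z$ and second argument $x$. The Askey--Wilson function $\mathcal{E}(x,z)$ is the meromorphic function on $\mathbb{C}\times\mathbb{C}$ which for $|q^{s-z}/\widetilde d_s|<1$ is given by $$\mathcal{E}(x,z)=\frac{\Bigl(\frac{\widetilde a_sq^{s+z-x}}{d_s},\frac{\widetilde a_sq^{s+z+x}}{d_s},a_sb_s,a_sc_s,\frac{q^sa_s}{d_s};q^s\Bigr)_\infty}{\Bigl(\frac{q^{s+x}}{d_s},\frac{q^{s-x}}{d_s},\frac{q^{s+z}}{\widetilde d_s},\widetilde a_s\widetilde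 b_s\widetilde c_sq^z;q^s\Bigr)_\infty}\;{}_8W_7\Bigl(\widetilde a_s\widetilde b_s\widetilde c_sq^{-s+z};a_sq^x,a_sq^{-x},\widetilde a_sq^z,\widetilde b_sq^z,\widetilde c_sq^z;q^s,\frac{q^{s-z}}{\widetilde d_s}\Bigr).$$ *)

theory Defs
  imports "HOL-Analysis.Analysis"
begin

section \<open>Holomorphic and meromorphic functions of two complex variables\<close>

text \<open>
  Complex Frechet differentiability at every point of \<open>D\<close>; meant for open \<open>D\<close>.
\<close>

definition holomorphic2_on :: "(complex \<times> complex \<Rightarrow> complex) \<Rightarrow> (complex \<times> complex) set \<Rightarrow> bool"
  where "holomorphic2_on f D \<longleftrightarrow>
    (\<forall>w\<in>D. \<exists>a b. (f has_derivative (\<lambda>h. a * fst h + b * snd h)) (at w))"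

text \<open>
  A meromorphic function is represented by a total function that is locally a quotient \<open>g / h\<close> of
  holomorphic functions with \<open>h\<close> not identically zero on a connected neighbourhood.  The values of
  the representative on the zero set of \<open>h\<close> are irrelevant, so two representatives stand for the
  same meromorphic function on an open set \<open>D\<close> iff they agree on an open dense subset of \<open>D\<close>.
\<close>

definition meromorphic2_on :: "(complex \<times> complex \<Rightarrow> complex) \<Rightarrow> (complex \<times> complex) set \<Rightarrow> bool"
  where "meromorphic2_on f D \<longleftrightarrow>
    (\<forall>w\<in>D. \<exists>U g h. open U \<and> connected U \<and> w \<in> U \<and> U \<subseteq> D \<and>
       holomorphic2_on g U \<and> holomorphic2_on h U \<and> (\<exists>v\<in>U. h v \<noteq> 0) \<and>
       (\<forall>v\<in>U. h v \<noteq> 0 \<longrightarrow> f v = g v / h v))"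

definition mero_eq_on ::
    "(complex \<times> complex) set \<Rightarrow> (complex \<times> complex \<Rightarrow> complex) \<Rightarrow> (complex \<times> complex \<Rightarrow> complex) \<Rightarrow> bool"
  where "mero_eq_on D f g \<longleftrightarrow>
    (\<exists>V. open V \<and> V \<subseteq> D \<and> D \<subseteq> closure V \<and> (\<forall>v\<in>V. f v = g v))"

abbreviation mero_eq :: "(complex \<times> complex \<Rightarrow> complex) \<Rightarrow> (complex \<times> complex \<Rightarrow> complex) \<Rightarrow> bool"
  where "mero_eq \<equiv> mero_eq_on UNIV"


section \<open>\<open>q\<close>-shifted factorials, theta functions, very-well-poised series\<close>

definition qpoch :: "complex \<Rightarrow> complex \<Rightarrow> nat \<Rightarrow> complex"
  where "qpoch a p j = (\<Prod>i<j. 1 - a * p ^ i)"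

definition qpoch_inf :: "complex list \<Rightarrow> complex \<Rightarrow> complex"
  where "qpoch_inf as p = (\<Prod>a\<leftarrow>as. \<Prod>i. 1 - a * p ^ i)"

definition theta :: "complex list \<Rightarrow> complex \<Rightarrow> complex"
  where "theta us p = (\<Prod>u\<leftarrow>us. qpoch_inf [u, p / u] p)"

text \<open>\<open>W87 \<alpha>0 [\<alpha>1, \<dots>, \<alpha>5] p u\<close> is the series with base \<open>p\<close> and argument \<open>u\<close>.\<close>

definition W87 :: "complex \<Rightarrow> complex list \<Rightarrow> complex \<Rightarrow> complex \<Rightarrow> complex"
  where "W87 \<alpha>0 \<alpha>s p u =
    (\<Sum>r. (1 - \<alpha>0 * p ^ (2 * r)) / (1 - \<alpha>0) * u ^ r *
          (\<Prod>\<alpha>\<leftarrow>\<alpha>0 # \<alpha>s. qpoch \<alpha> p r / qpoch (p * \<alpha>0 / \<alpha>) p r))"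


section \<open>Askey--Wilson parameters\<close>

text \<open>
  The fields are \<open>\<tau>\<close>, the step-size \<open>s\<close> and the Hecke parameters
  \<open>\<kappa>\<close>, lambda, \<open>\<upsilon>\<close> and varsigma.
\<close>

record aw_params =
  tau :: complex
  step :: real
  kap :: real
  lam :: real
  ups :: real
  vsig :: real

definition dual :: "aw_params \<Rightarrow> aw_params"
  where "dual P = P\<lparr>lam := ups P, ups := lam P\<rparr>"

definition qpw :: "aw_params \<Rightarrow> complex \<Rightarrow> complex"
  where "qpw P x = exp (2 * of_real pi * \<i> * tau P * x)"

abbreviation base :: "aw_params \<Rightarrow> complex"
  where "base P \<equiv> qpw P (of_real (step P))"

definition aw_a :: "aw_params \<Rightarrow> complex"
  where "aw_a P = qpw P (of_real (kap P + lam P))"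

definition aw_b :: "aw_params \<Rightarrow> complex"
  where "aw_b P = - qpw P (of_real (kap P - lam P))"

definition aw_c :: "aw_params \<Rightarrow> complex"
  where "aw_c P = qpw P (of_real (step P / 2 + ups P + vsig P))"

definition aw_d :: "aw_params \<Rightarrow> complex"
  where "aw_d P = - qpw P (of_real (step P / 2 + ups P - vsig P))"


section \<open>The asymptotically free eigenfunction\<close>

definition W_fun :: "aw_params \<Rightarrow> complex \<Rightarrow> complex \<Rightarrow> complex"
  where "W_fun P x z =
    qpw P ((of_real (kap P + lam P) + x) * (of_real (kap P + ups P) + z) / of_real (step P))"

text \<open>\<open>St (dual P)\<close> is the function \<open>St\<^sup>d\<close>.\<close>

definition St :: "aw_params \<Rightarrow> complex \<Rightarrow> complex"
  where "St P x =
    (let Q = qpw P (of_real (step P) + x)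
     in qpoch_inf [Q / aw_a P, Q / aw_b P, Q / aw_c P, Q / aw_d P] (base P))"

definition Psi_series :: "aw_params \<Rightarrow> complex \<Rightarrow> complex \<Rightarrow> complex"
  where "Psi_series P x z =
    (let s = of_real (step P); p = base P; q = qpw P;
         a = aw_a P; b = aw_b P; c = aw_c P; d = aw_d P;
         a' = aw_a (dual P); b' = aw_b (dual P); c' = aw_c (dual P); d' = aw_d (dual P)
     in qpoch_inf [q (s + x + z) * a / a', q (s + x + z) * b / a', q (s + x + z) * c / a',
                   q (s + x + z) * a' / d, q (s + 2 * z), d * q x] p
        / qpoch_inf [q (2 * s + x + 2 * z) / d] p
        * W87 (q (s + x + 2 * z) / d)
            [q (s + z) / a', q (s + z) / d', b' * q z, c' * q z, q (s + x) / d] p (d * q x))"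

text \<open>
  The defining formula has removable singularities, where HOL division gives arbitrary values;
  hence the comparison on an open dense subset of the half-space.  By the identity theorem at most
  one entire function satisfies the description.
\<close>

definition Psi :: "aw_params \<Rightarrow> complex \<Rightarrow> complex \<Rightarrow> complex"
  where "Psi P x z =
    (THE F. holomorphic2_on F UNIV \<and>
       mero_eq_on {(x, z). norm (aw_d P * qpw P x) < 1} F (\<lambda>(x, z). Psi_series P x z)) (x, z)"

definition Phi :: "aw_params \<Rightarrow> complex \<Rightarrow> complex \<Rightarrow> complex"
  where "Phi P x z = W_fun P x z / (St P x * St (dual P) z) * Psi P x z"


section \<open>The normalized \<open>c\<close>-function and the renormalized eigenfunction\<close>

definition c_fun :: "aw_params \<Rightarrow> complex \<Rightarrow> complex \<Rightarrow> complex"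
  where "c_fun P x z =
    (let p = base P; q = qpw P; d = aw_d P;
         a' = aw_a (dual P); b' = aw_b (dual P); c' = aw_c (dual P)
     in theta [a' * q (- z), b' * q (- z), c' * q (- z), d * q (x - z) / a'] p
        / (W_fun P x z * theta [q (- 2 * z), d * q x] p))"

definition Phi_ren :: "aw_params \<Rightarrow> complex \<Rightarrow> complex \<Rightarrow> complex"
  where "Phi_ren P x z = c_fun P x z * Phi P x z"


section \<open>The Askey--Wilson function\<close>

definition AW_series :: "aw_params \<Rightarrow> complex \<Rightarrow> complex \<Rightarrow> complex"
  where "AW_series P x z =
    (let s = of_real (step P); p = base P; q = qpw P;
         a = aw_a P; b = aw_b P; c = aw_c P; d = aw_d P;
         a' = aw_a (dual P); b' = aw_b (dual P); c' = aw_c (dual P); d' = aw_d (dual P)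
     in qpoch_inf [a' * q (s + z - x) / d, a' * q (s + z + x) / d, a * b, a * c, p * a / d] p
        / qpoch_inf [q (s + x) / d, q (s - x) / d, q (s + z) / d', a' * b' * c' * q z] p
        * W87 (a' * b' * c' * q (- s + z))
            [a * q x, a * q (- x), a' * q z, b' * q z, c' * q z] p (q (s - z) / d'))"

text \<open>
  \<open>SOME\<close> picks a representative; the meromorphic function itself is determined by the description.
  If \<open>a' * c' = a * c\<close> is a nonpositive integer power of \<open>q\<^sup>s\<close>, then the denominator factor
  \<open>qpoch (a' * c') p r\<close> of the series vanishes for large \<open>r\<close> and the formula would need the
  usual limiting interpretation.  This never happens when the \<open>c\<close>-function is self-dual.
\<close>

definition AW_fun :: "aw_params \<Rightarrow> complex \<Rightarrow> complex \<Rightarrow> complex"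
  where "AW_fun P x z =
    (SOME F. meromorphic2_on F UNIV \<and>
       mero_eq_on {(x, z). norm (qpw P (of_real (step P) - z) / aw_d (dual P)) < 1}
         F (\<lambda>(x, z). AW_series P x z)) (x, z)"

end

theory Submission
  imports Defs "HOL-Complex_Analysis.Complex_Analysis"
begin

text \<open>
  Write \<open>p = q^s\<close>, \<open>X = q^x\<close>, \<open>Z = q^z\<close>.  Bailey's two-term transformation of nonterminating
  \<open>8W7\<close> series shows that \<open>\<Psi>\<close> is entire in \<open>(X, Z)\<close> (it moves the poles of one representation away from
  those of another one, and the Taylor coefficients in one variable then propagate along the other)
  and that it is invariant under \<open>x \<leftrightarrow> z\<close>, \<open>lambda \<leftrightarrow> \<upsilon>\<close>.  Hence self-duality of the \<open>c\<close>-function carries over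
  to the renormalized eigenfunction.  The three-term transformation expands the Askey--Wilson function as
  \<open>E(x, z) = \<Phi>(x, z) + \<Phi>(x, -z)\<close> with \<open>\<Phi>\<close> renormalized, first where all series converge and then
  everywhere by the identity theorem.  The left-hand side is even in \<open>x\<close>; comparing this with the same fact for
  the dual parameters gives \<open>2 \<Phi>(-x, z) = 2 \<Phi>(x, -z)\<close>.  For half-integral parameters all theta functions in
  \<open>c\<close> differ from \<open>\<theta>(u)\<close>, \<open>\<theta>(p^(1/2) u)\<close> by monomials, whose exponents and constants turn out to be
  symmetric in lambda and \<open>\<upsilon>\<close>.
\<close>

section \<open>Terminating series\<close>

text \<open>Both transformations of infinite series grow out of finite ones: telescoping proves two
  summation formulas, these give Watson's transformation, and applying Watson's twice gives the
  terminating cases, which are then interpolated. The obstacle is that nearly every quotient has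
  poles or removable singularities, so that the formulas hold only at generic points. Series are
  therefore multiplied by the products that cancel their poles, genericity is stated as finitely
  many monomials in \<open>X\<close>, \<open>Z\<close> avoiding the powers of \<open>p\<close>, and
  the missing points are recovered by the identity theorem in two variables. Reality of the
  parameters enters through signs. With \<open>a, b, c, d\<close> the Askey--Wilson parameters and
  \<open>t\<close> the dual \<open>a\<close>, the numbers \<open>a, c, t\<close> are positive and
  \<open>b, d\<close> negative; hence \<open>a / d\<close> and \<open>t^2 / (a d)\<close> are never
  powers of \<open>p\<close>, which keeps the poles of two representations of \<Psi> apart. The
  lower parameter \<open>a c\<close> of the Askey--Wilson series is positive and can be a power of
  \<open>p\<close>; self-duality has to exclude this.\<close>

lemma qpoch_0 [simp]: "qpoch a p 0 = 1"
  by (simp add: qpoch_def)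

lemma qpoch_Suc: "qpoch a p (Suc n) = qpoch a p n * (1 - a * p ^ n)"
  by (simp add: qpoch_def)

lemma qpoch_add: "qpoch a p (m + n) = qpoch a p m * qpoch (a * p ^ m) p n"
proof (induction n)
  case (Suc n)
  have "qpoch a p (m + Suc n) = qpoch a p (m + n) * (1 - a * p ^ (m + n))"
    by (simp add: qpoch_Suc)
  also have "\<dots> = qpoch a p m * (qpoch (a * p ^ m) p n * (1 - a * p ^ m * p ^ n))"
    by (simp only: Suc.IH power_add mult.assoc)
  finally show ?case by (simp only: qpoch_Suc)
qed simp

lemma qpoch_Suc_left: "qpoch a p (Suc n) = (1 - a) * qpoch (a * p) p n"
proof -
  have "qpoch a p (Suc n) = qpoch a p 1 * qpoch (a * p ^ 1) p n"
    using qpoch_add[of a p 1 n] by (simp only: plus_1_eq_Suc)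
  also have "qpoch a p 1 = 1 - a" by (simp add: qpoch_def)
  finally show ?thesis by (simp only: power_one_right)
qed

text \<open>Under this condition no \<open>qpoch x q n\<close> vanishes and, for
  \<open>norm q < 1\<close>, neither does the infinite product (\<open>Q_eq_0_iff\<close>). It is
  imposed on the lower parameters of series.\<close>

definition qfree :: "complex \<Rightarrow> complex \<Rightarrow> bool"
  where "qfree q x \<longleftrightarrow> (\<forall>n. x * q ^ n \<noteq> 1)"

lemma qpoch_nonzero: "qfree q x \<Longrightarrow> qpoch x q n \<noteq> 0"
  by (auto simp: qpoch_def qfree_def)

lemma qfree_mult: "qfree q x \<Longrightarrow> qfree q (x * q ^ n)"
  by (auto simp: qfree_def mult.assoc simp flip: power_add)

lemma qfree_mult1: "qfree q x \<Longrightarrow> qfree q (x * q)"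
  using qfree_mult[of q x 1] by simp

lemma qfree_1: "qfree q x \<Longrightarrow> x \<noteq> 1"
  by (auto simp: qfree_def dest: spec[of _ 0])

lemma qfree_D: "qfree q x \<Longrightarrow> 1 - x * q ^ n \<noteq> 0"
  by (auto simp: qfree_def dest: spec[of _ n])

text \<open>The theory of basic series is developed for a general complex base; the locale
  \<open>aw\<close> instantiates it with \<open>q ^ s\<close>.\<close>

locale qbase =
  fixes q :: complex
  assumes q_nonzero [simp]: "q \<noteq> 0" and norm_q: "norm q < 1"
begin

abbreviation "P x n \<equiv> qpoch x q n"

lemma q_power_ne_1: "n > 0 \<Longrightarrow> q ^ n \<noteq> 1"
proof
  assume "n > 0" "q ^ n = 1"
  then have "norm q ^ n = 1" by (metis norm_one norm_power)
  with \<open>n > 0\<close> norm_q show False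
    by (metis norm_ge_zero power_less_one_iff less_irrefl)
qed

lemma qfree_q: "qfree q q"
  using q_power_ne_1 by (auto simp: qfree_def simp flip: power_Suc)

lemma P_q_nonzero [simp]: "P q n \<noteq> 0"
  by (rule qpoch_nonzero[OF qfree_q])

text \<open>This is \<open>(- x) ^ n * q ^ (- n (n + 1) / 2)\<close>, the monomial that splits off
  when the factors of \<open>P (x / q ^ n) n\<close> are read backwards. Kept as a product it obeys
  \<open>refl_mult\<close>, so such monomials cancel without computing with exponents.\<close>

definition refl :: "complex \<Rightarrow> nat \<Rightarrow> complex"
  where "refl x n = (\<Prod>k<n. - x / q ^ Suc k)"

lemma refl_nonzero: "x \<noteq> 0 \<Longrightarrow> refl x n \<noteq> 0"
  by (simp add: refl_def)

lemma refl_mult: "refl (x * y) n = x ^ n * refl y n"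
  by (induction n) (simp_all add: refl_def)

lemma qpoch_reflect:
  assumes "x \<noteq> 0" shows "P (x / q ^ n) n = refl x n * P (q / x) n"
proof -
  have "P (x / q ^ n) n = (\<Prod>i<n. 1 - x / q ^ n * q ^ (n - Suc i))"
    unfolding qpoch_def by (rule prod.nat_diff_reindex[symmetric])
  also have "\<dots> = (\<Prod>i<n. (- x / q ^ Suc i) * (1 - q / x * q ^ i))"
  proof (rule prod.cong)
    fix i assume "i \<in> {..<n}"
    then have "q ^ n = q ^ (n - Suc i) * q ^ Suc i"
      by (simp flip: power_add del: power_Suc)
    then show "1 - x / q ^ n * q ^ (n - Suc i) = (- x / q ^ Suc i) * (1 - q / x * q ^ i)"
      using assms by (simp add: field_simps)
  qed simp
  also have "\<dots> = refl x n * P (q / x) n"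
    by (simp only: prod.distrib refl_def qpoch_def)
  finally show ?thesis .
qed

lemma qpoch_inverse_power_eq_0: "n < k \<Longrightarrow> P (1 / q ^ n) k = 0"
  by (auto simp: qpoch_def prod_zero_iff)

section \<open>Two summation formulas proved by telescoping\<close>

text \<open>A telescoping induction on \<open>n\<close>: with \<open>\<rho>\<close> the ratio of
  consecutive right-hand sides, \<open>t (Suc n) k - \<rho> * t n k\<close> is a difference in
  \<open>k\<close>. The last hypothesis says that \<open>P (C / (A * B)) n\<close> is non-zero. It
  is confined to \<open>k \<le> n\<close> because in \<open>watson\<close> the quotient is
  \<open>c / (a * q ^ r)\<close>, whose multiples by powers of \<open>q\<close> are known to avoid 1
  only in this range.\<close>

lemma q_saalschuetz:
  assumes "A \<noteq> 0" "B \<noteq> 0" "C \<noteq> 0" "qfree q C"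
    and "\<And>k. 0 < k \<Longrightarrow> k \<le> n \<Longrightarrow> C / (A * B) * q ^ (k - 1) \<noteq> 1"
  shows "(\<Sum>k\<le>n. P (1 / q ^ n) k * P A k * P B k / (P q k * P C k * P (A * B * q / (C * q ^ n)) k) * q ^ k)
     = P (C / A) n * P (C / B) n / (P C n * P (C / (A * B)) n)"
  using assms(5)
proof (induction n)
  case 0
  then show ?case by simp
next
  case (Suc n)
  define N where "N = q ^ n"
  define D where "D = A * B / (C * N)"
  define R where "R = (\<lambda>n. P (C / A) n * P (C / B) n / (P C n * P (C / (A * B)) n))"
  define t where "t = (\<lambda>n k. P (1 / q ^ n) k * P A k * P B k / (P q k * P C k * P (A * B * q / (C * q ^ n)) k) * q ^ k)"
  \<comment> \<open>The antidifference: \<open>t (Suc n) k - \<rho> * t n k\<close> equals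
    \<open>(g (Suc k) - g k) / (1 - C * N)\<close>. The value \<open>g 0 = 0\<close> makes the lower
    end of the telescope vanish.\<close>
  define g where "g = (\<lambda>k. case k of 0 \<Rightarrow> 0 | Suc j \<Rightarrow> P A k * P B k * P (1 / N) j / (P q j * P C j * P D k))"
  have N0: "N \<noteq> 0" by (simp add: N_def)
  have AB: "A * B \<noteq> 0" "A * B * q \<noteq> 0" using assms by auto
  have CN: "C * N \<noteq> 1" using assms(4) by (auto simp: qfree_def N_def)
  have CABN: "C * N \<noteq> A * B"
    using Suc.prems[of "Suc n"] assms by (auto simp: N_def field_simps)
  have Dk: "D * q ^ k \<noteq> 1" if "k \<le> n" for k
  proof
    assume "D * q ^ k = 1"
    then have "A * B * q ^ k = C * q ^ n"
      using assms by (simp add: D_def N_def field_simps)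
    also have "q ^ n = q ^ (n - k) * q ^ k" using that by (simp flip: power_add)
    finally have "A * B = C * q ^ (n - k)" by simp
    with Suc.prems[of "Suc n - k"] that assms show False by (simp add: field_simps Suc_diff_le)
  qed
  have PD: "P D k \<noteq> 0" if "k \<le> Suc n" for k
  proof -
    have "\<forall>i<k. D * q ^ i \<noteq> 1" using Dk that by auto
    then show ?thesis by (auto simp: qpoch_def)
  qed
  have PDq: "P (D * q) k \<noteq> 0" if "k \<le> n" for k
    using PD[of "Suc k"] that by (simp add: qpoch_Suc_left)
  define \<rho> where "\<rho> = (1 - C / A * N) * (1 - C / B * N) / ((1 - C * N) * (1 - C / (A * B) * N))"
  have R_Suc: "R (Suc n) = \<rho> * R n"
    by (simp add: R_def \<rho>_def qpoch_Suc N_def mult_ac)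
  have step: "t (Suc n) k - \<rho> * t n k = (g (Suc k) - g k) / (1 - C * N)" if "k \<le> n" for k
  proof (cases k)
    case 0
    have "1 - \<rho> = (1 - A) * (1 - B) / (1 - D) / (1 - C * N)"
    proof -
      have "1 - D = - D * (1 - C / (A * B) * N)"
        using assms N0 by (simp add: D_def field_simps)
      then have "(1 - A) * (1 - B) / (1 - D) / (1 - C * N)
         = (1 - A) * (1 - B) * (- (C * N) / (A * B)) / ((1 - C * N) * (1 - C / (A * B) * N))"
        using assms N0 by (simp add: D_def)
      moreover have "1 - \<rho> = ((1 - C * N) * (1 - C / (A * B) * N) - (1 - C / A * N) * (1 - C / B * N))
            / ((1 - C * N) * (1 - C / (A * B) * N))"
        using CN CABN assms by (simp add: \<rho>_def divide_simps)
      moreover have "(1 - C * N) * (1 - C / (A * B) * N) - (1 - C / A * N) * (1 - C / B * N)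
          = (1 - A) * (1 - B) * (- (C * N) / (A * B))"
        using assms by (simp add: field_simps)
      ultimately show ?thesis by simp
    qed
    then show ?thesis using 0 by (simp add: t_def g_def qpoch_Suc N_def)
  next
    case (Suc j)
    define K where "K = q ^ j"
    have nz: "P q j \<noteq> 0" "P C j \<noteq> 0" "P D (Suc j) \<noteq> 0" "1 - q * K \<noteq> 0" "1 - C * K \<noteq> 0"
       "1 - D * (q * K) \<noteq> 0" "1 - D \<noteq> 0" "1 - D * K \<noteq> 0" "P (D * q) j \<noteq> 0" "P D j \<noteq> 0"
      using PD[of "Suc j"] PD[of "Suc (Suc j)"] PDq[of j] PD[of j] that Suc
        qpoch_nonzero[OF assms(4)] qfree_D[OF assms(4), of j] qfree_D[OF qfree_q, of j] Dk[of 0] Dk[of j]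
      by (auto simp: qpoch_Suc K_def mult_ac)
    define G where "G = P (1 / N) j * P A j * P B j * (1 - A * K) * (1 - B * K) / (P q j * P C j * P D (Suc j))"
    have DqN: "A * B * q / (C * q ^ Suc n) = D" "A * B * q / (C * q ^ n) = D * q"
      by (simp_all add: D_def N_def field_simps)
    have a1: "P (1 / q ^ Suc n) (Suc j) = (1 - 1 / (N * q)) * P (1 / N) j"
      by (simp add: qpoch_Suc_left N_def field_simps)
    have e1: "t (Suc n) k = G * ((1 - 1 / (N * q)) * (q * K) / ((1 - q * K) * (1 - C * K)))"
      unfolding t_def Suc DqN a1 G_def qpoch_Suc[of A] qpoch_Suc[of B] qpoch_Suc[of C] qpoch_Suc[of q]
      by (simp add: K_def[symmetric] mult_ac)
    have PDD: "(1 - D) * P (D * q) (Suc j) = P D (Suc j) * (1 - D * (q * K))"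
      using qpoch_Suc_left[of D q "Suc j"] qpoch_Suc[of D q "Suc j"] by (simp add: K_def)
    have "P (D * q) (Suc j) = P D (Suc j) * (1 - D * (q * K)) / (1 - D)"
      using PDD nz by (simp add: field_simps)
    then have e2: "t n k = G * ((1 - K / N) * (1 - D) * (q * K) / ((1 - q * K) * (1 - C * K) * (1 - D * (q * K))))"
      unfolding t_def Suc DqN G_def qpoch_Suc[of A] qpoch_Suc[of B] qpoch_Suc[of C] qpoch_Suc[of q]
        qpoch_Suc[of "1 / q ^ n"]
      by (simp add: K_def[symmetric] N_def[symmetric] mult_ac)
    have e3: "g k = G" unfolding g_def Suc G_def by (simp add: qpoch_Suc K_def)
    have e4: "g (Suc k) = G * ((1 - A * (q * K)) * (1 - B * (q * K)) * (1 - K / N) / ((1 - q * K) * (1 - C * K) * (1 - D * (q * K))))"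
      unfolding g_def Suc G_def nat.case qpoch_Suc[of A] qpoch_Suc[of B] qpoch_Suc[of C] qpoch_Suc[of q]
        qpoch_Suc[of "1 / N"] qpoch_Suc[of D q "Suc j"]
      by (simp add: K_def[symmetric] mult_ac)
    define d1 d2 d3 d4 where "d1 = 1 - q * K" and "d2 = 1 - C * K" and "d3 = 1 - D * (q * K)" and "d4 = 1 - C * N"
    have Dn: "D * (C * N) = A * B" using assms N0 by (simp add: D_def)
    have rho: "\<rho> * (1 - D) = - D * (1 - C / A * N) * (1 - C / B * N) / d4"
    proof -
      have "1 - D = - D * (1 - C / (A * B) * N)"
        using assms N0 by (simp add: D_def field_simps)
      moreover have "1 - C / (A * B) * N \<noteq> 0" using CABN AB by (simp add: field_simps)
      moreover have "x * y / (d * w) * (- D * w) = - D * x * y / d" if "w \<noteq> 0" for x y d w :: complex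
        using that by simp
      ultimately show ?thesis unfolding \<rho>_def d4_def by metis
    qed
    have rho': "\<rho> * (1 - D) = - (D - A - B + C * N) / d4"
    proof -
      have "- D * (1 - C / A * N) * (1 - C / B * N) = - (D - A - B + C * N)"
      proof -
        have "D * (1 - C / A * N) * (1 - C / B * N) = D - D * (C * N) / A - D * (C * N) / B + D * (C * N) * (C * N) / (A * B)"
          using assms(1,2) by (simp add: field_simps)
        also have "\<dots> = D - B - A + C * N"
          unfolding Dn using assms by simp
        finally show ?thesis by simp
      qed
      then show ?thesis unfolding rho by simp
    qed
    \<comment> \<open>What remains after clearing denominators, with \<open>k = q * K\<close>,
      \<open>M = K / N\<close> and \<open>c = C * N\<close>; the parameters are linked by
      \<open>A * B = D * c\<close>.\<close>
    have poly: "(k - M) * (1 - D * k) * (1 - c) + (D - A - B + c) * (1 - M) * k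
        = (1 - A * k) * (1 - B * k) * (1 - M) - (1 - k) * (1 - c * M) * (1 - D * k)"
      if "A * B = D * c" for k M c
    proof -
      have h: "(1 - A * k) * (1 - B * k) = 1 - (A + B) * k + A * B * k * k"
        by (simp add: algebra_simps)
      show ?thesis unfolding h that by (simp add: algebra_simps)
    qed
    have key: "((1 - 1 / (N * q)) * (q * K) * d3 * d4 + (D - A - B + C * N) * (1 - K / N) * (q * K))
       = (1 - A * (q * K)) * (1 - B * (q * K)) * (1 - K / N) - d1 * d2 * d3"
    proof -
      have "(1 - 1 / (N * q)) * (q * K) = q * K - K / N" "d2 = 1 - C * N * (K / N)"
        using N0 by (simp_all add: field_simps d2_def)
      then show ?thesis using poly[of "C * N" "q * K" "K / N"] Dn
        by (simp add: d1_def d3_def d4_def)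
    qed
    have dn: "d1 \<noteq> 0" "d2 \<noteq> 0" "d3 \<noteq> 0" "d4 \<noteq> 0" using nz CN by (auto simp: d1_def d2_def d3_def d4_def)
    have comb1: "G * (x / (d1 * d2)) - r * (G * (y * (1 - D) * z / (d1 * d2 * d3)))
       = G * ((x * d3 * d4 + w * y * z) / (d1 * d2 * d3 * d4))" if "r * (1 - D) = - w / d4" for x y z r w
    proof -
      have "r * (G * (y * (1 - D) * z / (d1 * d2 * d3))) = G * (y * (r * (1 - D)) * z / (d1 * d2 * d3))"
        by simp
      also have "\<dots> = - (G * (w * y * z / (d1 * d2 * d3 * d4)))" unfolding that by (simp add: mult_ac)
      finally have *: "r * (G * (y * (1 - D) * z / (d1 * d2 * d3))) = - (G * (w * y * z / (d1 * d2 * d3 * d4)))" .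
      show ?thesis unfolding * using dn by (simp add: add_divide_distrib distrib_left)
    qed
    have comb2: "G * ((x - d1 * d2 * d3) / (d1 * d2 * d3 * d4)) = (G * (x / (d1 * d2 * d3)) - G) / d4" for x
      using dn by (simp add: diff_divide_distrib right_diff_distrib)
    have "t (Suc n) k - \<rho> * t n k = G * (((1 - 1 / (N * q)) * (q * K) * d3 * d4 + (D - A - B + C * N) * (1 - K / N) * (q * K)) / (d1 * d2 * d3 * d4))"
      unfolding e1 e2 d1_def[symmetric] d2_def[symmetric] d3_def[symmetric] by (rule comb1[OF rho'])
    also have "\<dots> = (g (Suc k) - g k) / d4"
      unfolding key e3 e4 d1_def[symmetric] d2_def[symmetric] d3_def[symmetric] by (rule comb2)
    finally show ?thesis by (simp add: d4_def)
  qed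
  have IH: "(\<Sum>k\<le>n. t n k) = R n"
    unfolding t_def R_def by (rule Suc.IH) (use Suc.prems in auto)
  have "(\<Sum>k\<le>n. t (Suc n) k) - \<rho> * R n = (\<Sum>k\<le>n. t (Suc n) k - \<rho> * t n k)"
    by (simp add: sum_subtractf sum_distrib_left IH[symmetric])
  also have "\<dots> = (\<Sum>k\<le>n. (g (Suc k) - g k) / (1 - C * N))"
    by (rule sum.cong) (auto simp: step)
  also have "\<dots> = g (Suc n) / (1 - C * N)"
    unfolding sum_divide_distrib[symmetric] lessThan_Suc_atMost[symmetric] sum_lessThan_telescope
    by (simp add: g_def)
  \<comment> \<open>The telescope runs to \<open>k = n\<close> only; its upper end is minus the
    additional term \<open>k = Suc n\<close> of the longer sum.\<close>
  also have "\<dots> = - t (Suc n) (Suc n)"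
  proof -
    have "P (1 / q ^ Suc n) (Suc n) = (1 - 1 / (N * q)) * P (1 / N) n"
      by (simp add: qpoch_Suc_left N_def field_simps)
    moreover have "A * B * q / (C * q ^ Suc n) = D" by (simp add: D_def N_def field_simps)
    moreover have "1 - q * N \<noteq> 0" using qfree_D[OF qfree_q, of n] by (simp add: N_def)
    moreover have "(1 - 1 / (N * q)) * (q * N) = - (1 - q * N)" using N0 by (simp add: field_simps)
    ultimately have e: "t (Suc n) (Suc n) = ((1 - 1 / (N * q)) * (q * N)) / ((1 - q * N) * (1 - C * N)) * g (Suc n)"
      unfolding t_def g_def nat.case qpoch_Suc[of C q n] qpoch_Suc[of q q n] by (simp add: N_def[symmetric] mult_ac)
    have e': "(1 - 1 / (N * q)) * (q * N) / ((1 - q * N) * (1 - C * N)) = - 1 / (1 - C * N)"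
      unfolding \<open>(1 - 1 / (N * q)) * (q * N) = - (1 - q * N)\<close> using \<open>1 - q * N \<noteq> 0\<close>
      by (metis divide_minus_left mult_divide_mult_cancel_left mult.right_neutral)
    show ?thesis unfolding e e' by simp
  qed
  finally have "(\<Sum>k\<le>Suc n. t (Suc n) k) = R (Suc n)" by (simp add: R_Suc diff_eq_eq)
  then show ?case unfolding t_def R_def by simp
qed

text \<open>The same kind of telescoping induction as for \<open>q_saalschuetz\<close>. Here the
  argument \<open>a * q * q ^ n / (d * e)\<close> changes with \<open>n\<close> as well, which puts
  the additional factor \<open>K = q ^ k\<close> into \<open>t1\<close> as compared with
  \<open>t2\<close>.\<close>

lemma terminating_6phi5:
  assumes "a \<noteq> 0" "d \<noteq> 0" "e \<noteq> 0" "qfree q a" "qfree q (a * q / d)" "qfree q (a * q / e)"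
  shows "(\<Sum>k\<le>n. (1 - a * q ^ (2 * k)) / (1 - a) * (P a k * P d k * P e k * P (1 / q ^ n) k /
            (P q k * P (a * q / d) k * P (a * q / e) k * P (a * q * q ^ n) k)) * (a * q * q ^ n / (d * e)) ^ k)
     = P (a * q) n * P (a * q / (d * e)) n / (P (a * q / d) n * P (a * q / e) n)"
proof (induction n)
  case 0
  then show ?case using qfree_1[OF assms(4)] by simp
next
  case (Suc n)
  define N where "N = q * q ^ n"
  define w where "w = a * N / (d * e)"
  define R where "R = (\<lambda>n. P (a * q) n * P (a * q / (d * e)) n / (P (a * q / d) n * P (a * q / e) n))"
  define t where "t = (\<lambda>n k. (1 - a * q ^ (2 * k)) / (1 - a) * (P a k * P d k * P e k * P (1 / q ^ n) k /
            (P q k * P (a * q / d) k * P (a * q / e) k * P (a * q * q ^ n) k)) * (a * q * q ^ n / (d * e)) ^ k)"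
  \<comment> \<open>Again the antidifference, now up to the factor \<open>w / (E1 * E2)\<close>. The
    factor \<open>P (a * q) j\<close> is \<open>P a (Suc j) / (1 - a)\<close>.\<close>
  define g where "g = (\<lambda>k. case k of 0 \<Rightarrow> 0 | Suc j \<Rightarrow> P (a * q) j * P d k * P e k * P (1 / q ^ n) j * w ^ j
      / (P q j * P (a * q / d) j * P (a * q / e) j * P (a * q * N) j))"
  define E1 E2 where "E1 = 1 - a * N / d" and "E2 = 1 - a * N / e"
  have N0: "N \<noteq> 0" by (simp add: N_def)
  have a1: "1 - a \<noteq> 0" using qfree_1[OF assms(4)] by simp
  have E: "E1 \<noteq> 0" "E2 \<noteq> 0"
    using qfree_D[OF assms(5), of n] qfree_D[OF assms(6), of n] by (simp_all add: E1_def E2_def N_def mult_ac)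
  have aN: "1 - a * N \<noteq> 0" using qfree_D[OF assms(4), of "Suc n"] by (simp add: N_def)
  have ds: "d * w = a / e * N" "e * w = a / d * N" "d * e * w = a * N" "a * w = a / d * (a / e) * N"
    using assms by (simp_all add: w_def)
  define \<rho> where "\<rho> = (1 - a * N) * (1 - w) / (E1 * E2)"
  have R_Suc: "R (Suc n) = \<rho> * R n"
    by (simp add: R_def \<rho>_def qpoch_Suc N_def E1_def E2_def w_def mult_ac)
  have Eprod: "E1 * E2 = 1 - (a / d + a / e) * N + a * w * N"
    unfolding ds(4) by (simp add: E1_def E2_def algebra_simps)
  have step: "t (Suc n) k - \<rho> * t n k = w * (g (Suc k) - g k) / (E1 * E2)" for k
  proof (cases k)
    case 0
    have "w * ((1 - d) * (1 - e)) = E1 * E2 - (1 - a * N) * (1 - w)"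
    proof -
      have "w * ((1 - d) * (1 - e)) = w - d * w - e * w + d * e * w" by (simp add: algebra_simps)
      then show ?thesis unfolding Eprod ds(1-3) by (simp add: algebra_simps)
    qed
    then have "1 - \<rho> = w * ((1 - d) * (1 - e)) / (E1 * E2)"
      using E by (simp add: \<rho>_def diff_divide_distrib)
    then show ?thesis using 0 a1 by (simp add: t_def g_def qpoch_Suc)
  next
    case (Suc j)
    define m where "m = q ^ j / q ^ n"
    define K where "K = q * q ^ j"
    have K: "K = m * N" "K / N = m" by (simp_all add: K_def m_def N_def)
    define d1 d2 d3 d4 where "d1 = 1 - K" and "d2 = 1 - a * K / d" and "d3 = 1 - a * K / e" and "d4 = 1 - a * K * N"
    have dn: "d1 \<noteq> 0" "d2 \<noteq> 0" "d3 \<noteq> 0" "d4 \<noteq> 0"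
      using qfree_D[OF qfree_q, of j] qfree_D[OF assms(5), of j] qfree_D[OF assms(6), of j]
        qfree_D[OF assms(4), of "Suc j + Suc n"]
      by (simp_all add: d1_def d2_def d3_def d4_def K_def N_def mult_ac power_add)
    define G where "G = P (a * q) j * P d (Suc j) * P e (Suc j) * P (1 / q ^ n) j * w ^ j
      / (P q j * P (a * q / d) j * P (a * q / e) j * P (a * q * N) j)"
    have gk: "g k = G" unfolding g_def G_def Suc by simp
    have P1: "P a (Suc j) / (1 - a) = P (a * q) j" using a1 by (simp add: qpoch_Suc_left)
    have P2: "P (1 / q ^ Suc n) (Suc j) = (1 - 1 / N) * P (1 / q ^ n) j"
      by (simp add: qpoch_Suc_left N_def)
    have P3: "P (1 / q ^ n) (Suc j) = P (1 / q ^ n) j * (1 - m)"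
      by (simp add: qpoch_Suc m_def)
    have P4: "P (a * q * q ^ Suc n) (Suc j) = P (a * q * N) j * d4"
      by (simp add: qpoch_Suc N_def d4_def K_def mult_ac)
    have P5: "P (a * q * q ^ n) (Suc j) = (1 - a * N) * P (a * q * N) j"
      by (simp add: qpoch_Suc_left N_def mult_ac)
    have P6: "P q (Suc j) = P q j * d1" "P (a * q / d) (Suc j) = P (a * q / d) j * d2"
        "P (a * q / e) (Suc j) = P (a * q / e) j * d3"
      by (simp_all add: qpoch_Suc d1_def d2_def d3_def K_def mult_ac)
    have w1: "(a * q * q ^ Suc n / (d * e)) ^ Suc j = w ^ j * w * K"
    proof -
      have "a * q * q ^ Suc n / (d * e) = w * q" by (simp add: w_def N_def)
      then show ?thesis by (simp add: power_mult_distrib K_def)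
    qed
    have w2: "(a * q * q ^ n / (d * e)) ^ Suc j = w ^ j * w"
      by (simp add: w_def N_def mult_ac)
    have K2: "q ^ (2 * Suc j) = K * K"
      by (simp add: K_def mult_2 power_add)
    have t1: "t (Suc n) k = G * ((1 - a * (K * K)) * (1 - 1 / N) * w * K / (d1 * d2 * d3 * d4))"
    proof -
      have "t (Suc n) k = (1 - a * (K * K)) * ((P a (Suc j) / (1 - a)) * P d (Suc j) * P e (Suc j) * P (1 / q ^ Suc n) (Suc j) /
            (P q (Suc j) * P (a * q / d) (Suc j) * P (a * q / e) (Suc j) * P (a * q * q ^ Suc n) (Suc j))) * (a * q * q ^ Suc n / (d * e)) ^ Suc j"
        unfolding t_def Suc K2 by simp
      then show ?thesis
        unfolding P1 P2 P4 P6 w1 G_def by (simp add: mult_ac)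
    qed
    have t2: "t n k = G * ((1 - a * (K * K)) * (1 - m) * w / (d1 * d2 * d3 * (1 - a * N)))"
    proof -
      have "t n k = (1 - a * (K * K)) * ((P a (Suc j) / (1 - a)) * P d (Suc j) * P e (Suc j) * P (1 / q ^ n) (Suc j) /
            (P q (Suc j) * P (a * q / d) (Suc j) * P (a * q / e) (Suc j) * P (a * q * q ^ n) (Suc j))) * (a * q * q ^ n / (d * e)) ^ Suc j"
        unfolding t_def Suc K2 by simp
      then show ?thesis
        unfolding P1 P3 P5 P6 w2 G_def by (simp add: mult_ac)
    qed
    have P7: "P (a * q) (Suc j) = P (a * q) j * (1 - a * K)"
         "P d (Suc (Suc j)) = P d (Suc j) * (1 - d * K)" "P e (Suc (Suc j)) = P e (Suc j) * (1 - e * K)"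
         "P (a * q * N) (Suc j) = P (a * q * N) j * d4"
      by (simp_all add: qpoch_Suc K_def d4_def mult_ac)
    have gs: "g (Suc k) = G * ((1 - a * K) * (1 - d * K) * (1 - e * K) * (1 - m) * w / (d1 * d2 * d3 * d4))"
      unfolding g_def Suc nat.case P7 P3 P6 G_def by (simp add: mult_ac)
    \<comment> \<open>\<open>S\<close> stands for \<open>a / d + a / e\<close>: after clearing
      denominators, \<open>d\<close> and \<open>e\<close> enter only through this sum and through
      \<open>w\<close>.\<close>
    have poly: "(1 - a * K * K) * (K - m) * (1 - S * N + a * w * N) - (1 - w) * (1 - a * K * K) * (1 - m) * (1 - a * K * N)
       = (1 - a * K) * (w - S * N * K + a * N * K * K) * (1 - m) - (1 - K) * (1 - S * K + a * w * K * m) * (1 - a * K * N)" for S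
      unfolding K(1) by (simp add: algebra_simps)
    have key: "(1 - a * (K * K)) * (1 - 1 / N) * K * (E1 * E2) - (1 - w) * (1 - a * (K * K)) * (1 - m) * d4
       = (1 - a * K) * (1 - d * K) * (1 - e * K) * (1 - m) * w - d1 * d2 * d3 * d4"
    proof -
      have h1: "(1 - 1 / N) * K = K - m" using N0 by (simp add: algebra_simps K)
      have h2: "(1 - d * K) * (1 - e * K) * w = w - (a / d + a / e) * N * K + a * N * K * K"
      proof -
        have "(1 - d * K) * (1 - e * K) * w = w - (d * w + e * w) * K + d * e * w * K * K"
          by (simp add: algebra_simps)
        then show ?thesis unfolding ds(1-3) by (simp add: algebra_simps)
      qed
      have h3: "d2 * d3 = 1 - (a / d + a / e) * K + a * w * K * m"
      proof -
        have "a * w * K * m = a / d * (a / e) * (N * m) * K" unfolding ds(4) by (simp add: mult_ac)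
        also have "N * m = K" by (simp add: K(1))
        finally show ?thesis unfolding d2_def d3_def by (simp add: algebra_simps)
      qed
      have l: "(1 - a * (K * K)) * (1 - 1 / N) * K * (E1 * E2) - (1 - w) * (1 - a * (K * K)) * (1 - m) * d4
          = (1 - a * K * K) * ((1 - 1 / N) * K) * (E1 * E2) - (1 - w) * (1 - a * K * K) * (1 - m) * (1 - a * K * N)"
        by (simp add: d4_def mult_ac)
      have r: "(1 - a * K) * (1 - d * K) * (1 - e * K) * (1 - m) * w - d1 * d2 * d3 * d4
          = (1 - a * K) * ((1 - d * K) * (1 - e * K) * w) * (1 - m) - (1 - K) * (d2 * d3) * (1 - a * K * N)"
        by (simp add: d1_def d4_def mult_ac)
      show ?thesis unfolding l r unfolding h1 h2 h3 Eprod by (rule poly)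
    qed
    have comb: "G * (x * w * K / (d1 * d2 * d3 * d4)) - \<rho> * (G * (y * w / (d1 * d2 * d3 * (1 - a * N))))
       = w * (G * ((x * K * (E1 * E2) - (1 - w) * y * d4) / (d1 * d2 * d3 * d4))) / (E1 * E2)" for x y
    proof -
      have "\<rho> * (G * (y * w / (d1 * d2 * d3 * (1 - a * N)))) = G * (y * w * (1 - w) / (d1 * d2 * d3)) / (E1 * E2)"
        unfolding \<rho>_def using aN by (simp add: mult_ac)
      moreover have "G * (x * w * K / (d1 * d2 * d3 * d4)) - G * (y * w * s / (d1 * d2 * d3)) / (E1 * E2)
         = w * (G * ((x * K * (E1 * E2) - s * y * d4) / (d1 * d2 * d3 * d4))) / (E1 * E2)" for s
        using dn E by (simp add: diff_divide_distrib right_diff_distrib mult_ac)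
      ultimately show ?thesis by metis
    qed
    have "t (Suc n) k - \<rho> * t n k = w * (G * (((1 - a * (K * K)) * (1 - 1 / N) * K * (E1 * E2) - (1 - w) * ((1 - a * (K * K)) * (1 - m)) * d4) / (d1 * d2 * d3 * d4))) / (E1 * E2)"
      unfolding t1 t2 by (rule comb)
    also have "\<dots> = w * (g (Suc k) - g k) / (E1 * E2)"
    proof -
      have key': "(1 - a * (K * K)) * (1 - 1 / N) * K * (E1 * E2) - (1 - w) * ((1 - a * (K * K)) * (1 - m)) * d4
       = (1 - a * K) * (1 - d * K) * (1 - e * K) * (1 - m) * w - d1 * d2 * d3 * d4"
        using key by (simp add: mult_ac)
      show ?thesis unfolding key' gs gk using dn by (simp add: diff_divide_distrib right_diff_distrib)
    qed
    finally show ?thesis .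
  qed
  have IH: "(\<Sum>k\<le>n. t n k) = R n"
    unfolding t_def R_def by (rule Suc.IH)
  have "(\<Sum>k\<le>n. t (Suc n) k) - \<rho> * R n = (\<Sum>k\<le>n. t (Suc n) k - \<rho> * t n k)"
    by (simp add: sum_subtractf sum_distrib_left IH[symmetric])
  also have "\<dots> = w * (\<Sum>k<Suc n. g (Suc k) - g k) / (E1 * E2)"
    unfolding sum_distrib_left sum_divide_distrib lessThan_Suc_atMost by (simp add: step)
  also have "\<dots> = w * g (Suc n) / (E1 * E2)"
    unfolding sum_lessThan_telescope by (simp add: g_def)
  also have "\<dots> = - t (Suc n) (Suc n)"
  proof -
    have P1: "P a (Suc n) / (1 - a) = P (a * q) n" using a1 by (simp add: qpoch_Suc_left)
    have P2: "P (1 / q ^ Suc n) (Suc n) = (1 - 1 / N) * P (1 / q ^ n) n"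
      by (simp add: qpoch_Suc_left N_def)
    have P4: "P (a * q * q ^ Suc n) (Suc n) = P (a * q * N) n * (1 - a * (N * N))"
      by (simp add: qpoch_Suc N_def mult_ac)
    have P6: "P q (Suc n) = P q n * (1 - N)" "P (a * q / d) (Suc n) = P (a * q / d) n * E1"
        "P (a * q / e) (Suc n) = P (a * q / e) n * E2"
      by (simp_all add: qpoch_Suc E1_def E2_def N_def mult_ac)
    have K2: "q ^ (2 * Suc n) = N * N" by (simp add: N_def mult_2 power_add)
    have w1: "(a * q * q ^ Suc n / (d * e)) ^ Suc n = w ^ n * w * N"
    proof -
      have "a * q * q ^ Suc n / (d * e) = w * q" by (simp add: w_def N_def)
      then show ?thesis by (simp add: power_mult_distrib N_def)
    qed
    have n1: "1 - N \<noteq> 0" using qfree_D[OF qfree_q, of n] by (simp add: N_def)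
    have n2: "1 - a * (N * N) \<noteq> 0" using qfree_D[OF assms(4), of "Suc n + Suc n"]
      by (simp add: N_def power_add mult_ac)
    have "t (Suc n) (Suc n) = (1 - a * (N * N)) * ((P a (Suc n) / (1 - a)) * P d (Suc n) * P e (Suc n) * P (1 / q ^ Suc n) (Suc n) /
            (P q (Suc n) * P (a * q / d) (Suc n) * P (a * q / e) (Suc n) * P (a * q * q ^ Suc n) (Suc n))) * (a * q * q ^ Suc n / (d * e)) ^ Suc n"
      unfolding t_def K2 by simp
    also have "\<dots> = ((1 - 1 / N) * N / (1 - N)) * (w * g (Suc n) / (E1 * E2))"
      unfolding P1 P2 P4 P6 w1 g_def nat.case using n2 by (simp add: mult_ac)
    also have "(1 - 1 / N) * N / (1 - N) = - 1"
    proof -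
      have "(1 - 1 / N) * N = - (1 - N)" using N0 by (simp add: algebra_simps)
      then show ?thesis using n1 by (metis divide_self minus_divide_left)
    qed
    finally show ?thesis by simp
  qed
  finally have "(\<Sum>k\<le>Suc n. t (Suc n) k) = R (Suc n)" by (simp add: R_Suc diff_eq_eq)
  then show ?case unfolding t_def R_def by simp
qed

section \<open>Watson's transformation\<close>

text \<open>The terms of an 8W7 whose argument is tied to its parameters, as it is in the two- and
  three-term transformations; \<open>W87_w8s\<close> makes the connection with
  \<open>W87\<close>.\<close>

definition w8 :: "complex \<Rightarrow> complex \<Rightarrow> complex \<Rightarrow> complex \<Rightarrow> complex \<Rightarrow> complex \<Rightarrow> nat \<Rightarrow> complex"
  where "w8 a b c d e f r = (1 - a * q ^ (2 * r)) / (1 - a) *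
    (P a r * P b r * P c r * P d r * P e r * P f r /
     (P q r * P (a * q / b) r * P (a * q / c) r * P (a * q / d) r * P (a * q / e) r * P (a * q / f) r)) *
    (a\<^sup>2 * q\<^sup>2 / (b * c * d * e * f)) ^ r"

text \<open>The terminating basic hypergeometric series 4phi3 with argument \<open>q\<close>. It
  will occur balanced, \<open>D * E * F * q ^ n = A * B * C * q\<close>, which is what
  \<open>phi43_reverse\<close> relies on.\<close>

definition phi43 :: "complex \<Rightarrow> complex \<Rightarrow> complex \<Rightarrow> complex \<Rightarrow> complex \<Rightarrow> complex \<Rightarrow> nat \<Rightarrow> complex"
  where "phi43 A B C D E F n =
    (\<Sum>j\<le>n. P A j * P B j * P C j * P (1 / q ^ n) j / (P q j * P D j * P E j * P F j) * q ^ j)"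

lemma sum_triangle:
  fixes f :: "nat \<Rightarrow> nat \<Rightarrow> complex"
  shows "(\<Sum>r\<le>n. \<Sum>j\<le>r. f r j) = (\<Sum>j\<le>n. \<Sum>m\<le>n - j. f (j + m) j)"
proof -
  have "(\<Sum>r\<le>n. \<Sum>j\<le>r. f r j) = (\<Sum>r\<le>n. \<Sum>j\<le>r. f (j + (r - j)) j)"
    by (intro sum.cong) auto
  also have "\<dots> = (\<Sum>(j, m)\<in>{(i, j). i + j \<le> n}. f (j + m) j)"
    by (rule sum.triangle_reindex_eq[symmetric])
  also have "{(i, j). i + j \<le> n} = (SIGMA j:{..n}. {..n - j})"
    by auto
  finally show ?thesis by (simp add: sum.Sigma)
qed

text \<open>The part of the r-th term depending on \<open>b\<close> and \<open>c\<close> is the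
  value of a Saalschuetz sum over \<open>j\<close>. After the two sums are interchanged, the inner
  one, over \<open>m = r - j\<close>, is a 6phi5 with parameters shifted by
  \<open>q ^ (2 * j)\<close> and \<open>q ^ j\<close>, hence summable; what is left over are the
  terms of the 4phi3.\<close>

lemma watson:
  assumes nz: "a \<noteq> 0" "b \<noteq> 0" "c \<noteq> 0" "d \<noteq> 0" "e \<noteq> 0"
    and fr: "qfree q a" "qfree q (a * q / b)" "qfree q (a * q / c)" "qfree q (a * q / d)" "qfree q (a * q / e)"
      "qfree q (a * q / (d * e))"
  shows "(\<Sum>r\<le>n. w8 a b c d e (1 / q ^ n) r) =
    P (a * q) n * P (a * q / (d * e)) n / (P (a * q / d) n * P (a * q / e) n) *
    phi43 (a * q / (b * c)) d e (a * q / b) (a * q / c) (d * e / (a * q ^ n)) n"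
proof -
  define g x y z v where "g = a * q / (b * c)" and "x = a * q / b" and "y = a * q / c"
    and "z = a * q / (d * e)" and "v = a * q * q ^ n / (d * e)"
  note Pnz = fr[THEN qpoch_nonzero]
  define f1 where "f1 = (\<lambda>r. (1 - a * q ^ (2 * r)) / (1 - a) * (P a r * P d r * P e r * P (1 / q ^ n) r /
        (P q r * P (a * q / d) r * P (a * q / e) r * P (a * q * q ^ n) r)) * v ^ r)"
  \<comment> \<open>The terms of the Saalschuetz sum with value
    \<open>P b r * P c r / (P x r * P y r) * g ^ r\<close>; the rest of the term of the 8W7 is
    \<open>f1\<close>.\<close>
  define f2 where "f2 = (\<lambda>r j. P (1 / q ^ r) j * P (a * q ^ r) j * P g j / (P q j * P x j * P y j) * q ^ j)"
  have f2_sum: "(\<Sum>j\<le>r. f2 r j) = P b r * P c r / (P x r * P y r) * g ^ r" for r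
  proof -
    have eqs: "a * q ^ r * g * q / (x * q ^ r) = y" "x / (a * q ^ r) = q / b / q ^ r" "x / g = c"
       "x / (a * q ^ r * g) = c / a / q ^ r" "q / (q / b) = b" "q / (c / a) = y" "q / b = g * (c / a)"
      using nz by (simp_all add: g_def x_def y_def field_simps)
    have side: "x / (a * q ^ r * g) * q ^ (k - 1) \<noteq> 1" if "0 < k" "k \<le> r" for k
    proof
      assume "x / (a * q ^ r * g) * q ^ (k - 1) = 1"
      then have "c / a / q ^ r * q ^ (k - 1) = 1" unfolding eqs(4) .
      then have "c * q ^ (k - 1) = a * q ^ r" using nz by (simp add: field_simps)
      also have "q ^ r = q ^ (r - k) * q * q ^ (k - 1)" using that
        by (simp flip: power_Suc power_add power_Suc2)
      finally have "c = a * q ^ (r - k) * q" by simp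
      then have "y * q ^ (r - k) = 1" using nz by (simp add: y_def)
      with fr(3) show False by (simp add: qfree_def y_def)
    qed
    have "(\<Sum>j\<le>r. f2 r j) = P (x / (a * q ^ r)) r * P (x / g) r / (P x r * P (x / (a * q ^ r * g)) r)"
      using q_saalschuetz[of "a * q ^ r" g x r] nz side fr(2)
      unfolding f2_def eqs(1) by (simp add: g_def x_def)
    also have "\<dots> = P b r * P c r / (P x r * P y r) * g ^ r"
    proof -
      have 1: "P (q / b / q ^ r) r = refl (q / b) r * P b r"
        using qpoch_reflect[of "q / b" r] nz unfolding eqs(5) by simp
      have 2: "P (c / a / q ^ r) r = refl (c / a) r * P y r"
        using qpoch_reflect[of "c / a" r] nz unfolding eqs(6) by simp
      have 3: "refl (q / b) r = g ^ r * refl (c / a) r" unfolding eqs(7) by (rule refl_mult)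
      have "refl (c / a) r \<noteq> 0" using nz by (simp add: refl_nonzero)
      then show ?thesis unfolding eqs(2-4) 1 2 3 by simp
    qed
    finally show ?thesis .
  qed
  have w8_eq: "w8 a b c d e (1 / q ^ n) r = (\<Sum>j\<le>r. f1 r * f2 r j)" for r
  proof -
    have "a\<^sup>2 * q\<^sup>2 / (b * c * d * e * (1 / q ^ n)) = v * g"
      by (simp add: v_def g_def power2_eq_square mult_ac)
    moreover have "a * q / (1 / q ^ n) = a * q * q ^ n" by simp
    ultimately show ?thesis
      unfolding sum_distrib_left[symmetric] f2_sum w8_def f1_def by (simp add: power_mult_distrib x_def y_def mult_ac)
  qed
  \<comment> \<open>The part of \<open>f1 (j + m) * f2 (j + m) j\<close> that does not depend on
    \<open>m\<close>, up to the factor \<open>1 - a * q ^ (2 * j)\<close>.\<close>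
  define coef where "coef = (\<lambda>j. P a (2 * j) * P d j * P e j * P (1 / q ^ n) j * v ^ j * refl 1 j * P g j * q ^ j /
      ((1 - a) * P (a * q / d) j * P (a * q / e) j * P (a * q * q ^ n) j * P q j * P x j * P y j))"
  have inner: "(\<Sum>m\<le>n - j. f1 (j + m) * f2 (j + m) j) =
      P (a * q) n * P z n / (P (a * q / d) n * P (a * q / e) n) *
      (P g j * P d j * P e j * P (1 / q ^ n) j / (P q j * P x j * P y j * P (d * e / (a * q ^ n)) j) * q ^ j)" if j: "j \<le> n" for j
  proof -
    define a' d' e' where "a' = a * q ^ (2 * j)" and "d' = d * q ^ j" and "e' = e * q ^ j"
    have qn: "q ^ n = q ^ (n - j) * q ^ j" using j by (simp flip: power_add)
    have qj2: "q ^ (2 * j) = q ^ j * q ^ j" by (simp add: mult_2 power_add)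
    have eqs: "a' * q / d' = a * q / d * q ^ j" "a' * q / e' = a * q / e * q ^ j"
        "a' * q * q ^ (n - j) = a * q * q ^ n * q ^ j" "a' * q * q ^ (n - j) / (d' * e') = v / q ^ j"
        "a' * q / (d' * e') = z" "1 / q ^ n * q ^ j = 1 / q ^ (n - j)"
      unfolding a'_def d'_def e'_def v_def z_def qn qj2 using nz by (simp_all add: field_simps)
    have nz': "a' \<noteq> 0" "d' \<noteq> 0" "e' \<noteq> 0" using nz by (simp_all add: a'_def d'_def e'_def)
    have fr': "qfree q a'" "qfree q (a' * q / d')" "qfree q (a' * q / e')"
      unfolding eqs unfolding a'_def by (intro qfree_mult fr)+
    have a'1: "1 - a' \<noteq> 0" using qfree_1[OF fr'(1)] by simp
    have s65: "(\<Sum>m\<le>n - j. (1 - a' * q ^ (2 * m)) / (1 - a') * (P a' m * P d' m * P e' m * P (1 / q ^ (n - j)) m /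
            (P q m * P (a' * q / d') m * P (a' * q / e') m * P (a' * q * q ^ (n - j)) m)) * (a' * q * q ^ (n - j) / (d' * e')) ^ m)
        = P (a' * q) (n - j) * P z (n - j) / (P (a' * q / d') (n - j) * P (a' * q / e') (n - j))"
      using terminating_6phi5[OF nz' fr', of "n - j"] by (simp add: eqs(5))
    have trm: "f1 (j + m) * f2 (j + m) j = coef j * (1 - a') * ((1 - a' * q ^ (2 * m)) / (1 - a') * (P a' m * P d' m * P e' m * P (1 / q ^ (n - j)) m /
            (P q m * P (a' * q / d') m * P (a' * q / e') m * P (a' * q * q ^ (n - j)) m)) * (a' * q * q ^ (n - j) / (d' * e')) ^ m)" for m
    proof -
      have r1: "P (1 / q ^ (j + m)) j = refl 1 j * P q (j + m) / (P q m * (q ^ j) ^ m)"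
      proof -
        have "P (1 / q ^ (j + m)) j = P (1 / q ^ m / q ^ j) j" by (simp add: power_add mult.commute)
        also have "\<dots> = refl (1 / q ^ m) j * P (q * q ^ m) j"
          by (subst qpoch_reflect) simp_all
        also have "refl (1 / q ^ m) j = refl 1 j / (q ^ j) ^ m"
          using refl_mult[of "1 / q ^ m" 1 j] by (simp add: power_one_over power_mult[symmetric] mult.commute)
        also have "P (q * q ^ m) j = P q (j + m) / P q m"
          using qpoch_add[of q q m j] by (simp add: add.commute)
        finally show ?thesis by (simp add: mult_ac)
      qed
      have r2: "P a (j + m) * P (a * q ^ (j + m)) j = P a (2 * j) * P a' m"
      proof -
        have "P a (j + m) * P (a * q ^ (j + m)) j = P a (j + m + j)" by (rule qpoch_add[symmetric])
        also have "j + m + j = 2 * j + m" by simp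
        also have "P a \<dots> = P a (2 * j) * P a' m" unfolding a'_def by (rule qpoch_add)
        finally show ?thesis .
      qed
      have r3: "a * q ^ (2 * (j + m)) = a' * q ^ (2 * m)" by (simp add: a'_def power_add distrib_left mult_ac)
      have adds: "P d (j + m) = P d j * P d' m" "P e (j + m) = P e j * P e' m"
         "P (1 / q ^ n) (j + m) = P (1 / q ^ n) j * P (1 / q ^ (n - j)) m"
         "P (a * q / d) (j + m) = P (a * q / d) j * P (a' * q / d') m"
         "P (a * q / e) (j + m) = P (a * q / e) j * P (a' * q / e') m"
         "P (a * q * q ^ n) (j + m) = P (a * q * q ^ n) j * P (a' * q * q ^ (n - j)) m"
        unfolding qpoch_add eqs(1-3,6) by (simp_all add: d'_def e'_def)
      have "f1 (j + m) * f2 (j + m) j = (1 - a' * q ^ (2 * m)) / (1 - a) * ((P a (j + m) * P (a * q ^ (j + m)) j) * P d (j + m) * P e (j + m) * P (1 / q ^ n) (j + m) /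
        (P q (j + m) * P (a * q / d) (j + m) * P (a * q / e) (j + m) * P (a * q * q ^ n) (j + m))) * (v ^ j * v ^ m) *
        (P (1 / q ^ (j + m)) j * P g j / (P q j * P x j * P y j) * q ^ j)"
        unfolding f1_def f2_def r3 by (simp add: power_add)
      also have "\<dots> = coef j * (1 - a') * ((1 - a' * q ^ (2 * m)) / (1 - a') * (P a' m * P d' m * P e' m * P (1 / q ^ (n - j)) m /
            (P q m * P (a' * q / d') m * P (a' * q / e') m * P (a' * q * q ^ (n - j)) m)) * (v ^ m / (q ^ j) ^ m))"
        unfolding r1 r2 adds coef_def using a'1 by (simp add: mult_ac)
      also have "v ^ m / (q ^ j) ^ m = (a' * q * q ^ (n - j) / (d' * e')) ^ m"
        unfolding eqs(4) by (simp add: power_divide)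
      finally show ?thesis by (simp add: mult.assoc)
    qed
    have "(\<Sum>m\<le>n - j. f1 (j + m) * f2 (j + m) j) = coef j * (1 - a') * (P (a' * q) (n - j) * P z (n - j) / (P (a' * q / d') (n - j) * P (a' * q / e') (n - j)))"
      unfolding trm sum_distrib_left[symmetric] s65 ..
    also have "\<dots> = P (a * q) n * P z n / (P (a * q / d) n * P (a * q / e) n) *
      (P g j * P d j * P e j * P (1 / q ^ n) j / (P q j * P x j * P y j * P (d * e / (a * q ^ n)) j) * q ^ j)"
    proof -
      have b1: "P a (2 * j) * (1 - a') / (1 - a) * P (a' * q) (n - j) = P (a * q) n * P (a * q * q ^ n) j"
      proof -
        have "P a (2 * j) * (1 - a') = P a (Suc (2 * j))" by (simp add: qpoch_Suc a'_def)
        also have "\<dots> = (1 - a) * P (a * q) (2 * j)" by (rule qpoch_Suc_left)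
        finally have "P a (2 * j) * (1 - a') / (1 - a) = P (a * q) (2 * j)" using qfree_1[OF fr(1)] by simp
        moreover have "P (a * q) (2 * j) * P (a' * q) (n - j) = P (a * q) (2 * j + (n - j))"
          unfolding qpoch_add by (simp add: a'_def mult_ac)
        moreover have "2 * j + (n - j) = n + j" using j by simp
        ultimately show ?thesis by (simp add: qpoch_add)
      qed
      have b2: "P (a * q / d) j * P (a' * q / d') (n - j) = P (a * q / d) n" "P (a * q / e) j * P (a' * q / e') (n - j) = P (a * q / e) n"
        unfolding eqs qpoch_add[symmetric] using j by simp_all
      \<comment> \<open>Completing \<open>P z (n - j)\<close> to \<open>P z n\<close> takes
        \<open>j\<close> more factors; read backwards they form the shifted factorial of the lower
        parameter \<open>d * e / (a * q ^ n)\<close> of the 4phi3.\<close>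
      have b3: "P z (n - j) * v ^ j * refl 1 j * P (d * e / (a * q ^ n)) j = P z n"
      proof -
        have "P z n = P z (n - j + j)" using j by simp
        also have "\<dots> = P z (n - j) * P (z * q ^ (n - j)) j" by (rule qpoch_add)
        also have "z * q ^ (n - j) = v / q ^ j" unfolding z_def v_def qn by simp
        also have "P (v / q ^ j) j = refl v j * P (q / v) j" using nz by (intro qpoch_reflect) (simp add: v_def)
        also have "refl v j = v ^ j * refl 1 j" using refl_mult[of v 1 j] by simp
        also have "q / v = d * e / (a * q ^ n)" by (simp add: v_def)
        finally show ?thesis by (simp add: mult_ac)
      qed
      have zn: "P z n \<noteq> 0" using Pnz(6) by (simp add: z_def)
      have b4: "P z (n - j) * v ^ j * refl 1 j = P z n / P (d * e / (a * q ^ n)) j"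
        using b3 zn by (metis mult_eq_0_iff nonzero_eq_divide_eq)
      have Pn: "P (a * q * q ^ n) j \<noteq> 0" using qfree_mult[OF qfree_mult1[OF fr(1)]] by (rule qpoch_nonzero)
      have "coef j * (1 - a') * (P (a' * q) (n - j) * P z (n - j) / (P (a' * q / d') (n - j) * P (a' * q / e') (n - j)))
         = (P a (2 * j) * (1 - a') / (1 - a) * P (a' * q) (n - j)) * (P z (n - j) * v ^ j * refl 1 j) /
           ((P (a * q / d) j * P (a' * q / d') (n - j)) * (P (a * q / e) j * P (a' * q / e') (n - j)))
           * (P g j * P d j * P e j * P (1 / q ^ n) j / (P (a * q * q ^ n) j * P q j * P x j * P y j) * q ^ j)"
        unfolding coef_def by (simp add: mult_ac)
      also have "\<dots> = (P (a * q) n * P (a * q * q ^ n) j) * (P z n / P (d * e / (a * q ^ n)) j) /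
           (P (a * q / d) n * P (a * q / e) n)
           * (P g j * P d j * P e j * P (1 / q ^ n) j / (P (a * q * q ^ n) j * P q j * P x j * P y j) * q ^ j)"
        unfolding b1 b2 b4 ..
      finally show ?thesis using Pn by (simp add: mult_ac)
    qed
    finally show ?thesis .
  qed
  have "(\<Sum>r\<le>n. w8 a b c d e (1 / q ^ n) r) = (\<Sum>j\<le>n. \<Sum>m\<le>n - j. f1 (j + m) * f2 (j + m) j)"
    unfolding w8_eq by (rule sum_triangle)
  also have "\<dots> = (\<Sum>j\<le>n. P (a * q) n * P z n / (P (a * q / d) n * P (a * q / e) n) *
      (P g j * P d j * P e j * P (1 / q ^ n) j / (P q j * P x j * P y j * P (d * e / (a * q ^ n)) j) * q ^ j))"
    by (intro sum.cong inner) auto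
  finally show ?thesis
    unfolding sum_distrib_left[symmetric] phi43_def g_def x_def y_def z_def .
qed

end

section \<open>Infinite products\<close>

definition qinf :: "complex \<Rightarrow> complex \<Rightarrow> complex"
  where "qinf q x = (\<Prod>i. 1 - x * q ^ i)"

text \<open>\<open>qgen q x\<close>: \<open>x\<close> is not an integral power of \<open>q\<close>; in particular \<open>x\<close> and \<open>q / x\<close> are both \<open>qfree\<close>.\<close>

definition qgen :: "complex \<Rightarrow> complex \<Rightarrow> bool"
  where "qgen q x \<longleftrightarrow> x \<noteq> 0 \<and> (\<forall>m n. x * q ^ m \<noteq> q ^ n)"

lemma holomorphic_on_suminf:
  fixes t :: "nat \<Rightarrow> complex \<Rightarrow> complex"
  assumes S: "open S" and hol: "\<And>r. t r holomorphic_on S"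
    and bd: "\<And>x. x \<in> S \<Longrightarrow> \<exists>d C \<theta>. 0 < d \<and> cball x d \<subseteq> S \<and> 0 \<le> \<theta> \<and> \<theta> < 1 \<and> (\<forall>r. \<forall>y\<in>cball x d. norm (t r y) \<le> C * \<theta> ^ r)"
  shows "(\<lambda>x. \<Sum>r. t r x) holomorphic_on S"
proof (rule holomorphic_uniform_sequence[OF S, where f = "\<lambda>n x. \<Sum>r<n. t r x"])
  show "(\<lambda>x. \<Sum>r<n. t r x) holomorphic_on S" for n
    by (intro holomorphic_intros hol)
next
  fix x assume "x \<in> S"
  then obtain d C \<theta> where d: "0 < d" "cball x d \<subseteq> S" "0 \<le> \<theta>" "\<theta> < 1"
    "\<forall>r. \<forall>y\<in>cball x d. norm (t r y) \<le> C * \<theta> ^ r" using bd by blast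
  have "uniform_limit (cball x d) (\<lambda>n x. \<Sum>r<n. t r x) (\<lambda>x. \<Sum>r. t r x) sequentially"
    by (rule Weierstrass_m_test[where M = "\<lambda>r. C * \<theta> ^ r"])
      (use d in \<open>auto intro!: summable_mult summable_geometric\<close>)
  with d show "\<exists>d>0. cball x d \<subseteq> S \<and> uniform_limit (cball x d) (\<lambda>n x. \<Sum>r<n. t r x) (\<lambda>x. \<Sum>r. t r x) sequentially"
    by blast
qed

context qbase
begin

abbreviation "Q x \<equiv> qinf q x"

lemma summable_norm_q: "summable (\<lambda>i. norm (x * q ^ i))" for x :: complex
  using norm_q by (simp add: norm_mult norm_power summable_mult summable_geometric)

lemma convergent_prod_q: "convergent_prod (\<lambda>i. 1 - x * q ^ i)"
proof (rule abs_convergent_prod_imp_convergent_prod, rule summable_imp_abs_convergent_prod)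
  show "summable (\<lambda>i. norm (1 - x * q ^ i - 1))" using summable_norm_q[of x] by simp
qed

lemma P_tendsto_Q: "(\<lambda>n. P x n) \<longlonglongrightarrow> Q x"
  unfolding qpoch_def qinf_def
  using convergent_prod_LIMSEQ[OF convergent_prod_q] by (simp add: LIMSEQ_lessThan_iff_atMost)

lemma Q_eq_0_iff: "Q x = 0 \<longleftrightarrow> \<not> qfree q x"
proof
  assume "Q x = 0"
  then have "\<exists>i. 1 - x * q ^ i = 0"
    using prodinf_nonzero[OF convergent_prod_q[of x]] unfolding qinf_def by blast
  then show "\<not> qfree q x" by (auto simp: qfree_def)
next
  assume "\<not> qfree q x"
  then obtain n where "x * q ^ n = 1" by (auto simp: qfree_def)
  then have "P x m = 0" if "m > n" for m using that by (auto simp: qpoch_def)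
  then have "eventually (\<lambda>m. P x m = 0) sequentially"
    by (auto intro!: eventually_sequentiallyI[of "Suc n"])
  then have "(\<lambda>n. P x n) \<longlonglongrightarrow> 0" by (rule tendsto_eventually)
  with P_tendsto_Q[of x] show "Q x = 0" using LIMSEQ_unique by blast
qed

lemma Q_nonzero: "qfree q x \<Longrightarrow> Q x \<noteq> 0"
  by (simp add: Q_eq_0_iff)

lemma Q_split: "Q x = P x n * Q (x * q ^ n)"
proof -
  have "(\<lambda>m. P x (n + m)) \<longlonglongrightarrow> P x n * Q (x * q ^ n)"
    unfolding qpoch_add by (intro tendsto_intros P_tendsto_Q)
  moreover have "(\<lambda>m. P x (n + m)) \<longlonglongrightarrow> Q x"
    using LIMSEQ_ignore_initial_segment[OF P_tendsto_Q[of x], of n] by (simp add: add.commute)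
  ultimately show ?thesis using LIMSEQ_unique by blast
qed

lemma Q_split1: "Q x = (1 - x) * Q (x * q)"
  using Q_split[of x 1] by (simp add: qpoch_def)

lemma Q_0 [simp]: "Q 0 = 1"
  by (simp add: qinf_def)

text \<open>An upper bound for the product of all \<open>1 + t * norm q ^ i\<close>, hence a common
  majorant of the finite and infinite products whose argument has norm at most
  \<open>t\<close>.\<close>

definition qexp :: "real \<Rightarrow> real"
  where "qexp t = exp (t / (1 - norm q))"

lemma qexp_pos [simp]: "qexp t > 0" "qexp t \<ge> 0"
  by (simp_all add: qexp_def)

lemma qexp_mono: "s \<le> t \<Longrightarrow> qexp s \<le> qexp t"
  using norm_q by (simp add: qexp_def divide_right_mono)

lemma prod_one_plus_le:
  assumes "t \<ge> 0" shows "(\<Prod>i<n. 1 + t * norm q ^ i) \<le> qexp t"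
proof -
  have "(\<Prod>i<n. 1 + t * norm q ^ i) \<le> (\<Prod>i<n. exp (t * norm q ^ i))"
    using assms by (intro prod_mono) (auto intro: add_nonneg_nonneg)
  also have "\<dots> = exp (\<Sum>i<n. t * norm q ^ i)" by (simp add: exp_sum)
  also have "(\<Sum>i<n. t * norm q ^ i) \<le> (\<Sum>i. t * norm q ^ i)"
    using assms norm_q by (intro sum_le_suminf summable_mult summable_geometric) auto
  also have "(\<Sum>i. t * norm q ^ i) = t / (1 - norm q)"
    using norm_q by (simp add: suminf_mult summable_geometric suminf_geometric)
  finally show ?thesis by (simp add: qexp_def)
qed

lemma norm_P_le: "norm x \<le> t \<Longrightarrow> norm (P x n) \<le> qexp t"
proof -
  assume "norm x \<le> t"
  have "norm (P x n) \<le> (\<Prod>i<n. 1 + norm x * norm q ^ i)"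
    unfolding qpoch_def prod_norm[symmetric]
    by (intro prod_mono) (auto intro!: order_trans[OF norm_triangle_ineq4] simp: norm_mult norm_power)
  also have "\<dots> \<le> qexp (norm x)" by (rule prod_one_plus_le) simp
  also have "\<dots> \<le> qexp t" by (rule qexp_mono) fact
  finally show ?thesis .
qed

lemma norm_Q_le: "norm x \<le> t \<Longrightarrow> norm (Q x) \<le> qexp t"
  by (rule LIMSEQ_le_const2[OF tendsto_norm[OF P_tendsto_Q]]) (auto intro: norm_P_le)

lemma norm_xq_le: "norm x \<le> t \<Longrightarrow> norm (x * q ^ n) \<le> t"
  using mult_mono[of "norm x" t "norm q ^ n" 1] norm_q
  by (simp add: norm_mult norm_power power_le_one order_trans[OF norm_ge_zero])

lemma P_inverse_bounded:
  assumes "qfree q y" obtains C where "C > 0" "\<And>n. norm (1 / P y n) \<le> C"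
proof -
  have "(\<lambda>n. 1 / P y n) \<longlonglongrightarrow> 1 / Q y"
    by (intro tendsto_intros P_tendsto_Q Q_nonzero assms)
  then have "Bseq (\<lambda>n. 1 / P y n)" by (intro convergent_imp_Bseq convergentI)
  then show thesis using that unfolding Bseq_def by blast
qed

lemma Q_holomorphic_UNIV: "Q holomorphic_on UNIV"
proof (rule holomorphic_uniform_sequence[where f = "\<lambda>n x. P x n"])
  show "(\<lambda>x. P x n) holomorphic_on UNIV" for n
    unfolding qpoch_def by (intro holomorphic_intros)
next
  fix x :: complex
  have "uniformly_convergent_on (cball x 1) (\<lambda>N x. \<Prod>n<N. 1 - x * q ^ n)"
  proof (rule uniformly_convergent_on_prod')
    have "uniformly_convergent_on (cball x 1) (\<lambda>N y. \<Sum>n<N. norm (y * q ^ n))"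
    proof (rule Weierstrass_m_test'[where M = "\<lambda>n. (norm x + 1) * norm q ^ n"])
      fix n y assume "y \<in> cball x 1"
      then have "norm y \<le> norm x + 1"
        using norm_triangle_ineq2[of y x] by (simp add: dist_norm norm_minus_commute)
      then show "norm (norm (y * q ^ n)) \<le> (norm x + 1) * norm q ^ n"
        by (simp add: norm_mult norm_power mult_right_mono)
    qed (use norm_q in \<open>auto intro!: summable_mult summable_geometric\<close>)
    then show "uniformly_convergent_on (cball x 1) (\<lambda>N y. \<Sum>n<N. norm (1 - y * q ^ n - 1))" by simp
  qed (auto intro!: continuous_intros)
  then obtain l where l: "uniform_limit (cball x 1) (\<lambda>N x. P x N) l sequentially"
    unfolding uniformly_convergent_on_def qpoch_def by blast
  have "l y = Q y" if "y \<in> cball x 1" for y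
    using tendsto_uniform_limitI[OF l that] P_tendsto_Q LIMSEQ_unique by blast
  then have "uniform_limit (cball x 1) (\<lambda>N x. P x N) Q sequentially"
    using l by (subst uniform_limit_cong'[where g = "\<lambda>N x. P x N" and i = l]) auto
  then show "\<exists>d>0. cball x d \<subseteq> UNIV \<and> uniform_limit (cball x d) (\<lambda>n x. P x n) Q sequentially"
    by (intro exI[of _ 1]) auto
qed simp

lemma Q_holomorphic [holomorphic_intros]: "f holomorphic_on S \<Longrightarrow> (\<lambda>x. Q (f x)) holomorphic_on S"
  using holomorphic_on_compose_gen[OF _ Q_holomorphic_UNIV, of f S] by (simp add: o_def)

lemma Q_continuous [continuous_intros]: "continuous_on S f \<Longrightarrow> continuous_on S (\<lambda>x. Q (f x))"
  using continuous_on_compose2[OF holomorphic_on_imp_continuous_on[OF Q_holomorphic_UNIV], of S f] by simp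

lemma P_holomorphic [holomorphic_intros]: "f holomorphic_on S \<Longrightarrow> (\<lambda>x. P (f x) n) holomorphic_on S"
  unfolding qpoch_def by (intro holomorphic_intros)

lemma P_continuous [continuous_intros]: "continuous_on S f \<Longrightarrow> continuous_on S (\<lambda>x. P (f x) n)"
  unfolding qpoch_def by (intro continuous_intros)

lemma qgen_qfree: "qgen q x \<Longrightarrow> qfree q x"
  unfolding qgen_def qfree_def by (metis power_0)

lemma qgen_mult: "qgen q x \<Longrightarrow> qgen q (x * q ^ k)"
  unfolding qgen_def by (metis mult.assoc power_add mult_eq_0_iff power_not_zero q_nonzero)

lemma qgen_mult1: "qgen q x \<Longrightarrow> qgen q (x * q)"
  using qgen_mult[of x 1] by simp

lemma qgen_divide: "qgen q x \<Longrightarrow> qgen q (x / q ^ k)"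
  unfolding qgen_def
proof (intro conjI allI)
  fix m n assume *: "x \<noteq> 0 \<and> (\<forall>m n. x * q ^ m \<noteq> q ^ n)"
  then have "x * q ^ m \<noteq> q ^ (n + k)" by blast
  then show "x / q ^ k * q ^ m \<noteq> q ^ n" by (simp add: field_simps power_add)
qed auto

lemma qgen_inverse: "qgen q x \<Longrightarrow> qgen q (1 / x)"
  unfolding qgen_def by (auto simp: field_simps) metis

section \<open>Transformations of terminating very-well-poised series\<close>

text \<open>By Watson's transformation both sides become 4phi3 series with the same lower
  parameters, and their upper parameters differ only in the order of \<open>d\<close> and
  \<open>d' = a * q / (b * c)\<close>.\<close>

lemma terminating_bailey:
  assumes nz: "a \<noteq> 0" "b \<noteq> 0" "c \<noteq> 0" "d \<noteq> 0" "e \<noteq> 0"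
    and l: "l = a\<^sup>2 * q / (b * c * d)"
    and fr: "qfree q a" "qfree q (a * q / b)" "qfree q (a * q / c)" "qfree q (a * q / d)" "qfree q (a * q / e)"
      "qfree q (a * q / (d * e))" "qfree q l" "qfree q (l * q / e)"
  shows "(\<Sum>r\<le>n. w8 a b c d e (1 / q ^ n) r) = P (a * q) n * P (l * q / e) n / (P (a * q / e) n * P (l * q) n) *
     (\<Sum>r\<le>n. w8 l (a * q / (c * d)) (a * q / (b * d)) (a * q / (b * c)) e (1 / q ^ n) r)"
proof -
  define b' c' d' where "b' = a * q / (c * d)" and "c' = a * q / (b * d)" and "d' = a * q / (b * c)"
  have eqs: "l * q / b' = a * q / b" "l * q / c' = a * q / c" "l * q / d' = a * q / d" "l * q / (d' * e) = a * q / (d * e)"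
    "l * q / (b' * c') = d" "d' * e / (l * q ^ n) = d * e / (a * q ^ n)"
    using nz by (simp_all add: l b'_def c'_def d'_def field_simps power2_eq_square)
  have nz': "l \<noteq> 0" "b' \<noteq> 0" "c' \<noteq> 0" "d' \<noteq> 0" using nz by (simp_all add: l b'_def c'_def d'_def)
  have W1: "(\<Sum>r\<le>n. w8 a b c d e (1 / q ^ n) r) =
    P (a * q) n * P (a * q / (d * e)) n / (P (a * q / d) n * P (a * q / e) n) *
    phi43 d' d e (a * q / b) (a * q / c) (d * e / (a * q ^ n)) n"
    unfolding d'_def by (rule watson) fact+
  have W2: "(\<Sum>r\<le>n. w8 l b' c' d' e (1 / q ^ n) r) =
    P (l * q) n * P (a * q / (d * e)) n / (P (a * q / d) n * P (l * q / e) n) *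
    phi43 d d' e (a * q / b) (a * q / c) (d * e / (a * q ^ n)) n"
    using watson[of l b' c' d' e n] nz' nz fr unfolding eqs by blast
  have s: "phi43 d d' e (a * q / b) (a * q / c) (d * e / (a * q ^ n)) n = phi43 d' d e (a * q / b) (a * q / c) (d * e / (a * q ^ n)) n"
    unfolding phi43_def by (simp add: mult_ac)
  have pn: "P (l * q) n \<noteq> 0" "P (l * q / e) n \<noteq> 0" "P (a * q / (d * e)) n \<noteq> 0"
    using fr qfree_mult1 by (auto intro!: qpoch_nonzero)
  show ?thesis unfolding b'_def[symmetric] c'_def[symmetric] d'_def[symmetric] W1 W2 s
    using pn by (simp add: mult_ac)
qed

text \<open>Summation from the other end, with \<open>j\<close> replaced by \<open>n - j\<close>.
  Each reversed factor leaves a monomial, and the balance condition \<open>bal\<close> makes these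
  monomials combine to the powers of \<open>q\<close> on the right.\<close>

lemma phi43_reverse:
  assumes nz: "A \<noteq> 0" "B \<noteq> 0" "C \<noteq> 0" "D \<noteq> 0" "E \<noteq> 0" "F \<noteq> 0"
    and bal: "D * E * F * q ^ n = A * B * C * q"
    and pn: "P A n \<noteq> 0" "P B n \<noteq> 0" "P C n \<noteq> 0" "P D n \<noteq> 0" "P E n \<noteq> 0" "P F n \<noteq> 0"
  shows "phi43 A B C D E F n = P A n * P B n * P C n * P (1 / q ^ n) n / (P q n * P D n * P E n * P F n) * q ^ n *
     phi43 (q / (D * q ^ n)) (q / (E * q ^ n)) (q / (F * q ^ n)) (q / (A * q ^ n)) (q / (B * q ^ n)) (q / (C * q ^ n)) n"
proof -
  have rev: "P x n = P x (n - j) * (x ^ j * (q ^ n) ^ j * refl 1 j) * P (q / (x * q ^ n)) j" if "j \<le> n" "x \<noteq> 0" for x j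
  proof -
    have qn: "q ^ n = q ^ (n - j) * q ^ j" using that by (simp flip: power_add)
    have "P x n = P x (n - j + j)" using that by simp
    also have "\<dots> = P x (n - j) * P (x * q ^ (n - j)) j" by (rule qpoch_add)
    also have "x * q ^ (n - j) = x * q ^ n / q ^ j" unfolding qn by simp
    also have "P (x * q ^ n / q ^ j) j = refl (x * q ^ n) j * P (q / (x * q ^ n)) j"
      using that by (intro qpoch_reflect) simp
    also have "refl (x * q ^ n) j = x ^ j * (q ^ n) ^ j * refl 1 j"
      using refl_mult[of "x * q ^ n" 1 j] by (simp add: power_mult_distrib)
    finally show ?thesis by simp
  qed
  have T: "P A (n - j) * P B (n - j) * P C (n - j) * P (1 / q ^ n) (n - j) / (P q (n - j) * P D (n - j) * P E (n - j) * P F (n - j)) * q ^ (n - j)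
     = P A n * P B n * P C n * P (1 / q ^ n) n / (P q n * P D n * P E n * P F n) * q ^ n *
      (P (q / (D * q ^ n)) j * P (q / (E * q ^ n)) j * P (q / (F * q ^ n)) j * P (1 / q ^ n) j /
       (P q j * P (q / (A * q ^ n)) j * P (q / (B * q ^ n)) j * P (q / (C * q ^ n)) j) * q ^ j)" if j: "j \<le> n" for j
  proof -
    define N where "N = q ^ n"
    have N0: "N \<noteq> 0" by (simp add: N_def)
    define R where "R = refl 1 j"
    have R0: "R \<noteq> 0" by (simp add: R_def refl_nonzero)
    note r = rev[OF j, folded N_def R_def]
    define X where "X = (\<lambda>x. x ^ j * N ^ j * R)"
    have X0: "X x \<noteq> 0" if "x \<noteq> 0" for x using that N0 R0 by (simp add: X_def)
    have rA: "P A n = P A (n - j) * X A * P (q / (A * N)) j" and rB: "P B n = P B (n - j) * X B * P (q / (B * N)) j"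
      and rC: "P C n = P C (n - j) * X C * P (q / (C * N)) j" and rD: "P D n = P D (n - j) * X D * P (q / (D * N)) j"
      and rE: "P E n = P E (n - j) * X E * P (q / (E * N)) j" and rF: "P F n = P F (n - j) * X F * P (q / (F * N)) j"
      unfolding X_def by (rule r; fact)+
    have r1: "P (1 / N) n = P (1 / N) (n - j) * X (1 / N) * P q j" unfolding X_def using r[of "1 / N"] N0 by simp
    have rq: "P q n = P q (n - j) * X q * P (1 / N) j" unfolding X_def using r[of q] N0 by simp
    have n1: "P (1 / N) j \<noteq> 0" using rq P_q_nonzero[of n] by auto
    have nn: "P A (n - j) \<noteq> 0" "P (q / (A * N)) j \<noteq> 0" "P B (n - j) \<noteq> 0" "P (q / (B * N)) j \<noteq> 0"
      "P C (n - j) \<noteq> 0" "P (q / (C * N)) j \<noteq> 0" "P D (n - j) \<noteq> 0" "P (q / (D * N)) j \<noteq> 0"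
      "P E (n - j) \<noteq> 0" "P (q / (E * N)) j \<noteq> 0" "P F (n - j) \<noteq> 0" "P (q / (F * N)) j \<noteq> 0"
      using pn rA rB rC rD rE rF by auto
    have Xr: "X A * X B * X C * X (1 / N) * q ^ n * q ^ j = X q * X D * X E * X F * q ^ (n - j)"
    proof -
      have "X q * X D * X E * X F * q ^ (n - j) = (q * (D * E * F * N)) ^ j * (N ^ j) ^ 3 * R ^ 4 * q ^ (n - j)"
        by (simp add: X_def power_mult_distrib power3_eq_cube power4_eq_xxxx)
      also have "\<dots> = (A * B * C) ^ j * (N ^ j) ^ 3 * R ^ 4 * (q ^ j * (q ^ j * q ^ (n - j)))"
        unfolding N_def bal by (simp add: power_mult_distrib)
      also have "q ^ j * q ^ (n - j) = q ^ n" using j by (simp flip: power_add)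
      finally have h: "X q * X D * X E * X F * q ^ (n - j) = (A * B * C) ^ j * (N ^ j) ^ 3 * R ^ 4 * (q ^ j * q ^ n)" .
      show ?thesis unfolding h using N0
        by (simp add: X_def power_mult_distrib power3_eq_cube power4_eq_xxxx power_divide)
    qed
    have alg: "a1 * a2 * a3 * a4 / (a5 * a6 * a7 * a8) * t2 =
      (a1 * x1 * b1) * (a2 * x2 * b2) * (a3 * x3 * b3) * (a4 * x4 * b4) / ((a5 * x5 * b5) * (a6 * x6 * b6) * (a7 * x7 * b7) * (a8 * x8 * b8)) * t1 *
      (b6 * b7 * b8 * b5 / (b4 * b1 * b2 * b3) * t3)"
      if "x1 * x2 * x3 * x4 * t1 * t3 = x5 * x6 * x7 * x8 * t2" "x5 * x6 * x7 * x8 \<noteq> 0"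
        "b1 \<noteq> 0" "b2 \<noteq> 0" "b3 \<noteq> 0" "b4 \<noteq> 0" "b5 \<noteq> 0" "b6 \<noteq> 0" "b7 \<noteq> 0" "b8 \<noteq> 0"
      for a1 a2 a3 a4 a5 a6 a7 a8 b1 b2 b3 b4 b5 b6 b7 b8 x1 x2 x3 x4 x5 x6 x7 x8 t1 t2 t3 :: complex
    proof -
      have "(a1 * x1 * b1) * (a2 * x2 * b2) * (a3 * x3 * b3) * (a4 * x4 * b4) / ((a5 * x5 * b5) * (a6 * x6 * b6) * (a7 * x7 * b7) * (a8 * x8 * b8)) * t1 *
      (b6 * b7 * b8 * b5 / (b4 * b1 * b2 * b3) * t3)
        = a1 * a2 * a3 * a4 / (a5 * a6 * a7 * a8) * ((x1 * x2 * x3 * x4 * t1 * t3) / (x5 * x6 * x7 * x8))"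
        using that(3-) by (simp add: mult_ac)
      also have "(x1 * x2 * x3 * x4 * t1 * t3) / (x5 * x6 * x7 * x8) = t2"
        unfolding that(1) using that(2) by simp
      finally show ?thesis by simp
    qed
    show ?thesis unfolding N_def[symmetric] rA rB rC rD rE rF r1 rq
      by (rule alg[OF Xr[folded N_def]]) (use X0 nz N0 nn n1 in auto)
  qed
  have "phi43 A B C D E F n = (\<Sum>j\<le>n. P A (n - j) * P B (n - j) * P C (n - j) * P (1 / q ^ n) (n - j) / (P q (n - j) * P D (n - j) * P E (n - j) * P F (n - j)) * q ^ (n - j))"
    unfolding phi43_def by (rule sum.nat_diff_reindex[symmetric, of _ "Suc n", unfolded lessThan_Suc_atMost diff_Suc_Suc])
  also have "\<dots> = (\<Sum>j\<le>n. P A n * P B n * P C n * P (1 / q ^ n) n / (P q n * P D n * P E n * P F n) * q ^ n *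
      (P (q / (D * q ^ n)) j * P (q / (E * q ^ n)) j * P (q / (F * q ^ n)) j * P (1 / q ^ n) j /
       (P q j * P (q / (A * q ^ n)) j * P (q / (B * q ^ n)) j * P (q / (C * q ^ n)) j) * q ^ j))"
    by (intro sum.cong T) auto
  finally show ?thesis unfolding sum_distrib_left[symmetric] phi43_def .
qed

text \<open>Watson's transformation, reversal of the 4phi3, and Watson's transformation backwards.
  For \<open>f = F * q ^ n\<close> the parameters \<open>f / (c * q ^ n)\<close> and
  \<open>f / (a * q ^ n)\<close> of the new series become the constants \<open>F / c\<close> and
  \<open>F / a\<close>; this is the germ of the three-term relation.\<close>

lemma terminating_reversed:
  assumes nz: "a \<noteq> 0" "b \<noteq> 0" "c \<noteq> 0" "d \<noteq> 0" "f \<noteq> 0"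
    and ge: "qgen q a" "qgen q (a / b)" "qgen q (a / c)" "qgen q (a / d)" "qgen q (a / f)" "qgen q (a / (c * d))"
      "qgen q (a / (b * f))" "qgen q c" "qgen q d" "qgen q (f / c)" "qgen q (a / (d * f))"
  shows "(\<Sum>r\<le>n. w8 a b c d f (1 / q ^ n) r) =
     P (a * q) n * P (a * q / (d * f)) n * P (q / (c * q ^ n)) n * P (b * f / (a * q ^ n)) n /
      (P (a * q / d) n * P (a * q / f) n * P (f * q / (c * q ^ n)) n * P (b / (a * q ^ n)) n) *
     (\<Sum>r\<le>n. w8 (f / (c * q ^ n)) (a * q / (b * c)) (a * q / (c * d)) (f / (a * q ^ n)) f (1 / q ^ n) r)"
proof -
  define N where "N = q ^ n"
  have N0: "N \<noteq> 0" by (simp add: N_def)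
  have gm: "qgen q (x * q / y)" if "qgen q (x / y)" for x y
    using qgen_mult1[OF that] by (simp add: mult_ac)
  have gd: "qgen q (x / (y * N))" if "qgen q (x / y)" for x y
    using qgen_divide[OF that, of n] by (simp add: N_def)
  have gi: "qgen q (y / x)" if "qgen q (x / y)" for x y
    using qgen_inverse[OF that] by simp
  define \<alpha> where "\<alpha> = f / (c * N)"
  define b' c' d' where "b' = a * q / (b * c)" and "c' = a * q / (c * d)" and "d' = f / (a * N)"
  have nz': "\<alpha> \<noteq> 0" "b' \<noteq> 0" "c' \<noteq> 0" "d' \<noteq> 0" using nz N0 by (simp_all add: \<alpha>_def b'_def c'_def d'_def)
  define A E F where "A = a * q / (b * f)" and "E = a * q / b" and "F = a * q / f"
  define G where "G = c * d / (a * N)"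
  have eqs: "\<alpha> * q / f = q / (c * N)" "\<alpha> * q / b' = b * f / (a * N)" "\<alpha> * q / c' = d * f / (a * N)"
      "\<alpha> * q / d' = a * q / c" "\<alpha> * q / (c' * d') = d" "\<alpha> * q / (f * b') = b / (a * N)" "c' * d' / (\<alpha> * N) = q / (d * N)"
      "a * q / (b * f) = A"
    using nz N0 by (simp_all add: \<alpha>_def b'_def c'_def d'_def A_def field_simps)
  have c1: "qgen q (1 / c)" by (rule qgen_inverse) fact
  have fr2: "qfree q \<alpha>" "qfree q (q / (c * N))" "qfree q (b * f / (a * N))" "qfree q (d * f / (a * N))" "qfree q (a * q / c)" "qfree q d"
    using qgen_qfree[OF gd[OF ge(10)]] qgen_qfree[OF gd[OF gm[OF c1]]] qgen_qfree[OF gd[OF gi[OF ge(7)]]]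
      qgen_qfree[OF gd[OF gi[OF ge(11)]]] qgen_qfree[OF gm[OF ge(3)]] qgen_qfree[OF ge(9)]
    by (simp_all add: \<alpha>_def)
  have fr1: "qfree q a" "qfree q E" "qfree q F" "qfree q (a * q / d)" "qfree q c'" "qfree q A" "qfree q c" "qfree q G"
      "qfree q (a * q / (d * f))"
    unfolding E_def F_def c'_def A_def G_def using ge(1,8) gm[OF ge(2)] gm[OF ge(5)] gm[OF ge(4)] gm[OF ge(6)] gm[OF ge(7)]
      gd[OF gi[OF ge(6)]] gm[OF ge(11)] by (auto intro: qgen_qfree)
  \<comment> \<open>Watson's transformation treats its parameters unequally. With the order
    \<open>b, f, c, d\<close> the reversed 4phi3 is again of Watson's form, now with
    \<open>\<alpha> = f / (c * N)\<close> in the role of \<open>a\<close>.\<close>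
  have W1: "(\<Sum>r\<le>n. w8 a b f c d (1 / q ^ n) r) = P (a * q) n * P c' n / (P (a * q / c) n * P (a * q / d) n) * phi43 A c d E F G n"
    using watson[of a b f c d n] nz fr1 fr2 unfolding c'_def E_def F_def G_def N_def A_def by simp
  have R: "phi43 A c d E F G n = P A n * P c n * P d n * P (1 / q ^ n) n / (P q n * P E n * P F n * P G n) * q ^ n *
     phi43 (b / (a * N)) d' c' (b * f / (a * N)) (q / (c * N)) (q / (d * N)) n"
  proof -
    have "q / (E * N) = b / (a * N)" "q / (F * N) = d'" "q / (G * N) = c'" "q / (A * N) = b * f / (a * N)"
      using nz N0 by (simp_all add: A_def E_def F_def G_def c'_def d'_def field_simps)
    moreover have "E * F * G * q ^ n = A * c * d * q" using nz N0
      by (simp add: A_def E_def F_def G_def N_def field_simps)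
    moreover have "P A n \<noteq> 0" "P c n \<noteq> 0" "P d n \<noteq> 0" "P E n \<noteq> 0" "P F n \<noteq> 0" "P G n \<noteq> 0"
      using fr1 fr2 by (auto simp: qpoch_nonzero)
    ultimately show ?thesis
      using phi43_reverse[of A c d E F G n] nz N0 by (simp add: A_def E_def F_def G_def N_def)
  qed
  have W2: "(\<Sum>r\<le>n. w8 \<alpha> f b' c' d' (1 / q ^ n) r) = P (\<alpha> * q) n * P d n / (P (d * f / (a * N)) n * P (a * q / c) n) *
      phi43 (b / (a * N)) c' d' (q / (c * N)) (b * f / (a * N)) (q / (d * N)) n"
    using watson[of \<alpha> f b' c' d' n] nz nz' fr2 unfolding eqs N_def[symmetric] by blast
  have s: "phi43 (b / (a * N)) d' c' (b * f / (a * N)) (q / (c * N)) (q / (d * N)) n =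
      phi43 (b / (a * N)) c' d' (q / (c * N)) (b * f / (a * N)) (q / (d * N)) n"
    unfolding phi43_def by (simp add: mult_ac)
  have refls: "P (d * f / (a * N)) n = refl (d * f / a) n * P (a * q / (d * f)) n" "P G n = refl (c * d / a) n * P c' n"
     "P (1 / N) n = refl 1 n * P q n" "P (q / (c * N)) n = refl (q / c) n * P c n" "P (b * f / (a * N)) n = refl (b * f / a) n * P A n"
     "P (b / (a * N)) n = refl (b / a) n * P E n"
    using qpoch_reflect[of "d * f / a" n] qpoch_reflect[of "c * d / a" n] qpoch_reflect[of 1 n] qpoch_reflect[of "q / c" n]
      qpoch_reflect[of "b * f / a" n] qpoch_reflect[of "b / a" n] nz
    unfolding G_def c'_def A_def E_def N_def by (simp_all add: mult_ac)
  have refl_rel: "refl (d * f / a) n * refl 1 n * q ^ n * refl (b / a) n = refl (q / c) n * refl (b * f / a) n * refl (c * d / a) n"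
    using refl_mult[of "d * f / a" 1 n] refl_mult[of "b / a" 1 n] refl_mult[of "q / c" 1 n] refl_mult[of "b * f / a" 1 n] refl_mult[of "c * d / a" 1 n] nz
    by (simp add: power_mult_distrib power_divide)
  have pnz: "P (a * q / c) n \<noteq> 0" "P c' n \<noteq> 0" "P (d * f / (a * N)) n \<noteq> 0" "P d n \<noteq> 0" "P (\<alpha> * q) n \<noteq> 0" "refl (c * d / a) n \<noteq> 0" "refl (b / a) n \<noteq> 0"
     "P E n \<noteq> 0" "P (a * q / (d * f)) n \<noteq> 0"
    using fr1 fr2 nz qfree_mult1[OF fr2(1)] by (auto simp: qpoch_nonzero refl_nonzero)
  have "(\<Sum>r\<le>n. w8 a b c d f (1 / q ^ n) r) = (\<Sum>r\<le>n. w8 a b f c d (1 / q ^ n) r)"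
    by (simp add: w8_def mult_ac)
  also have "\<dots> = (P (a * q) n * P c' n / (P (a * q / c) n * P (a * q / d) n)) *
     (P A n * P c n * P d n * P (1 / N) n / (P q n * P E n * P F n * P G n) * N) *
     (P (d * f / (a * N)) n * P (a * q / c) n / (P (\<alpha> * q) n * P d n)) * (\<Sum>r\<le>n. w8 \<alpha> f b' c' d' (1 / q ^ n) r)"
    unfolding W1 R W2 s unfolding N_def[symmetric] using pnz by (simp add: mult_ac)
  also have "(P (a * q) n * P c' n / (P (a * q / c) n * P (a * q / d) n)) *
     (P A n * P c n * P d n * P (1 / N) n / (P q n * P E n * P F n * P G n) * N) *
     (P (d * f / (a * N)) n * P (a * q / c) n / (P (\<alpha> * q) n * P d n))
     = P (a * q) n * P (a * q / (d * f)) n * P (q / (c * N)) n * P (b * f / (a * N)) n /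
      (P (a * q / d) n * P F n * P (\<alpha> * q) n * P (b / (a * N)) n)"
  proof -
    have "(P (a * q) n * P c' n / (P (a * q / c) n * P (a * q / d) n)) *
     (P A n * P c n * P d n * P (1 / N) n / (P q n * P E n * P F n * P G n) * N) *
     (P (d * f / (a * N)) n * P (a * q / c) n / (P (\<alpha> * q) n * P d n))
     = P (a * q) n * P (a * q / (d * f)) n * P c n * P A n / (P (a * q / d) n * P F n * P (\<alpha> * q) n * P E n) *
       (refl (d * f / a) n * refl 1 n * N / refl (c * d / a) n)"
      unfolding refls using pnz by (simp add: mult_ac)
    also have "refl (d * f / a) n * refl 1 n * N / refl (c * d / a) n = refl (q / c) n * refl (b * f / a) n / refl (b / a) n"
      using refl_rel pnz unfolding N_def by (simp add: divide_simps mult_ac)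
    finally show ?thesis unfolding refls by (simp add: mult_ac)
  qed
  also have "(\<Sum>r\<le>n. w8 \<alpha> f b' c' d' (1 / q ^ n) r) = (\<Sum>r\<le>n. w8 \<alpha> b' c' d' f (1 / q ^ n) r)"
    by (simp add: w8_def mult_ac)
  finally show ?thesis by (simp add: \<alpha>_def b'_def c'_def d'_def F_def N_def mult_ac)
qed

subsection \<open>Nonterminating very-well-poised series and Bailey's two-term transformation\<close>

text \<open>The part of the term of an 8W7 that involves neither \<open>e\<close> and
  \<open>f\<close> nor the power of the argument; it stays bounded in \<open>r\<close>.\<close>

definition kterm :: "complex \<Rightarrow> complex \<Rightarrow> complex \<Rightarrow> complex \<Rightarrow> nat \<Rightarrow> complex"
  where "kterm a b c d r = (1 - a * q ^ (2 * r)) / (1 - a) *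
    (P a r * P b r * P c r * P d r / (P q r * P (a * q / b) r * P (a * q / c) r * P (a * q / d) r))"

definition wnt :: "complex \<Rightarrow> complex \<Rightarrow> complex \<Rightarrow> complex \<Rightarrow> complex \<Rightarrow> complex \<Rightarrow> nat \<Rightarrow> complex"
  where "wnt a b c d e f r = kterm a b c d r * (a\<^sup>2 * q\<^sup>2 / (b * c * d * e * f)) ^ r *
     (P e r * P f r * Q (a * q / e * q ^ r) * Q (a * q / f * q ^ r))"

text \<open>The factors of \<open>e\<close> and \<open>f\<close> are absorbed, so that \<open>wn\<close> is entire in them up to the power \<open>(1 / (e f)) ^ r\<close>.\<close>

definition wn :: "complex \<Rightarrow> complex \<Rightarrow> complex \<Rightarrow> complex \<Rightarrow> complex \<Rightarrow> complex \<Rightarrow> complex"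
  where "wn a b c d e f = (\<Sum>r. wnt a b c d e f r)"

lemma wnt_w8:
  assumes "qfree q (a * q / e)" "qfree q (a * q / f)"
  shows "wnt a b c d e f r = Q (a * q / e) * Q (a * q / f) * w8 a b c d e f r"
  unfolding wnt_def w8_def kterm_def Q_split[of "a * q / e" r] Q_split[of "a * q / f" r]
  using qpoch_nonzero[OF assms(1)] qpoch_nonzero[OF assms(2)] by (simp add: mult_ac)

lemma w8_terminates: "r > n \<Longrightarrow> w8 a b c d e (1 / q ^ n) r = 0"
  by (simp add: w8_def qpoch_inverse_power_eq_0)

lemma wn_terminating:
  assumes "qfree q (a * q / e)" "qfree q (a * q * q ^ n)"
  shows "wn a b c d e (1 / q ^ n) = Q (a * q / e) * Q (a * q * q ^ n) * (\<Sum>r\<le>n. w8 a b c d e (1 / q ^ n) r)"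
proof -
  have "wn a b c d e (1 / q ^ n) = (\<Sum>r. Q (a * q / e) * Q (a * q * q ^ n) * w8 a b c d e (1 / q ^ n) r)"
    unfolding wn_def using wnt_w8[of a e "1 / q ^ n"] assms by (simp cong: suminf_cong)
  also have "\<dots> = (\<Sum>r\<le>n. Q (a * q / e) * Q (a * q * q ^ n) * w8 a b c d e (1 / q ^ n) r)"
    by (rule suminf_finite) (auto simp: w8_terminates)
  finally show ?thesis by (simp add: sum_distrib_left)
qed

lemma kterm_bounded:
  assumes "qfree q (a * q / b)" "qfree q (a * q / c)" "qfree q (a * q / d)"
  obtains C where "C > 0" "\<And>r. norm (kterm a b c d r) \<le> C"
proof -
  obtain C1 where C1: "C1 > 0" "\<And>n. norm (1 / P (a * q / b) n) \<le> C1" using P_inverse_bounded[OF assms(1)] by blast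
  obtain C2 where C2: "C2 > 0" "\<And>n. norm (1 / P (a * q / c) n) \<le> C2" using P_inverse_bounded[OF assms(2)] by blast
  obtain C3 where C3: "C3 > 0" "\<And>n. norm (1 / P (a * q / d) n) \<le> C3" using P_inverse_bounded[OF assms(3)] by blast
  obtain C4 where C4: "C4 > 0" "\<And>n. norm (1 / P q n) \<le> C4" using P_inverse_bounded[OF qfree_q] by blast
  define C where "C = (1 + norm a) * norm (1 / (1 - a)) * (qexp (norm a) * qexp (norm b) * qexp (norm c) * qexp (norm d) * (C4 * C1 * C2 * C3))"
  have "norm (kterm a b c d r) \<le> C + 1" for r
  proof -
    have b1: "norm (1 - a * q ^ (2 * r)) \<le> 1 + norm a"
      using norm_triangle_ineq4[of 1 "a * q ^ (2 * r)"] norm_xq_le[of a "norm a" "2 * r"] by simp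
    have eq: "kterm a b c d r = (1 - a * q ^ (2 * r)) * (1 / (1 - a)) * (P a r * P b r * P c r * P d r *
        ((1 / P q r) * (1 / P (a * q / b) r) * (1 / P (a * q / c) r) * (1 / P (a * q / d) r)))"
      by (simp add: kterm_def)
    have "norm (kterm a b c d r) \<le> C"
      unfolding eq C_def norm_mult
      by (intro mult_mono b1 norm_P_le order_refl C1(2) C2(2) C3(2) C4(2) mult_nonneg_nonneg norm_ge_zero qexp_pos)
        (use C1 C2 C3 C4 in \<open>auto intro!: mult_nonneg_nonneg simp: less_imp_le\<close>)
    then show ?thesis by simp
  qed
  moreover have "C + 1 > 0" unfolding C_def using C1 C2 C3 C4
    by (intro add_nonneg_pos mult_nonneg_nonneg) (auto simp: less_imp_le)
  ultimately show thesis using that by blast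
qed

text \<open>For \<open>g \<noteq> 0\<close> this is \<open>g ^ r * P (1 / g) r\<close>. Written with
  it, the series as a function of \<open>g = 1 / f\<close> is holomorphic at \<open>g = 0\<close>,
  where \<open>f\<close> would be infinite.\<close>

definition gp :: "complex \<Rightarrow> nat \<Rightarrow> complex"
  where "gp g r = (\<Prod>i<r. g - q ^ i)"

lemma gp_eq: "g \<noteq> 0 \<Longrightarrow> g ^ r * P (1 / g) r = gp g r"
proof -
  assume "g \<noteq> 0"
  have "g ^ r * P (1 / g) r = (\<Prod>i<r. g * (1 - 1 / g * q ^ i))"
    by (simp add: qpoch_def prod.distrib)
  also have "\<dots> = gp g r" unfolding gp_def using \<open>g \<noteq> 0\<close> by (intro prod.cong) (auto simp: field_simps)
  finally show ?thesis .
qed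

lemma norm_gp_le:
  assumes "norm g \<le> G" "G > 0" shows "norm (gp g r) \<le> G ^ r * qexp (1 / G)"
proof -
  have "norm (gp g r) \<le> (\<Prod>i<r. G * (1 + 1 / G * norm q ^ i))"
    unfolding gp_def prod_norm[symmetric]
  proof (intro prod_mono conjI)
    fix i
    have "norm (g - q ^ i) \<le> norm g + norm (q ^ i)" by (rule norm_triangle_ineq4)
    also have "\<dots> \<le> G * (1 + 1 / G * norm q ^ i)" using assms by (simp add: norm_power algebra_simps)
    finally show "norm (g - q ^ i) \<le> G * (1 + 1 / G * norm q ^ i)" .
  qed auto
  also have "\<dots> = G ^ r * (\<Prod>i<r. 1 + 1 / G * norm q ^ i)" by (simp only: prod.distrib prod_constant card_lessThan)
  also have "\<dots> \<le> G ^ r * qexp (1 / G)"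
    using assms by (intro mult_left_mono prod_one_plus_le) auto
  finally show ?thesis .
qed

text \<open>On the disc of radius \<open>G\<close> the factor \<open>gp g r\<close> is at most a
  constant times \<open>G ^ r\<close>, so \<open>G * norm v < 1\<close> gives a geometric majorant.
  The alternative of a terminating series serves \<open>three_term_swapped_zero\<close>, where the
  argument of one series is not assumed small.\<close>

lemma gp_series_holomorphic:
  assumes G: "G > 0" and K: "\<And>r. norm (k r) \<le> C"
    and conv: "G * norm v < 1 \<or> (\<forall>r>m. k r = 0)"
  shows "(\<lambda>g. \<Sum>r. k r * v ^ r * gp g r * Q (\<alpha> * g * q ^ r)) holomorphic_on ball 0 G"
proof (rule holomorphic_on_suminf)
  show "(\<lambda>g. k r * v ^ r * gp g r * Q (\<alpha> * g * q ^ r)) holomorphic_on ball 0 G" for r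
    unfolding gp_def by (intro holomorphic_intros)
  fix x :: complex assume "x \<in> ball 0 G"
  define d where "d = (G - norm x) / 2"
  have d: "d > 0" "cball x d \<subseteq> ball 0 G"
  proof -
    show "d > 0" using \<open>x \<in> ball 0 G\<close> by (simp add: d_def)
    show "cball x d \<subseteq> ball 0 G"
    proof
      fix y assume "y \<in> cball x d"
      then have "norm y \<le> norm x + d" using norm_triangle_ineq2[of y x] by (simp add: dist_norm norm_minus_commute)
      also have "\<dots> < G" using \<open>x \<in> ball 0 G\<close> by (simp add: d_def field_simps)
      finally show "y \<in> ball 0 G" by simp
    qed
  qed
  have C0: "C \<ge> 0" using K[of 0] norm_ge_zero order_trans by blast
  define B where "B = qexp (1 / G) * qexp (norm \<alpha> * G)"
  have bd: "norm (k r * v ^ r * gp y r * Q (\<alpha> * y * q ^ r)) \<le> norm (k r) * B * (G * norm v) ^ r" if "y \<in> ball 0 G" for r y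
  proof -
    have y: "norm y \<le> G" using that by simp
    have 1: "norm (gp y r) \<le> G ^ r * qexp (1 / G)" by (rule norm_gp_le[OF y G])
    have 2: "norm (Q (\<alpha> * y * q ^ r)) \<le> qexp (norm \<alpha> * G)"
      by (intro norm_Q_le norm_xq_le) (use y in \<open>auto simp: norm_mult intro!: mult_left_mono\<close>)
    have "norm (k r * v ^ r * gp y r * Q (\<alpha> * y * q ^ r)) = norm (k r) * norm v ^ r * (norm (gp y r) * norm (Q (\<alpha> * y * q ^ r)))"
      by (simp add: norm_mult norm_power)
    also have "\<dots> \<le> norm (k r) * norm v ^ r * ((G ^ r * qexp (1 / G)) * qexp (norm \<alpha> * G))"
      using 1 2 G by (intro mult_left_mono mult_mono) auto
    finally show ?thesis by (simp add: B_def power_mult_distrib mult_ac)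
  qed
  have B0: "B \<ge> 0" by (simp add: B_def)
  show "\<exists>d C \<theta>. 0 < d \<and> cball x d \<subseteq> ball 0 G \<and> 0 \<le> \<theta> \<and> \<theta> < 1 \<and>
      (\<forall>r. \<forall>y\<in>cball x d. norm (k r * v ^ r * gp y r * Q (\<alpha> * y * q ^ r)) \<le> C * \<theta> ^ r)"
    using conv
  proof
    assume "G * norm v < 1"
    have "norm (k r * v ^ r * gp y r * Q (\<alpha> * y * q ^ r)) \<le> C * B * (G * norm v) ^ r" if "y \<in> cball x d" for r y
    proof -
      have "norm (k r * v ^ r * gp y r * Q (\<alpha> * y * q ^ r)) \<le> norm (k r) * B * (G * norm v) ^ r"
        using bd that d by blast
      also have "\<dots> \<le> C * B * (G * norm v) ^ r"
        using K B0 G by (intro mult_right_mono) auto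
      finally show ?thesis .
    qed
    then show ?thesis using d G \<open>G * norm v < 1\<close>
      by (intro exI[of _ d] exI[of _ "C * B"] exI[of _ "G * norm v"]) auto
  next
    assume fin: "\<forall>r>m. k r = 0"
    \<comment> \<open>A finite sum is fitted into the geometric pattern with ratio
      \<open>1 / 2\<close>; the factor \<open>2 ^ r\<close> in the constant compensates the
      ratio.\<close>
    define M where "M = (\<Sum>r\<le>m. C * B * (G * norm v) ^ r * 2 ^ r)"
    have "norm (k r * v ^ r * gp y r * Q (\<alpha> * y * q ^ r)) \<le> M * (1 / 2) ^ r" if "y \<in> cball x d" for r y
    proof (cases "r \<le> m")
      case True
      have "norm (k r * v ^ r * gp y r * Q (\<alpha> * y * q ^ r)) \<le> norm (k r) * B * (G * norm v) ^ r"
        using bd that d by blast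
      also have "\<dots> \<le> C * B * (G * norm v) ^ r"
        using K B0 G by (intro mult_right_mono) auto
      also have "\<dots> = C * B * (G * norm v) ^ r * 2 ^ r * (1 / 2) ^ r" by (simp add: power_divide)
      also have "\<dots> \<le> M * (1 / 2) ^ r"
        unfolding M_def using True C0 B0 G
        by (intro mult_right_mono member_le_sum) (auto intro!: mult_nonneg_nonneg)
      finally show ?thesis .
    next
      case False
      then show ?thesis using fin C0 B0 G
        by (auto simp: M_def intro!: mult_nonneg_nonneg sum_nonneg)
    qed
    then show ?thesis using d
      by (intro exI[of _ d] exI[of _ M] exI[of _ "1 / 2"]) auto
  qed
qed simp

end

lemma ex_between_mult:
  assumes "x * w < 1" "x \<ge> 0" "w \<ge> (0::real)"
  obtains G where "G > x" "G * w < 1"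
proof (cases "w = 0")
  case True
  then show ?thesis using that[of "x + 1"] by simp
next
  case False
  with assms have "x < 1 / w" by (simp add: field_simps)
  then obtain G where "x < G" "G < 1 / w" using dense by blast
  with False assms show ?thesis using that[of G] by (simp add: field_simps)
qed

context qbase
begin

lemma wn_swap: "wn a b c d e f = wn a b c d f e"
  unfolding wn_def wnt_def by (simp add: mult_ac)

lemma norm_wnt_le:
  assumes "qfree q (a * q / b)" "qfree q (a * q / c)" "qfree q (a * q / d)"
  obtains C where "\<And>r. norm (wnt a b c d e f r) \<le> C * norm (a\<^sup>2 * q\<^sup>2 / (b * c * d * e * f)) ^ r"
proof -
  obtain C where C: "C > 0" "\<And>r. norm (kterm a b c d r) \<le> C"
    using kterm_bounded[OF assms] by blast
  define B where "B = qexp (norm e) * qexp (norm f) * qexp (norm (a * q / e)) * qexp (norm (a * q / f))"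
  have "norm (wnt a b c d e f r) \<le> (C * B) * norm (a\<^sup>2 * q\<^sup>2 / (b * c * d * e * f)) ^ r" for r
  proof -
    have "norm (P e r * P f r * Q (a * q / e * q ^ r) * Q (a * q / f * q ^ r)) \<le> B"
      unfolding B_def norm_mult[of "_ * _"] norm_mult[of "P e r"]
      by (intro mult_mono norm_P_le norm_Q_le norm_xq_le mult_nonneg_nonneg order_refl) auto
    then have "norm (kterm a b c d r) * norm (P e r * P f r * Q (a * q / e * q ^ r) * Q (a * q / f * q ^ r)) \<le> C * B"
      using C by (intro mult_mono) (auto simp: less_imp_le)
    moreover have "wnt a b c d e f r = (kterm a b c d r * (P e r * P f r * Q (a * q / e * q ^ r) * Q (a * q / f * q ^ r))) *
        (a\<^sup>2 * q\<^sup>2 / (b * c * d * e * f)) ^ r"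
      by (simp add: wnt_def)
    ultimately show ?thesis by (simp only: norm_mult[of "_ * _" "_ ^ _"] norm_power norm_mult[of "kterm a b c d r"] mult_right_mono zero_le_power norm_ge_zero)
  qed
  then show thesis using that by blast
qed

lemma summable_wnt:
  assumes "qfree q (a * q / b)" "qfree q (a * q / c)" "qfree q (a * q / d)"
    and "norm (a\<^sup>2 * q\<^sup>2 / (b * c * d * e * f)) < 1"
  shows "summable (wnt a b c d e f)"
proof -
  obtain C where C: "\<And>r. norm (wnt a b c d e f r) \<le> C * norm (a\<^sup>2 * q\<^sup>2 / (b * c * d * e * f)) ^ r"
    using norm_wnt_le[OF assms(1-3)] by blast
  show ?thesis
    by (rule summable_comparison_test'[OF _ C]) (use assms(4) in \<open>auto intro!: summable_mult summable_geometric\<close>)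
qed

lemma wn_w8:
  assumes fr: "qfree q (a * q / b)" "qfree q (a * q / c)" "qfree q (a * q / d)" "qfree q (a * q / e)" "qfree q (a * q / f)"
    and conv: "norm (a\<^sup>2 * q\<^sup>2 / (b * c * d * e * f)) < 1 \<or> (\<exists>m. b * q ^ m = 1) \<or> (\<exists>m. e * q ^ m = 1)"
  shows "wn a b c d e f = Q (a * q / e) * Q (a * q / f) * (\<Sum>r. w8 a b c d e f r)"
proof -
  have s: "summable (wnt a b c d e f)"
    using conv
  proof (elim disjE exE)
    fix m assume "b * q ^ m = 1"
    then have "P b r = 0" if "r > m" for r using that by (auto simp: qpoch_def)
    then have "wnt a b c d e f r = 0" if "r > m" for r using that by (simp add: wnt_def kterm_def)
    then show ?thesis by (intro summable_finite[of "{..m}"]) auto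
  next
    fix m assume "e * q ^ m = 1"
    then have "P e r = 0" if "r > m" for r using that by (auto simp: qpoch_def)
    then have "wnt a b c d e f r = 0" if "r > m" for r using that by (simp add: wnt_def)
    then show ?thesis by (intro summable_finite[of "{..m}"]) auto
  qed (rule summable_wnt[OF fr(1-3)])
  have Q0: "Q (a * q / e) * Q (a * q / f) \<noteq> 0" using Q_nonzero fr by simp
  have "(\<lambda>r. w8 a b c d e f r) = (\<lambda>r. wnt a b c d e f r / (Q (a * q / e) * Q (a * q / f)))"
    unfolding wnt_w8[OF fr(4,5)] using Q0 by simp
  then have "(\<Sum>r. w8 a b c d e f r) = (\<Sum>r. wnt a b c d e f r) / (Q (a * q / e) * Q (a * q / f))"
    using suminf_divide[OF s] by metis
  then show ?thesis unfolding wn_def using Q0 by (simp add: field_simps)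
qed

text \<open>Both sides are holomorphic in \<open>g = 1 / f\<close> near \<open>0\<close>, and they agree at \<open>g = q ^ n\<close>, where both series terminate.
  The identity is (III.23) in Gasper and Rahman, \<open>Basic Hypergeometric Series\<close>.\<close>

theorem bailey_two_term:
  assumes nz: "a \<noteq> 0" "b \<noteq> 0" "c \<noteq> 0" "d \<noteq> 0" "e \<noteq> 0" "f \<noteq> 0"
    and l: "l = a\<^sup>2 * q / (b * c * d)"
    and fr: "qfree q a" "qfree q (a * q / b)" "qfree q (a * q / c)" "qfree q (a * q / d)" "qfree q (a * q / e)"
      "qfree q (a * q / (d * e))" "qfree q l" "qfree q (l * q / e)"
    and conv1: "norm (a * q / (e * f)) < 1"
    and conv2: "norm (a\<^sup>2 * q\<^sup>2 / (b * c * d * e * f)) < 1 \<or> (\<exists>m. b * q ^ m = 1)"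
  shows "Q (l * q) * Q (l * q / (e * f)) * wn a b c d e f =
         Q (a * q) * Q (a * q / (e * f)) * wn l (a * q / (c * d)) (a * q / (b * d)) (a * q / (b * c)) e f"
proof -
  define b' c' d' where "b' = a * q / (c * d)" and "c' = a * q / (b * d)" and "d' = a * q / (b * c)"
  define v v' where "v = a\<^sup>2 * q\<^sup>2 / (b * c * d * e)" and "v' = a * q / e"
  have eqs: "l * q / b' = a * q / b" "l * q / c' = a * q / c" "l * q / d' = a * q / d"
    "l\<^sup>2 * q\<^sup>2 / (b' * c' * d' * e) = v'"
    using nz by (simp_all add: l b'_def c'_def d'_def v'_def field_simps power2_eq_square)
  have fr': "qfree q (l * q / b')" "qfree q (l * q / c')" "qfree q (l * q / d')"
    unfolding eqs by fact+
  define k where "k = (\<lambda>a b c d r. kterm a b c d r * (P e r * Q (a * q / e * q ^ r)))"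
  define S where "S = (\<lambda>a b c d v g. \<Sum>r. k a b c d r * v ^ r * gp g r * Q (a * q * g * q ^ r))"
  have k_bd: "\<exists>C. \<forall>r. norm (k a b c d r) \<le> C"
    if h: "qfree q (a * q / b)" "qfree q (a * q / c)" "qfree q (a * q / d)" for a b c d
  proof -
    obtain C where C: "C > 0" "\<And>r. norm (kterm a b c d r) \<le> C"
      using kterm_bounded[OF h] by blast
    have "norm (k a b c d r) \<le> C * (qexp (norm e) * qexp (norm (a * q / e)))" for r
      unfolding k_def norm_mult[of "kterm a b c d r"] norm_mult[of "P e r"]
      using C by (intro mult_mono norm_P_le norm_Q_le norm_xq_le mult_nonneg_nonneg order_refl) (auto simp: less_imp_le)
    then show ?thesis by blast
  qed
  have wn_S: "wn a b c d e (1 / g) = S a b c d (a\<^sup>2 * q\<^sup>2 / (b * c * d * e)) g" if "g \<noteq> 0" for a b c d g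
  proof -
    have "wnt a b c d e (1 / g) r = k a b c d r * (a\<^sup>2 * q\<^sup>2 / (b * c * d * e)) ^ r * gp g r * Q (a * q * g * q ^ r)" for r
    proof -
      have h: "a\<^sup>2 * q\<^sup>2 / (b * c * d * e * (1 / g)) = a\<^sup>2 * q\<^sup>2 / (b * c * d * e) * g" by simp
      show ?thesis unfolding wnt_def k_def gp_eq[OF that, symmetric] h power_mult_distrib[of "a\<^sup>2 * q\<^sup>2 / (b * c * d * e)" g]
        by (simp add: mult_ac)
    qed
    then show ?thesis unfolding wn_def S_def by (simp cong: suminf_cong)
  qed
  \<comment> \<open>The disc has to contain \<open>1 / f\<close> together with its centre 0, the
    limit of the points \<open>q ^ n\<close>, and on all of it each of the two series has to
    converge or terminate.\<close>
  obtain G where G: "G > norm (1 / f)" "G * norm v' < 1" "G * norm v < 1 \<or> (\<exists>m. b * q ^ m = 1)"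
  proof -
    have c1: "norm (1 / f) * norm v' < 1" using conv1 by (simp add: v'_def norm_mult norm_divide mult_ac)
    show thesis
    proof (cases "\<exists>m. b * q ^ m = 1")
      case True
      then show ?thesis using ex_between_mult[OF c1] that by auto
    next
      case False
      then have "norm (1 / f) * norm v < 1" using conv2 by (simp add: v_def norm_mult norm_divide mult_ac)
      with c1 have "norm (1 / f) * max (norm v) (norm v') < 1" by (auto simp: max_def)
      then obtain G where "G > norm (1 / f)" "G * max (norm v) (norm v') < 1"
        by (rule ex_between_mult) (auto intro: max.coboundedI1)
      moreover have "G > 0" using \<open>G > norm (1 / f)\<close> by (meson norm_ge_zero order_le_less_trans)
      ultimately show ?thesis using that[of G] mult_left_mono[of "norm v" "max (norm v) (norm v')" G]
          mult_left_mono[of "norm v'" "max (norm v) (norm v')" G] by (smt (verit) max.cobounded1 max.cobounded2)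
    qed
  qed
  have G0: "G > 0" using G(1) by (meson norm_ge_zero order_le_less_trans)
  have hol1: "S a b c d v holomorphic_on ball 0 G"
  proof -
    obtain C where C: "\<And>r. norm (k a b c d r) \<le> C" using k_bd[OF fr(2-4)] by blast
    have "k a b c d r = 0" if "b * q ^ m = 1" "r > m" for m r
    proof -
      have "P b r = 0" using that by (auto simp: qpoch_def)
      then show ?thesis by (simp add: k_def kterm_def)
    qed
    then obtain m where "G * norm v < 1 \<or> (\<forall>r>m. k a b c d r = 0)" using G(3) by blast
    then show ?thesis unfolding S_def by (rule gp_series_holomorphic[OF G0 C])
  qed
  have hol2: "S l b' c' d' v' holomorphic_on ball 0 G"
  proof -
    obtain C where C: "\<And>r. norm (k l b' c' d' r) \<le> C" using k_bd[OF fr'] by blast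
    show ?thesis unfolding S_def by (rule gp_series_holomorphic[OF G0 C]) (use G in auto)
  qed
  define D where "D = (\<lambda>g. Q (l * q) * Q (l * q / e * g) * S a b c d v g - Q (a * q) * Q (a * q / e * g) * S l b' c' d' v' g)"
  have holD: "D holomorphic_on ball 0 G"
    unfolding D_def by (intro holomorphic_intros hol1 hol2)
  have Dq: "D (q ^ n) = 0" for n
  proof -
    have 1: "wn a b c d e (1 / q ^ n) = Q (a * q / e) * Q (a * q * q ^ n) * (\<Sum>r\<le>n. w8 a b c d e (1 / q ^ n) r)"
      by (rule wn_terminating) (use fr qfree_mult qfree_mult1 in auto)
    have 2: "wn l b' c' d' e (1 / q ^ n) = Q (l * q / e) * Q (l * q * q ^ n) * (\<Sum>r\<le>n. w8 l b' c' d' e (1 / q ^ n) r)"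
      by (rule wn_terminating) (use fr qfree_mult qfree_mult1 in auto)
    have 3: "(\<Sum>r\<le>n. w8 a b c d e (1 / q ^ n) r) = P (a * q) n * P (l * q / e) n / (P (a * q / e) n * P (l * q) n) *
     (\<Sum>r\<le>n. w8 l b' c' d' e (1 / q ^ n) r)"
      unfolding b'_def c'_def d'_def by (rule terminating_bailey) fact+
    have 4: "P (a * q / e) n \<noteq> 0" "P (l * q) n \<noteq> 0"
      using fr qfree_mult1 by (auto simp: qpoch_nonzero)
    have "D (q ^ n) = Q (l * q) * Q (l * q / e * q ^ n) * wn a b c d e (1 / q ^ n) - Q (a * q) * Q (a * q / e * q ^ n) * wn l b' c' d' e (1 / q ^ n)"
      unfolding D_def wn_S[OF power_not_zero[OF q_nonzero]] eqs(4) v_def by simp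
    also have "\<dots> = 0"
      unfolding 1 2 3 Q_split[of "l * q" n] Q_split[of "a * q" n] Q_split[of "a * q / e" n] Q_split[of "l * q / e" n]
      using 4 by simp
    finally show ?thesis .
  qed
  have "D (1 / f) = 0"
  proof (rule analytic_continuation[OF holD, where U = "{q ^ n | n. norm (q ^ n) < G}" and \<xi> = 0])
    show "0 islimpt {q ^ n |n. norm (q ^ n) < G}"
      unfolding islimpt_approachable
    proof (intro allI impI)
      fix \<epsilon> :: real assume "\<epsilon> > 0"
      then obtain n where "norm q ^ n < min \<epsilon> G"
        using real_arch_pow_inv[of "min \<epsilon> G" "norm q"] norm_q G0 by auto
      then show "\<exists>x'\<in>{q ^ n |n. norm (q ^ n) < G}. x' \<noteq> 0 \<and> dist x' 0 < \<epsilon>"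
        by (intro bexI[of _ "q ^ n"]) (auto simp: norm_power)
    qed
  qed (use G G0 Dq in auto)
  then show ?thesis
    using wn_S[of "1 / f" a b c d] wn_S[of "1 / f" l b' c' d'] nz
    unfolding D_def b'_def[symmetric] c'_def[symmetric] d'_def[symmetric] eqs(4) v_def by (simp add: mult_ac)
qed

end

section \<open>Quotients and growth of holomorphic functions on the punctured plane\<close>

text \<open>At a zero of \<open>E\<close> the quotient tends to
  \<open>deriv D z / deriv E z\<close>, so its singularity is removable.\<close>

lemma holomorphic_quotient_simple_zeros:
  assumes S: "open S" and D: "D holomorphic_on S" and E: "E holomorphic_on S"
    and zero: "\<And>z. z \<in> S \<Longrightarrow> E z = 0 \<Longrightarrow> D z = 0 \<and> deriv E z \<noteq> 0"
  obtains h where "h holomorphic_on S" "\<And>z. z \<in> S \<Longrightarrow> D z = h z * E z"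
proof -
  define h where "h = (\<lambda>z. if E z = 0 then deriv D z / deriv E z else D z / E z)"
  have derD: "(D has_field_derivative deriv D z) (at z)" and derE: "(E has_field_derivative deriv E z) (at z)" if "z \<in> S" for z
    using holomorphic_derivI[OF D S that] holomorphic_derivI[OF E S that] by auto
  have "h field_differentiable at z" if z: "z \<in> S" for z
  proof (cases "E z = 0")
    case False
    define U where "U = {w\<in>S. E w \<noteq> 0}"
    have "U = S \<inter> E -` (- {0})" by (auto simp: U_def)
    then have U: "open U"
      using continuous_open_preimage[OF holomorphic_on_imp_continuous_on[OF E] S, of "- {0}"]
      by (simp add: open_Compl)
    have "(\<lambda>w. D w / E w) holomorphic_on U"
      by (intro holomorphic_on_divide holomorphic_on_subset[OF D] holomorphic_on_subset[OF E]) (auto simp: U_def)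
    then have "h holomorphic_on U" by (rule holomorphic_transform) (auto simp: U_def h_def)
    then show ?thesis using U z False by (auto simp: holomorphic_on_open field_differentiable_def U_def)
  next
    case True
    with zero z have Dz: "D z = 0" and E': "deriv E z \<noteq> 0" by auto
    have limE: "((\<lambda>w. (E w - E z) / (w - z)) \<longlongrightarrow> deriv E z) (at z)"
      using derE[OF z] by (simp add: has_field_derivative_iff)
    have limD: "((\<lambda>w. (D w - D z) / (w - z)) \<longlongrightarrow> deriv D z) (at z)"
      using derD[OF z] by (simp add: has_field_derivative_iff)
    have "eventually (\<lambda>w. (E w - E z) / (w - z) \<noteq> 0) (at z)"
      using tendsto_imp_eventually_ne[OF limE E'] .
    then have evE: "eventually (\<lambda>w. E w \<noteq> 0) (at z)"
      by eventually_elim (use True in auto)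
    then obtain d1 where d1: "d1 > 0" "\<And>w. w \<noteq> z \<Longrightarrow> dist w z < d1 \<Longrightarrow> E w \<noteq> 0"
      unfolding eventually_at by auto
    obtain d2 where d2: "d2 > 0" "ball z d2 \<subseteq> S" using S z open_contains_ball by blast
    define B where "B = ball z (min d1 d2)"
    have B: "open B" "z \<in> B" "B \<subseteq> S" using d1 d2 by (auto simp: B_def)
    have "(\<lambda>w. D w / E w) holomorphic_on (B - {z})"
      using B d1 by (intro holomorphic_on_divide holomorphic_on_subset[OF D] holomorphic_on_subset[OF E])
        (auto simp: B_def dist_commute)
    then have hol: "h holomorphic_on (B - {z})"
      by (rule holomorphic_transform) (use d1 in \<open>auto simp: h_def B_def dist_commute\<close>)
    have "((\<lambda>w. ((D w - D z) / (w - z)) / ((E w - E z) / (w - z))) \<longlongrightarrow> deriv D z / deriv E z) (at z)"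
      by (intro tendsto_divide limD limE E')
    then have "(h \<longlongrightarrow> deriv D z / deriv E z) (at z)"
    proof (rule Lim_transform_eventually)
      show "eventually (\<lambda>w. ((D w - D z) / (w - z)) / ((E w - E z) / (w - z)) = h w) (at z)"
        using evE eventually_at_ball[of 1 z] unfolding eventually_at_filter
        by (auto elim!: eventually_mono eventually_elim2 simp: h_def Dz True)
    qed
    then have "(h \<longlongrightarrow> h z) (at z)" by (simp add: h_def True)
    then have "h holomorphic_on B"
      using no_isolated_singularity'[of "{z}" h B] hol B by (auto intro: tendsto_within_subset)
    then show ?thesis using B by (auto simp: holomorphic_on_open field_differentiable_def)
  qed
  then have "h holomorphic_on S" using S by (auto simp: holomorphic_on_def intro: field_differentiable_at_within)
  moreover have "D z = h z * E z" if "z \<in> S" for z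
    using zero[OF that] by (simp add: h_def)
  ultimately show thesis using that by blast
qed

text \<open>The maximum modulus principle on annuli with growing outer and shrinking inner radius.
  Bounds are asked for only on two sequences of circles, because the quotient in
  \<open>three_term\<close> is estimated only where its denominator is under control.\<close>

lemma holomorphic_annuli_zero:
  fixes h :: "complex \<Rightarrow> complex" and s \<rho> \<rho>' :: real
  assumes hol: "h holomorphic_on - {0}" and s: "0 < s" "s < 1" and \<rho>: "\<rho> > 0" "\<rho>' > 0"
    and bd: "\<And>N e. norm e = \<rho> / s ^ N \<Longrightarrow> norm (h e) \<le> \<epsilon> N" "\<And>N e. norm e = \<rho>' * s ^ N \<Longrightarrow> norm (h e) \<le> \<epsilon> N"
    and lim: "\<epsilon> \<longlonglongrightarrow> 0" and z: "z \<noteq> 0"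
  shows "h z = 0"
proof -
  have sN: "(\<lambda>N. s ^ N) \<longlonglongrightarrow> 0" using s by (intro LIMSEQ_realpow_zero) auto
  have "eventually (\<lambda>N. s ^ N < \<rho> / norm z) sequentially" "eventually (\<lambda>N. s ^ N < norm z / \<rho>') sequentially"
    using \<rho> z by (intro order_tendstoD(2)[OF sN]; simp)+
  then have "eventually (\<lambda>N. norm (h z) \<le> \<epsilon> N) sequentially"
  proof eventually_elim
    case (elim N)
    define R r where "R = \<rho> / s ^ N" and "r = \<rho>' * s ^ N"
    have R: "norm z < R" "r < norm z" "r > 0" using elim \<rho> s z by (auto simp: R_def r_def field_simps)
    define S :: "complex set" where "S = ball 0 R - cball 0 r"
    have S: "open S" "bounded S" unfolding S_def by auto
    have cl: "closure S \<subseteq> cball 0 R - ball 0 r"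
      unfolding S_def by (intro closure_minimal) (auto intro!: closed_Diff)
    have "closure S \<subseteq> - {0}" using cl R by auto
    then have c: "continuous_on (closure S) h"
      using holomorphic_on_imp_continuous_on[OF hol] continuous_on_subset by blast
    have hS: "h holomorphic_on interior S"
      using hol by (rule holomorphic_on_subset) (use R interior_subset[of S] in \<open>auto simp: S_def\<close>)
    show ?case
    proof (rule maximum_modulus_frontier[OF hS c S(2)])
      fix w assume "w \<in> frontier S"
      then have "w \<in> cball 0 R - ball 0 r" "w \<notin> S" using cl S(1) by (auto simp: frontier_def interior_open)
      then have "norm w = R \<or> norm w = r" by (auto simp: S_def)
      then show "norm (h w) \<le> \<epsilon> N" using bd by (auto simp: R_def r_def)
    qed (use R in \<open>auto simp: S_def\<close>)
  qed
  then have "norm (h z) \<le> 0"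
    by (intro tendsto_lowerbound[OF lim]) auto
  then show ?thesis by simp
qed

lemma tendsto_mult_geometric: "0 \<le> \<theta> \<Longrightarrow> \<theta> < 1 \<Longrightarrow> (\<lambda>N. K * real (Suc N) * \<theta> ^ N) \<longlonglongrightarrow> 0" for \<theta> :: real
proof -
  assume \<theta>: "0 \<le> \<theta>" "\<theta> < 1"
  have "(\<lambda>N. real N * \<theta> ^ N) \<longlonglongrightarrow> 0"
    using powser_times_n_limit_0[of \<theta>] \<theta> by simp
  moreover have "(\<lambda>N. \<theta> ^ N) \<longlonglongrightarrow> 0" using \<theta> by (intro LIMSEQ_realpow_zero) auto
  ultimately have "(\<lambda>N. K * (real N * \<theta> ^ N + \<theta> ^ N)) \<longlonglongrightarrow> K * (0 + 0)"
    by (intro tendsto_mult tendsto_add tendsto_const)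
  then show ?thesis by (simp add: algebra_simps)
qed

text \<open>Every \<open>r \<le> N\<close> contributes \<open>\<theta> ^ N\<close>, and the larger
  \<open>r\<close> contribute a geometric tail starting from this value. This is the source of the
  factor \<open>Suc N\<close> in \<open>wn_decay\<close>.\<close>

lemma suminf_two_sided_geometric:
  fixes \<theta> :: real
  assumes "0 \<le> \<theta>" "\<theta> < 1"
  shows "summable (\<lambda>r. \<theta> ^ r * \<theta> ^ (N - r))"
    and "(\<Sum>r. \<theta> ^ r * \<theta> ^ (N - r)) \<le> (1 + 1 / (1 - \<theta>)) * real (Suc N) * \<theta> ^ N"
proof -
  show s: "summable (\<lambda>r. \<theta> ^ r * \<theta> ^ (N - r))"
  proof (rule summable_comparison_test')
    show "norm (\<theta> ^ r * \<theta> ^ (N - r)) \<le> \<theta> ^ r" for r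
      using assms by (simp add: mult_left_le power_le_one)
  qed (use assms in \<open>auto intro: summable_geometric\<close>)
  have "(\<Sum>r. \<theta> ^ r * \<theta> ^ (N - r)) = (\<Sum>r. \<theta> ^ (r + N) * \<theta> ^ (N - (r + N))) + (\<Sum>r<N. \<theta> ^ r * \<theta> ^ (N - r))"
    by (rule suminf_split_initial_segment[OF s])
  also have "(\<Sum>r. \<theta> ^ (r + N) * \<theta> ^ (N - (r + N))) = \<theta> ^ N / (1 - \<theta>)"
    using assms by (simp add: power_add suminf_mult2[symmetric] suminf_geometric summable_geometric)
  also have "(\<Sum>r<N. \<theta> ^ r * \<theta> ^ (N - r)) = real N * \<theta> ^ N"
    by (simp flip: power_add)
  also have "\<theta> ^ N / (1 - \<theta>) + real N * \<theta> ^ N \<le> (1 + 1 / (1 - \<theta>)) * real (Suc N) * \<theta> ^ N"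
  proof -
    define c T where "c = 1 / (1 - \<theta>)" and "T = \<theta> ^ N"
    have "0 \<le> T + c * real N * T" using assms by (simp add: c_def T_def)
    then have "T * c + real N * T \<le> (1 + c) * real (Suc N) * T" by (simp add: algebra_simps)
    then show ?thesis by (simp add: c_def T_def)
  qed
  finally show "(\<Sum>r. \<theta> ^ r * \<theta> ^ (N - r)) \<le> (1 + 1 / (1 - \<theta>)) * real (Suc N) * \<theta> ^ N" .
qed

context qbase
begin

section \<open>Decay of the series along circles that avoid all zeros\<close>

text \<open>No point of modulus \<open>\<rho>\<close> has the modulus of an integral power of
  \<open>q\<close>, and this persists when \<open>\<rho>\<close> is scaled by powers of
  \<open>norm q\<close>. Circles of such radii miss all zeros of \<open>Q\<close>.\<close>

definition gen_radius :: "real \<Rightarrow> bool"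
  where "gen_radius \<rho> \<longleftrightarrow> \<rho> > 0 \<and> (\<forall>m n. \<rho> * norm q ^ m \<noteq> norm q ^ n)"

lemma gen_radius_qgen: "gen_radius (norm \<nu>) \<Longrightarrow> qgen q \<nu>"
  unfolding gen_radius_def qgen_def by (metis norm_mult norm_power norm_zero less_irrefl)

lemma gen_radius_inverse: "gen_radius (\<rho> / \<kappa>) \<Longrightarrow> \<kappa> > 0 \<Longrightarrow> gen_radius (\<kappa> / \<rho>)"
proof -
  assume *: "gen_radius (\<rho> / \<kappa>)" "\<kappa> > 0"
  then have "\<rho> > 0" by (auto simp: gen_radius_def zero_less_divide_iff)
  moreover have "\<kappa> / \<rho> * norm q ^ m \<noteq> norm q ^ n" for m n
  proof
    assume "\<kappa> / \<rho> * norm q ^ m = norm q ^ n"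
    with * \<open>\<rho> > 0\<close> have "\<rho> / \<kappa> * norm q ^ n = norm q ^ m" by (simp add: field_simps)
    with * show False by (auto simp: gen_radius_def)
  qed
  ultimately show ?thesis using * by (simp add: gen_radius_def)
qed

text \<open>Each condition excludes countably many radii, whereas an interval is
  uncountable.\<close>

lemma ex_gen_radius:
  assumes "finite K" "\<And>\<kappa>. \<kappa> \<in> K \<Longrightarrow> \<kappa> > 0"
  obtains \<rho> where "\<rho> > 0" "\<And>\<kappa>. \<kappa> \<in> K \<Longrightarrow> gen_radius (\<rho> * \<kappa>)"
proof -
  define B where "B = (\<Union>\<kappa>\<in>K. (\<lambda>(m, n). norm q ^ n / (\<kappa> * norm q ^ m)) ` (UNIV :: (nat \<times> nat) set))"
  have "countable B" unfolding B_def using assms(1) by (intro countable_UN) (auto intro: countable_finite)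
  moreover have "uncountable {0<..<1::real}" by (simp add: uncountable_open_interval)
  ultimately have "\<not> {0<..<1} \<subseteq> B" using countable_subset by blast
  then obtain \<rho> where "\<rho> \<in> {0<..<1}" and \<rho>B: "\<rho> \<notin> B" by blast
  then have \<rho>: "\<rho> > 0" "\<rho> \<notin> B" by auto
  have "gen_radius (\<rho> * \<kappa>)" if "\<kappa> \<in> K" for \<kappa>
    unfolding gen_radius_def
  proof (intro conjI allI notI)
    show "\<rho> * \<kappa> > 0" using \<rho> assms that by simp
    fix m n assume "\<rho> * \<kappa> * norm q ^ m = norm q ^ n"
    then have "\<rho> = norm q ^ n / (\<kappa> * norm q ^ m)" using assms(2)[OF that] by (simp add: field_simps)
    then have "\<rho> \<in> B" unfolding B_def by (intro UN_I[OF that] image_eqI[of _ _ "(m, n)"]) simp_all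
    then show False using \<rho> by blast
  qed
  with \<rho> show thesis using that by blast
qed

lemma sphere_lower_bound:
  assumes "continuous_on (sphere 0 \<rho>) f" "\<rho> \<ge> 0" "\<And>\<nu>. norm \<nu> = \<rho> \<Longrightarrow> f \<nu> \<noteq> (0::complex)"
  obtains c where "c > 0" "\<And>\<nu>::complex. norm \<nu> = \<rho> \<Longrightarrow> norm (f \<nu>) \<ge> c"
proof -
  have "\<exists>x\<in>sphere (0::complex) \<rho>. \<forall>y\<in>sphere 0 \<rho>. norm (f x) \<le> norm (f y)"
    using assms(1,2) by (intro continuous_attains_inf continuous_intros) auto
  then obtain x where "norm x = \<rho>" "\<And>y. norm y = \<rho> \<Longrightarrow> norm (f x) \<le> norm (f y)" by auto
  with assms(3)[of x] show thesis using that[of "norm (f x)"] by auto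
qed

text \<open>Far out, both products are monomials \<open>refl\<close> times bounded factors, and the
  factors belonging to \<open>\<nu>\<close> are also bounded away from 0 on the circle; the two
  monomials have the ratio \<open>t ^ n\<close>. For \<open>r > N\<close> the arguments stay bounded
  and no power arises, in agreement with the truncated difference \<open>N - r = 0\<close>.\<close>

lemma Q_ratio_bound:
  assumes \<rho>: "gen_radius \<rho>" and t: "t \<noteq> 0"
  obtains M where "M > 0" "\<And>\<nu> N r. norm \<nu> = \<rho> \<Longrightarrow>
    norm (Q (t * (\<nu> / q ^ N * q ^ r))) \<le> M * norm t ^ (N - r) * norm (Q (\<nu> / q ^ N * q ^ r))"
proof -
  have \<rho>0: "\<rho> > 0" using \<rho> by (simp add: gen_radius_def)
  have ge: "qgen q \<nu>" if "norm \<nu> = \<rho>" for \<nu> using \<rho> gen_radius_qgen that by blast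
  obtain c0 where c0: "c0 > 0" "\<And>\<nu>. norm \<nu> = \<rho> \<Longrightarrow> norm (Q \<nu>) \<ge> c0"
    by (rule sphere_lower_bound[of \<rho> Q]) (use \<rho>0 ge in \<open>auto intro!: continuous_intros Q_nonzero qgen_qfree\<close>)
  obtain c1 where c1: "c1 > 0" "\<And>\<nu>. norm \<nu> = \<rho> \<Longrightarrow> norm (Q (q / \<nu>)) \<ge> c1"
  proof (rule sphere_lower_bound[of \<rho> "\<lambda>\<nu>. Q (q / \<nu>)"])
    show "continuous_on (sphere 0 \<rho>) (\<lambda>\<nu>. Q (q / \<nu>))"
      using \<rho>0 by (intro continuous_intros) auto
    show "Q (q / \<nu>) \<noteq> 0" if "norm \<nu> = \<rho>" for \<nu>
      using qgen_mult1[OF qgen_inverse[OF ge[OF that]]] by (intro Q_nonzero qgen_qfree) simp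
  qed (use \<rho>0 in auto)
  define M1 where "M1 = qexp (norm t * \<rho>) * qexp \<rho> / c0"
  define M2 where "M2 = qexp (1 / (norm t * \<rho>)) * qexp (norm t * \<rho>) * qexp (1 / \<rho>) / (c1 * c0)"
  have M1: "norm (Q (t * (\<nu> * q ^ m))) \<le> M1 * norm (Q (\<nu> * q ^ m))" if \<nu>: "norm \<nu> = \<rho>" for \<nu> m
  proof -
    have "norm (t * \<nu> * q ^ m) \<le> norm t * \<rho>" by (rule norm_xq_le) (simp add: \<nu> norm_mult)
    then have "norm (Q (t * (\<nu> * q ^ m))) \<le> qexp (norm t * \<rho>)" by (intro norm_Q_le) (simp add: mult.assoc)
    moreover have "c0 \<le> qexp \<rho> * norm (Q (\<nu> * q ^ m))"
    proof -
      have "c0 \<le> norm (Q \<nu>)" using c0 \<nu> by blast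
      also have "\<dots> = norm (P \<nu> m) * norm (Q (\<nu> * q ^ m))" using Q_split[of \<nu> m] by (simp add: norm_mult)
      also have "\<dots> \<le> qexp \<rho> * norm (Q (\<nu> * q ^ m))"
        by (intro mult_right_mono norm_P_le) (simp_all add: \<nu>)
      finally show ?thesis .
    qed
    ultimately have "norm (Q (t * (\<nu> * q ^ m))) * c0 \<le> qexp (norm t * \<rho>) * (qexp \<rho> * norm (Q (\<nu> * q ^ m)))"
      using c0 by (intro mult_mono) auto
    then show ?thesis using c0 by (simp add: M1_def field_simps)
  qed
  have M2: "norm (Q (t * (\<nu> / q ^ n))) \<le> M2 * norm t ^ n * norm (Q (\<nu> / q ^ n))" if \<nu>: "norm \<nu> = \<rho>" for \<nu> n
  proof -
    have \<nu>0: "\<nu> \<noteq> 0" using \<nu> \<rho>0 by auto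
    have sp: "Q (x / q ^ n) = refl x n * P (q / x) n * Q x" if "x \<noteq> 0" for x
      using Q_split[of "x / q ^ n" n] qpoch_reflect[OF that, of n] by simp
    have e1: "Q (\<nu> / q ^ n) = refl \<nu> n * P (q / \<nu>) n * Q \<nu>" by (rule sp[OF \<nu>0])
    have e2: "Q (t * (\<nu> / q ^ n)) = t ^ n * refl \<nu> n * P (q / (t * \<nu>)) n * Q (t * \<nu>)"
      using sp[of "t * \<nu>"] t \<nu>0 refl_mult[of t \<nu> n] by simp
    have b1: "norm (P (q / (t * \<nu>)) n) \<le> qexp (1 / (norm t * \<rho>))"
      using norm_q t \<rho>0 by (intro norm_P_le) (simp add: norm_divide norm_mult \<nu> divide_right_mono)
    have b2: "norm (Q (t * \<nu>)) \<le> qexp (norm t * \<rho>)"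
      by (intro norm_Q_le) (simp add: norm_mult \<nu>)
    have b3: "c1 \<le> norm (P (q / \<nu>) n) * qexp (1 / \<rho>)"
    proof -
      have "c1 \<le> norm (Q (q / \<nu>))" using c1 \<nu> by blast
      also have "\<dots> = norm (P (q / \<nu>) n) * norm (Q (q / \<nu> * q ^ n))"
        using Q_split[of "q / \<nu>" n] by (simp add: norm_mult)
      also have "\<dots> \<le> norm (P (q / \<nu>) n) * qexp (1 / \<rho>)"
        using norm_q \<rho>0 by (intro mult_left_mono norm_Q_le norm_xq_le) (simp_all add: norm_divide \<nu> divide_right_mono)
      finally show ?thesis .
    qed
    have b4: "c0 \<le> norm (Q \<nu>)" using c0 \<nu> by blast
    have "norm (P (q / (t * \<nu>)) n) * norm (Q (t * \<nu>)) * (c1 * c0)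
       \<le> (qexp (1 / (norm t * \<rho>)) * qexp (norm t * \<rho>)) * ((norm (P (q / \<nu>) n) * qexp (1 / \<rho>)) * norm (Q \<nu>))"
      using b1 b2 b3 b4 c0 c1 by (intro mult_mono) (auto intro!: mult_nonneg_nonneg simp: less_imp_le)
    then have "norm (P (q / (t * \<nu>)) n) * norm (Q (t * \<nu>)) \<le> M2 * (norm (P (q / \<nu>) n) * norm (Q \<nu>))"
      using c0 c1 by (simp add: M2_def field_simps)
    then have "(norm t ^ n * norm (refl \<nu> n)) * (norm (P (q / (t * \<nu>)) n) * norm (Q (t * \<nu>)))
       \<le> (norm t ^ n * norm (refl \<nu> n)) * (M2 * (norm (P (q / \<nu>) n) * norm (Q \<nu>)))"
      by (intro mult_left_mono) auto
    then show ?thesis unfolding e1 e2 by (simp add: norm_mult norm_power mult_ac)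
  qed
  define M where "M = max M1 M2"
  have M: "M > 0" "M1 \<le> M" "M2 \<le> M" using c0 by (auto simp: M_def M1_def less_max_iff_disj)
  have "norm (Q (t * (\<nu> / q ^ N * q ^ r))) \<le> M * norm t ^ (N - r) * norm (Q (\<nu> / q ^ N * q ^ r))" if \<nu>: "norm \<nu> = \<rho>" for \<nu> N r
  proof (cases "r \<le> N")
    case True
    then have qN: "q ^ N = q ^ (N - r) * q ^ r" by (simp flip: power_add)
    have "norm (Q (t * (\<nu> / q ^ N * q ^ r))) \<le> M2 * norm t ^ (N - r) * norm (Q (\<nu> / q ^ N * q ^ r))"
      using M2[OF \<nu>, of "N - r"] unfolding qN by simp
    also have "\<dots> \<le> M * norm t ^ (N - r) * norm (Q (\<nu> / q ^ N * q ^ r))"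
      using M by (intro mult_right_mono) auto
    finally show ?thesis .
  next
    case False
    then have qr: "q ^ r = q ^ (r - N) * q ^ N" by (simp flip: power_add)
    have "norm (Q (t * (\<nu> / q ^ N * q ^ r))) \<le> M1 * norm (Q (\<nu> / q ^ N * q ^ r))"
      using M1[OF \<nu>, of "r - N"] unfolding qr by simp
    also have "\<dots> \<le> M * norm (Q (\<nu> / q ^ N * q ^ r))"
      using M by (intro mult_right_mono) auto
    finally show ?thesis using False by simp
  qed
  with M show thesis using that by blast
qed

text \<open>As \<open>e * f = F\<close>, the lower products have the arguments
  \<open>\<alpha> * q / f = t' * e\<close> and \<open>\<alpha> * q / e = t' * f\<close> with
  \<open>t' = \<alpha> * q / F\<close>. \<open>Q_ratio_bound\<close> compares the first with
  \<open>Q e = P e r * Q (e * q ^ r)\<close> and gains \<open>norm t' ^ (N - r)\<close>, while the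
  argument of the series contributes \<open>norm u' ^ r\<close>.\<close>

lemma wn_decay:
  assumes nz: "F \<noteq> 0" "\<alpha> \<noteq> 0"
    and u: "norm (\<alpha>\<^sup>2 * q\<^sup>2 / (x * y * z * F)) < 1" and t: "norm (\<alpha> * q / F) < 1"
    and fr: "qfree q (\<alpha> * q / x)" "qfree q (\<alpha> * q / y)" "qfree q (\<alpha> * q / z)"
    and \<rho>: "gen_radius \<rho>" "gen_radius (norm F / \<rho>)"
  obtains K \<theta> where "K \<ge> 0" "0 \<le> \<theta>" "\<theta> < 1"
    "\<And>N \<nu>. norm \<nu> = \<rho> \<Longrightarrow> norm (wn \<alpha> x y z (\<nu> / q ^ N) (F / (\<nu> / q ^ N)))
       \<le> K * real (Suc N) * \<theta> ^ N * norm (Q (\<nu> / q ^ N) * Q (F / (\<nu> / q ^ N)))"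
proof -
  define t' where "t' = \<alpha> * q / F"
  have t0: "t' \<noteq> 0" using nz by (simp add: t'_def)
  obtain M where M: "M > 0" "\<And>\<nu> N r. norm \<nu> = \<rho> \<Longrightarrow>
    norm (Q (t' * (\<nu> / q ^ N * q ^ r))) \<le> M * norm t' ^ (N - r) * norm (Q (\<nu> / q ^ N * q ^ r))"
    using Q_ratio_bound[OF \<rho>(1) t0] by blast
  obtain M' where M': "M' > 0" "\<And>\<nu> N r. norm \<nu> = norm F / \<rho> \<Longrightarrow>
    norm (Q (t' * (\<nu> / q ^ N * q ^ r))) \<le> M' * norm t' ^ (N - r) * norm (Q (\<nu> / q ^ N * q ^ r))"
    using Q_ratio_bound[OF \<rho>(2) t0] by blast
  obtain C where C: "C > 0" "\<And>r. norm (kterm \<alpha> x y z r) \<le> C"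
    using kterm_bounded[OF fr] by blast
  define u' where "u' = \<alpha>\<^sup>2 * q\<^sup>2 / (x * y * z * F)"
  define \<theta> where "\<theta> = max (norm u') (norm t')"
  have \<theta>: "0 \<le> \<theta>" "\<theta> < 1" "norm u' \<le> \<theta>" "norm t' \<le> \<theta>"
    using u t by (auto simp: \<theta>_def u'_def t'_def le_max_iff_disj)
  define K where "K = C * M * M' * (1 + 1 / (1 - \<theta>))"
  have "norm (wn \<alpha> x y z (\<nu> / q ^ N) (F / (\<nu> / q ^ N)))
       \<le> K * real (Suc N) * \<theta> ^ N * norm (Q (\<nu> / q ^ N) * Q (F / (\<nu> / q ^ N)))" if \<nu>: "norm \<nu> = \<rho>" for N \<nu>
  proof -
    define e f where "e = \<nu> / q ^ N" and "f = F / e"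
    have \<nu>0: "\<nu> \<noteq> 0" using \<nu> \<rho> by (auto simp: gen_radius_def)
    have e0: "e \<noteq> 0" "f \<noteq> 0" using \<nu>0 nz by (auto simp: e_def f_def)
    have f: "f = F / \<nu> * q ^ N" by (simp add: f_def e_def)
    have "norm (wnt \<alpha> x y z e f r) \<le> C * M * M' * norm (Q e * Q f) * (\<theta> ^ r * \<theta> ^ (N - r))" for r
    proof -
      have "\<alpha> * q / f = t' * e" "\<alpha> * q / e = t' * f" using e0 nz by (simp_all add: t'_def f_def)
      moreover have "\<alpha>\<^sup>2 * q\<^sup>2 / (x * y * z * e * f) = u'" using e0 by (simp add: u'_def f_def)
      ultimately have w: "wnt \<alpha> x y z e f r = kterm \<alpha> x y z r * u' ^ r * ((P e r * Q (t' * (e * q ^ r))) * (P f r * Q (t' * (f * q ^ r))))"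
        by (simp add: wnt_def mult_ac)
      have 1: "norm (P e r * Q (t' * (e * q ^ r))) \<le> M * \<theta> ^ (N - r) * norm (Q e)"
      proof -
        have "norm (Q (t' * (e * q ^ r))) \<le> M * norm t' ^ (N - r) * norm (Q (e * q ^ r))"
          using M(2)[OF \<nu>] by (simp add: e_def)
        also have "\<dots> \<le> M * \<theta> ^ (N - r) * norm (Q (e * q ^ r))"
          using M(1) \<theta> by (intro mult_mono power_mono) auto
        finally have "norm (P e r) * norm (Q (t' * (e * q ^ r))) \<le> norm (P e r) * (M * \<theta> ^ (N - r) * norm (Q (e * q ^ r)))"
          by (intro mult_left_mono) auto
        then show ?thesis unfolding Q_split[of e r] by (simp add: norm_mult mult_ac)
      qed
      have 2: "norm (P f r * Q (t' * (f * q ^ r))) \<le> M' * norm (Q f)"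
      proof -
        have "norm (Q (t' * (F / \<nu> / q ^ 0 * q ^ (N + r)))) \<le> M' * norm t' ^ (0 - (N + r)) * norm (Q (F / \<nu> / q ^ 0 * q ^ (N + r)))"
          by (rule M'(2)) (simp add: norm_divide \<nu>)
        then have "norm (Q (t' * (f * q ^ r))) \<le> M' * norm (Q (f * q ^ r))"
          by (simp add: f power_add mult.assoc)
        then have "norm (P f r) * norm (Q (t' * (f * q ^ r))) \<le> norm (P f r) * (M' * norm (Q (f * q ^ r)))"
          by (intro mult_left_mono) auto
        then show ?thesis unfolding Q_split[of f r] by (simp add: norm_mult mult_ac)
      qed
      have "norm (wnt \<alpha> x y z e f r) = norm (kterm \<alpha> x y z r) * norm u' ^ r * (norm (P e r * Q (t' * (e * q ^ r))) * norm (P f r * Q (t' * (f * q ^ r))))"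
        unfolding w by (simp only: norm_mult norm_power)
      also have "\<dots> \<le> C * \<theta> ^ r * ((M * \<theta> ^ (N - r) * norm (Q e)) * (M' * norm (Q f)))"
        using C M M' \<theta> 1 2 by (intro mult_mono power_mono) (auto intro!: mult_nonneg_nonneg simp: less_imp_le)
      finally show ?thesis by (simp add: norm_mult mult_ac)
    qed
    then have "norm (wn \<alpha> x y z e f) \<le> (\<Sum>r. C * M * M' * norm (Q e * Q f) * (\<theta> ^ r * \<theta> ^ (N - r)))"
      unfolding wn_def by (intro norm_suminf_le summable_mult suminf_two_sided_geometric \<theta>)
    also have "\<dots> = C * M * M' * norm (Q e * Q f) * (\<Sum>r. \<theta> ^ r * \<theta> ^ (N - r))"
      by (intro suminf_mult suminf_two_sided_geometric \<theta>)
    also have "\<dots> \<le> C * M * M' * norm (Q e * Q f) * ((1 + 1 / (1 - \<theta>)) * real (Suc N) * \<theta> ^ N)"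
      using C M M' by (intro mult_left_mono suminf_two_sided_geometric \<theta>) (auto intro!: mult_nonneg_nonneg simp: less_imp_le)
    finally show ?thesis by (simp add: K_def e_def f_def mult_ac)
  qed
  moreover have "K \<ge> 0" using C M M' \<theta> by (auto simp: K_def intro!: mult_nonneg_nonneg)
  ultimately show thesis using that \<theta> by blast
qed

text \<open>With the product \<open>e * f = F\<close> fixed, the argument of the series does not
  depend on \<open>e\<close>, so one geometric ratio serves as majorant near every
  \<open>e\<close>.\<close>

lemma wn_holomorphic:
  assumes u: "norm (\<alpha>\<^sup>2 * q\<^sup>2 / (x * y * z * F)) < 1"
    and fr: "qfree q (\<alpha> * q / x)" "qfree q (\<alpha> * q / y)" "qfree q (\<alpha> * q / z)" and F: "F \<noteq> 0"
  shows "(\<lambda>e. wn \<alpha> x y z e (F / e)) holomorphic_on - {0}"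
  unfolding wn_def
proof (rule holomorphic_on_suminf)
  define u' where "u' = \<alpha>\<^sup>2 * q\<^sup>2 / (x * y * z * F)"
  have w: "wnt \<alpha> x y z e (F / e) r = kterm \<alpha> x y z r * u' ^ r * (P e r * P (F / e) r * Q (\<alpha> * q / e * q ^ r) * Q (\<alpha> * q * e / F * q ^ r))" if "e \<noteq> 0" for e r
    using that unfolding wnt_def u'_def by (simp add: mult_ac)
  show "(\<lambda>e. wnt \<alpha> x y z e (F / e) r) holomorphic_on - {0}" for r
  proof -
    have "(\<lambda>e. kterm \<alpha> x y z r * u' ^ r * (P e r * P (F / e) r * Q (\<alpha> * q / e * q ^ r) * Q (\<alpha> * q * e / F * q ^ r))) holomorphic_on - {0}"
      using F by (intro holomorphic_intros) auto
    then show ?thesis by (rule holomorphic_transform) (use w in auto)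
  qed
  obtain C where C: "C > 0" "\<And>r. norm (kterm \<alpha> x y z r) \<le> C"
    using kterm_bounded[OF fr] by blast
  fix e0 :: complex assume "e0 \<in> - {0}"
  then have e0: "e0 \<noteq> 0" by simp
  define d where "d = norm e0 / 2"
  have d: "d > 0" using e0 by (simp add: d_def)
  have near: "norm e \<le> 3 * d" "d \<le> norm e" "e \<noteq> 0" if "e \<in> cball e0 d" for e
  proof -
    have "norm (e0 - e) \<le> d" using that by (simp add: dist_norm)
    then show "norm e \<le> 3 * d" "d \<le> norm e"
      using norm_triangle_ineq2[of e e0] norm_triangle_ineq2[of e0 e] by (auto simp: d_def norm_minus_commute)
    then show "e \<noteq> 0" using d by auto
  qed
  define B where "B = qexp (3 * d) * qexp (norm F / d) * qexp (norm (\<alpha> * q) / d) * qexp (norm (\<alpha> * q) * (3 * d) / norm F)"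
  have bd: "norm (wnt \<alpha> x y z e (F / e) r) \<le> (C * B) * norm u' ^ r" if e: "e \<in> cball e0 d" for e r
  proof -
    note n = near[OF e]
    have i: "norm (P e r) \<le> qexp (3 * d)" "norm (P (F / e) r) \<le> qexp (norm F / d)"
      using n d by (auto intro!: norm_P_le divide_left_mono mult_pos_pos simp: norm_divide)
    have i3: "norm (Q (\<alpha> * q / e * q ^ r)) \<le> qexp (norm (\<alpha> * q) / d)"
      by (intro norm_Q_le norm_xq_le, unfold norm_divide) (use n d in \<open>auto intro!: divide_left_mono mult_pos_pos\<close>)
    have i4: "norm (Q (\<alpha> * q * e / F * q ^ r)) \<le> qexp (norm (\<alpha> * q) * (3 * d) / norm F)"
      by (intro norm_Q_le norm_xq_le, unfold norm_divide norm_mult[of _ e])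
        (use n d in \<open>auto intro!: divide_right_mono mult_left_mono\<close>)
    have "norm (kterm \<alpha> x y z r) * norm u' ^ r * (norm (P e r) * norm (P (F / e) r) * norm (Q (\<alpha> * q / e * q ^ r)) * norm (Q (\<alpha> * q * e / F * q ^ r)))
      \<le> C * norm u' ^ r * B"
      unfolding B_def using C i i3 i4 by (intro mult_mono) (auto intro!: mult_nonneg_nonneg simp: less_imp_le)
    then show ?thesis unfolding w[OF n(3)] norm_mult[of _ "_ * _"] norm_mult norm_power by (simp add: mult_ac)
  qed
  show "\<exists>d C \<theta>. 0 < d \<and> cball e0 d \<subseteq> - {0} \<and> 0 \<le> \<theta> \<and> \<theta> < 1 \<and> (\<forall>r. \<forall>e\<in>cball e0 d. norm (wnt \<alpha> x y z e (F / e) r) \<le> C * \<theta> ^ r)"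
  proof (rule exI[of _ d], rule exI[of _ "C * B"], rule exI[of _ "norm u'"], intro conjI allI ballI)
    show "cball e0 d \<subseteq> - {0}" using near by blast
  qed (use d u bd in \<open>auto simp: u'_def\<close>)
qed auto

subsection \<open>The three-term transformation\<close>

text \<open>The hypotheses of \<open>terminating_reversed\<close> with \<open>F\<close> in place of
  \<open>f\<close>. They carry over to \<open>f = F * q ^ n\<close> because \<open>qgen\<close> is
  stable under multiplication and division by powers of \<open>q\<close>.\<close>

definition tt_gen :: "complex \<Rightarrow> complex \<Rightarrow> complex \<Rightarrow> complex \<Rightarrow> complex \<Rightarrow> bool"
  where "tt_gen a b c d F \<longleftrightarrow> a \<noteq> 0 \<and> b \<noteq> 0 \<and> c \<noteq> 0 \<and> d \<noteq> 0 \<and> F \<noteq> 0 \<and>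
    qgen q a \<and> qgen q (a / b) \<and> qgen q (a / c) \<and> qgen q (a / d) \<and> qgen q (a / F) \<and> qgen q (a / (c * d)) \<and>
    qgen q (a / (b * F)) \<and> qgen q c \<and> qgen q d \<and> qgen q (F / c) \<and> qgen q (a / (d * F))"

text \<open>The three-term relation is viewed as an identity in \<open>e\<close> for a fixed product
  \<open>e * f = F\<close>: \<open>ttL\<close> and \<open>ttR\<close> carry the factors that depend
  on \<open>e\<close>, while the coefficients \<open>ttC1\<close> and \<open>ttC2\<close> do not
  involve \<open>e\<close>.\<close>

definition ttL :: "complex \<Rightarrow> complex \<Rightarrow> complex \<Rightarrow> complex \<Rightarrow> complex \<Rightarrow> complex \<Rightarrow> complex"
  where "ttL a b c d F e = Q (b * e / a) * Q (b * F / (a * e)) * wn a b c d e (F / e)"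

definition ttR :: "complex \<Rightarrow> complex \<Rightarrow> complex \<Rightarrow> complex \<Rightarrow> complex \<Rightarrow> complex \<Rightarrow> complex"
  where "ttR a b c d F e = Q (a * q / (d * e)) * Q (a * q * e / (d * F)) *
     wn (F / c) (a * q / (b * c)) (a * q / (c * d)) (F / a) e (F / e)"

definition ttC1 :: "complex \<Rightarrow> complex \<Rightarrow> complex \<Rightarrow> complex \<Rightarrow> complex \<Rightarrow> complex"
  where "ttC1 a b c d F = Q (a * q) * Q (a * q / F) * Q (b / a) * Q (b * F / a) /
     (Q (a * q / d) * Q (a * q / (d * F)) * Q (q / c) * Q (F * q / c))"

definition ttC2 :: "complex \<Rightarrow> complex \<Rightarrow> complex \<Rightarrow> complex \<Rightarrow> complex \<Rightarrow> complex"
  where "ttC2 a b c d F = b / a * Q (a * q) * Q (b * q / a) * Q (b * q / c) * Q (b * q / d) * Q d * Q (a * q / (b * c)) *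
      Q (b * d * F / a\<^sup>2) * Q (a\<^sup>2 * q / (b * d * F)) /
     (Q (a * q / b) * Q (a * q / c) * Q (a * q / d) * Q (b * d / a) * Q (d * F / a) * Q (a * q / (d * F)) * Q (q / c) * Q (b\<^sup>2 * q / a))"

lemma qgen_over_mult: "qgen q (x / y) \<Longrightarrow> qgen q (x * q / y)"
  using qgen_mult1[of "x / y"] by (simp add: mult_ac)

lemma qgen_over_swap: "qgen q (x / y) \<Longrightarrow> qgen q (y / x)"
  using qgen_inverse[of "x / y"] by simp

text \<open>At \<open>e = 1 / q ^ n\<close> the factor \<open>Q e\<close> of the third series
  vanishes, and what is left of the three-term relation is \<open>terminating_reversed\<close> with
  \<open>f = F * q ^ n\<close>.\<close>

lemma three_term_terminating:
  assumes g: "tt_gen a b c d F"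
  shows "ttL a b c d F (1 / q ^ n) = ttC1 a b c d F * ttR a b c d F (1 / q ^ n)"
proof -
  have nz: "a \<noteq> 0" "b \<noteq> 0" "c \<noteq> 0" "d \<noteq> 0" "F \<noteq> 0"
    and ge: "qgen q a" "qgen q (a / b)" "qgen q (a / c)" "qgen q (a / d)" "qgen q (a / F)" "qgen q (a / (c * d))"
      "qgen q (a / (b * F))" "qgen q c" "qgen q d" "qgen q (F / c)" "qgen q (a / (d * F))"
    using g by (auto simp: tt_gen_def)
  define N f where "N = q ^ n" and "f = F * N"
  have N0: "N \<noteq> 0" by (simp add: N_def)
  have f0: "f \<noteq> 0" using nz N0 by (simp add: f_def)
  have gd: "qgen q (x / (y * N))" if "qgen q (x / y)" for x y
    using qgen_divide[OF that, of n] by (simp add: N_def)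
  have gm: "qgen q (x * N / y)" if "qgen q (x / y)" for x y
    using qgen_mult[OF that, of n] by (simp add: N_def)
  have gef: "qgen q (a / f)" "qgen q (a / (b * f))" "qgen q (f / c)" "qgen q (a / (d * f))"
    using gd[OF ge(5)] gd[OF ge(7)] gm[OF ge(10)] gd[OF ge(11)] by (simp_all add: f_def mult.assoc)
  define S1 S2 where "S1 = (\<Sum>r\<le>n. w8 a b c d f (1 / q ^ n) r)"
    and "S2 = (\<Sum>r\<le>n. w8 (F / c) (a * q / (b * c)) (a * q / (c * d)) (F / a) f (1 / q ^ n) r)"
  have c1: "qgen q (1 / c)" by (rule qgen_inverse) fact
  have w1: "wn a b c d (1 / q ^ n) f = Q (a * q / f) * Q (a * q * N) * S1"
    unfolding wn_swap[of a b c d "1 / q ^ n"] S1_def N_def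
    by (rule wn_terminating) (use qgen_over_mult[OF gef(1)] qgen_mult[OF qgen_mult1[OF ge(1)]] in \<open>auto intro: qgen_qfree\<close>)
  have fc: "F / c * q / f = q / (c * N)" using nz N0 by (simp add: f_def field_simps)
  have w2: "wn (F / c) (a * q / (b * c)) (a * q / (c * d)) (F / a) (1 / q ^ n) f = Q (q / (c * N)) * Q (F * q / c * N) * S2"
    using wn_terminating[of "F / c" f n "a * q / (b * c)" "a * q / (c * d)" "F / a"]
      qgen_qfree[OF gd[OF qgen_over_mult[OF c1]]] qgen_qfree[OF qgen_mult[OF qgen_over_mult[OF ge(10)], of n]]
    unfolding wn_swap[of "F / c" _ _ _ "1 / q ^ n"] S2_def fc N_def by simp
  have eqs: "f / (c * N) = F / c" "f / (a * N) = F / a" "b * f / (a * N) = b * F / a" "f * q / (c * N) = F * q / c"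
    using N0 by (simp_all add: f_def)
  have T2: "S1 = P (a * q) n * P (a * q / (d * f)) n * P (q / (c * N)) n * P (b * F / a) n /
      (P (a * q / d) n * P (a * q / f) n * P (F * q / c) n * P (b / (a * N)) n) * S2"
    using terminating_reversed[OF nz(1-4) f0 ge(1-4) gef(1) ge(6) gef(2) ge(8,9) gef(3,4), of n]
    unfolding S1_def S2_def N_def[symmetric] eqs .
  have sp: "Q (a * q) = P (a * q) n * Q (a * q * N)" "Q (a * q / d) = P (a * q / d) n * Q (a * q / d * N)"
     "Q (a * q / f) = P (a * q / f) n * Q (a * q / F)" "Q (b / (a * N)) = P (b / (a * N)) n * Q (b / a)"
     "Q (b * F / a) = P (b * F / a) n * Q (b * F / a * N)" "Q (a * q / (d * f)) = P (a * q / (d * f)) n * Q (a * q / (d * F))"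
     "Q (q / (c * N)) = P (q / (c * N)) n * Q (q / c)" "Q (F * q / c) = P (F * q / c) n * Q (F * q / c * N)"
    using Q_split[of "a * q" n] Q_split[of "a * q / d" n] Q_split[of "a * q / f" n] Q_split[of "b / (a * N)" n]
      Q_split[of "b * F / a" n] Q_split[of "a * q / (d * f)" n] Q_split[of "q / (c * N)" n] Q_split[of "F * q / c" n] N0
    unfolding N_def[symmetric] by (simp_all add: f_def)
  have args: "b * (1 / q ^ n) / a = b / (a * N)" "b * F / (a * (1 / q ^ n)) = b * F / a * N" "F / (1 / q ^ n) = f"
      "a * q / (d * (1 / q ^ n)) = a * q / d * N" "a * q * (1 / q ^ n) / (d * F) = a * q / (d * f)"
    by (simp_all add: N_def f_def mult_ac)
  have qn: "Q (a * q / d) \<noteq> 0" "Q (a * q / f) \<noteq> 0" "Q (F * q / c) \<noteq> 0" "Q (b / (a * N)) \<noteq> 0" "Q (a * q / (d * F)) \<noteq> 0" "Q (q / c) \<noteq> 0"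
    using qgen_over_mult[OF ge(4)] qgen_over_mult[OF gef(1)] qgen_over_mult[OF ge(10)] gd[OF qgen_over_swap[OF ge(2)]]
      qgen_over_mult[OF ge(11)] qgen_over_mult[OF c1] by (auto intro!: Q_nonzero qgen_qfree)
  have alg: "(p4 * q4) * q5 * ((p3 * q3) * q1 * (p1 * p6 * p7 * p5 / (p2 * p3 * p8 * p4) * s)) =
     (p1 * q1) * q3 * q4 * (p5 * q5) / ((p2 * q2) * q6 * q7 * (p8 * q8)) * (q2 * (p6 * q6) * ((p7 * q7) * q8 * s))"
    if "p4 \<noteq> 0" "p3 \<noteq> 0" "q2 \<noteq> 0" "q6 \<noteq> 0" "q7 \<noteq> 0" "q8 \<noteq> 0"
    for p1 p2 p3 p4 p5 p6 p7 p8 q1 q2 q3 q4 q5 q6 q7 q8 s :: complex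
    using that by (simp add: mult_ac)
  have "Q (b / (a * N)) * Q (b * F / a * N) * (Q (a * q / f) * Q (a * q * N) * S1) =
     Q (a * q) * Q (a * q / F) * Q (b / a) * Q (b * F / a) /
     (Q (a * q / d) * Q (a * q / (d * F)) * Q (q / c) * Q (F * q / c)) *
     (Q (a * q / d * N) * Q (a * q / (d * f)) * (Q (q / (c * N)) * Q (F * q / c * N) * S2))"
    unfolding T2 sp by (rule alg) (use qn sp in auto)
  then show ?thesis unfolding ttL_def ttR_def ttC1_def args w1 w2 .
qed

text \<open>At a zero of \<open>Q (b * e / a)\<close> the side \<open>ttL\<close> vanishes and the
  third series terminates. \<open>three_term_terminating\<close> for the swapped parameters
  \<open>b^2 / a, b, b * c / a, b * d / a\<close> rewrites it as a series with base parameter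
  \<open>l\<close>, which Bailey's transformation carries into the series of \<open>ttR\<close>;
  \<open>ttC2\<close> is the coefficient for which the two contributions cancel.\<close>

lemma three_term_swapped_zero:
  assumes g: "tt_gen a b c d F" and g': "tt_gen (b\<^sup>2 / a) b (b * c / a) (b * d / a) (b\<^sup>2 * F / a\<^sup>2)"
    and g2: "qgen q (b * F / (a * c))" "qgen q (a / (b * c))" "qgen q (b * c * d * F / a\<^sup>2)"
    and conv: "norm (b * d / a) < 1" and e: "e = a / (b * q ^ m)"
  shows "ttC1 a b c d F * ttR a b c d F e +
     ttC2 a b c d F * Q e * Q (F / e) * wn (b\<^sup>2 / a) b (b * c / a) (b * d / a) (b * e / a) (b * F / (a * e)) = 0"
proof -
  have nz: "a \<noteq> 0" "b \<noteq> 0" "c \<noteq> 0" "d \<noteq> 0" "F \<noteq> 0"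
    and ge: "qgen q a" "qgen q (a / b)" "qgen q (a / c)" "qgen q (a / d)" "qgen q (a / F)" "qgen q (a / (c * d))"
      "qgen q (a / (b * F))" "qgen q c" "qgen q d" "qgen q (F / c)" "qgen q (a / (d * F))"
    using g by (auto simp: tt_gen_def)
  define N where "N = q ^ m"
  have N0: "N \<noteq> 0" by (simp add: N_def)
  have e0: "e \<noteq> 0" using nz N0 by (simp add: e N_def)
  have be: "b * e / a = 1 / q ^ m" using nz by (simp add: e)
  define a' c' d' F' where "a' = b\<^sup>2 / a" and "c' = b * c / a" and "d' = b * d / a" and "F' = b\<^sup>2 * F / a\<^sup>2"
  define f f' where "f = F / e" and "f' = b * F / (a * e)"
  define l where "l = b * F / (a * c)"
  have g'': "tt_gen a' b c' d' F'" using g' by (simp add: a'_def c'_def d'_def F'_def)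
  then have ge': "qgen q a'" "qgen q (a' / b)" "qgen q (a' / c')" "qgen q (a' / d')" "qgen q (a' / (d' * F'))"
    by (auto simp: tt_gen_def)
  have t1: "ttL a' b c' d' F' (1 / q ^ m) = ttC1 a' b c' d' F' * ttR a' b c' d' F' (1 / q ^ m)"
    by (rule three_term_terminating[OF g''])
  have args: "b * (1 / q ^ m) / a' = e" "b * F' / (a' * (1 / q ^ m)) = f" "F' / (1 / q ^ m) = f'"
     "a' * q / (d' * (1 / q ^ m)) = a * q / (d * e)" "a' * q * (1 / q ^ m) / (d' * F') = a * q * e / (d * F)"
     "F' / c' = l" "a' * q / (b * c') = q / c" "a' * q / (c' * d') = a * q / (c * d)" "F' / a' = F / a"
    unfolding be[symmetric] using nz e0
    by (simp_all add: a'_def c'_def d'_def F'_def f_def f'_def l_def field_simps power2_eq_square)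
  define X WA WB where "X = Q (a * q / (d * e)) * Q (a * q * e / (d * F))"
    and "WA = (\<Sum>r. w8 (F / c) (a * q / (b * c)) (a * q / (c * d)) (F / a) e f r)"
    and "WB = (\<Sum>r. w8 l (q / c) (a * q / (c * d)) (F / a) (b * e / a) f' r)"
  have L': "Q e * Q f * wn a' b c' d' (b * e / a) f' = ttC1 a' b c' d' F' * (X * wn l (q / c) (a * q / (c * d)) (F / a) (b * e / a) f')"
    using t1 unfolding ttL_def ttR_def args X_def be .
  have gN: "qgen q (x * N / y)" "qgen q (x / (y * N))" if "qgen q (x / y)" for x y
    using qgen_mult[OF that, of m] qgen_divide[OF that, of m] by (simp_all add: N_def)
  have Fq: "qfree q (F * q / c)" "qfree q (b * F / a)" "qfree q (d * F / a)" "qfree q (a * q / c)" "qfree q (F * q / (c * e))" "qfree q (e * q / c)"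
     "qfree q (b * d * F / a\<^sup>2)" "qfree q (b * q / c)" "qfree q l" "qfree q (F / c)" "qfree q (l * q)"
     "qfree q (a * q / (b * c) * q / N)" "qfree q (b * c * d * F / (a\<^sup>2 * q))"
  proof -
    show "qfree q (F * q / c)" "qfree q (b * F / a)" "qfree q (d * F / a)" "qfree q (a * q / c)" "qfree q l" "qfree q (F / c)" "qfree q (l * q)"
      using qgen_over_mult[OF ge(10)] qgen_over_swap[OF ge(7)] qgen_over_swap[OF ge(11)] qgen_over_mult[OF ge(3)] g2(1) ge(10) qgen_mult1[OF g2(1)]
      by (auto intro: qgen_qfree simp: l_def)
    have "F * q / (c * e) = b * F / (a * c) * q * N" using nz N0 by (simp add: e N_def[symmetric] field_simps)
    then show "qfree q (F * q / (c * e))" using qgen_mult[OF qgen_mult1[OF g2(1)], of m] by (auto intro: qgen_qfree simp: N_def)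
    have "e * q / c = a * q / (b * c * N)" using nz N0 by (simp add: e N_def[symmetric] field_simps)
    then show "qfree q (e * q / c)" using gN(2)[OF qgen_over_mult[OF g2(2)]] by (auto intro: qgen_qfree)
    have "a' / (d' * F') = a\<^sup>2 / (b * d * F)" using nz by (simp add: a'_def d'_def F'_def field_simps power2_eq_square)
    then show "qfree q (b * d * F / a\<^sup>2)" using qgen_over_swap[of "a\<^sup>2" "b * d * F"] ge'(5) by (auto intro: qgen_qfree)
    have "a' / c' = b / c" using nz by (simp add: a'_def c'_def field_simps power2_eq_square)
    then show "qfree q (b * q / c)" using qgen_over_mult[of b c] ge'(3) by (auto intro: qgen_qfree)
    show "qfree q (a * q / (b * c) * q / N)" using gN(2)[OF qgen_over_mult[OF qgen_over_mult[OF g2(2)]]] by (auto intro: qgen_qfree simp: mult_ac)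
    show "qfree q (b * c * d * F / (a\<^sup>2 * q))" using qgen_divide[OF g2(3), of 1] by (auto intro: qgen_qfree)
  qed
  have la: "F / c * q / (a * q / (b * c)) = b * F / a" "F / c * q / (a * q / (c * d)) = d * F / a" "F / c * q / (F / a) = a * q / c"
     "F / c * q / e = F * q / (c * e)" "F / c * q / f = e * q / c"
     "(F / c)\<^sup>2 * q\<^sup>2 / (a * q / (b * c) * (a * q / (c * d)) * (F / a) * e * f) = b * d / a"
    using nz e0 by (simp_all add: f_def field_simps power2_eq_square)
  have lb: "l * q / (q / c) = b * F / a" "l * q / (a * q / (c * d)) = b * d * F / a\<^sup>2" "l * q / (F / a) = b * q / c"
     "l * q / (b * e / a) = F * q / (c * e)" "l * q / f' = e * q / c"
    using nz e0 by (simp_all add: l_def f'_def field_simps power2_eq_square)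
  have wA: "wn (F / c) (a * q / (b * c)) (a * q / (c * d)) (F / a) e f = Q (F * q / (c * e)) * Q (e * q / c) * WA"
    unfolding WA_def using wn_w8[of "F / c" "a * q / (b * c)" "a * q / (c * d)" "F / a" e f] Fq conv unfolding la by blast
  have bem: "b * e / a * q ^ m = 1" unfolding be by simp
  have wB: "wn l (q / c) (a * q / (c * d)) (F / a) (b * e / a) f' = Q (F * q / (c * e)) * Q (e * q / c) * WB"
    unfolding WB_def using wn_w8[of l "q / c" "a * q / (c * d)" "F / a" "b * e / a" f'] Fq bem unfolding lb by blast
  \<comment> \<open>Bailey's transformation from the base parameter \<open>l\<close> to
    \<open>F / c\<close>. The series it starts from terminates, since
    \<open>b * e / a = 1 / q ^ m\<close>.\<close>
  have III: "Q (F * q / c) * Q d * wn l (b * e / a) f' (q / c) (a * q / (c * d)) (F / a) =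
     Q (l * q) * Q (b * d / a) * wn (F / c) e f (a * q / (b * c)) (a * q / (c * d)) (F / a)"
  proof -
    have 1: "F / c = l\<^sup>2 * q / (b * e / a * f' * (q / c))" using nz e0
      by (simp add: l_def f'_def field_simps power2_eq_square)
    have 2: "l * q / (b * e / a) = F * q / (c * e)" "l * q / f' = e * q / c" "l * q / (q / c * (a * q / (c * d))) = b * c * d * F / (a\<^sup>2 * q)"
       "F / c * q / (a * q / (c * d)) = d * F / a" "l * q / (a * q / (c * d) * (F / a)) = b * d / a"
       "l * q / (f' * (q / c)) = e" "l * q / (b * e / a * (q / c)) = f" "l * q / (b * e / a * f') = a * q / (b * c)"
       "F / c * q / (a * q / (c * d) * (F / a)) = d"
      using nz e0 by (simp_all add: l_def f'_def f_def field_simps power2_eq_square)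
    have nzz: "l \<noteq> 0" "b * e / a \<noteq> 0" "f' \<noteq> 0" "q / c \<noteq> 0" "a * q / (c * d) \<noteq> 0" "F / a \<noteq> 0"
      using nz e0 by (simp_all add: l_def f'_def)
    have fcq: "F / c * q = F * q / c" by simp
    show ?thesis
      using bailey_two_term[OF nzz 1] Fq conv bem unfolding 2 lb unfolding fcq by blast
  qed
  have wB': "wn l (b * e / a) f' (q / c) (a * q / (c * d)) (F / a) = Q (b * d * F / a\<^sup>2) * Q (b * q / c) * WB"
  proof -
    have "w8 l (b * e / a) f' (q / c) (a * q / (c * d)) (F / a) = w8 l (q / c) (a * q / (c * d)) (F / a) (b * e / a) f'"
      unfolding w8_def by (simp add: mult_ac)
    then show ?thesis
      unfolding WB_def using wn_w8[of l "b * e / a" f' "q / c" "a * q / (c * d)" "F / a"] Fq bem unfolding lb by metis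
  qed
  have wA': "wn (F / c) e f (a * q / (b * c)) (a * q / (c * d)) (F / a) = Q (d * F / a) * Q (a * q / c) * WA"
  proof -
    have "w8 (F / c) e f (a * q / (b * c)) (a * q / (c * d)) (F / a) = w8 (F / c) (a * q / (b * c)) (a * q / (c * d)) (F / a) e f"
      unfolding w8_def by (simp add: mult_ac)
    moreover have "(F / c)\<^sup>2 * q\<^sup>2 / (e * f * (a * q / (b * c)) * (a * q / (c * d)) * (F / a)) = b * d / a"
    proof -
      have p: "e * f * (a * q / (b * c)) * (a * q / (c * d)) * (F / a) = a * q / (b * c) * (a * q / (c * d)) * (F / a) * e * f"
        by (simp only: mult_ac)
      show ?thesis unfolding p by (rule la(6))
    qed
    ultimately show ?thesis
      unfolding WA_def using wn_w8[of "F / c" e f "a * q / (b * c)" "a * q / (c * d)" "F / a"] Fq conv unfolding la by metis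
  qed
  have bd: "qfree q (b * d / a)"
    using g'' by (auto simp: tt_gen_def d'_def intro: qgen_qfree)
  have Qn: "Q (F * q / c) \<noteq> 0" "Q d \<noteq> 0" "Q (b * d * F / a\<^sup>2) \<noteq> 0" "Q (b * q / c) \<noteq> 0" "Q (l * q) \<noteq> 0" "Q (b * d / a) \<noteq> 0"
     "Q (d * F / a) \<noteq> 0" "Q (a * q / c) \<noteq> 0"
    using Fq ge(9) bd by (auto intro!: Q_nonzero intro: qgen_qfree)
  have WB: "WB = Q (l * q) * Q (b * d / a) * Q (d * F / a) * Q (a * q / c) / (Q (F * q / c) * Q d * Q (b * d * F / a\<^sup>2) * Q (b * q / c)) * WA"
    using III unfolding wA' wB' using Qn by (simp add: field_simps)
  have C1': "ttC1 a' b c' d' F' = Q (b\<^sup>2 * q / a) * Q (a * q / F) * Q (a / b) * Q (b * F / a) /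
      (Q (b * q / d) * Q (a\<^sup>2 * q / (b * d * F)) * Q (a * q / (b * c)) * Q (l * q))"
  proof -
    have "a' * q = b\<^sup>2 * q / a" "a' * q / F' = a * q / F" "b / a' = a / b" "b * F' / a' = b * F / a"
      "a' * q / d' = b * q / d" "a' * q / (d' * F') = a\<^sup>2 * q / (b * d * F)" "q / c' = a * q / (b * c)" "F' * q / c' = l * q"
      using nz by (simp_all add: a'_def c'_def d'_def F'_def l_def field_simps power2_eq_square)
    then show ?thesis unfolding ttC1_def by metis
  qed
  have Qm: "Q (b\<^sup>2 * q / a) \<noteq> 0" "Q (b * q / d) \<noteq> 0" "Q (a\<^sup>2 * q / (b * d * F)) \<noteq> 0" "Q (a * q / (b * c)) \<noteq> 0" "Q (a * q / b) \<noteq> 0"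
    "Q (b * q / a) \<noteq> 0"
  proof -
    have "a' / d' = b / d" "a' / (d' * F') = a\<^sup>2 / (b * d * F)"
      using nz by (simp_all add: a'_def d'_def F'_def field_simps power2_eq_square)
    then show "Q (b\<^sup>2 * q / a) \<noteq> 0" "Q (b * q / d) \<noteq> 0" "Q (a\<^sup>2 * q / (b * d * F)) \<noteq> 0" "Q (a * q / (b * c)) \<noteq> 0" "Q (a * q / b) \<noteq> 0"
      "Q (b * q / a) \<noteq> 0"
      using qgen_over_mult[of "b\<^sup>2" a] qgen_over_mult[of b d] qgen_over_mult[of "a\<^sup>2" "b * d * F"] qgen_over_mult[OF g2(2)]
        qgen_over_mult[OF ge(2)] qgen_over_mult[OF qgen_over_swap[OF ge(2)]] ge'
      by (auto intro!: Q_nonzero qgen_qfree simp: a'_def)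
  qed
  \<comment> \<open>The inversion formula \<open>\<theta>(u) = - u * \<theta>(1 / u)\<close> of the
    theta function at \<open>u = b / a\<close>; it supplies the minus sign of the
    cancellation.\<close>
  have rel: "Q (b / a) * Q (a * q / b) = - (b / a * Q (b * q / a) * Q (a / b))"
  proof -
    have e1: "Q (b / a) = (1 - b / a) * Q (b * q / a)" using Q_split1[of "b / a"] by simp
    have e2: "Q (a / b) = (1 - a / b) * Q (a * q / b)" using Q_split1[of "a / b"] by simp
    have k: "b / a * (1 - a / b) = - (1 - b / a)" using nz by (simp add: field_simps)
    have x: "b / a * Q (b * q / a) * ((1 - a / b) * Q (a * q / b)) = (b / a * (1 - a / b)) * (Q (b * q / a) * Q (a * q / b))"
      by (simp only: mult_ac)
    show ?thesis unfolding e1 e2 unfolding x unfolding k by (simp add: algebra_simps)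
  qed
  have sum0: "ttC1 a b c d F * WA + ttC2 a b c d F * ttC1 a' b c' d' F' * WB = 0"
  proof -
    define r1 r2 where "r1 = Q (b / a)" and "r2 = Q (a * q / b)"
    have alg: "x1 * x2 * r1 * x3 / (x4 * x5 * x6 * x7) * wa +
      ba * x1 * y1 * y2 * y3 * y4 * y5 * y6 * y7 / (r2 * y8 * x4 * y9 * z1 * x5 * x6 * z2) * (z2 * x2 * z3 * x3 / (y3 * y7 * y5 * z4)) *
       (z4 * y9 * z1 * y8 / (x7 * y4 * y6 * y2) * wa) = 0"
      if "r1 * r2 = - (ba * y1 * z3)" "r2 \<noteq> 0" "y2 \<noteq> 0" "y3 \<noteq> 0" "y4 \<noteq> 0" "y5 \<noteq> 0" "y6 \<noteq> 0" "y7 \<noteq> 0" "y8 \<noteq> 0" "y9 \<noteq> 0" "z1 \<noteq> 0" "z2 \<noteq> 0" "z4 \<noteq> 0"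
      for r1 r2 x1 x2 x3 x4 x5 x6 x7 y1 y2 y3 y4 y5 y6 y7 y8 y9 z1 z2 z3 z4 ba wa :: complex
    proof -
      have "ba * x1 * y1 * y2 * y3 * y4 * y5 * y6 * y7 / (r2 * y8 * x4 * y9 * z1 * x5 * x6 * z2) * (z2 * x2 * z3 * x3 / (y3 * y7 * y5 * z4)) *
       (z4 * y9 * z1 * y8 / (x7 * y4 * y6 * y2) * wa) = (ba * y1 * z3) * x1 * x2 * x3 * wa / (r2 * x4 * x5 * x6 * x7)"
        using that(2-) by (simp add: mult_ac)
      also have "ba * y1 * z3 = - (r1 * r2)" using that(1) by simp
      finally show ?thesis using that(2) by (simp add: mult_ac)
    qed
    show ?thesis unfolding C1' WB unfolding ttC1_def ttC2_def
      by (rule alg) (use rel Qn Qm in auto)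
  qed
  have "ttC1 a b c d F * ttR a b c d F e + ttC2 a b c d F * Q e * Q (F / e) * wn a' b c' d' (b * e / a) f'
     = ttC1 a b c d F * (X * (Q (F * q / (c * e)) * Q (e * q / c) * WA)) + ttC2 a b c d F * (Q e * Q f * wn a' b c' d' (b * e / a) f')"
    unfolding ttR_def X_def wA[symmetric] f_def by (simp add: mult_ac)
  also have "\<dots> = X * Q (F * q / (c * e)) * Q (e * q / c) * (ttC1 a b c d F * WA + ttC2 a b c d F * ttC1 a' b c' d' F' * WB)"
    unfolding L' wB by (simp add: algebra_simps)
  also have "\<dots> = 0" unfolding sum0 by simp
  finally show ?thesis unfolding a'_def c'_def d'_def f'_def .
qed

text \<open>Split off the factor \<open>1 - y * q ^ n\<close> that vanishes at
  \<open>x = 1 / q ^ n\<close>. The other factors give \<open>P x n\<close>, non-zero because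
  distinct powers of \<open>q\<close> differ, and \<open>Q q\<close>.\<close>

lemma Q_deriv_nonzero:
  assumes "Q x = 0" shows "deriv Q x \<noteq> 0"
proof -
  obtain n where n: "x * q ^ n = 1" using assms by (auto simp: Q_eq_0_iff qfree_def)
  define g where "g = (\<lambda>y. P y n * Q (y * q ^ Suc n))"
  have Qg: "Q = (\<lambda>y. (1 - y * q ^ n) * g y)"
  proof
    fix y
    show "Q y = (1 - y * q ^ n) * g y"
      unfolding g_def using Q_split[of y "Suc n"] by (simp add: qpoch_Suc)
  qed
  have "g holomorphic_on UNIV" unfolding g_def by (intro holomorphic_intros)
  then have g': "(g has_field_derivative deriv g x) (at x)" by (rule holomorphic_derivI) auto
  have x: "x = 1 / q ^ n" using n by (simp add: field_simps)
  have "P x n \<noteq> 0"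
    unfolding qpoch_def x
  proof (simp, intro ballI)
    fix i assume "i \<in> {..<n}"
    then have "q ^ n = q ^ (n - i) * q ^ i" "n - i > 0" by (simp_all flip: power_add)
    then show "q ^ i \<noteq> q ^ n" using q_power_ne_1[of "n - i"] by (metis mult_cancel_right1 power_not_zero q_nonzero)
  qed
  moreover have "x * q ^ Suc n = q" using n by simp
  ultimately have gx: "g x \<noteq> 0" unfolding g_def using Q_nonzero[OF qfree_q] by (metis mult_eq_0_iff)
  have "(Q has_field_derivative (1 - x * q ^ n) * deriv g x + (- (q ^ n)) * g x) (at x)"
    unfolding Qg by (rule derivative_eq_intros g' refl | simp)+
  then have "deriv Q x = - (q ^ n) * g x" using n by (simp add: DERIV_imp_deriv)
  with gx show ?thesis by simp
qed

lemma simple_zero_mult: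
  assumes "Q (f z) = 0" "(f has_field_derivative f') (at z)" "f' \<noteq> 0"
    and "(g has_field_derivative g') (at z)" "g z \<noteq> 0"
  shows "deriv (\<lambda>z. Q (f z) * g z) z \<noteq> 0"
proof -
  have "(Q has_field_derivative deriv Q (f z)) (at (f z))"
    by (rule holomorphic_derivI[OF Q_holomorphic_UNIV]) auto
  then have "((\<lambda>z. Q (f z)) has_field_derivative deriv Q (f z) * f') (at z)"
    by (rule DERIV_chain2) fact
  then have "((\<lambda>z. Q (f z) * g z) has_field_derivative deriv Q (f z) * f' * g z) (at z)"
    by (rule DERIV_cong[OF DERIV_mult]) (use assms in auto)
  then show ?thesis using Q_deriv_nonzero[OF assms(1)] assms by (simp add: DERIV_imp_deriv)
qed

text \<open>
  Regard the difference of the two sides as a function of \<open>e\<close> on the punctured plane.  Divided by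
  \<open>Q(e) Q(F/e) Q(be/a) Q(bF/(ae))\<close> it stays holomorphic, because it vanishes where one of the series
  terminates, and it tends to \<open>0\<close> along circles with radii tending to \<open>0\<close> and \<open>\<infinity>\<close>.
  The identity is (III.37) in Gasper and Rahman.
\<close>

theorem three_term:
  assumes g: "tt_gen a b c d F" and g': "tt_gen (b\<^sup>2 / a) b (b * c / a) (b * d / a) (b\<^sup>2 * F / a\<^sup>2)"
    and g2: "qgen q (b * F / (a * c))" "qgen q (a / (b * c))" "qgen q (b * c * d * F / a\<^sup>2)"
    and g3: "qgen q F" "qgen q (b\<^sup>2 * F / a\<^sup>2)"
    and conv: "norm (b * d / a) < 1" "norm (a\<^sup>2 * q\<^sup>2 / (b * c * d * F)) < 1" "norm (a * q / F) < 1"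
      "norm (q / c) < 1" "norm (a\<^sup>2 * q / (b * d * F)) < 1"
    and e: "e \<noteq> 0"
  shows "ttL a b c d F e = ttC1 a b c d F * ttR a b c d F e +
     ttC2 a b c d F * Q e * Q (F / e) * wn (b\<^sup>2 / a) b (b * c / a) (b * d / a) (b * e / a) (b * F / (a * e))"
proof -
  have nz: "a \<noteq> 0" "b \<noteq> 0" "c \<noteq> 0" "d \<noteq> 0" "F \<noteq> 0"
    and ge: "qgen q a" "qgen q (a / b)" "qgen q (a / c)" "qgen q (a / d)" "qgen q (a / F)" "qgen q (a / (c * d))"
      "qgen q (a / (b * F))" "qgen q c" "qgen q d" "qgen q (F / c)" "qgen q (a / (d * F))"
    using g by (auto simp: tt_gen_def)
  define a' c' d' F' where "a' = b\<^sup>2 / a" and "c' = b * c / a" and "d' = b * d / a" and "F' = b\<^sup>2 * F / a\<^sup>2"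
  have nz': "a' \<noteq> 0" "c' \<noteq> 0" "d' \<noteq> 0" "F' \<noteq> 0" using nz by (simp_all add: a'_def c'_def d'_def F'_def)
  have "tt_gen a' b c' d' F'" using g' by (simp add: a'_def c'_def d'_def F'_def)
  then have ge': "qgen q (a' / b)" "qgen q (a' / c')" "qgen q (a' / d')" by (auto simp: tt_gen_def)
  define T0 T1 T2 where "T0 = (\<lambda>e. wn a b c d e (F / e))"
    and "T1 = (\<lambda>e. wn (F / c) (a * q / (b * c)) (a * q / (c * d)) (F / a) e (F / e))"
    and "T2 = (\<lambda>e. wn a' b c' d' e (F' / e))"
  define C1 C2 where "C1 = ttC1 a b c d F" and "C2 = ttC2 a b c d F"
  define E where "E = (\<lambda>e. Q e * Q (F / e) * Q (b / a * e) * Q (F' / (b / a * e)))"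
  have F'e: "F' / (b / a * e) = b * F / (a * e)" for e
    using nz by (simp add: F'_def field_simps power2_eq_square)
  define D where "D = (\<lambda>e. Q (b / a * e) * Q (F' / (b / a * e)) * T0 e
      - C1 * (Q (a * q / (d * e)) * Q (a * q * e / (d * F)) * T1 e) - C2 * (Q e * Q (F / e) * T2 (b / a * e)))"
  have D_eq: "D e = ttL a b c d F e - (C1 * ttR a b c d F e + C2 * Q e * Q (F / e) * wn (b\<^sup>2 / a) b (b * c / a) (b * d / a) (b * e / a) (b * F / (a * e)))" for e
    unfolding D_def ttL_def ttR_def T0_def T1_def T2_def F'e by (simp add: a'_def c'_def d'_def)
  have fr0: "qfree q (a * q / b)" "qfree q (a * q / c)" "qfree q (a * q / d)"
    using qgen_over_mult[OF ge(2)] qgen_over_mult[OF ge(3)] qgen_over_mult[OF ge(4)] by (auto intro: qgen_qfree)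
  have fr2: "qfree q (a' * q / b)" "qfree q (a' * q / c')" "qfree q (a' * q / d')"
    using qgen_over_mult[OF ge'(1)] qgen_over_mult[OF ge'(2)] qgen_over_mult[OF ge'(3)] by (auto intro: qgen_qfree)
  have l1: "F / c * q / (a * q / (b * c)) = b * F / a" "F / c * q / (a * q / (c * d)) = d * F / a" "F / c * q / (F / a) = a * q / c"
    using nz by (simp_all add: field_simps)
  have fr1: "qfree q (F / c * q / (a * q / (b * c)))" "qfree q (F / c * q / (a * q / (c * d)))" "qfree q (F / c * q / (F / a))"
    unfolding l1 using qgen_over_swap[OF ge(7)] qgen_over_swap[OF ge(11)] qgen_over_mult[OF ge(3)] by (auto intro: qgen_qfree)
  have u0: "norm (a\<^sup>2 * q\<^sup>2 / (b * c * d * F)) < 1" by fact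
  have "(F / c)\<^sup>2 * q\<^sup>2 / (a * q / (b * c) * (a * q / (c * d)) * (F / a) * F) = b * d / a"
    using nz by (simp add: field_simps power2_eq_square)
  then have u1: "norm ((F / c)\<^sup>2 * q\<^sup>2 / (a * q / (b * c) * (a * q / (c * d)) * (F / a) * F)) < 1" using conv by simp
  have "a'\<^sup>2 * q\<^sup>2 / (b * c' * d' * F') = a\<^sup>2 * q\<^sup>2 / (b * c * d * F)"
    using nz by (simp add: a'_def c'_def d'_def F'_def field_simps power2_eq_square)
  then have u2: "norm (a'\<^sup>2 * q\<^sup>2 / (b * c' * d' * F')) < 1" using conv by simp
  have holT: "T0 holomorphic_on - {0}" "T1 holomorphic_on - {0}" "T2 holomorphic_on - {0}"
    unfolding T0_def T1_def T2_def
    by (rule wn_holomorphic[OF u0 fr0 nz(5)] wn_holomorphic[OF u1 fr1 nz(5)] wn_holomorphic[OF u2 fr2 nz'(4)])+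
  have holT2: "(\<lambda>e. T2 (b / a * e)) holomorphic_on - {0}"
  proof -
    have "(T2 \<circ> (\<lambda>e. b / a * e)) holomorphic_on - {0}"
      by (rule holomorphic_on_compose_gen[OF _ holT(3)]) (use nz in \<open>auto intro!: holomorphic_intros\<close>)
    then show ?thesis by (simp only: o_def)
  qed
  have holD: "D holomorphic_on - {0}"
    unfolding D_def using nz by (intro holomorphic_intros holT holT2) auto
  have holE: "E holomorphic_on - {0}"
    unfolding E_def using nz by (intro holomorphic_intros) auto
  \<comment> \<open>The involution exchanging \<open>e\<close> and \<open>F / e\<close> preserves
    \<open>D\<close> and \<open>E\<close>. It reduces the zeros of the second and fourth factor of
    \<open>E\<close> to those of the first and third, and the inner circles to the outer
    ones.\<close>
  have symE: "E (F / e) = E e" if "e \<noteq> 0" for e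
  proof -
    have "F / (F / e) = e" "b / a * (F / e) = F' / (b / a * e)" "F' / (b / a * (F / e)) = b / a * e"
      using nz that by (simp_all add: F'_def field_simps power2_eq_square)
    then show ?thesis unfolding E_def by (simp add: mult_ac)
  qed
  have symD: "D (F / e) = D e" if "e \<noteq> 0" for e
  proof -
    have 1: "F / (F / e) = e" "b / a * (F / e) = F' / (b / a * e)" "F' / (b / a * (F / e)) = b / a * e"
      "a * q / (d * (F / e)) = a * q * e / (d * F)" "a * q * (F / e) / (d * F) = a * q / (d * e)"
      "F' / (F' / (b / a * e)) = b / a * e"
      using nz that by (simp_all add: F'_def field_simps power2_eq_square)
    show ?thesis unfolding D_def T0_def T1_def T2_def 1
      unfolding wn_swap[of a b c d "F / e"] wn_swap[of "F / c" _ _ _ "F / e"] wn_swap[of a' b c' d' "F' / _"]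
      by (simp add: mult_ac)
  qed
  have zero1: "D e = 0" if h: "Q e = 0" for e
  proof -
    obtain n where "e * q ^ n = 1" using h by (auto simp: Q_eq_0_iff qfree_def)
    then have "e = 1 / q ^ n" by (simp add: field_simps)
    then show ?thesis unfolding D_eq C1_def using three_term_terminating[OF g, of n] h by simp
  qed
  have zero2: "D e = 0" if h: "Q (b / a * e) = 0" for e
  proof -
    obtain m where "b / a * e * q ^ m = 1" using h by (auto simp: Q_eq_0_iff qfree_def)
    then have "e = a / (b * q ^ m)" using nz by (simp add: field_simps)
    from three_term_swapped_zero[OF g g' g2 conv(1) this] h show ?thesis
      unfolding D_eq C1_def C2_def ttL_def by simp
  qed
  have zeroD: "D e = 0" if "E e = 0" and "e \<noteq> 0" for e
  proof -
    consider "Q e = 0" | "Q (F / e) = 0" | "Q (b / a * e) = 0" | "Q (b / a * (F / e)) = 0"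
    proof -
      have "F' / (b / a * e) = b / a * (F / e)"
        using nz \<open>e \<noteq> 0\<close> by (simp add: F'_def field_simps power2_eq_square)
      then show thesis using that \<open>E e = 0\<close> by (auto simp: E_def)
    qed
    then show ?thesis using zero1 zero2 symD[OF \<open>e \<noteq> 0\<close>] by metis
  qed
  have qz: "\<exists>n. x * q ^ n = 1" if "Q x = 0" for x using that by (auto simp: Q_eq_0_iff qfree_def)
  have excl: False if h: "Q x = 0" "Q y = 0" "qgen q (x / y) \<or> qgen q (x * y)" for x y
  proof -
    obtain m n where "x * q ^ m = 1" "y * q ^ n = 1" using qz[OF h(1)] qz[OF h(2)] by blast
    then have xy: "x = 1 / q ^ m" "y = 1 / q ^ n" by (simp_all add: field_simps)
    have "x / y * q ^ m = q ^ n" "x * y * q ^ (m + n) = q ^ 0" unfolding xy by (simp_all add: power_add)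
    then show False using h(3) unfolding qgen_def by blast
  qed
  have simpleE: "deriv E e \<noteq> 0" if "E e = 0" "e \<noteq> 0" for e
  proof -
    have e: "e \<noteq> 0" by fact
    \<comment> \<open>Two factors of \<open>E\<close> can vanish together only if the quotient and
      the product of their arguments are integral powers of \<open>q\<close>. For each of the six
      pairs one of the two is independent of \<open>e\<close> and generic by assumption; hence all
      zeros of \<open>E\<close> are simple.\<close>
    have gens: "qgen q (e * (F / e))" "qgen q (e / (b / a * e))" "qgen q (e * (F' / (b / a * e)))"
       "qgen q (F / e * (b / a * e))" "qgen q (F / e / (F' / (b / a * e)))" "qgen q (b / a * e * (F' / (b / a * e)))"
    proof -
      have e6: "e * (F / e) = F" "e / (b / a * e) = a / b" "e * (F' / (b / a * e)) = b * F / a"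
        "F / e * (b / a * e) = b * F / a" "F / e / (F' / (b / a * e)) = a / b" "b / a * e * (F' / (b / a * e)) = F'"
        using nz e by (simp_all add: F'_def field_simps power2_eq_square)
      show "qgen q (e * (F / e))" "qgen q (e / (b / a * e))" "qgen q (e * (F' / (b / a * e)))"
       "qgen q (F / e * (b / a * e))" "qgen q (F / e / (F' / (b / a * e)))" "qgen q (b / a * e * (F' / (b / a * e)))"
        unfolding e6 using g3 ge(2) qgen_over_swap[OF ge(7)] unfolding F'_def by simp_all
    qed
    have dq: "((\<lambda>e. Q e) has_field_derivative deriv (\<lambda>e. Q e) e) (at e)"
      "((\<lambda>e. Q (F / e)) has_field_derivative deriv (\<lambda>e. Q (F / e)) e) (at e)"
      "((\<lambda>e. Q (b / a * e)) has_field_derivative deriv (\<lambda>e. Q (b / a * e)) e) (at e)"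
      "((\<lambda>e. Q (F' / (b / a * e))) has_field_derivative deriv (\<lambda>e. Q (F' / (b / a * e))) e) (at e)"
      using e nz by (intro holomorphic_derivI[of _ "- {0}"] holomorphic_intros; auto)+
    have di: "((\<lambda>e. e) has_field_derivative 1) (at e)" "((\<lambda>e. F / e) has_field_derivative (- F / e\<^sup>2)) (at e)"
      "((\<lambda>e. b / a * e) has_field_derivative b / a) (at e)" "((\<lambda>e. F' / (b / a * e)) has_field_derivative (- (b * F / a) / e\<^sup>2)) (at e)"
      using e nz by (auto intro!: derivative_eq_intros simp: F'_def power2_eq_square field_simps)
    have ne: "Q e = 0 \<Longrightarrow> Q (F / e) \<noteq> 0" "Q e = 0 \<Longrightarrow> Q (b / a * e) \<noteq> 0" "Q e = 0 \<Longrightarrow> Q (F' / (b / a * e)) \<noteq> 0"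
      "Q (F / e) = 0 \<Longrightarrow> Q (b / a * e) \<noteq> 0" "Q (F / e) = 0 \<Longrightarrow> Q (F' / (b / a * e)) \<noteq> 0" "Q (b / a * e) = 0 \<Longrightarrow> Q (F' / (b / a * e)) \<noteq> 0"
      using excl gens by blast+
    consider "Q e = 0" | "Q (F / e) = 0" | "Q (b / a * e) = 0" | "Q (F' / (b / a * e)) = 0"
      using \<open>E e = 0\<close> by (auto simp: E_def)
    then show ?thesis
    proof cases
      case 1
      have "deriv (\<lambda>e. Q e * (Q (F / e) * Q (b / a * e) * Q (F' / (b / a * e)))) e \<noteq> 0"
        by (rule simple_zero_mult[OF 1 di(1) _ DERIV_mult[OF DERIV_mult[OF dq(2) dq(3)] dq(4)]])
          (use ne 1 in \<open>simp_all del: times_divide_eq_left times_divide_eq_right divide_divide_eq_right\<close>)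
      then show ?thesis unfolding E_def by (simp only: mult_ac not_False_eq_True)
    next
      case 2
      have "deriv (\<lambda>e. Q (F / e) * (Q e * Q (b / a * e) * Q (F' / (b / a * e)))) e \<noteq> 0"
        by (rule simple_zero_mult[OF 2 di(2) _ DERIV_mult[OF DERIV_mult[OF dq(1) dq(3)] dq(4)]])
          (use ne 2 nz e in \<open>auto simp del: times_divide_eq_left times_divide_eq_right divide_divide_eq_right\<close>)
      then show ?thesis unfolding E_def by (simp only: mult_ac not_False_eq_True)
    next
      case 3
      have "deriv (\<lambda>e. Q (b / a * e) * (Q e * Q (F / e) * Q (F' / (b / a * e)))) e \<noteq> 0"
        by (rule simple_zero_mult[OF 3 di(3) _ DERIV_mult[OF DERIV_mult[OF dq(1) dq(2)] dq(4)]])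
          (use ne 3 nz e in \<open>auto simp del: times_divide_eq_left times_divide_eq_right divide_divide_eq_right\<close>)
      then show ?thesis unfolding E_def by (simp only: mult_ac not_False_eq_True)
    next
      case 4
      have "deriv (\<lambda>e. Q (F' / (b / a * e)) * (Q e * Q (F / e) * Q (b / a * e))) e \<noteq> 0"
        by (rule simple_zero_mult[OF 4 di(4) _ DERIV_mult[OF DERIV_mult[OF dq(1) dq(2)] dq(3)]])
          (use ne 4 nz e in \<open>auto simp del: times_divide_eq_left times_divide_eq_right divide_divide_eq_right\<close>)
      then show ?thesis unfolding E_def by (simp only: mult_ac not_False_eq_True)
    qed
  qed
  obtain h where h: "h holomorphic_on - {0}" "\<And>z. z \<in> - {0} \<Longrightarrow> D z = h z * E z"
    using holomorphic_quotient_simple_zeros[OF _ holD holE] zeroD simpleE by auto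
  define ba where "ba = norm (b / a)"
  have ba0: "ba > 0" using nz by (simp add: ba_def)
  \<comment> \<open>One radius such that the circles described by \<open>e\<close>,
    \<open>F / e\<close>, \<open>b * e / a\<close> and \<open>F' / (b * e / a)\<close>, the
    arguments of the factors of \<open>E\<close>, are all generic.\<close>
  obtain \<rho> where \<rho>0: "\<rho> > 0" and \<rho>: "\<And>\<kappa>. \<kappa> \<in> {1, 1 / norm F, ba, ba / norm F'} \<Longrightarrow> gen_radius (\<rho> * \<kappa>)"
    by (rule ex_gen_radius[of "{1, 1 / norm F, ba, ba / norm F'}"]) (use nz nz' ba0 in auto)
  have "gen_radius (\<rho> * 1)" by (rule \<rho>) simp
  then have r1: "gen_radius \<rho>" by simp
  have "gen_radius (\<rho> * (1 / norm F))" by (rule \<rho>) simp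
  then have r2: "gen_radius (norm F / \<rho>)"
    using gen_radius_inverse[of \<rho> "norm F"] nz(5) by (metis times_divide_eq_right mult_1_right zero_less_norm_iff)
  have r3: "gen_radius (\<rho> * ba)" by (rule \<rho>) simp
  have "gen_radius (\<rho> * (ba / norm F'))" by (rule \<rho>) simp
  then have r4: "gen_radius (norm F' / (\<rho> * ba))"
    using gen_radius_inverse[of "\<rho> * ba" "norm F'"] nz'(4) by (metis times_divide_eq_right zero_less_norm_iff)
  define s where "s = norm q"
  have s: "0 < s" "s < 1" using norm_q by (auto simp: s_def)
  obtain K0 \<theta>0 where K0: "K0 \<ge> 0" "0 \<le> \<theta>0" "\<theta>0 < 1" "\<And>N \<nu>. norm \<nu> = \<rho> \<Longrightarrow> norm (T0 (\<nu> / q ^ N))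
       \<le> K0 * real (Suc N) * \<theta>0 ^ N * norm (Q (\<nu> / q ^ N) * Q (F / (\<nu> / q ^ N)))"
    using wn_decay[OF nz(5,1) u0 conv(3) fr0 r1 r2] unfolding T0_def by metis
  have t1: "norm (F / c * q / F) < 1" using conv(4) nz by simp
  have Fc: "F / c \<noteq> 0" using nz by simp
  obtain K1 \<theta>1 where K1: "K1 \<ge> 0" "0 \<le> \<theta>1" "\<theta>1 < 1" "\<And>N \<nu>. norm \<nu> = \<rho> \<Longrightarrow> norm (T1 (\<nu> / q ^ N))
       \<le> K1 * real (Suc N) * \<theta>1 ^ N * norm (Q (\<nu> / q ^ N) * Q (F / (\<nu> / q ^ N)))"
    using wn_decay[OF nz(5) Fc u1 t1 fr1 r1 r2] unfolding T1_def by metis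
  have "a' * q / F' = a * q / F" using nz by (simp add: a'_def F'_def field_simps power2_eq_square)
  then have t2: "norm (a' * q / F') < 1" using conv(3) by simp
  obtain K2 \<theta>2 where K2: "K2 \<ge> 0" "0 \<le> \<theta>2" "\<theta>2 < 1" "\<And>N \<nu>. norm \<nu> = \<rho> * ba \<Longrightarrow> norm (T2 (\<nu> / q ^ N))
       \<le> K2 * real (Suc N) * \<theta>2 ^ N * norm (Q (\<nu> / q ^ N) * Q (F' / (\<nu> / q ^ N)))"
    using wn_decay[OF nz'(4,1) u2 t2 fr2 r3 r4] unfolding T2_def by metis
  \<comment> \<open>The ratio that links the two products of \<open>ttR\<close> to factors of
    \<open>E\<close>: \<open>a * q * e / (d * F) = t3 * (b / a * e)\<close> and
    \<open>a * q / (d * e) = t3 * (F' / (b / a * e))\<close>.\<close>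
  define t3 where "t3 = a\<^sup>2 * q / (b * d * F)"
  have t30: "t3 \<noteq> 0" "norm t3 < 1" using nz conv(5) by (auto simp: t3_def)
  obtain M where M: "M > 0" "\<And>\<nu> N r. norm \<nu> = \<rho> * ba \<Longrightarrow>
    norm (Q (t3 * (\<nu> / q ^ N * q ^ r))) \<le> M * norm t3 ^ (N - r) * norm (Q (\<nu> / q ^ N * q ^ r))"
    using Q_ratio_bound[OF r3 t30(1)] by blast
  obtain M' where M': "M' > 0" "\<And>\<nu> N r. norm \<nu> = norm F' / (\<rho> * ba) \<Longrightarrow>
    norm (Q (t3 * (\<nu> / q ^ N * q ^ r))) \<le> M' * norm t3 ^ (N - r) * norm (Q (\<nu> / q ^ N * q ^ r))"
    using Q_ratio_bound[OF r4 t30(1)] by blast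
  define \<epsilon> where "\<epsilon> = (\<lambda>N. K0 * real (Suc N) * \<theta>0 ^ N + (norm C1 * M * M' * K1) * real (Suc N) * \<theta>1 ^ N + (norm C2 * K2) * real (Suc N) * \<theta>2 ^ N)"
  have eps: "\<epsilon> \<longlonglongrightarrow> 0"
  proof -
    have "\<epsilon> \<longlonglongrightarrow> 0 + 0 + 0" unfolding \<epsilon>_def
      by (intro tendsto_add tendsto_mult_geometric K0 K1 K2)
    then show ?thesis by simp
  qed
  have outer: "norm (h e) \<le> \<epsilon> N" if e: "norm e = \<rho> / s ^ N" for e N
  proof -
    define \<nu> where "\<nu> = e * q ^ N"
    have e\<nu>: "e = \<nu> / q ^ N" by (simp add: \<nu>_def)
    have \<nu>: "norm \<nu> = \<rho>" using e s by (simp add: \<nu>_def norm_mult norm_power s_def)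
    have e0: "e \<noteq> 0" using e \<rho>0 s by auto
    have be: "b / a * e = b / a * \<nu> / q ^ N" by (simp add: e\<nu>)
    have b\<nu>: "norm (b / a * \<nu>) = \<rho> * ba" by (simp add: ba_def norm_mult \<nu> norm_divide)
    have 0: "norm (T0 e) \<le> K0 * real (Suc N) * \<theta>0 ^ N * norm (Q e * Q (F / e))" using K0(4)[OF \<nu>, of N] unfolding e\<nu> .
    have 1: "norm (T1 e) \<le> K1 * real (Suc N) * \<theta>1 ^ N * norm (Q e * Q (F / e))" using K1(4)[OF \<nu>, of N] unfolding e\<nu> .
    have 2: "norm (T2 (b / a * e)) \<le> K2 * real (Suc N) * \<theta>2 ^ N * norm (Q (b / a * e) * Q (F' / (b / a * e)))"
      using K2(4)[OF b\<nu>, of N] unfolding be .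
    have 3: "norm (Q (a * q * e / (d * F))) \<le> M * norm (Q (b / a * e))"
    proof -
      have "t3 * (b / a * e * 1) = a * q * e / (d * F)" using nz by (simp add: t3_def field_simps power2_eq_square)
      then have "norm (Q (a * q * e / (d * F))) \<le> M * norm t3 ^ N * norm (Q (b / a * e))"
        using M(2)[OF b\<nu>, of N 0] unfolding be[symmetric] by simp
      also have "\<dots> \<le> M * 1 * norm (Q (b / a * e))"
        using M(1) t30 by (intro mult_right_mono mult_left_mono power_le_one) auto
      finally show ?thesis by simp
    qed
    have 4: "norm (Q (a * q / (d * e))) \<le> M' * norm (Q (F' / (b / a * e)))"
    proof -
      define \<mu> where "\<mu> = F' / (b / a * \<nu>)"
      have \<mu>: "norm \<mu> = norm F' / (\<rho> * ba)" unfolding \<mu>_def norm_divide b\<nu>[symmetric] ..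
      have \<mu>e: "\<mu> / q ^ 0 * q ^ N = F' / (b / a * e)" by (simp add: \<mu>_def e\<nu>)
      have "t3 * (F' / (b / a * e)) = a * q / (d * e)" using nz e0 by (simp add: t3_def F'_def field_simps power2_eq_square)
      then show ?thesis using M'(2)[OF \<mu>, of 0 N] unfolding \<mu>e by simp
    qed
    have "norm (D e) \<le> norm (Q (b / a * e) * Q (F' / (b / a * e)) * T0 e) + norm (C1 * (Q (a * q / (d * e)) * Q (a * q * e / (d * F)) * T1 e))
        + norm (C2 * (Q e * Q (F / e) * T2 (b / a * e)))"
      unfolding D_def by (intro order_trans[OF norm_triangle_ineq4] add_right_mono norm_triangle_ineq4)
    also have "\<dots> \<le> K0 * real (Suc N) * \<theta>0 ^ N * norm (E e) + (norm C1 * M * M' * K1) * real (Suc N) * \<theta>1 ^ N * norm (E e) + (norm C2 * K2) * real (Suc N) * \<theta>2 ^ N * norm (E e)"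
    proof (intro add_mono)
      show "norm (Q (b / a * e) * Q (F' / (b / a * e)) * T0 e) \<le> K0 * real (Suc N) * \<theta>0 ^ N * norm (E e)"
        using mult_left_mono[OF 0, of "norm (Q (b / a * e) * Q (F' / (b / a * e)))"] by (simp add: E_def norm_mult mult_ac)
      show "norm (C2 * (Q e * Q (F / e) * T2 (b / a * e))) \<le> (norm C2 * K2) * real (Suc N) * \<theta>2 ^ N * norm (E e)"
        using mult_left_mono[OF 2, of "norm C2 * norm (Q e * Q (F / e))"] by (simp add: E_def norm_mult mult_ac)
      have "norm (Q (a * q / (d * e))) * norm (Q (a * q * e / (d * F))) * norm (T1 e)
        \<le> (M' * norm (Q (F' / (b / a * e)))) * (M * norm (Q (b / a * e))) * (K1 * real (Suc N) * \<theta>1 ^ N * norm (Q e * Q (F / e)))"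
        using 1 3 4 M M' by (intro mult_mono) (auto intro!: mult_nonneg_nonneg simp: less_imp_le)
      from mult_left_mono[OF this, of "norm C1"]
      show "norm (C1 * (Q (a * q / (d * e)) * Q (a * q * e / (d * F)) * T1 e)) \<le> (norm C1 * M * M' * K1) * real (Suc N) * \<theta>1 ^ N * norm (E e)"
        by (simp add: E_def norm_mult mult_ac)
    qed
    finally have "norm (h e) * norm (E e) \<le> \<epsilon> N * norm (E e)"
      using h(2)[of e] e0 by (simp add: \<epsilon>_def norm_mult algebra_simps)
    moreover have "E e \<noteq> 0"
    proof -
      have "qgen q \<nu>" "qgen q (F / \<nu>)" "qgen q (b / a * \<nu>)" "qgen q (F' / (b / a * \<nu>))"
        using r1 r2 r3 r4 by (intro gen_radius_qgen; simp only: norm_divide[of F] norm_divide[of F'] b\<nu> \<nu>)+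
      then have "qgen q e" "qgen q (F / e)" "qgen q (b / a * e)" "qgen q (F' / (b / a * e))"
        using qgen_divide[of \<nu> N] qgen_mult[of "F / \<nu>" N] qgen_divide[of "b / a * \<nu>" N] qgen_mult[of "F' / (b / a * \<nu>)" N]
        by (simp_all add: e\<nu> mult.assoc)
      then show ?thesis unfolding E_def by (auto simp: Q_nonzero qgen_qfree)
    qed
    ultimately show ?thesis by simp
  qed
  have hsym: "h (F / e) = h e" if "e \<noteq> 0" "E e \<noteq> 0" for e
  proof -
    have "h (F / e) * E e = h e * E e"
      using h(2)[of e] h(2)[of "F / e"] symD[OF that(1)] symE[OF that(1)] that nz by auto
    with that show ?thesis by simp
  qed
  have inner: "norm (h e) \<le> \<epsilon> N" if e: "norm e = norm F / \<rho> * s ^ N" for e N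
  proof -
    have e0: "e \<noteq> 0" using e nz \<rho>0 s by auto
    define e' where "e' = F / e"
    have ne': "norm e' = \<rho> / s ^ N" using e0 e nz \<rho>0 s by (simp add: e'_def norm_divide field_simps)
    have e'0: "e' \<noteq> 0" "e = F / e'" using e0 nz by (auto simp: e'_def)
    define \<nu> where "\<nu> = e' * q ^ N"
    have e\<nu>: "e' = \<nu> / q ^ N" by (simp add: \<nu>_def)
    have \<nu>: "norm \<nu> = \<rho>" using ne' s by (simp add: \<nu>_def norm_mult norm_power s_def)
    have b\<nu>: "norm (b / a * \<nu>) = \<rho> * ba" by (simp add: ba_def norm_mult \<nu> norm_divide)
    have "E e' \<noteq> 0"
    proof -
      have "qgen q \<nu>" "qgen q (F / \<nu>)" "qgen q (b / a * \<nu>)" "qgen q (F' / (b / a * \<nu>))"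
        using r1 r2 r3 r4 by (intro gen_radius_qgen; simp only: norm_divide[of F] norm_divide[of F'] b\<nu> \<nu>)+
      then have "qgen q e'" "qgen q (F / e')" "qgen q (b / a * e')" "qgen q (F' / (b / a * e'))"
        using qgen_divide[of \<nu> N] qgen_mult[of "F / \<nu>" N] qgen_divide[of "b / a * \<nu>" N] qgen_mult[of "F' / (b / a * \<nu>)" N]
        by (simp_all add: e\<nu> mult.assoc)
      then show ?thesis unfolding E_def by (auto simp: Q_nonzero qgen_qfree)
    qed
    then have "h e = h e'" unfolding e'0(2) using hsym e'0 by blast
    then show ?thesis using outer[OF ne'] by simp
  qed
  have "h e = 0"
    by (rule holomorphic_annuli_zero[where \<rho>' = "norm F / \<rho>", OF h(1) s \<rho>0 _ outer inner eps e]) (use nz \<rho>0 in auto)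
  then have "D e = 0" using h(2)[of e] e by simp
  then show ?thesis unfolding D_eq C1_def C2_def by simp
qed

end

section \<open>Holomorphic functions of two variables\<close>

lemma holomorphic2_imp_continuous: "holomorphic2_on f D \<Longrightarrow> continuous_on D f"
  unfolding holomorphic2_on_def
  by (metis has_derivative_continuous continuous_at_imp_continuous_on)

lemma holomorphic2_subset: "holomorphic2_on f D \<Longrightarrow> E \<subseteq> D \<Longrightarrow> holomorphic2_on f E"
  unfolding holomorphic2_on_def by blast

lemma holomorphic2_curve:
  assumes f: "holomorphic2_on f D" and u: "u holomorphic_on S" and v: "v holomorphic_on S"
    and S: "open S" "\<And>t. t \<in> S \<Longrightarrow> (u t, v t) \<in> D"
  shows "(\<lambda>t. f (u t, v t)) holomorphic_on S"
  unfolding holomorphic_on_open[OF S(1)]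
proof
  fix t assume t: "t \<in> S"
  obtain a b where ab: "(f has_derivative (\<lambda>h. a * fst h + b * snd h)) (at (u t, v t))"
    using f S(2)[OF t] unfolding holomorphic2_on_def by blast
  have u': "(u has_derivative (\<lambda>h. deriv u t * h)) (at t)" and v': "(v has_derivative (\<lambda>h. deriv v t * h)) (at t)"
    using holomorphic_derivI[OF u S(1) t] holomorphic_derivI[OF v S(1) t] by (simp_all add: has_field_derivative_def)
  have "((\<lambda>t. (u t, v t)) has_derivative (\<lambda>h. (deriv u t * h, deriv v t * h))) (at t)"
    by (intro has_derivative_Pair u' v')
  from has_derivative_compose[OF this ab]
  have "((\<lambda>t. f (u t, v t)) has_derivative (\<lambda>h. (a * deriv u t + b * deriv v t) * h)) (at t)"
    by (simp add: algebra_simps)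
  then show "\<exists>f'. ((\<lambda>t. f (u t, v t)) has_field_derivative f') (at t)"
    by (auto simp: has_field_derivative_def)
qed

lemma open_slice1: "open D \<Longrightarrow> open {x. (x, z) \<in> D}"
  using open_vimage[of D "\<lambda>x. (x, z)"] by (simp add: vimage_def continuous_intros)

lemma open_slice2: "open D \<Longrightarrow> open {z. (x, z) \<in> D}"
  using open_vimage[of D "\<lambda>z. (x, z)"] by (simp add: vimage_def continuous_intros)

lemma holomorphic2_slice1: "holomorphic2_on f D \<Longrightarrow> open D \<Longrightarrow> (\<lambda>x. f (x, z)) holomorphic_on {x. (x, z) \<in> D}"
  by (rule holomorphic2_curve[where D = D]) (auto intro!: holomorphic_intros open_slice1)

lemma holomorphic2_slice2: "holomorphic2_on f D \<Longrightarrow> open D \<Longrightarrow> (\<lambda>z. f (x, z)) holomorphic_on {z. (x, z) \<in> D}"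
  by (rule holomorphic2_curve[where D = D]) (auto intro!: holomorphic_intros open_slice2)

lemma open_contains_cball_Times:
  fixes D :: "(complex \<times> complex) set"
  assumes "open D" "(x, z) \<in> D"
  obtains r where "r > 0" "cball x r \<times> cball z r \<subseteq> D"
proof -
  obtain A B where AB: "open A" "open B" "x \<in> A" "z \<in> B" "A \<times> B \<subseteq> D"
    using open_prod_elim[OF assms] by (metis mem_Sigma_iff)
  obtain r1 where "r1 > 0" "cball x r1 \<subseteq> A" using AB open_contains_cball by metis
  moreover obtain r2 where "r2 > 0" "cball z r2 \<subseteq> B" using AB open_contains_cball by metis
  ultimately have "cball x (min r1 r2) \<times> cball z (min r1 r2) \<subseteq> D" "min r1 r2 > 0"
    using AB(5) by (auto simp: subset_iff)
  then show thesis using that by blast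
qed

lemma deriv_diff_bound:
  assumes "f holomorphic_on ball z r" "g holomorphic_on ball z r" "continuous_on (cball z r) f" "continuous_on (cball z r) g"
    and "r > 0" "\<And>w. w \<in> cball z r \<Longrightarrow> norm (f w - g w) < B"
  shows "norm (deriv f z - deriv g z) \<le> B / r"
proof -
  have "norm ((deriv ^^ 1) (\<lambda>w. f w - g w) z) \<le> fact 1 * B / r ^ 1"
    by (rule Cauchy_higher_deriv_bound[where y = 0]) (use assms in \<open>auto intro!: holomorphic_intros continuous_intros\<close>)
  moreover have "deriv (\<lambda>w. f w - g w) z = deriv f z - deriv g z"
    using assms by (intro deriv_diff holomorphic_on_imp_differentiable_at[of _ "ball z r"]) auto
  ultimately show ?thesis by simp
qed

text \<open>Cauchy's estimate turns uniform closeness of \<open>f (x, _)\<close> and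
  \<open>f (x0, _)\<close> on a disc into closeness of their derivatives at the same
  \<open>z\<close>. The change from \<open>z\<close> to \<open>z0\<close> then concerns the one
  function \<open>f (x0, _)\<close>.\<close>

lemma continuous_on_partial2:
  fixes f :: "complex \<times> complex \<Rightarrow> complex"
  assumes D: "open D" and c: "continuous_on D f"
    and h: "\<And>x. (\<lambda>z. f (x, z)) holomorphic_on {z. (x, z) \<in> D}"
  shows "continuous_on D (\<lambda>(x, z). deriv (\<lambda>w. f (x, w)) z)"
  unfolding continuous_on_iff
proof (intro ballI allI impI)
  fix w \<epsilon> assume w: "w \<in> D" and \<epsilon>: "(\<epsilon>::real) > 0"
  obtain x0 z0 where wxz: "w = (x0, z0)" by force
  obtain r where r: "r > 0" "cball x0 r \<times> cball z0 r \<subseteq> D"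
    using open_contains_cball_Times D w wxz by metis
  define K where "K = cball x0 r \<times> cball z0 r"
  have "uniformly_continuous_on K f"
    unfolding K_def by (intro compact_uniformly_continuous continuous_on_subset[OF c] compact_Times r(2)) auto
  \<comment> \<open>With radius \<open>r / 2\<close> in Cauchy's estimate, the tolerance
    \<open>\<epsilon> * r / 8\<close> becomes \<open>\<epsilon> / 4\<close>.\<close>
  then obtain d where d: "d > 0" "\<And>p p'. p \<in> K \<Longrightarrow> p' \<in> K \<Longrightarrow> dist p' p < d \<Longrightarrow> dist (f p') (f p) < \<epsilon> * r / 8"
    unfolding uniformly_continuous_on_def using \<epsilon> r by (metis divide_pos_pos mult_pos_pos zero_less_numeral)
  have sub: "cball z0 r \<subseteq> {z. (x, z) \<in> D}" if "x \<in> cball x0 r" for x using r that by auto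
  have h0: "(\<lambda>z. f (x0, z)) holomorphic_on ball z0 r"
    by (rule holomorphic_on_subset[OF h]) (use sub[of x0] r ball_subset_cball[of z0 r] in auto)
  have "continuous_on (ball z0 r) (deriv (\<lambda>z. f (x0, z)))"
    by (intro holomorphic_on_imp_continuous_on holomorphic_deriv h0) auto
  then obtain d' where d': "d' > 0" "\<And>z. z \<in> ball z0 r \<Longrightarrow> dist z z0 < d' \<Longrightarrow> dist (deriv (\<lambda>z. f (x0, z)) z) (deriv (\<lambda>z. f (x0, z)) z0) < \<epsilon> / 2"
    unfolding continuous_on_iff using \<epsilon> r by (metis centre_in_ball half_gt_zero)
  define \<delta> where "\<delta> = min (min d d') (r / 2)"
  have "\<delta> > 0" using d d' r by (simp add: \<delta>_def)
  moreover have "dist (case w' of (x, z) \<Rightarrow> deriv (\<lambda>w. f (x, w)) z) (case w of (x, z) \<Rightarrow> deriv (\<lambda>w. f (x, w)) z) < \<epsilon>"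
    if "w' \<in> D" "dist w' w < \<delta>" for w'
  proof -
    obtain x z where xz: "w' = (x, z)" by force
    have dx: "dist x x0 < \<delta>" and dz: "dist z z0 < \<delta>"
      using that(2) dist_fst_le[of w' w] dist_snd_le[of w' w] by (auto simp: xz wxz)
    have cz: "cball z (r / 2) \<subseteq> cball z0 r"
    proof
      fix y assume "y \<in> cball z (r / 2)"
      then have "dist z0 y \<le> dist z0 z + dist z y" "dist z y \<le> r / 2" by (auto intro: dist_triangle)
      then show "y \<in> cball z0 r" using dz by (simp add: \<delta>_def dist_commute)
    qed
    have bz: "ball z (r / 2) \<subseteq> cball z0 r" using cz ball_subset_cball by blast
    have x: "x \<in> cball x0 r" using dx r by (simp add: \<delta>_def dist_commute)
    have x0: "x0 \<in> cball x0 r" using r by simp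
    have hx: "(\<lambda>z. f (x', z)) holomorphic_on ball z (r / 2)" "continuous_on (cball z (r / 2)) (\<lambda>z. f (x', z))"
      if "x' \<in> cball x0 r" for x'
      using holomorphic_on_subset[OF h[of x']] holomorphic_on_imp_continuous_on[OF h[of x']] continuous_on_subset sub[OF that] cz bz
      by (meson subset_trans)+
    have "norm (deriv (\<lambda>w. f (x, w)) z - deriv (\<lambda>w. f (x0, w)) z) \<le> (\<epsilon> * r / 8) / (r / 2)"
    proof (rule deriv_diff_bound[OF hx(1)[OF x] hx(1)[OF x0] hx(2)[OF x] hx(2)[OF x0]])
      fix y assume y: "y \<in> cball z (r / 2)"
      have "dist (x, y) (x0, y) < d" using dx by (simp add: dist_Pair_Pair \<delta>_def)
      then show "norm (f (x, y) - f (x0, y)) < \<epsilon> * r / 8"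
        using d(2)[of "(x0, y)" "(x, y)"] x x0 y cz by (auto simp: K_def dist_norm)
    qed (use r in auto)
    also have "\<dots> = \<epsilon> / 4" using r by simp
    finally have 1: "dist (deriv (\<lambda>w. f (x, w)) z) (deriv (\<lambda>w. f (x0, w)) z) \<le> \<epsilon> / 4" by (simp add: dist_norm)
    have 2: "dist (deriv (\<lambda>w. f (x0, w)) z) (deriv (\<lambda>w. f (x0, w)) z0) < \<epsilon> / 2"
      using d'(2)[of z] dz r by (auto simp: \<delta>_def dist_commute)
    have "dist (deriv (\<lambda>w. f (x, w)) z) (deriv (\<lambda>w. f (x0, w)) z0) < \<epsilon>"
      using dist_triangle[of "deriv (\<lambda>w. f (x, w)) z" "deriv (\<lambda>w. f (x0, w)) z0" "deriv (\<lambda>w. f (x0, w)) z"] 1 2 \<epsilon> by linarith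
    then show ?thesis by (simp add: xz wxz)
  qed
  ultimately show "\<exists>d>0. \<forall>x'\<in>D. dist x' w < d \<longrightarrow> dist (case x' of (x, z) \<Rightarrow> deriv (\<lambda>w. f (x, w)) z) (case w of (x, z) \<Rightarrow> deriv (\<lambda>w. f (x, w)) z) < \<epsilon>"
    by blast
qed

text \<open>Osgood's lemma. Joint continuity of \<open>f\<close> makes its second partial derivative
  jointly continuous, and this together with the existence of the first partial derivative gives
  Frechet differentiability.\<close>

lemma osgood:
  assumes D: "open D" and c: "continuous_on D f"
    and h1: "\<And>z. (\<lambda>x. f (x, z)) holomorphic_on {x. (x, z) \<in> D}"
    and h2: "\<And>x. (\<lambda>z. f (x, z)) holomorphic_on {z. (x, z) \<in> D}"
  shows "holomorphic2_on f D"
  unfolding holomorphic2_on_def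
proof
  fix w assume w: "w \<in> D"
  obtain x0 z0 where wxz: "w = (x0, z0)" by force
  obtain r where r: "r > 0" "cball x0 r \<times> cball z0 r \<subseteq> D"
    using open_contains_cball_Times D w wxz by metis
  define X Y where "X = ball x0 r" and "Y = ball z0 r"
  have XY: "X \<times> Y \<subseteq> D" "open (X \<times> Y)" "x0 \<in> X" "z0 \<in> Y"
    using r ball_subset_cball[of x0 r] ball_subset_cball[of z0 r] by (auto simp: X_def Y_def intro!: open_Times)
  define a where "a = deriv (\<lambda>x. f (x, z0)) x0"
  have fx: "((\<lambda>x. f (x, z0)) has_derivative (\<lambda>h. a * h)) (at x0 within X)"
    using holomorphic_derivI[OF h1 open_slice1[OF D], of x0 z0] w wxz unfolding a_def
    by (auto simp: has_field_derivative_def intro: has_derivative_at_withinI)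
  define fy where "fy = (\<lambda>x z. blinfun_mult_right (deriv (\<lambda>w. f (x, w)) z))"
  have fy: "((\<lambda>z. f (x, z)) has_derivative blinfun_apply (fy x z)) (at z within Y)" if "x \<in> X" "z \<in> Y" for x z
  proof -
    have "(x, z) \<in> D" using that XY(1) by blast
    then have "((\<lambda>z. f (x, z)) has_field_derivative deriv (\<lambda>w. f (x, w)) z) (at z)"
      by (intro holomorphic_derivI[OF h2 open_slice2[OF D]]) simp
    then show ?thesis
      unfolding fy_def blinfun_mult_right.rep_eq has_field_derivative_def by (rule has_derivative_at_withinI)
  qed
  have "continuous_on D (\<lambda>(x, z). deriv (\<lambda>w. f (x, w)) z)"
    by (rule continuous_on_partial2[OF D c h2])
  then have "continuous_on D (\<lambda>p. blinfun_mult_right ((\<lambda>(x, z). deriv (\<lambda>w. f (x, w)) z) p))"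
    by (rule bounded_linear.continuous_on[OF bounded_linear_blinfun_mult_right])
  then have "continuous_on (X \<times> Y) (\<lambda>(x, z). fy x z)"
    unfolding fy_def case_prod_unfold by (rule continuous_on_subset[OF _ XY(1)])
  then have fyc: "continuous (at (x0, z0) within X \<times> Y) (\<lambda>(x, z). fy x z)"
    using XY by (simp add: continuous_on_eq_continuous_within)
  have "((\<lambda>(x, z). f (x, z)) has_derivative (\<lambda>(tx, ty). a * tx + blinfun_apply (fy x0 z0) ty)) (at (x0, z0) within X \<times> Y)"
    by (rule has_derivative_partialsI[OF fx fy fyc]) (use XY in \<open>auto simp: Y_def\<close>)
  then have "(f has_derivative (\<lambda>h. a * fst h + deriv (\<lambda>w. f (x0, w)) z0 * snd h)) (at (x0, z0))"
    using XY by (simp add: at_within_open[of "(x0, z0)" "X \<times> Y"] fy_def case_prod_unfold)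
  then show "\<exists>a b. (f has_derivative (\<lambda>h. a * fst h + b * snd h)) (at w)"
    unfolding wxz by blast
qed

section \<open>Closure properties of holomorphy in two variables\<close>

lemma holomorphic2_const: "holomorphic2_on (\<lambda>w. c) D"
  unfolding holomorphic2_on_def by (auto intro!: exI[of _ 0] derivative_eq_intros)

lemma holomorphic2_fst: "holomorphic2_on fst D"
proof -
  have "(fst has_derivative (\<lambda>h. 1 * fst h + 0 * snd h)) (at w)" for w :: "complex \<times> complex"
    by (auto intro!: derivative_eq_intros)
  then show ?thesis unfolding holomorphic2_on_def by blast
qed

lemma holomorphic2_snd: "holomorphic2_on snd D"
proof -
  have "(snd has_derivative (\<lambda>h. 0 * fst h + 1 * snd h)) (at w)" for w :: "complex \<times> complex"
    by (auto intro!: derivative_eq_intros)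
  then show ?thesis unfolding holomorphic2_on_def by blast
qed

lemma holomorphic2_add: "holomorphic2_on f D \<Longrightarrow> holomorphic2_on g D \<Longrightarrow> holomorphic2_on (\<lambda>w. f w + g w) D"
  unfolding holomorphic2_on_def
proof
  fix w assume *: "\<forall>w\<in>D. \<exists>a b. (f has_derivative (\<lambda>h. a * fst h + b * snd h)) (at w)"
    "\<forall>w\<in>D. \<exists>a b. (g has_derivative (\<lambda>h. a * fst h + b * snd h)) (at w)" "w \<in> D"
  then obtain a b c d where "(f has_derivative (\<lambda>h. a * fst h + b * snd h)) (at w)"
    "(g has_derivative (\<lambda>h. c * fst h + d * snd h)) (at w)" by meson
  from has_derivative_add[OF this]
  show "\<exists>a b. ((\<lambda>w. f w + g w) has_derivative (\<lambda>h. a * fst h + b * snd h)) (at w)"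
    by (intro exI[of _ "a + c"] exI[of _ "b + d"]) (simp add: algebra_simps)
qed

lemma holomorphic2_mult: "holomorphic2_on f D \<Longrightarrow> holomorphic2_on g D \<Longrightarrow> holomorphic2_on (\<lambda>w. f w * g w) D"
  unfolding holomorphic2_on_def
proof
  fix w assume *: "\<forall>w\<in>D. \<exists>a b. (f has_derivative (\<lambda>h. a * fst h + b * snd h)) (at w)"
    "\<forall>w\<in>D. \<exists>a b. (g has_derivative (\<lambda>h. a * fst h + b * snd h)) (at w)" "w \<in> D"
  then obtain a b c d where "(f has_derivative (\<lambda>h. a * fst h + b * snd h)) (at w)"
    "(g has_derivative (\<lambda>h. c * fst h + d * snd h)) (at w)" by meson
  from has_derivative_mult[OF this]
  show "\<exists>a b. ((\<lambda>w. f w * g w) has_derivative (\<lambda>h. a * fst h + b * snd h)) (at w)"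
    by (intro exI[of _ "f w * c + a * g w"] exI[of _ "f w * d + b * g w"]) (simp add: algebra_simps)
qed

lemma holomorphic2_compose:
  assumes "holomorphic2_on f D" "g holomorphic_on S" "open S" "f ` D \<subseteq> S"
  shows "holomorphic2_on (\<lambda>w. g (f w)) D"
  unfolding holomorphic2_on_def
proof
  fix w assume w: "w \<in> D"
  then obtain a b where ab: "(f has_derivative (\<lambda>h. a * fst h + b * snd h)) (at w)"
    using assms(1) unfolding holomorphic2_on_def by blast
  have "(g has_derivative (\<lambda>h. deriv g (f w) * h)) (at (f w))"
    using holomorphic_derivI[OF assms(2,3), of "f w"] assms(4) w by (auto simp: has_field_derivative_def)
  from has_derivative_compose[OF ab this]
  show "\<exists>a b. ((\<lambda>w. g (f w)) has_derivative (\<lambda>h. a * fst h + b * snd h)) (at w)"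
    by (intro exI[of _ "deriv g (f w) * a"] exI[of _ "deriv g (f w) * b"]) (simp add: algebra_simps)
qed

lemma holomorphic2_pair:
  assumes F: "holomorphic2_on F E" and f: "holomorphic2_on f D" and g: "holomorphic2_on g D"
    and DE: "\<And>w. w \<in> D \<Longrightarrow> (f w, g w) \<in> E"
  shows "holomorphic2_on (\<lambda>w. F (f w, g w)) D"
  unfolding holomorphic2_on_def
proof
  fix w assume w: "w \<in> D"
  obtain a b where 1: "(f has_derivative (\<lambda>h. a * fst h + b * snd h)) (at w)"
    using f w unfolding holomorphic2_on_def by blast
  obtain c d where 2: "(g has_derivative (\<lambda>h. c * fst h + d * snd h)) (at w)"
    using g w unfolding holomorphic2_on_def by blast
  obtain s t where 3: "(F has_derivative (\<lambda>h. s * fst h + t * snd h)) (at (f w, g w))"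
    using F DE[OF w] unfolding holomorphic2_on_def by blast
  from has_derivative_compose[OF has_derivative_Pair[OF 1 2] 3]
  show "\<exists>a b. ((\<lambda>w. F (f w, g w)) has_derivative (\<lambda>h. a * fst h + b * snd h)) (at w)"
    by (intro exI[of _ "s * a + t * c"] exI[of _ "s * b + t * d"]) (simp add: algebra_simps)
qed

lemmas holomorphic2_entire = holomorphic2_compose[where S = UNIV, OF _ _ open_UNIV subset_UNIV]

lemma holomorphic2_uminus: "holomorphic2_on f D \<Longrightarrow> holomorphic2_on (\<lambda>w. - f w) D"
  using holomorphic2_entire[of f D uminus] by (simp add: holomorphic_intros)

lemma holomorphic2_diff: "holomorphic2_on f D \<Longrightarrow> holomorphic2_on g D \<Longrightarrow> holomorphic2_on (\<lambda>w. f w - g w) D"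
  using holomorphic2_add[of f D "\<lambda>w. - g w"] holomorphic2_uminus[of g D] by simp

lemma holomorphic2_power: "holomorphic2_on f D \<Longrightarrow> holomorphic2_on (\<lambda>w. f w ^ n) D"
  using holomorphic2_entire[of f D "\<lambda>x. x ^ n"] by (simp add: holomorphic_intros)

lemma holomorphic2_divide_const: "holomorphic2_on f D \<Longrightarrow> holomorphic2_on (\<lambda>w. f w / c) D"
  using holomorphic2_mult[OF _ holomorphic2_const[of "1 / c"]] by simp

lemma holomorphic2_divide:
  assumes "holomorphic2_on f D" "holomorphic2_on g D" "\<And>w. w \<in> D \<Longrightarrow> g w \<noteq> 0"
  shows "holomorphic2_on (\<lambda>w. f w / g w) D"
proof -
  have "holomorphic2_on (\<lambda>w. inverse (g w)) D"
    by (rule holomorphic2_compose[where S = "- {0}"]) (use assms in \<open>auto intro!: holomorphic_intros\<close>)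
  from holomorphic2_mult[OF assms(1) this] show ?thesis by (simp add: divide_inverse)
qed

lemma holomorphic2_cong:
  assumes "holomorphic2_on f D" "open D" "\<And>w. w \<in> D \<Longrightarrow> f w = g w"
  shows "holomorphic2_on g D"
  unfolding holomorphic2_on_def
proof
  fix w assume w: "w \<in> D"
  then obtain a b where "(f has_derivative (\<lambda>h. a * fst h + b * snd h)) (at w)"
    using assms(1) unfolding holomorphic2_on_def by blast
  then have "(g has_derivative (\<lambda>h. a * fst h + b * snd h)) (at w)"
    by (rule has_derivative_transform_within_open[OF _ assms(2) w]) (rule assms(3))
  then show "\<exists>a b. (g has_derivative (\<lambda>h. a * fst h + b * snd h)) (at w)" by blast
qed

lemma holomorphic2_local:
  assumes "\<And>w. w \<in> D \<Longrightarrow> \<exists>U. w \<in> U \<and> holomorphic2_on f U"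
  shows "holomorphic2_on f D"
  using assms unfolding holomorphic2_on_def by blast

lemmas holomorphic2_intros = holomorphic2_const holomorphic2_fst holomorphic2_snd holomorphic2_add holomorphic2_mult
  holomorphic2_uminus holomorphic2_diff holomorphic2_power holomorphic2_divide_const

text \<open>Continuity comes from locally uniform convergence and holomorphy in each variable from
  \<open>holomorphic_on_suminf\<close>; \<open>osgood\<close> combines them.\<close>

lemma holomorphic2_suminf:
  assumes D: "open D" and hol: "\<And>r. holomorphic2_on (t r) D"
    and bd: "\<And>w. w \<in> D \<Longrightarrow> \<exists>U C \<theta>. open U \<and> w \<in> U \<and> U \<subseteq> D \<and> 0 \<le> \<theta> \<and> \<theta> < 1 \<and> (\<forall>r. \<forall>y\<in>U. norm (t r y) \<le> C * \<theta> ^ r)"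
  shows "holomorphic2_on (\<lambda>w. \<Sum>r. t r w) D"
proof (rule osgood[OF D])
  have "isCont (\<lambda>w. \<Sum>r. t r w) w" if w: "w \<in> D" for w
  proof -
    obtain U C \<theta> where U: "open U" "w \<in> U" "U \<subseteq> D" "0 \<le> \<theta>" "\<theta> < 1" "\<forall>r. \<forall>y\<in>U. norm (t r y) \<le> C * \<theta> ^ r"
      using bd[OF w] by blast
    have "uniform_limit U (\<lambda>n x. \<Sum>r<n. t r x) (\<lambda>x. \<Sum>r. t r x) sequentially"
      by (rule Weierstrass_m_test[where M = "\<lambda>r. C * \<theta> ^ r"])
        (use U in \<open>auto intro!: summable_mult summable_geometric\<close>)
    then have "continuous_on U (\<lambda>x. \<Sum>r. t r x)"
      by (rule uniform_limit_theorem[rotated])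
        (auto intro!: always_eventually continuous_on_sum continuous_on_subset[OF holomorphic2_imp_continuous[OF hol] U(3)])
    then show ?thesis using U continuous_on_eq_continuous_at by blast
  qed
  then show "continuous_on D (\<lambda>w. \<Sum>r. t r w)" by (simp add: continuous_at_imp_continuous_on)
next
  have cb: "\<exists>d. 0 < d \<and> cball x d \<subseteq> S" if "open S" "x \<in> S" for S and x :: complex
    using that open_contains_cball by metis
  show "(\<lambda>x. \<Sum>r. t r (x, z)) holomorphic_on {x. (x, z) \<in> D}" for z
  proof (rule holomorphic_on_suminf[OF open_slice1[OF D]])
    show "(\<lambda>x. t r (x, z)) holomorphic_on {x. (x, z) \<in> D}" for r by (rule holomorphic2_slice1[OF hol D])
    fix x assume "x \<in> {x. (x, z) \<in> D}"
    then have "(x, z) \<in> D" by simp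
    from bd[OF this] obtain U C \<theta> where U: "open U" "(x, z) \<in> U" "U \<subseteq> D" "0 \<le> \<theta>" "\<theta> < 1" "\<forall>r. \<forall>y\<in>U. norm (t r y) \<le> C * \<theta> ^ r"
      by (elim exE conjE)
    obtain d where d: "0 < d" "cball x d \<subseteq> {x. (x, z) \<in> U}" using cb[OF open_slice1[OF U(1), of z], of x] U(2) by auto
    show "\<exists>d C \<theta>. 0 < d \<and> cball x d \<subseteq> {x. (x, z) \<in> D} \<and> 0 \<le> \<theta> \<and> \<theta> < 1 \<and> (\<forall>r. \<forall>y\<in>cball x d. norm (t r (y, z)) \<le> C * \<theta> ^ r)"
      by (rule exI[of _ d], rule exI[of _ C], rule exI[of _ \<theta>], intro conjI) (use U(3-6) d in auto)
  qed
  show "(\<lambda>z. \<Sum>r. t r (x, z)) holomorphic_on {z. (x, z) \<in> D}" for x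
  proof (rule holomorphic_on_suminf[OF open_slice2[OF D]])
    show "(\<lambda>z. t r (x, z)) holomorphic_on {z. (x, z) \<in> D}" for r by (rule holomorphic2_slice2[OF hol D])
    fix z assume "z \<in> {z. (x, z) \<in> D}"
    then have "(x, z) \<in> D" by simp
    from bd[OF this] obtain U C \<theta> where U: "open U" "(x, z) \<in> U" "U \<subseteq> D" "0 \<le> \<theta>" "\<theta> < 1" "\<forall>r. \<forall>y\<in>U. norm (t r y) \<le> C * \<theta> ^ r"
      by (elim exE conjE)
    obtain d where d: "0 < d" "cball z d \<subseteq> {z. (x, z) \<in> U}" using cb[OF open_slice2[OF U(1), of x], of z] U(2) by auto
    show "\<exists>d C \<theta>. 0 < d \<and> cball z d \<subseteq> {z. (x, z) \<in> D} \<and> 0 \<le> \<theta> \<and> \<theta> < 1 \<and> (\<forall>r. \<forall>y\<in>cball z d. norm (t r (x, y)) \<le> C * \<theta> ^ r)"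
      by (rule exI[of _ d], rule exI[of _ C], rule exI[of _ \<theta>], intro conjI) (use U(3-6) d in auto)
  qed
qed

section \<open>The identity theorem in two variables and density of non-zero sets\<close>

text \<open>Restriction to the complex line through \<open>w\<close> and a point of
  \<open>V\<close>. The line meets the convex set \<open>D\<close> in a convex, hence connected, set
  of parameters, where the one-variable identity theorem applies.\<close>

lemma holomorphic2_identity_convex:
  assumes f: "holomorphic2_on f D" and D: "open D" "convex D" and V: "open V" "V \<noteq> {}" "V \<subseteq> D"
    and z: "\<And>v. v \<in> V \<Longrightarrow> f v = 0" and w: "w \<in> D"
  shows "f w = 0"
proof -
  obtain v where v: "v \<in> V" using V by blast
  define g where "g = (\<lambda>t::complex. (fst v + t * (fst w - fst v), snd v + t * (snd w - snd v)))"
  have cg: "continuous_on UNIV g" unfolding g_def by (intro continuous_intros)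
  define S where "S = g -` D"
  have S: "open S" unfolding S_def by (rule open_vimage[OF D(1) cg])
  have "convex S"
  proof (rule convexI)
    fix s t and a b :: real assume st: "s \<in> S" "t \<in> S" "0 \<le> a" "0 \<le> b" "a + b = 1"
    have ab: "complex_of_real a + complex_of_real b = 1" using st by (metis of_real_1 of_real_add)
    have aff: "A = complex_of_real a * A + complex_of_real b * A" for A
      using ab by (metis distrib_right mult_1)
    have lin: "A + (a *\<^sub>R s + b *\<^sub>R t) * B = a *\<^sub>R (A + s * B) + b *\<^sub>R (A + t * B)" for A B :: complex
      using aff[of A] by (simp add: scaleR_conv_of_real algebra_simps)
    have "g (a *\<^sub>R s + b *\<^sub>R t) = a *\<^sub>R g s + b *\<^sub>R g t"
      unfolding g_def by (simp only: lin scaleR_Pair add_Pair)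
    then show "a *\<^sub>R s + b *\<^sub>R t \<in> S" using st D(2) unfolding S_def vimage_def convex_def by simp
  qed
  then have conn: "connected S" by (rule convex_connected)
  have hol: "(\<lambda>t. f (fst v + t * (fst w - fst v), snd v + t * (snd w - snd v))) holomorphic_on S"
    by (rule holomorphic2_curve[OF f]) (use S in \<open>auto simp: S_def g_def intro!: holomorphic_intros\<close>)
  define U where "U = g -` V"
  have U: "open U" unfolding U_def by (rule open_vimage[OF V(1) cg])
  have 0: "0 \<in> U" using v by (simp add: U_def g_def)
  have 1: "1 \<in> S" using w by (simp add: S_def g_def)
  have US: "U \<subseteq> S" using V by (auto simp: U_def S_def)
  have "(\<lambda>t. f (fst v + t * (fst w - fst v), snd v + t * (snd w - snd v))) 1 = 0"
    by (rule analytic_continuation_open[OF U S _ conn US hol holomorphic_on_const _ 1])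
      (use 0 in blast, simp add: U_def g_def z)
  then show ?thesis by simp
qed

text \<open>The points near which \<open>f\<close> vanishes form a set that is open and, by the
  convex case on balls, closed in \<open>D\<close>.\<close>

lemma holomorphic2_identity:
  assumes f: "holomorphic2_on f D" and D: "open D" "connected D" and V: "open V" "V \<noteq> {}" "V \<subseteq> D"
    and z: "\<And>v. v \<in> V \<Longrightarrow> f v = 0" and w: "w \<in> D"
  shows "f w = 0"
proof -
  define A where "A = {x\<in>D. \<exists>U. open U \<and> x \<in> U \<and> (\<forall>y\<in>U. f y = 0)}"
  have "open A"
    unfolding open_subopen[of A]
  proof
    fix x assume "x \<in> A"
    then obtain U where "open U" "x \<in> U" "\<forall>y\<in>U. f y = 0" "x \<in> D" unfolding A_def by blast
    then show "\<exists>T. open T \<and> x \<in> T \<and> T \<subseteq> A"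
      using D(1) by (intro exI[of _ "U \<inter> D"]) (auto simp: A_def)
  qed
  moreover have "closedin (top_of_set D) A"
    unfolding closedin_limpt
  proof (intro conjI allI impI)
    fix x assume x: "x islimpt A \<and> x \<in> D"
    obtain \<epsilon> where \<epsilon>: "\<epsilon> > 0" "ball x \<epsilon> \<subseteq> D" using D x open_contains_ball by blast
    obtain y where y: "y \<in> A" "y \<in> ball x \<epsilon>"
      using x \<epsilon> unfolding islimpt_def by (metis centre_in_ball open_ball)
    then obtain U where U: "open U" "y \<in> U" "\<forall>y\<in>U. f y = 0" unfolding A_def by blast
    have "f u = 0" if "u \<in> ball x \<epsilon>" for u
      by (rule holomorphic2_identity_convex[OF holomorphic2_subset[OF f \<epsilon>(2)], where V = "U \<inter> ball x \<epsilon>"])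
        (use U y that in auto)
    then show "x \<in> A" using \<epsilon> x unfolding A_def by (auto intro!: exI[of _ "ball x \<epsilon>"])
  qed (auto simp: A_def)
  moreover have "openin (top_of_set D) A" using \<open>open A\<close> by (auto simp: A_def intro: openin_open_eq[THEN iffD2] D)
  moreover have "A \<noteq> {}" using V z unfolding A_def by blast
  ultimately have "A = D" using D(2) unfolding connected_clopen by blast
  then show ?thesis using w unfolding A_def by blast
qed

lemma holomorphic2_nonzero_dense:
  assumes f: "holomorphic2_on f D" and D: "open D" "connected D" and v: "v \<in> D" "f v \<noteq> 0"
  shows "open {w\<in>D. f w \<noteq> 0}" "D \<subseteq> closure {w\<in>D. f w \<noteq> 0}"
proof -
  have "open (D \<inter> f -` (- {0}))"
    by (intro continuous_open_preimage holomorphic2_imp_continuous f D) auto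
  also have "D \<inter> f -` (- {0}) = {w\<in>D. f w \<noteq> 0}" by auto
  finally show "open {w\<in>D. f w \<noteq> 0}" .
  show "D \<subseteq> closure {w\<in>D. f w \<noteq> 0}"
  proof (rule ccontr)
    assume "\<not> ?thesis"
    then obtain x where x: "x \<in> D" "x \<notin> closure {w\<in>D. f w \<noteq> 0}" by blast
    define V where "V = D - closure {w\<in>D. f w \<noteq> 0}"
    have "f u = 0" if "u \<in> V" for u using that closure_subset[of "{w\<in>D. f w \<noteq> 0}"] by (auto simp: V_def)
    moreover have "open V" "V \<noteq> {}" "V \<subseteq> D" using x D(1) by (auto simp: V_def open_Diff)
    ultimately have "f v = 0" using holomorphic2_identity[OF f D] v(1) by metis
    with v show False by simp
  qed
qed

lemma dense_Int:
  fixes A B D :: "'a::topological_space set"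
  assumes "open A" "open B" "A \<subseteq> D" "B \<subseteq> D" "D \<subseteq> closure A" "D \<subseteq> closure B"
  shows "D \<subseteq> closure (A \<inter> B)"
proof
  fix x assume x: "x \<in> D"
  show "x \<in> closure (A \<inter> B)"
    unfolding closure_iff_nhds_not_empty
  proof (intro allI impI)
    fix N V assume V: "V \<subseteq> N" "open V" "x \<in> V"
    have "V \<inter> A \<noteq> {}" using x assms V by (metis (no_types) IntI closure_iff_nhds_not_empty order_refl subsetD Int_commute)
    then obtain y where "y \<in> V \<inter> A" by blast
    moreover have "open (V \<inter> A)" using V assms by blast
    moreover have "y \<in> closure B" using calculation assms by blast
    ultimately have "B \<inter> (V \<inter> A) \<noteq> {}" using closure_iff_nhds_not_empty[of y B] by blast
    then show "A \<inter> B \<inter> N \<noteq> {}" using V by blast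
  qed
qed

section \<open>Partial derivatives and Taylor coefficients in one of two variables\<close>

text \<open>Kept as a function of both variables so that it can be iterated; the iterates at
  \<open>x = 0\<close> give the Taylor coefficients in the first variable as functions of the
  second.\<close>

definition partial1 :: "(complex \<times> complex \<Rightarrow> complex) \<Rightarrow> complex \<times> complex \<Rightarrow> complex"
  where "partial1 f = (\<lambda>(x, z). deriv (\<lambda>y. f (y, z)) x)"

lemma holomorphic2_swap: "holomorphic2_on f D \<Longrightarrow> holomorphic2_on (\<lambda>(x, z). f (z, x)) {(x, z). (z, x) \<in> D}"
  unfolding case_prod_unfold by (rule holomorphic2_pair[OF _ holomorphic2_snd holomorphic2_fst]) auto

lemma open_swap: "open D \<Longrightarrow> open {(x, z). (z, x) \<in> D}" for D :: "(complex \<times> complex) set"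
proof -
  assume "open D"
  then have "open ((\<lambda>w. (snd w, fst w)) -` D)"
    by (rule open_vimage) (intro continuous_intros)
  then show ?thesis by (simp add: vimage_def case_prod_unfold)
qed

lemma partial1_continuous:
  assumes D: "open D" and f: "holomorphic2_on f D"
  shows "continuous_on D (partial1 f)"
proof -
  let ?D = "{(x, z). (z, x) \<in> D}" and ?g = "\<lambda>(x, z). f (z, x)"
  have g: "holomorphic2_on ?g ?D" by (rule holomorphic2_swap[OF f])
  have "continuous_on ?D (\<lambda>(x, z). deriv (\<lambda>w. ?g (x, w)) z)"
    by (rule continuous_on_partial2[OF open_swap[OF D] holomorphic2_imp_continuous[OF g] holomorphic2_slice2[OF g open_swap[OF D]]])
  then have c: "continuous_on ?D (\<lambda>p. deriv (\<lambda>w. f (w, fst p)) (snd p))" by (simp add: case_prod_unfold)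
  have "continuous_on D (\<lambda>p. deriv (\<lambda>w. f (w, fst (snd p, fst p))) (snd (snd p, fst p)))"
    by (rule continuous_on_compose2[OF c, of D "\<lambda>p. (snd p, fst p)"]) (auto intro!: continuous_intros)
  then show ?thesis by (simp add: partial1_def case_prod_unfold)
qed

text \<open>In the second variable \<open>partial1 f\<close> is a uniform limit of the difference
  quotients \<open>g n\<close>, which are holomorphic there; \<open>osgood\<close> does the
  rest.\<close>

lemma holomorphic2_partial1:
  assumes D: "open D" and f: "holomorphic2_on f D"
  shows "holomorphic2_on (partial1 f) D"
proof (rule osgood[OF D partial1_continuous[OF D f]])
  show "(\<lambda>x. partial1 f (x, z)) holomorphic_on {x. (x, z) \<in> D}" for z
    unfolding partial1_def prod.case
    by (intro holomorphic_deriv holomorphic2_slice1 open_slice1 f D)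
next
  fix x
  define S where "S = {z. (x, z) \<in> D}"
  have S: "open S" unfolding S_def by (rule open_slice2[OF D])
  show "(\<lambda>z. partial1 f (x, z)) holomorphic_on S"
    unfolding holomorphic_on_open[OF S]
  proof
    fix z0 assume "z0 \<in> S"
    then obtain r where r: "r > 0" "cball x r \<times> cball z0 r \<subseteq> D"
      using open_contains_cball_Times[OF D, of x z0] by (auto simp: S_def)
    define g where "g = (\<lambda>n z. (f (x + of_real (r / real (Suc n)), z) - f (x, z)) / of_real (r / real (Suc n)))"
    have xn: "x + of_real (t * r) \<in> cball x r" if "0 \<le> t" "t \<le> 1" for t :: real
      using that r by (simp add: dist_norm norm_mult mult_left_le_one_le)
    have xn': "x + of_real (r / real (Suc n)) \<in> cball x r" for n
      using xn[of "1 / real (Suc n)"] by simp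
    have bz: "ball z0 r \<subseteq> cball z0 r" by auto
    have sl: "(\<lambda>z. f (y, z)) holomorphic_on ball z0 r" if "y \<in> cball x r" for y
      by (rule holomorphic_on_subset[OF holomorphic2_slice2[OF f D]]) (use that r bz in blast)
    have "uniformly_continuous_on (cball x r \<times> cball z0 r) (partial1 f)"
      by (intro compact_uniformly_continuous continuous_on_subset[OF partial1_continuous[OF D f]] compact_Times r) auto
    then have ul: "uniform_limit (ball z0 r) g (\<lambda>z. partial1 f (x, z)) sequentially"
      unfolding uniformly_continuous_on_def uniform_limit_iff
    proof (intro allI impI)
      fix e :: real assume "e > 0" and "\<forall>e>0. \<exists>d>0. \<forall>p\<in>cball x r \<times> cball z0 r. \<forall>p'\<in>cball x r \<times> cball z0 r. dist p' p < d \<longrightarrow> dist (partial1 f p') (partial1 f p) < e"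
      then obtain d where d: "d > 0" "\<forall>p\<in>cball x r \<times> cball z0 r. \<forall>p'\<in>cball x r \<times> cball z0 r. dist p' p < d \<longrightarrow> dist (partial1 f p') (partial1 f p) < e / 2"
        using half_gt_zero by blast
      have "(\<lambda>n. r / real (Suc n)) \<longlonglongrightarrow> 0"
        using LIMSEQ_Suc[OF lim_const_over_n[of r]] by simp
      then have "eventually (\<lambda>n. r / real (Suc n) < d) sequentially" using d(1) by (rule order_tendstoD)
      then show "eventually (\<lambda>n. \<forall>z\<in>ball z0 r. dist (g n z) (partial1 f (x, z)) < e) sequentially"
      proof eventually_elim
        case (elim n)
        define \<delta> where "\<delta> = r / real (Suc n)"
        have \<delta>: "0 < \<delta>" "\<delta> \<le> r" "\<delta> < d" using r elim by (auto simp: \<delta>_def field_simps)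
        show ?case
        proof
          fix z assume z: "z \<in> ball z0 r"
          define B where "B = closed_segment x (x + of_real \<delta>)"
          have B: "B \<subseteq> cball x r" "\<And>y. y \<in> B \<Longrightarrow> dist y x \<le> \<delta>"
          proof -
            have seg: "dist y x \<le> \<delta>" if "y \<in> B" for y
              using segment_bound1[of y x "x + of_real \<delta>"] that \<delta> by (simp add: B_def dist_norm)
            then show "B \<subseteq> cball x r" using \<delta> by (force simp: dist_commute)
            show "\<And>y. y \<in> B \<Longrightarrow> dist y x \<le> \<delta>" by (rule seg)
          qed
          have der: "((\<lambda>y. f (y, z)) has_field_derivative partial1 f (y, z)) (at y)" if "y \<in> B" for y
          proof -
            have "(y, z) \<in> D" using r(2) that B(1) z bz by blast
            then show ?thesis
              unfolding partial1_def prod.case by (intro holomorphic_derivI[OF holomorphic2_slice1[OF f D] open_slice1[OF D]]) simp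
          qed
          \<comment> \<open>The mean value inequality for
            \<open>f (y, z) - partial1 f (x, z) * y\<close> on a short segment. Its derivative is
            small by uniform continuity of \<open>partial1 f\<close>, and so uniformly in
            \<open>z\<close>.\<close>
          have "norm ((f (x + of_real \<delta>, z) - partial1 f (x, z) * (x + of_real \<delta>)) - (f (x, z) - partial1 f (x, z) * x)) \<le> (e / 2) * norm (x + of_real \<delta> - x)"
          proof (rule field_differentiable_bound[of B])
            show "convex B" by (simp add: B_def)
            fix y assume y: "y \<in> B"
            show "((\<lambda>y. f (y, z) - partial1 f (x, z) * y) has_field_derivative (partial1 f (y, z) - partial1 f (x, z))) (at y within B)"
              by (rule has_field_derivative_at_within) (auto intro!: derivative_eq_intros der y)
            have "dist (y, z) (x, z) < d" using B(2)[OF y] \<delta> by (simp add: dist_Pair_Pair)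
            then show "norm (partial1 f (y, z) - partial1 f (x, z)) \<le> e / 2"
              using d(2) B(1) y z bz r(1) by (force simp: dist_norm intro: less_imp_le)
          qed (simp_all add: B_def)
          then have "norm ((f (x + of_real \<delta>, z) - f (x, z)) - partial1 f (x, z) * of_real \<delta>) \<le> (e / 2) * \<delta>"
            using \<delta> by (simp add: algebra_simps)
          moreover have "g n z - partial1 f (x, z) = ((f (x + of_real \<delta>, z) - f (x, z)) - partial1 f (x, z) * of_real \<delta>) / of_real \<delta>"
            using \<delta>(1) unfolding g_def \<delta>_def[symmetric] by (simp add: diff_divide_distrib)
          ultimately have "norm (g n z - partial1 f (x, z)) \<le> e / 2"
            using \<delta>(1) by (simp add: norm_divide divide_le_eq)
          then show "dist (g n z) (partial1 f (x, z)) < e" using \<open>e > 0\<close> by (simp add: dist_norm)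
        qed
      qed
    qed
    have "(\<lambda>z. partial1 f (x, z)) holomorphic_on ball z0 r"
    proof (rule holomorphic_uniform_sequence[of _ g])
      show "g n holomorphic_on ball z0 r" for n
        unfolding g_def by (intro holomorphic_intros sl xn') (use r in auto)
      fix z assume "z \<in> ball z0 r"
      then obtain d where "d > 0" "cball z d \<subseteq> ball z0 r" using open_contains_cball open_ball by blast
      then show "\<exists>d>0. cball z d \<subseteq> ball z0 r \<and> uniform_limit (cball z d) g (\<lambda>z. partial1 f (x, z)) sequentially"
        using uniform_limit_on_subset[OF ul] by blast
    qed simp
    then show "\<exists>f'. ((\<lambda>z. partial1 f (x, z)) has_field_derivative f') (at z0)"
      using r by (simp add: holomorphic_on_open)
  qed
qed

lemma taylor_coeff_bound:
  assumes f: "holomorphic2_on f (ball 0 \<rho> \<times> V)" and V: "open V" "compact K" "K \<subseteq> V" and r: "0 < r" "r < \<rho>"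
  obtains M where "M > 0" "\<And>m z. z \<in> K \<Longrightarrow> norm ((deriv ^^ m) (\<lambda>x. f (x, z)) 0 / fact m) \<le> M / r ^ m"
proof -
  have sub: "cball 0 r \<times> K \<subseteq> ball 0 \<rho> \<times> V" using r V by auto
  have "compact (f ` (cball 0 r \<times> K))"
    by (intro compact_continuous_image continuous_on_subset[OF holomorphic2_imp_continuous[OF f] sub] compact_Times V) auto
  then obtain M where M: "M > 0" "\<And>p. p \<in> cball 0 r \<times> K \<Longrightarrow> norm (f p) \<le> M"
    using bounded_pos compact_imp_bounded by (metis (no_types, lifting) imageI)
  have D: "open (ball (0::complex) \<rho> \<times> V)" by (intro open_Times V) auto
  \<comment> \<open>The bound is \<open>M + 1\<close> because Cauchy's estimate asks for values in
    an open ball.\<close>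
  have "norm ((deriv ^^ m) (\<lambda>x. f (x, z)) 0 / fact m) \<le> (M + 1) / r ^ m" if z: "z \<in> K" for m z
  proof -
    have hol: "(\<lambda>x. f (x, z)) holomorphic_on ball 0 \<rho>"
      using holomorphic2_slice1[OF f D, of z] z V by (auto simp: mem_Times_iff)
    have "norm ((deriv ^^ m) (\<lambda>x. f (x, z)) 0) \<le> fact m * (M + 1) / r ^ m"
    proof (cases "m = 0")
      case True
      then show ?thesis using M(2)[of "(0, z)"] z r by auto
    next
      case False
      show ?thesis
      proof (rule Cauchy_higher_deriv_bound[where y = 0])
        show "(\<lambda>x. f (x, z)) holomorphic_on ball 0 r" "continuous_on (cball 0 r) (\<lambda>x. f (x, z))"
          using r by (auto intro!: holomorphic_on_subset[OF hol] continuous_on_subset[OF holomorphic_on_imp_continuous_on[OF hol]])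
        show "f (w, z) \<in> ball 0 (M + 1)" if "w \<in> ball 0 r" for w
          using M(2)[of "(w, z)"] that z by auto
      qed (use r False in auto)
    qed
    then show ?thesis by (simp add: norm_divide field_simps)
  qed
  with M show thesis using that[of "M + 1"] by auto
qed

text \<open>
  The Taylor coefficients of \<open>f1\<close> in the first variable are entire in the second one.  Interpolating
  the two Cauchy estimates geometrically makes the double power series converge everywhere.
\<close>

lemma entire_extension:
  assumes \<rho>: "\<rho>1 > 0" "\<rho>2 > 0"
    and f1: "holomorphic2_on f1 (ball 0 \<rho>1 \<times> UNIV)" and f2: "holomorphic2_on f2 (UNIV \<times> ball 0 \<rho>2)"
    and eq: "\<And>x z. norm x < \<rho>1 \<Longrightarrow> norm z < \<rho>2 \<Longrightarrow> f1 (x, z) = f2 (x, z)"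
  obtains F where "holomorphic2_on F UNIV" "\<And>x z. norm x < \<rho>1 \<Longrightarrow> F (x, z) = f1 (x, z)"
proof -
  have D1: "open (ball (0::complex) \<rho>1 \<times> (UNIV::complex set))" by (intro open_Times) auto
  define \<Gamma> where "\<Gamma> = (\<lambda>m z. (deriv ^^ m) (\<lambda>x. f1 (x, z)) 0 / fact m)"
  have it: "(deriv ^^ m) (\<lambda>x. f1 (x, z)) x = (partial1 ^^ m) f1 (x, z)" for m x z
  proof (induction m arbitrary: x)
    case (Suc m)
    have "(deriv ^^ m) (\<lambda>x. f1 (x, z)) = (\<lambda>x. (partial1 ^^ m) f1 (x, z))" using Suc by blast
    moreover have "partial1 g (x, z) = deriv (\<lambda>y. g (y, z)) x" for g by (simp add: partial1_def)
    ultimately show ?case by simp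
  qed simp
  have "holomorphic2_on ((partial1 ^^ m) f1) (ball 0 \<rho>1 \<times> UNIV)" for m
    by (induction m) (simp_all add: f1 holomorphic2_partial1[OF D1])
  then have \<Gamma>: "\<Gamma> m holomorphic_on UNIV" for m
    unfolding \<Gamma>_def it using holomorphic2_slice2[OF _ D1, of "(partial1 ^^ m) f1" 0] \<rho> by (auto intro!: holomorphic_intros)
  have sums1: "(\<lambda>m. \<Gamma> m z * x ^ m) sums f1 (x, z)" if "norm x < \<rho>1" for x z
    using holomorphic_power_series[of "\<lambda>x. f1 (x, z)" 0 \<rho>1 x] holomorphic2_slice1[OF f1 D1, of z] that
    by (simp add: \<Gamma>_def mem_Times_iff ball_def)
  have b1: "\<exists>M>0. \<forall>m. \<forall>z\<in>cball 0 R. norm (\<Gamma> m z) \<le> M * (2 / \<rho>1) ^ m" for R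
  proof -
    obtain M where M: "M > 0" "\<And>m z. z \<in> cball 0 R \<Longrightarrow> norm (\<Gamma> m z) \<le> M / (\<rho>1 / 2) ^ m"
      unfolding \<Gamma>_def
      by (rule taylor_coeff_bound[OF f1 open_UNIV compact_cball subset_UNIV, of "\<rho>1 / 2" 0 R]) (use \<rho> in auto)
    moreover have "M / (\<rho>1 / 2) ^ m = M * (2 / \<rho>1) ^ m" for m by (simp add: power_divide)
    ultimately show ?thesis by (intro exI[of _ M]) simp
  qed
  have \<Gamma>2: "\<Gamma> m z = (deriv ^^ m) (\<lambda>x. f2 (x, z)) 0 / fact m" if "norm z < \<rho>2" for m z
  proof -
    have "(deriv ^^ m) (\<lambda>x. f1 (x, z)) 0 = (deriv ^^ m) (\<lambda>x. f2 (x, z)) 0"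
    proof (rule higher_deriv_transform_within_open[of _ "ball 0 \<rho>1"])
      show "(\<lambda>x. f1 (x, z)) holomorphic_on ball 0 \<rho>1"
        using holomorphic2_slice1[OF f1 D1, of z] by (simp add: mem_Times_iff ball_def)
      have "open (UNIV \<times> ball (0::complex) \<rho>2)" by (intro open_Times) auto
      from holomorphic2_slice1[OF f2 this, of z] that
      show "(\<lambda>x. f2 (x, z)) holomorphic_on ball 0 \<rho>1" by (auto simp: mem_Times_iff intro: holomorphic_on_subset)
    qed (use \<rho> eq that in auto)
    then show ?thesis by (simp add: \<Gamma>_def)
  qed
  have b2: "\<exists>M>0. \<forall>m. \<forall>z\<in>cball 0 (\<rho>2 / 2). norm (\<Gamma> m z) \<le> M / T ^ m" if T: "T > 0" for T
  proof -
    have f2': "holomorphic2_on f2 (ball 0 (2 * T) \<times> ball 0 \<rho>2)" by (rule holomorphic2_subset[OF f2]) auto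
    obtain M where M: "M > 0" "\<And>m z. z \<in> cball 0 (\<rho>2 / 2) \<Longrightarrow> norm ((deriv ^^ m) (\<lambda>x. f2 (x, z)) 0 / fact m) \<le> M / T ^ m"
      by (rule taylor_coeff_bound[OF f2' open_ball compact_cball _ T, of 0 "\<rho>2 / 2"]) (use T \<rho> in \<open>auto simp: subset_iff\<close>)
    then show ?thesis using \<Gamma>2 \<rho> by (intro exI[of _ M]) auto
  qed
  have coeff: "norm ((deriv ^^ n) (\<Gamma> m) 0 / fact n) \<le> B / R ^ n" if "\<forall>z\<in>cball 0 R. norm (\<Gamma> m z) \<le> B" "R > 0" for m n B and R :: real
  proof (cases "n = 0")
    case True
    then show ?thesis using that by auto
  next
    case False
    have "norm ((deriv ^^ n) (\<Gamma> m) 0) \<le> fact n * B' / R ^ n" if "B' > B" for B'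
    proof (rule Cauchy_higher_deriv_bound[where y = 0])
      show "\<Gamma> m holomorphic_on ball 0 R" by (rule holomorphic_on_subset[OF \<Gamma>]) simp
      show "continuous_on (cball 0 R) (\<Gamma> m)"
        by (rule continuous_on_subset[OF holomorphic_on_imp_continuous_on[OF \<Gamma>]]) simp
      show "\<Gamma> m w \<in> ball 0 B'" if "w \<in> ball 0 R" for w
      proof -
        have "w \<in> cball 0 R" using that by simp
        then have "norm (\<Gamma> m w) \<le> B" using \<open>\<forall>z\<in>cball 0 R. norm (\<Gamma> m z) \<le> B\<close> by blast
        then show ?thesis using \<open>B' > B\<close> by simp
      qed
    qed (use \<open>R > 0\<close> False in auto)
    then have "norm ((deriv ^^ n) (\<Gamma> m) 0) * R ^ n / fact n \<le> B'" if "B' > B" for B'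
      using that \<open>R > 0\<close> by (force simp: field_simps)
    then have "norm ((deriv ^^ n) (\<Gamma> m) 0) * R ^ n / fact n \<le> B" by (rule dense_ge)
    then show ?thesis using \<open>R > 0\<close> by (simp add: norm_divide field_simps)
  qed
  have key: "\<exists>C\<ge>0. \<forall>m. \<forall>z\<in>cball 0 B. norm (\<Gamma> m z) \<le> C / A ^ m" if AB: "A > 0" "B > 0" for A B
  proof -
    \<comment> \<open>Chosen so that \<open>(2 / \<rho>1) / T = 1 / A ^ 2\<close> and
      \<open>R * (\<rho>2 / 2) = (2 * B) ^ 2\<close>: the geometric mean of the two bounds for a
      coefficient is then a constant over \<open>A ^ m * (2 * B) ^ n\<close>.\<close>
    define T R where "T = 2 * A\<^sup>2 / \<rho>1" and "R = 8 * B\<^sup>2 / \<rho>2"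
    have TR: "T > 0" "R > 0" using AB \<rho> by (simp_all add: T_def R_def)
    obtain M where M: "M > 0" "\<forall>m. \<forall>z\<in>cball 0 R. norm (\<Gamma> m z) \<le> M * (2 / \<rho>1) ^ m" using b1 by blast
    obtain M' where M': "M' > 0" "\<forall>m. \<forall>z\<in>cball 0 (\<rho>2 / 2). norm (\<Gamma> m z) \<le> M' / T ^ m" using b2 TR by blast
    have c: "norm ((deriv ^^ n) (\<Gamma> m) 0 / fact n) \<le> sqrt (M * M') / A ^ m / (2 * B) ^ n" for m n
    proof -
      let ?c = "norm ((deriv ^^ n) (\<Gamma> m) 0 / fact n)"
      have "?c \<le> (M * (2 / \<rho>1) ^ m) / R ^ n" using coeff M TR by blast
      moreover have "?c \<le> (M' / T ^ m) / (\<rho>2 / 2) ^ n" using coeff[of "\<rho>2 / 2" m "M' / T ^ m" n] M'(2) \<rho>(2) by simp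
      ultimately have "?c * ?c \<le> ((M * (2 / \<rho>1) ^ m) / R ^ n) * ((M' / T ^ m) / (\<rho>2 / 2) ^ n)"
        using M M' TR \<rho> by (intro mult_mono) auto
      also have "\<dots> = (sqrt (M * M') / A ^ m / (2 * B) ^ n)\<^sup>2"
      proof -
        have e1: "(2 / \<rho>1) ^ m / T ^ m = 1 / (A ^ m)\<^sup>2"
        proof -
          have "(2 / \<rho>1) / T = 1 / A\<^sup>2" using AB \<rho> by (simp add: T_def)
          then show ?thesis by (metis power_divide power_one power_mult mult.commute)
        qed
        have e2: "1 / R ^ n / (\<rho>2 / 2) ^ n = 1 / ((2 * B) ^ n)\<^sup>2"
        proof -
          have "R * (\<rho>2 / 2) = (2 * B)\<^sup>2" using AB \<rho> by (simp add: R_def power2_eq_square)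
          then have "R ^ n * (\<rho>2 / 2) ^ n = ((2 * B) ^ n)\<^sup>2" by (metis power_mult_distrib power_mult mult.commute)
          then show ?thesis by simp
        qed
        have "((M * (2 / \<rho>1) ^ m) / R ^ n) * ((M' / T ^ m) / (\<rho>2 / 2) ^ n) = (M * M') * ((2 / \<rho>1) ^ m / T ^ m) * (1 / R ^ n / (\<rho>2 / 2) ^ n)"
          by (simp add: mult_ac)
        also have "\<dots> = (M * M') * (1 / (A ^ m)\<^sup>2) * (1 / ((2 * B) ^ n)\<^sup>2)" unfolding e1 e2 ..
        finally show ?thesis using M M' by (simp add: power_divide power_mult_distrib)
      qed
      finally have "?c\<^sup>2 \<le> (sqrt (M * M') / A ^ m / (2 * B) ^ n)\<^sup>2" by (simp add: power2_eq_square)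
      moreover have "0 \<le> sqrt (M * M') / A ^ m / (2 * B) ^ n"
        using AB M(1) M'(1) by (intro divide_nonneg_pos real_sqrt_ge_zero mult_nonneg_nonneg zero_less_power) auto
      ultimately show ?thesis by (rule power2_le_imp_le)
    qed
    define S where "S = sqrt (M * M')"
    have S0: "S \<ge> 0" using M M' by (simp add: S_def)
    have "norm (\<Gamma> m z) \<le> (2 * S) / A ^ m" if z: "z \<in> cball 0 B" for m z
    proof -
      have s: "(\<lambda>n. (deriv ^^ n) (\<Gamma> m) 0 / fact n * z ^ n) sums \<Gamma> m z"
        using holomorphic_power_series[of "\<Gamma> m" 0 "norm z + 1" z] holomorphic_on_subset[OF \<Gamma>[of m]] by simp
      have bd: "norm ((deriv ^^ n) (\<Gamma> m) 0 / fact n * z ^ n) \<le> S / A ^ m * (1 / 2) ^ n" for n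
      proof -
        have "norm ((deriv ^^ n) (\<Gamma> m) 0 / fact n * z ^ n) \<le> (S / A ^ m / (2 * B) ^ n) * B ^ n"
          unfolding norm_mult norm_power using c[of n m] z AB S0
          by (intro mult_mono power_mono) (auto simp: S_def)
        also have "\<dots> = S / A ^ m * (1 / 2) ^ n" using AB by (simp add: power_mult_distrib power_divide)
        finally show ?thesis .
      qed
      have "norm (\<Gamma> m z) \<le> (\<Sum>n. S / A ^ m * (1 / 2) ^ n)"
        unfolding sums_unique[OF s] by (intro norm_suminf_le bd summable_mult summable_geometric) simp
      also have "\<dots> = S / A ^ m * 2" by (subst suminf_mult) (simp_all add: summable_geometric suminf_geometric)
      finally show ?thesis by (simp add: mult.commute)
    qed
    then show ?thesis using S0 by (intro exI[of _ "2 * S"]) auto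
  qed
  define F where "F = (\<lambda>w. \<Sum>m. \<Gamma> m (snd w) * fst w ^ m)"
  have "holomorphic2_on F UNIV"
    unfolding F_def
  proof (rule holomorphic2_suminf)
    show "holomorphic2_on (\<lambda>w. \<Gamma> m (snd w) * fst w ^ m) UNIV" for m
      by (intro holomorphic2_intros holomorphic2_entire[OF holomorphic2_snd \<Gamma>])
    fix w :: "complex \<times> complex"
    define X B where "X = norm (fst w) + 1" and "B = norm (snd w) + 1"
    have XB: "X > 0" "B > 0" by (simp_all add: X_def B_def add_nonneg_pos)
    obtain C where C: "C \<ge> 0" "\<forall>m. \<forall>z\<in>cball 0 B. norm (\<Gamma> m z) \<le> C / (2 * X) ^ m" using key[of "2 * X" B] XB by auto
    have bd: "norm (\<Gamma> m (snd y) * fst y ^ m) \<le> C * (1 / 2) ^ m" if "y \<in> ball 0 X \<times> ball 0 B" for m y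
    proof -
      have "norm (\<Gamma> m (snd y) * fst y ^ m) \<le> (C / (2 * X) ^ m) * X ^ m"
        unfolding norm_mult norm_power using C that XB by (intro mult_mono power_mono) (auto simp: mem_Times_iff)
      also have "\<dots> = C * (1 / 2) ^ m" using XB by (simp add: power_mult_distrib power_divide)
      finally show ?thesis .
    qed
    have U: "open (ball (0::complex) X \<times> ball (0::complex) B)" by (intro open_Times) auto
    have w: "w \<in> ball 0 X \<times> ball 0 B" by (simp add: X_def B_def mem_Times_iff)
    show "\<exists>U C \<theta>. open U \<and> w \<in> U \<and> U \<subseteq> UNIV \<and> 0 \<le> \<theta> \<and> \<theta> < 1 \<and> (\<forall>r. \<forall>y\<in>U. norm (\<Gamma> r (snd y) * fst y ^ r) \<le> C * \<theta> ^ r)"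
      by (rule exI[of _ "ball 0 X \<times> ball 0 B"], rule exI[of _ C], rule exI[of _ "1 / 2"], intro conjI)
        (use bd U w in auto)
  qed simp
  moreover have "F (x, z) = f1 (x, z)" if "norm x < \<rho>1" for x z
    using sums_unique[OF sums1[OF that]] by (simp add: F_def)
  ultimately show thesis using that by blast
qed

context qbase
begin

subsection \<open>The holomorphic numerator of the asymptotically free eigenfunction\<close>

definition w8s :: "complex \<Rightarrow> complex \<Rightarrow> complex \<Rightarrow> complex \<Rightarrow> complex \<Rightarrow> complex \<Rightarrow> complex"
  where "w8s a b c d e f = (\<Sum>r. w8 a b c d e f r)"

lemma bailey_w8s:
  assumes nz: "a \<noteq> 0" "b \<noteq> 0" "c \<noteq> 0" "d \<noteq> 0" "e \<noteq> 0" "f \<noteq> 0"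
    and l: "l = a\<^sup>2 * q / (b * c * d)"
    and fr: "qfree q a" "qfree q (a * q / b)" "qfree q (a * q / c)" "qfree q (a * q / d)" "qfree q (a * q / e)"
      "qfree q (a * q / (d * e))" "qfree q l" "qfree q (l * q / e)" "qfree q (a * q / f)" "qfree q (l * q / f)"
    and conv1: "norm (a * q / (e * f)) < 1"
    and conv2: "norm (a\<^sup>2 * q\<^sup>2 / (b * c * d * e * f)) < 1"
  shows "Q (l * q) * Q (l * q / (e * f)) * Q (a * q / e) * Q (a * q / f) * w8s a b c d e f =
         Q (a * q) * Q (a * q / (e * f)) * Q (l * q / e) * Q (l * q / f) * w8s l (a * q / (c * d)) (a * q / (b * d)) (a * q / (b * c)) e f"
proof -
  define b' c' d' where "b' = a * q / (c * d)" and "c' = a * q / (b * d)" and "d' = a * q / (b * c)"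
  have eqs: "l * q / b' = a * q / b" "l * q / c' = a * q / c" "l * q / d' = a * q / d"
    "l\<^sup>2 * q\<^sup>2 / (b' * c' * d' * e * f) = a * q / (e * f)"
    using nz by (simp_all add: l b'_def c'_def d'_def field_simps power2_eq_square)
  have "wn a b c d e f = Q (a * q / e) * Q (a * q / f) * w8s a b c d e f"
    unfolding w8s_def by (rule wn_w8) (use fr conv2 in auto)
  moreover have "wn l b' c' d' e f = Q (l * q / e) * Q (l * q / f) * w8s l b' c' d' e f"
    unfolding w8s_def by (rule wn_w8) (use fr conv1 in \<open>auto simp: eqs\<close>)
  ultimately show ?thesis
    using bailey_two_term[OF nz l fr(1-8) conv1] conv2 unfolding b'_def[symmetric] c'_def[symmetric] d'_def[symmetric]
    by (simp add: mult_ac)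
qed

lemma W87_w8s:
  assumes "a \<noteq> 0" "u = a\<^sup>2 * q\<^sup>2 / (b * c * d * e * f)"
  shows "W87 a [b, c, d, e, f] q u = w8s a b c d e f"
  unfolding W87_def w8s_def w8_def assms(2) using assms(1) by (simp add: mult_ac)

text \<open>The sum \<open>w8s\<close> multiplied by \<open>1 - \<alpha>\<close> and the five
  products that cancel its poles. The lower parameters \<open>y1, ..., y5\<close>, later
  \<open>\<alpha> * q / x1\<close> and so on, are separate arguments; thus nothing is divided by a
  variable and the series is holomorphic in all of them.\<close>

definition vs where
  "vs \<alpha> u x1 x2 x3 x4 x5 y1 y2 y3 y4 y5 = (\<Sum>r. (1 - \<alpha> * q ^ (2 * r)) * P \<alpha> r * (1 / P q r) * u ^ r *
     (P x1 r * P x2 r * P x3 r * P x4 r * P x5 r * Q (y1 * q ^ r) * Q (y2 * q ^ r) * Q (y3 * q ^ r) * Q (y4 * q ^ r) * Q (y5 * q ^ r)))"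

lemma vs_w8s:
  assumes \<alpha>: "\<alpha> \<noteq> 1" and x: "y1 = \<alpha> * q / x1" "y2 = \<alpha> * q / x2" "y3 = \<alpha> * q / x3" "y4 = \<alpha> * q / x4" "y5 = \<alpha> * q / x5"
    and fr: "qfree q y1" "qfree q y2" "qfree q y3" "qfree q y4" "qfree q y5"
    and u: "u = \<alpha>\<^sup>2 * q\<^sup>2 / (x1 * x2 * x3 * x4 * x5)" "norm u < 1"
  shows "vs \<alpha> u x1 x2 x3 x4 x5 y1 y2 y3 y4 y5 = (1 - \<alpha>) * (Q y1 * Q y2 * Q y3 * Q y4 * Q y5) * w8s \<alpha> x1 x2 x3 x4 x5"
proof -
  let ?c = "(1 - \<alpha>) * (Q y1 * Q y2 * Q y3)"
  have t: "(1 - \<alpha> * q ^ (2 * r)) * P \<alpha> r * (1 / P q r) * u ^ r *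
     (P x1 r * P x2 r * P x3 r * P x4 r * P x5 r * Q (y1 * q ^ r) * Q (y2 * q ^ r) * Q (y3 * q ^ r) * Q (y4 * q ^ r) * Q (y5 * q ^ r))
     = ?c * wnt \<alpha> x1 x2 x3 x4 x5 r" for r
    unfolding wnt_def kterm_def x(1)[symmetric] x(2)[symmetric] x(3)[symmetric] x(4)[symmetric] x(5)[symmetric] u(1)[symmetric]
      Q_split[of y1 r] Q_split[of y2 r] Q_split[of y3 r]
    using \<alpha> fr(1-3)[THEN qpoch_nonzero, of r] by (simp add: mult_ac)
  have s: "summable (wnt \<alpha> x1 x2 x3 x4 x5)"
    by (rule summable_wnt) (use fr u in \<open>simp_all add: x\<close>)
  have "vs \<alpha> u x1 x2 x3 x4 x5 y1 y2 y3 y4 y5 = ?c * wn \<alpha> x1 x2 x3 x4 x5"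
    unfolding vs_def t wn_def by (rule suminf_mult[OF s])
  also have "wn \<alpha> x1 x2 x3 x4 x5 = Q y4 * Q y5 * w8s \<alpha> x1 x2 x3 x4 x5"
    unfolding w8s_def x(4,5) by (rule wn_w8) (use fr u in \<open>simp_all add: x\<close>)
  finally show ?thesis by (simp add: mult_ac)
qed

lemma vs_holomorphic2:
  assumes D: "open D" and u: "holomorphic2_on u D" "\<And>w. w \<in> D \<Longrightarrow> norm (u w) < 1"
    and h: "holomorphic2_on \<alpha> D" "holomorphic2_on x1 D" "holomorphic2_on x2 D" "holomorphic2_on x3 D" "holomorphic2_on x4 D" "holomorphic2_on x5 D"
      "holomorphic2_on y1 D" "holomorphic2_on y2 D" "holomorphic2_on y3 D" "holomorphic2_on y4 D" "holomorphic2_on y5 D"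
  shows "holomorphic2_on (\<lambda>w. vs (\<alpha> w) (u w) (x1 w) (x2 w) (x3 w) (x4 w) (x5 w) (y1 w) (y2 w) (y3 w) (y4 w) (y5 w)) D"
  unfolding vs_def
proof (rule holomorphic2_suminf[OF D])
  have hP: "holomorphic2_on (\<lambda>w. P (f w) r) D" and hQ: "holomorphic2_on (\<lambda>w. Q (f w)) D" if "holomorphic2_on f D" for f r
    using that by (auto intro!: holomorphic2_entire[of f D] holomorphic_intros)
  show "holomorphic2_on (\<lambda>w. (1 - \<alpha> w * q ^ (2 * r)) * P (\<alpha> w) r * (1 / P q r) * u w ^ r *
     (P (x1 w) r * P (x2 w) r * P (x3 w) r * P (x4 w) r * P (x5 w) r * Q (y1 w * q ^ r) * Q (y2 w * q ^ r) * Q (y3 w * q ^ r) * Q (y4 w * q ^ r) * Q (y5 w * q ^ r))) D" for r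
    by (intro holomorphic2_intros hP hQ h u)
  fix w assume w: "w \<in> D"
  obtain C where C: "C > 0" "\<And>n. norm (1 / P q n) \<le> C" using P_inverse_bounded[OF qfree_q] by blast
  define m where "m = (\<lambda>w. norm (\<alpha> w) + norm (x1 w) + norm (x2 w) + norm (x3 w) + norm (x4 w) + norm (x5 w) +
      norm (y1 w) + norm (y2 w) + norm (y3 w) + norm (y4 w) + norm (y5 w))"
  have cm: "continuous_on D m" "continuous_on D (\<lambda>w. norm (u w))"
    unfolding m_def by (intro continuous_intros holomorphic2_imp_continuous h u)+
  obtain \<theta> where \<theta>: "norm (u w) < \<theta>" "\<theta> < 1" using u(2)[OF w] dense by blast
  then have \<theta>0: "0 \<le> \<theta>" using norm_ge_zero[of "u w"] by linarith
  define M where "M = m w + 1"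
  define U where "U = {v\<in>D. m v < M} \<inter> {v\<in>D. norm (u v) < \<theta>}"
  have U: "open U" "w \<in> U" "U \<subseteq> D"
  proof -
    have "open (D \<inter> m -` {..<M})" "open (D \<inter> (\<lambda>w. norm (u w)) -` {..<\<theta>})"
      by (intro continuous_open_preimage cm D open_lessThan)+
    moreover have "U = (D \<inter> m -` {..<M}) \<inter> (D \<inter> (\<lambda>w. norm (u w)) -` {..<\<theta>})" by (auto simp: U_def)
    ultimately show "open U" by (metis open_Int)
  qed (use w \<theta> in \<open>auto simp: U_def M_def\<close>)
  define E where "E = qexp M"
  have "norm ((1 - \<alpha> v * q ^ (2 * r)) * P (\<alpha> v) r * (1 / P q r) * u v ^ r *
     (P (x1 v) r * P (x2 v) r * P (x3 v) r * P (x4 v) r * P (x5 v) r * Q (y1 v * q ^ r) * Q (y2 v * q ^ r) * Q (y3 v * q ^ r) * Q (y4 v * q ^ r) * Q (y5 v * q ^ r)))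
     \<le> ((1 + M) * E * C * (E * E * E * E * E * E * E * E * E * E)) * \<theta> ^ r" if v: "v \<in> U" for v r
  proof -
    have mv: "m v < M" "norm (u v) < \<theta>" using v by (auto simp: U_def)
    have b: "norm (\<alpha> v) \<le> M" "norm (x1 v) \<le> M" "norm (x2 v) \<le> M" "norm (x3 v) \<le> M" "norm (x4 v) \<le> M" "norm (x5 v) \<le> M"
      "norm (y1 v) \<le> M" "norm (y2 v) \<le> M" "norm (y3 v) \<le> M" "norm (y4 v) \<le> M" "norm (y5 v) \<le> M"
      using mv(1) unfolding m_def by (smt (verit) norm_ge_zero)+
    have 1: "norm (1 - \<alpha> v * q ^ (2 * r)) \<le> 1 + M"
      using norm_triangle_ineq4[of 1 "\<alpha> v * q ^ (2 * r)"] norm_xq_le[OF b(1), of "2 * r"] by simp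
    have M0: "M \<ge> 0" using b(1) norm_ge_zero order_trans by blast
    have "norm (1 - \<alpha> v * q ^ (2 * r)) * norm (P (\<alpha> v) r) * norm (1 / P q r) * norm (u v) ^ r *
     (norm (P (x1 v) r) * norm (P (x2 v) r) * norm (P (x3 v) r) * norm (P (x4 v) r) * norm (P (x5 v) r) *
      norm (Q (y1 v * q ^ r)) * norm (Q (y2 v * q ^ r)) * norm (Q (y3 v * q ^ r)) * norm (Q (y4 v * q ^ r)) * norm (Q (y5 v * q ^ r)))
      \<le> (1 + M) * E * C * \<theta> ^ r * (E * E * E * E * E * E * E * E * E * E)"
      unfolding E_def
      by (intro mult_mono norm_P_le norm_Q_le norm_xq_le b 1 C power_mono less_imp_le[OF mv(2)] mult_nonneg_nonneg norm_ge_zero zero_le_power qexp_pos)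
        (use M0 C \<theta>0 in \<open>auto intro!: mult_nonneg_nonneg\<close>)
    then show ?thesis by (simp only: norm_mult norm_power mult_ac)
  qed
  then have bd: "\<forall>r. \<forall>v\<in>U. norm ((1 - \<alpha> v * q ^ (2 * r)) * P (\<alpha> v) r * (1 / P q r) * u v ^ r *
     (P (x1 v) r * P (x2 v) r * P (x3 v) r * P (x4 v) r * P (x5 v) r * Q (y1 v * q ^ r) * Q (y2 v * q ^ r) * Q (y3 v * q ^ r) * Q (y4 v * q ^ r) * Q (y5 v * q ^ r)))
     \<le> ((1 + M) * E * C * (E * E * E * E * E * E * E * E * E * E)) * \<theta> ^ r" by blast
  from \<theta>0 U \<theta> bd show "\<exists>U C \<theta>. open U \<and> w \<in> U \<and> U \<subseteq> D \<and> 0 \<le> \<theta> \<and> \<theta> < 1 \<and> (\<forall>r. \<forall>y\<in>U. norm ((1 - \<alpha> y * q ^ (2 * r)) * P (\<alpha> y) r * (1 / P q r) * u y ^ r *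
     (P (x1 y) r * P (x2 y) r * P (x3 y) r * P (x4 y) r * P (x5 y) r * Q (y1 y * q ^ r) * Q (y2 y * q ^ r) * Q (y3 y * q ^ r) * Q (y4 y * q ^ r) * Q (y5 y * q ^ r))) \<le> C * \<theta> ^ r)"
    by metis
qed

text \<open>
  \<open>Nser / Q (q X Z^2 / d)\<close> is \<open>\<Psi>\<close> in the variables \<open>X\<close>, \<open>Z\<close>.  On the zeros of the denominator \<open>Spsi\<close> uses
  the representation with \<open>a\<close> and \<open>d\<close> exchanged.
\<close>

definition Nser :: "complex \<Rightarrow> complex \<Rightarrow> complex \<Rightarrow> complex \<Rightarrow> complex \<Rightarrow> complex \<times> complex \<Rightarrow> complex"
  where "Nser a b c d t w = (let X = fst w; Z = snd w in
    Q (d * X) * vs (q * X * Z\<^sup>2 / d) (d * X) (q * Z / t) (q * Z * t / (a * d)) (a * b / t * Z) (a * c / t * Z) (q * X / d)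
      (q * X * Z * t / d) (q * X * Z * a / t) (q * X * Z * c / t) (q * X * Z * b / t) (q * Z\<^sup>2))"

definition Spsi :: "complex \<Rightarrow> complex \<Rightarrow> complex \<Rightarrow> complex \<Rightarrow> complex \<Rightarrow> complex \<times> complex \<Rightarrow> complex"
  where "Spsi a b c d t w = (if Q (q * fst w * (snd w)\<^sup>2 / d) \<noteq> 0 then Nser a b c d t w / Q (q * fst w * (snd w)\<^sup>2 / d)
     else Nser d b c a t w / Q (q * fst w * (snd w)\<^sup>2 / a))"

lemma holomorphic2_Q: "holomorphic2_on f D \<Longrightarrow> holomorphic2_on (\<lambda>w. Q (f w)) D"
  by (rule holomorphic2_entire) (auto intro!: holomorphic_intros)

lemma open_disc_times: "open {w :: complex \<times> complex. norm (k * fst w) < 1}"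
  by (intro open_Collect_less continuous_intros)

lemma convex_disc_times: "convex {w :: complex \<times> complex. norm (k * fst w) < 1}"
proof -
  have "convex ((\<lambda>w. k * fst w) -` ball 0 1)"
    by (intro convex_linear_vimage linearI) (auto simp: algebra_simps)
  then show ?thesis by (simp add: vimage_def)
qed

lemma Nser_holomorphic: "holomorphic2_on (Nser a b c d t) {w. norm (d * fst w) < 1}"
  unfolding Nser_def Let_def
  by (intro holomorphic2_mult holomorphic2_Q vs_holomorphic2 open_disc_times holomorphic2_intros) auto

text \<open>It suffices to verify a holomorphic identity where \<open>X\<close>, \<open>Z\<close>
  and an auxiliary product \<open>G\<close> of denominators do not vanish. Since
  \<open>G (0, 0) \<noteq> 0\<close>, such points are found on the diagonal near the origin, and the
  identity theorem takes over.\<close>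

lemma generic_identity:
  assumes D: "open D" "connected D" "(0, 0) \<in> D" and E: "holomorphic2_on E D" and G: "continuous_on UNIV G" "G (0, 0) \<noteq> (0::complex)"
    and z: "\<And>X Z. (X, Z) \<in> D \<Longrightarrow> X \<noteq> 0 \<Longrightarrow> Z \<noteq> 0 \<Longrightarrow> G (X, Z) \<noteq> 0 \<Longrightarrow> E (X, Z) = 0"
    and w: "w \<in> D"
  shows "E w = 0"
proof -
  define V where "V = D \<inter> (\<lambda>w. fst w * snd w * G w) -` (- {0})"
  have "open V" unfolding V_def
    by (intro continuous_open_preimage D continuous_intros continuous_on_subset[OF G(1)]) auto
  moreover have "V \<noteq> {}"
  proof -
    define h where "h = (\<lambda>\<epsilon>::real. (complex_of_real \<epsilon>, complex_of_real \<epsilon>))"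
    have ch: "continuous_on UNIV h" unfolding h_def by (intro continuous_intros)
    have "open (G -` (- {0}) \<inter> D)"
      using continuous_open_preimage[OF G(1) open_UNIV, of "- {0}"] D by (auto intro: open_Int)
    then have "open (h -` (G -` (- {0}) \<inter> D))" by (rule open_vimage[OF _ ch])
    moreover have "0 \<in> h -` (G -` (- {0}) \<inter> D)" using G D by (simp add: h_def)
    ultimately obtain e where e: "e > 0" "ball 0 e \<subseteq> h -` (G -` (- {0}) \<inter> D)" using open_contains_ball by blast
    have "e / 2 \<in> ball 0 e" using e by simp
    then have "h (e / 2) \<in> G -` (- {0}) \<inter> D" using e by blast
    then have "h (e / 2) \<in> V" using e by (simp add: V_def h_def)
    then show ?thesis by blast
  qed
  moreover have "E v = 0" if "v \<in> V" for v
    using z[of "fst v" "snd v"] that by (auto simp: V_def)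
  ultimately show ?thesis using holomorphic2_identity[OF E D(1,2)] w by (metis Int_lower1 V_def)
qed

section \<open>Symmetries of the numerator and its entire continuation\<close>

text \<open>The parameters are treated as free numbers, with \<open>t\<close> in the role of the
  dual parameter \<open>aw_a (dual P)\<close>, a square root of \<open>a * b * c * d / q\<close>. In
  this form duality exchanges \<open>a\<close> and \<open>t\<close>
  (\<open>par_dual\<close>).\<close>

definition par :: "complex \<Rightarrow> complex \<Rightarrow> complex \<Rightarrow> complex \<Rightarrow> complex \<Rightarrow> bool"
  where "par a b c d t \<longleftrightarrow> a \<noteq> 0 \<and> b \<noteq> 0 \<and> c \<noteq> 0 \<and> d \<noteq> 0 \<and> t \<noteq> 0 \<and> a * b * c * d = q * t\<^sup>2"

lemma par_swap: "par a b c d t \<Longrightarrow> par d b c a t"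
  by (simp add: par_def mult_ac)

lemma par_dual: "par a b c d t \<Longrightarrow> par t (a * b / t) (a * c / t) (a * d / t) a"
  unfolding par_def by (auto simp: field_simps power2_eq_square)

lemma Nser_w8s:
  assumes p: "par a b c d t" and X: "X \<noteq> 0" and Z: "Z \<noteq> 0" and u: "norm (d * X) < 1"
    and fr: "qfree q (q * X * Z\<^sup>2 / d)" "qfree q (q * X * Z * t / d)" "qfree q (q * X * Z * a / t)" "qfree q (q * X * Z * c / t)"
      "qfree q (q * X * Z * b / t)" "qfree q (q * Z\<^sup>2)"
  shows "Nser a b c d t (X, Z) = Q (d * X) * ((1 - q * X * Z\<^sup>2 / d) * (Q (q * X * Z * t / d) * Q (q * X * Z * a / t) * Q (q * X * Z * c / t) *
     Q (q * X * Z * b / t) * Q (q * Z\<^sup>2)) * w8s (q * X * Z\<^sup>2 / d) (q * Z / t) (q * Z * t / (a * d)) (a * b / t * Z) (a * c / t * Z) (q * X / d))"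
proof -
  have nz: "a \<noteq> 0" "b \<noteq> 0" "c \<noteq> 0" "d \<noteq> 0" "t \<noteq> 0" and rel: "a * b * c * d = q * t\<^sup>2" using p by (auto simp: par_def)
  have y4: "q * X * Z * c / t = q * X * Z\<^sup>2 / d * q / (a * b / t * Z)"
  proof -
    have "q * X * Z\<^sup>2 / d * q / (a * b / t * Z) = q * X * Z * (q * t\<^sup>2) / (a * b * d * t)"
      using nz Z by (simp add: field_simps power2_eq_square)
    then show ?thesis unfolding rel[symmetric] using nz by (simp add: field_simps)
  qed
  have y5: "q * X * Z * b / t = q * X * Z\<^sup>2 / d * q / (a * c / t * Z)"
  proof -
    have "q * X * Z\<^sup>2 / d * q / (a * c / t * Z) = q * X * Z * (q * t\<^sup>2) / (a * c * d * t)"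
      using nz Z by (simp add: field_simps power2_eq_square)
    then show ?thesis unfolding rel[symmetric] using nz by (simp add: field_simps)
  qed
  have y: "q * X * Z * t / d = q * X * Z\<^sup>2 / d * q / (q * Z / t)" "q * X * Z * a / t = q * X * Z\<^sup>2 / d * q / (q * Z * t / (a * d))"
     "q * Z\<^sup>2 = q * X * Z\<^sup>2 / d * q / (q * X / d)"
    using nz X Z by (simp_all add: field_simps power2_eq_square)
  have u2: "d * X = (q * X * Z\<^sup>2 / d)\<^sup>2 * q\<^sup>2 / (q * Z / t * (q * Z * t / (a * d)) * (a * b / t * Z) * (a * c / t * Z) * (q * X / d))"
  proof -
    have "(q * X * Z\<^sup>2 / d)\<^sup>2 * q\<^sup>2 / (q * Z / t * (q * Z * t / (a * d)) * (a * b / t * Z) * (a * c / t * Z) * (q * X / d)) = X * (q * t\<^sup>2) / (a * b * c)"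
      using nz X Z by (simp add: field_simps power2_eq_square)
    then show ?thesis unfolding rel[symmetric] using nz by simp
  qed
  show ?thesis unfolding Nser_def Let_def fst_conv snd_conv
    by (rule arg_cong[of _ _ "\<lambda>x. Q (d * X) * x"], rule vs_w8s[OF _ y(1,2) y4 y5 y(3) fr(2-6) u2 u]) (use qfree_1[OF fr(1)] in simp)
qed

text \<open>Bailey's transformation with base parameters \<open>q * X * Z^2 / d\<close> and
  \<open>q * X * Z^2 / a\<close>. It connects two representations of the same function whose
  denominators have different zeros.\<close>

lemma Nser_cross:
  assumes p: "par a b c d t" and w: "norm (d * fst w) < 1" "norm (a * fst w) < 1"
  shows "Nser a b c d t w * Q (q * fst w * (snd w)\<^sup>2 / a) = Nser d b c a t w * Q (q * fst w * (snd w)\<^sup>2 / d)"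
proof -
  have nz: "a \<noteq> 0" "b \<noteq> 0" "c \<noteq> 0" "d \<noteq> 0" "t \<noteq> 0" and rel: "a * b * c * d = q * t\<^sup>2" using p by (auto simp: par_def)
  define D where "D = {w :: complex \<times> complex. norm (d * fst w) < 1} \<inter> {w. norm (a * fst w) < 1}"
  define E where "E = (\<lambda>w. Nser a b c d t w * Q (q * fst w * (snd w)\<^sup>2 / a) - Nser d b c a t w * Q (q * fst w * (snd w)\<^sup>2 / d))"
  define G where "G = (\<lambda>w. Q (q * fst w * (snd w)\<^sup>2 / d) * Q (q * fst w * snd w * t / d) * Q (q * fst w * snd w * a / t) * Q (q * fst w * snd w * c / t) *
     Q (q * fst w * snd w * b / t) * Q (q * (snd w)\<^sup>2) * Q (q * fst w * (snd w)\<^sup>2 / a) * Q (q * fst w * snd w * t / a) * Q (q * fst w * snd w * d / t) * Q (t * snd w))"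
  have D12: "open D" "convex D" unfolding D_def
    by (intro open_Int open_disc_times convex_Int convex_disc_times)+
  have "(0, 0) \<in> D" by (simp add: D_def)
  note D = D12 this
  have "E w = 0"
  proof (rule generic_identity[OF D(1) convex_connected[OF D(2)] D(3), of E G])
    show "holomorphic2_on E D" unfolding E_def
      by (intro holomorphic2_diff holomorphic2_mult holomorphic2_Q holomorphic2_intros holomorphic2_subset[OF Nser_holomorphic]) (auto simp: D_def)
    show "continuous_on UNIV G" unfolding G_def by (intro continuous_intros) (use nz in auto)
    show "G (0, 0) \<noteq> 0" by (simp add: G_def)
    show "w \<in> D" using w by (simp add: D_def)
    fix X Z assume XZ: "(X, Z) \<in> D" "X \<noteq> 0" "Z \<noteq> 0" "G (X, Z) \<noteq> 0"
    define \<alpha> l where "\<alpha> = q * X * Z\<^sup>2 / d" and "l = q * X * Z\<^sup>2 / a"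
    have u: "norm (d * X) < 1" "norm (a * X) < 1" using XZ(1) by (auto simp: D_def)
    have fr: "qfree q \<alpha>" "qfree q (q * X * Z * t / d)" "qfree q (q * X * Z * a / t)" "qfree q (q * X * Z * c / t)"
      "qfree q (q * X * Z * b / t)" "qfree q (q * Z\<^sup>2)" "qfree q l" "qfree q (q * X * Z * t / a)" "qfree q (q * X * Z * d / t)" "qfree q (t * Z)"
      using XZ(4) unfolding G_def \<alpha>_def l_def by (auto simp: Q_eq_0_iff)
    have N1: "Nser a b c d t (X, Z) = Q (d * X) * ((1 - \<alpha>) * (Q (q * X * Z * t / d) * Q (q * X * Z * a / t) * Q (q * X * Z * c / t) *
       Q (q * X * Z * b / t) * Q (q * Z\<^sup>2)) * w8s \<alpha> (q * Z / t) (q * Z * t / (a * d)) (a * b / t * Z) (a * c / t * Z) (q * X / d))"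
      unfolding \<alpha>_def by (rule Nser_w8s[OF p XZ(2,3) u(1)]) (use fr in \<open>simp_all add: \<alpha>_def\<close>)
    have N2: "Nser d b c a t (X, Z) = Q (a * X) * ((1 - l) * (Q (q * X * Z * t / a) * Q (q * X * Z * d / t) * Q (q * X * Z * c / t) *
       Q (q * X * Z * b / t) * Q (q * Z\<^sup>2)) * w8s l (q * Z / t) (q * Z * t / (d * a)) (d * b / t * Z) (d * c / t * Z) (q * X / a))"
      unfolding l_def by (rule Nser_w8s[OF par_swap[OF p] XZ(2,3) u(2)]) (use fr in \<open>simp_all add: l_def\<close>)
    \<comment> \<open>The parameters \<open>b', c', d'\<close> are the ones that Bailey's
      transformation changes; \<open>\<alpha>^2 * q / (b' * c' * d')\<close> is the base parameter
      with \<open>a\<close> in place of \<open>d\<close>.\<close>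
    define e f b' c' d' where "e = q * Z / t" and "f = q * Z * t / (a * d)" and "b' = a * b / t * Z" and "c' = a * c / t * Z" and "d' = q * X / d"
    have nz': "\<alpha> \<noteq> 0" "b' \<noteq> 0" "c' \<noteq> 0" "d' \<noteq> 0" "e \<noteq> 0" "f \<noteq> 0"
      using nz XZ by (simp_all add: \<alpha>_def e_def f_def b'_def c'_def d'_def)
    have tt: "t * t = a * b * c * d / q" using rel by (simp add: power2_eq_square field_simps)
    have eqs: "l = \<alpha>\<^sup>2 * q / (b' * c' * d')" "\<alpha> * q / b' = q * X * Z * c / t" "\<alpha> * q / c' = q * X * Z * b / t" "\<alpha> * q / d' = q * Z\<^sup>2"
      "\<alpha> * q / e = q * X * Z * t / d" "\<alpha> * q / f = q * X * Z * a / t" "\<alpha> * q / (d' * e) = t * Z" "l * q / e = q * X * Z * t / a" "l * q / f = q * X * Z * d / t"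
      "\<alpha> * q / (e * f) = a * X" "l * q / (e * f) = d * X" "\<alpha>\<^sup>2 * q\<^sup>2 / (b' * c' * d' * e * f) = d * X"
      "\<alpha> * q / (c' * d') = d * b / t * Z" "\<alpha> * q / (b' * d') = d * c / t * Z" "\<alpha> * q / (b' * c') = q * X / a"
    proof -
      have "\<alpha>\<^sup>2 * q / (b' * c' * d') = q * X * Z\<^sup>2 * (q * (t * t)) / (d * a * a * b * c)" "\<alpha> * q / b' = q * X * Z * (q * (t * t)) / (a * b * d * t)"
         "\<alpha> * q / c' = q * X * Z * (q * (t * t)) / (a * c * d * t)" "\<alpha>\<^sup>2 * q\<^sup>2 / (b' * c' * d' * e * f) = X * (q * (t * t)) / (a * b * c)"
         "\<alpha> * q / (c' * d') = Z * (q * (t * t)) / (a * c * t)" "\<alpha> * q / (b' * d') = Z * (q * (t * t)) / (a * b * t)"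
         "\<alpha> * q / (b' * c') = q * X * (q * (t * t)) / (d * a * a * b * c)"
        using nz XZ unfolding \<alpha>_def b'_def c'_def d'_def e_def f_def by (simp_all add: field_simps power2_eq_square)
      then show "l = \<alpha>\<^sup>2 * q / (b' * c' * d')" "\<alpha> * q / b' = q * X * Z * c / t" "\<alpha> * q / c' = q * X * Z * b / t"
        "\<alpha>\<^sup>2 * q\<^sup>2 / (b' * c' * d' * e * f) = d * X" "\<alpha> * q / (c' * d') = d * b / t * Z" "\<alpha> * q / (b' * d') = d * c / t * Z" "\<alpha> * q / (b' * c') = q * X / a"
        unfolding tt l_def using nz XZ by (simp_all add: field_simps)
    qed (use nz XZ in \<open>simp_all add: \<alpha>_def l_def d'_def e_def f_def field_simps power2_eq_square\<close>)
    have B: "Q (l * q) * Q (d * X) * Q (q * X * Z * t / d) * Q (q * X * Z * a / t) * w8s \<alpha> b' c' d' e f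
       = Q (\<alpha> * q) * Q (a * X) * Q (q * X * Z * t / a) * Q (q * X * Z * d / t) * w8s l (d * b / t * Z) (d * c / t * Z) (q * X / a) e f"
      using bailey_w8s[OF nz' eqs(1)] fr u unfolding eqs(2-15) by blast
    have p1: "w8s \<alpha> (q * Z / t) (q * Z * t / (a * d)) (a * b / t * Z) (a * c / t * Z) (q * X / d) = w8s \<alpha> b' c' d' e f"
      unfolding w8s_def w8_def b'_def c'_def d'_def e_def f_def by (simp only: mult_ac)
    have p2: "w8s l (q * Z / t) (q * Z * t / (d * a)) (d * b / t * Z) (d * c / t * Z) (q * X / a) = w8s l (d * b / t * Z) (d * c / t * Z) (q * X / a) e f"
      unfolding w8s_def w8_def e_def f_def by (simp only: mult_ac)
    have Q1: "Q \<alpha> = (1 - \<alpha>) * Q (\<alpha> * q)" "Q l = (1 - l) * Q (l * q)" by (rule Q_split1)+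
    have "Nser a b c d t (X, Z) * Q l = Nser d b c a t (X, Z) * Q \<alpha>"
    proof -
      have "Nser a b c d t (X, Z) * Q l = (1 - \<alpha>) * (1 - l) * (Q (q * X * Z * c / t) * Q (q * X * Z * b / t) * Q (q * Z\<^sup>2)) *
          (Q (l * q) * Q (d * X) * Q (q * X * Z * t / d) * Q (q * X * Z * a / t) * w8s \<alpha> b' c' d' e f)"
        unfolding N1 p1 Q1 by (simp only: mult_ac)
      also have "\<dots> = Nser d b c a t (X, Z) * Q \<alpha>"
        unfolding B N2 p2 Q1 by (simp only: mult_ac)
      finally show ?thesis .
    qed
    then show "E (X, Z) = 0" by (simp add: E_def \<alpha>_def l_def)
  qed
  then show ?thesis by (simp add: E_def)
qed

text \<open>Bailey's transformation with another choice of the three distinguished parameters leads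
  to the base parameter \<open>q * Z * X^2 / (a * d / t)\<close>, which is that of the dual series
  with \<open>X\<close> and \<open>Z\<close> exchanged.\<close>

lemma Nser_dual:
  assumes p: "par a b c d t" and w: "norm (d * X0) < 1" "norm (a * d / t * Z0) < 1"
  shows "Nser a b c d t (X0, Z0) * Q (q * Z0 * X0\<^sup>2 / (a * d / t)) =
     Nser t (a * b / t) (a * c / t) (a * d / t) a (Z0, X0) * Q (q * X0 * Z0\<^sup>2 / d)"
proof -
  have nz: "a \<noteq> 0" "b \<noteq> 0" "c \<noteq> 0" "d \<noteq> 0" "t \<noteq> 0" and rel: "a * b * c * d = q * t\<^sup>2" using p by (auto simp: par_def)
  define bt ct dt where "bt = a * b / t" and "ct = a * c / t" and "dt = a * d / t"
  have dt0: "dt \<noteq> 0" using nz by (simp add: dt_def)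
  have pd: "par t bt ct dt a" unfolding bt_def ct_def dt_def by (rule par_dual[OF p])
  define D where "D = {w :: complex \<times> complex. norm (d * fst w) < 1} \<inter> {(x, z). (z, x) \<in> {w. norm (dt * fst w) < 1}}"
  define E where "E = (\<lambda>w. Nser a b c d t w * Q (q * snd w * (fst w)\<^sup>2 / dt) - (\<lambda>(x, z). Nser t bt ct dt a (z, x)) w * Q (q * fst w * (snd w)\<^sup>2 / d))"
  define G where "G = (\<lambda>w. Q (q * fst w * (snd w)\<^sup>2 / d) * Q (q * fst w * snd w * t / d) * Q (q * fst w * snd w * a / t) * Q (q * fst w * snd w * c / t) *
     Q (q * fst w * snd w * b / t) * Q (q * (snd w)\<^sup>2) * Q (q * snd w * (fst w)\<^sup>2 / dt) * Q (q * fst w * snd w * t / a) * Q (q * (fst w)\<^sup>2) * Q (q * fst w / b))"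
  have "convex ((\<lambda>w. (snd w, fst w)) -` {w :: complex \<times> complex. norm (dt * fst w) < 1})"
    by (intro convex_linear_vimage linearI convex_disc_times) auto
  then have cv: "convex {(x, z). (z, x) \<in> {w :: complex \<times> complex. norm (dt * fst w) < 1}}" by (simp add: vimage_def case_prod_unfold)
  have D12: "open D" "convex D" unfolding D_def
    by (intro open_Int open_disc_times open_swap convex_Int convex_disc_times cv)+
  have "(0, 0) \<in> D" by (simp add: D_def)
  note D = D12 this
  have "E (X0, Z0) = 0"
  proof (rule generic_identity[OF D(1) convex_connected[OF D(2)] D(3), of E G])
    show "holomorphic2_on E D" unfolding E_def
      by (intro holomorphic2_diff holomorphic2_mult holomorphic2_Q holomorphic2_intros holomorphic2_subset[OF Nser_holomorphic]
         holomorphic2_subset[OF holomorphic2_swap[OF Nser_holomorphic]]) (auto simp: D_def)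
    show "continuous_on UNIV G" unfolding G_def by (intro continuous_intros) (use nz dt0 in auto)
    show "G (0, 0) \<noteq> 0" by (simp add: G_def)
    show "(X0, Z0) \<in> D" using w by (simp add: D_def dt_def)
    fix X Z assume XZ: "(X, Z) \<in> D" "X \<noteq> 0" "Z \<noteq> 0" "G (X, Z) \<noteq> 0"
    define \<alpha> l where "\<alpha> = q * X * Z\<^sup>2 / d" and "l = q * Z * X\<^sup>2 / dt"
    have u: "norm (d * X) < 1" "norm (dt * Z) < 1" using XZ(1) by (auto simp: D_def)
    have fr: "qfree q \<alpha>" "qfree q (q * X * Z * t / d)" "qfree q (q * X * Z * a / t)" "qfree q (q * X * Z * c / t)"
      "qfree q (q * X * Z * b / t)" "qfree q (q * Z\<^sup>2)" "qfree q l" "qfree q (q * X * Z * t / a)" "qfree q (q * X\<^sup>2)" "qfree q (q * X / b)"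
      using XZ(4) unfolding G_def \<alpha>_def l_def by (auto simp: Q_eq_0_iff)
    have N1: "Nser a b c d t (X, Z) = Q (d * X) * ((1 - \<alpha>) * (Q (q * X * Z * t / d) * Q (q * X * Z * a / t) * Q (q * X * Z * c / t) *
       Q (q * X * Z * b / t) * Q (q * Z\<^sup>2)) * w8s \<alpha> (q * Z / t) (q * Z * t / (a * d)) (a * b / t * Z) (a * c / t * Z) (q * X / d))"
      unfolding \<alpha>_def by (rule Nser_w8s[OF p XZ(2,3) u(1)]) (use fr in \<open>simp_all add: \<alpha>_def\<close>)
    have ys: "q * Z * X * a / dt = q * X * Z * t / d" "q * Z * X * t / a = q * X * Z * t / a" "q * Z * X * ct / a = q * X * Z * c / t"
      "q * Z * X * bt / a = q * X * Z * b / t" "q * X * a / (t * dt) = q * X / d" "t * bt / a * X = b * X" "t * ct / a * X = c * X"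
      using nz by (simp_all add: bt_def ct_def dt_def field_simps)
    have N2: "Nser t bt ct dt a (Z, X) = Q (dt * Z) * ((1 - l) * (Q (q * X * Z * t / d) * Q (q * X * Z * t / a) * Q (q * X * Z * c / t) *
       Q (q * X * Z * b / t) * Q (q * X\<^sup>2)) * w8s l (q * X / a) (q * X / d) (b * X) (c * X) (q * Z / dt))"
      using Nser_w8s[OF pd XZ(3,2) u(2)] fr unfolding ys l_def[symmetric] by blast
    \<comment> \<open>Compared with \<open>Nser_cross\<close>, the parameters
      \<open>q * X / d\<close> and \<open>q * Z / t\<close> have exchanged their roles.\<close>
    define e f b' c' d' where "e = q * Z * t / (a * d)" and "f = q * X / d" and "b' = q * Z / t" and "c' = a * c / t * Z" and "d' = a * b / t * Z"
    have nz': "\<alpha> \<noteq> 0" "b' \<noteq> 0" "c' \<noteq> 0" "d' \<noteq> 0" "e \<noteq> 0" "f \<noteq> 0"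
      using nz XZ by (simp_all add: \<alpha>_def e_def f_def b'_def c'_def d'_def)
    have tt: "t * t = a * b * c * d / q" using rel by (simp add: power2_eq_square field_simps)
    have e': "e = q * Z / dt" using nz by (simp add: e_def dt_def)
    have eqs: "l = \<alpha>\<^sup>2 * q / (b' * c' * d')" "\<alpha> * q / b' = q * X * Z * t / d" "\<alpha> * q / c' = q * X * Z * b / t" "\<alpha> * q / d' = q * X * Z * c / t"
      "\<alpha> * q / e = q * X * Z * a / t" "\<alpha> * q / f = q * Z\<^sup>2" "\<alpha> * q / (d' * e) = q * X / b" "l * q / e = q * X\<^sup>2" "l * q / f = q * X * Z * t / a"
      "\<alpha> * q / (e * f) = dt * Z" "l * q / (e * f) = d * X" "\<alpha>\<^sup>2 * q\<^sup>2 / (b' * c' * d' * e * f) = d * X"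
      "\<alpha> * q / (c' * d') = q * X / a" "\<alpha> * q / (b' * d') = c * X" "\<alpha> * q / (b' * c') = b * X"
    proof -
      have "\<alpha>\<^sup>2 * q / (b' * c' * d') = q * Z * X\<^sup>2 * (q * (t * t)) * t / (d * d * a * a * b * c)" "\<alpha> * q / d' = q * X * Z * (q * (t * t)) / (a * b * d * t)"
         "\<alpha> * q / c' = q * X * Z * (q * (t * t)) / (a * c * d * t)" "\<alpha>\<^sup>2 * q\<^sup>2 / (b' * c' * d' * e * f) = X * (q * (t * t)) / (a * b * c)"
         "\<alpha> * q / (c' * d') = q * X * (q * (t * t)) / (d * a * a * b * c)" "\<alpha> * q / (b' * d') = X * (q * (t * t)) / (a * b * d)"
         "\<alpha> * q / (b' * c') = X * (q * (t * t)) / (a * c * d)"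
        using nz XZ unfolding \<alpha>_def b'_def c'_def d'_def e_def f_def by (simp_all add: field_simps power2_eq_square)
      then show "l = \<alpha>\<^sup>2 * q / (b' * c' * d')" "\<alpha> * q / d' = q * X * Z * c / t" "\<alpha> * q / c' = q * X * Z * b / t"
        "\<alpha>\<^sup>2 * q\<^sup>2 / (b' * c' * d' * e * f) = d * X" "\<alpha> * q / (c' * d') = q * X / a" "\<alpha> * q / (b' * d') = c * X" "\<alpha> * q / (b' * c') = b * X"
        unfolding tt l_def dt_def using nz XZ by (simp_all add: field_simps)
    qed (use nz XZ in \<open>simp_all add: \<alpha>_def l_def b'_def d'_def e_def f_def dt_def field_simps power2_eq_square\<close>)
    have B: "Q (l * q) * Q (d * X) * Q (q * X * Z * a / t) * Q (q * Z\<^sup>2) * w8s \<alpha> b' c' d' e f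
       = Q (\<alpha> * q) * Q (dt * Z) * Q (q * X\<^sup>2) * Q (q * X * Z * t / a) * w8s l (q * X / a) (c * X) (b * X) e f"
      using bailey_w8s[OF nz' eqs(1)] fr u unfolding eqs(2-15) by blast
    have p1: "w8s \<alpha> (q * Z / t) (q * Z * t / (a * d)) (a * b / t * Z) (a * c / t * Z) (q * X / d) = w8s \<alpha> b' c' d' e f"
      unfolding w8s_def w8_def b'_def c'_def d'_def e_def f_def by (simp only: mult_ac)
    have p2: "w8s l (q * X / a) (q * X / d) (b * X) (c * X) (q * Z / dt) = w8s l (q * X / a) (c * X) (b * X) e f"
      unfolding w8s_def w8_def e' f_def by (simp only: mult_ac)
    have Q1: "Q \<alpha> = (1 - \<alpha>) * Q (\<alpha> * q)" "Q l = (1 - l) * Q (l * q)" by (rule Q_split1)+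
    have "Nser a b c d t (X, Z) * Q l = Nser t bt ct dt a (Z, X) * Q \<alpha>"
    proof -
      have "Nser a b c d t (X, Z) * Q l = (1 - \<alpha>) * (1 - l) * (Q (q * X * Z * c / t) * Q (q * X * Z * b / t) * Q (q * X * Z * t / d)) *
          (Q (l * q) * Q (d * X) * Q (q * X * Z * a / t) * Q (q * Z\<^sup>2) * w8s \<alpha> b' c' d' e f)"
        unfolding N1 p1 Q1 by (simp only: mult_ac)
      also have "\<dots> = Nser t bt ct dt a (Z, X) * Q \<alpha>"
        unfolding B N2 p2 Q1 by (simp only: mult_ac)
      finally show ?thesis .
    qed
    then show "E (X, Z) = 0" by (simp add: E_def \<alpha>_def l_def)
  qed
  then show ?thesis by (simp add: E_def bt_def ct_def dt_def)
qed

lemma small_disc: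
  fixes x :: complex
  assumes "a \<noteq> 0" "d \<noteq> 0" "norm x < 1 / (norm a + norm d)"
  shows "norm (a * x) < 1" "norm (d * x) < 1"
proof -
  have "norm a > 0" "norm d > 0" using assms by auto
  then have "norm x * (norm a + norm d) < 1"
    using assms(3) pos_less_divide_eq[of "norm a + norm d" "norm x" 1] \<open>norm a > 0\<close> \<open>norm d > 0\<close> by linarith
  then have "norm a * norm x + norm d * norm x < 1" by (simp add: algebra_simps)
  moreover have "norm a * norm x \<ge> 0" "norm d * norm x \<ge> 0" by (rule mult_nonneg_nonneg; simp)+
  ultimately have "norm a * norm x < 1" "norm d * norm x < 1" by linarith+
  then show "norm (a * x) < 1" "norm (d * x) < 1" by (simp_all add: norm_mult)
qed

lemma open_Collect_Q:
  assumes "open D" "holomorphic2_on g UNIV"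
  shows "open {v\<in>D. Q (g v) \<noteq> 0}"
proof -
  have "open (D \<inter> (\<lambda>v. Q (g v)) -` (- {0}))"
    by (intro continuous_open_preimage assms(1) continuous_on_subset[OF holomorphic2_imp_continuous[OF holomorphic2_Q[OF assms(2)]]]) auto
  moreover have "{v\<in>D. Q (g v) \<noteq> 0} = D \<inter> (\<lambda>v. Q (g v)) -` (- {0})" by auto
  ultimately show ?thesis by simp
qed

text \<open>A common zero of the two denominators would give \<open>a * q ^ m = d * q ^ n\<close>,
  contrary to \<open>ad\<close>. So near each point one of the two quotients is regular, and by
  \<open>Nser_cross\<close> they agree where both are.\<close>

lemma Spsi:
  assumes p: "par a b c d t" and ad: "\<And>m n. a * q ^ m \<noteq> d * q ^ n"
  defines "D \<equiv> ball 0 (1 / (norm a + norm d)) \<times> (UNIV :: complex set)"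
  shows "holomorphic2_on (Spsi a b c d t) D"
    and "\<And>w. w \<in> D \<Longrightarrow> Spsi a b c d t w * Q (q * fst w * (snd w)\<^sup>2 / d) = Nser a b c d t w"
proof -
  have nz: "a \<noteq> 0" "d \<noteq> 0" using p by (auto simp: par_def)
  define g h where "g = (\<lambda>w :: complex \<times> complex. q * fst w * (snd w)\<^sup>2 / d)" and "h = (\<lambda>w :: complex \<times> complex. q * fst w * (snd w)\<^sup>2 / a)"
  have gh: "holomorphic2_on g S" "holomorphic2_on h S" for S
    unfolding g_def h_def by (intro holomorphic2_intros)+
  have D: "open D" unfolding D_def by (intro open_Times) auto
  have disc: "norm (a * fst w) < 1" "norm (d * fst w) < 1" if "w \<in> D" for w
    using small_disc[OF nz, of "fst w"] that by (auto simp: D_def)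
  have cross: "Nser a b c d t w * Q (h w) = Nser d b c a t w * Q (g w)" if "w \<in> D" for w
    unfolding g_def h_def by (rule Nser_cross[OF p disc(2,1)[OF that]])
  have S: "Spsi a b c d t w = (if Q (g w) \<noteq> 0 then Nser a b c d t w / Q (g w) else Nser d b c a t w / Q (h w))" for w
    by (simp add: Spsi_def g_def h_def)
  have excl: "Q (h w) \<noteq> 0" if "Q (g w) = 0" for w
  proof
    assume "Q (h w) = 0"
    with that obtain m n where "g w * q ^ m = 1" "h w * q ^ n = 1" by (auto simp: Q_eq_0_iff qfree_def)
    then have "q * fst w * (snd w)\<^sup>2 * q ^ m = d" "q * fst w * (snd w)\<^sup>2 * q ^ n = a" using nz by (auto simp: g_def h_def field_simps)
    then have "a * q ^ m = d * q ^ n" by (metis mult.assoc mult.commute)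
    with ad show False by blast
  qed
  have N1: "holomorphic2_on (Nser a b c d t) D" and N2: "holomorphic2_on (Nser d b c a t) D"
    by (rule holomorphic2_subset[OF Nser_holomorphic]; use disc in blast)+
  show "holomorphic2_on (Spsi a b c d t) D"
  proof (rule holomorphic2_local)
    fix w assume w: "w \<in> D"
    show "\<exists>U. w \<in> U \<and> holomorphic2_on (Spsi a b c d t) U"
    proof (cases "Q (g w) = 0")
      case False
      define U where "U = {v\<in>D. Q (g v) \<noteq> 0}"
      have "holomorphic2_on (\<lambda>v. Nser a b c d t v / Q (g v)) U"
        by (intro holomorphic2_divide holomorphic2_subset[OF N1] holomorphic2_Q gh) (auto simp: U_def)
      then have "holomorphic2_on (Spsi a b c d t) U"
        by (rule holomorphic2_cong) (use open_Collect_Q[OF D gh(1)] in \<open>auto simp: U_def S\<close>)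
      then show ?thesis using w False by (intro exI[of _ U]) (auto simp: U_def)
    next
      case True
      define U where "U = {v\<in>D. Q (h v) \<noteq> 0}"
      have "holomorphic2_on (\<lambda>v. Nser d b c a t v / Q (h v)) U"
        by (intro holomorphic2_divide holomorphic2_subset[OF N2] holomorphic2_Q gh) (auto simp: U_def)
      then have "holomorphic2_on (Spsi a b c d t) U"
      proof (rule holomorphic2_cong)
        show "open U" unfolding U_def by (rule open_Collect_Q[OF D gh(2)])
        show "Nser d b c a t v / Q (h v) = Spsi a b c d t v" if "v \<in> U" for v
          using cross[of v] that by (auto simp: S U_def field_simps)
      qed
      then show ?thesis using w excl[OF True] by (intro exI[of _ U]) (auto simp: U_def)
    qed
  qed
  show "Spsi a b c d t w * Q (q * fst w * (snd w)\<^sup>2 / d) = Nser a b c d t w" if "w \<in> D" for w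
    unfolding g_def[symmetric, THEN fun_cong] using cross[OF that] excl[of w] by (auto simp: S g_def)
qed

text \<open>\<open>Spsi\<close> is holomorphic for small \<open>X\<close> and all \<open>Z\<close>,
  its dual counterpart for small \<open>Z\<close> and all \<open>X\<close>, and
  \<open>Nser_dual\<close> shows that they agree when both are small: the situation of
  \<open>entire_extension\<close>. The hypothesis \<open>td\<close> is \<open>ad\<close> for the
  dual parameters.\<close>

lemma psi_entire:
  assumes p: "par a b c d t" and ad: "\<And>m n. a * q ^ m \<noteq> d * q ^ n" and td: "\<And>m n. t * q ^ m \<noteq> a * d / t * q ^ n"
  obtains F where "holomorphic2_on F UNIV"
    "\<And>w. norm (d * fst w) < 1 \<Longrightarrow> F w * Q (q * fst w * (snd w)\<^sup>2 / d) = Nser a b c d t w"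
proof -
  define bt ct dt where "bt = a * b / t" and "ct = a * c / t" and "dt = a * d / t"
  have nz: "a \<noteq> 0" "d \<noteq> 0" "t \<noteq> 0" "dt \<noteq> 0" using p by (auto simp: par_def dt_def)
  have pd: "par t bt ct dt a" unfolding bt_def ct_def dt_def by (rule par_dual[OF p])
  define \<rho>1 \<rho>2 where "\<rho>1 = 1 / (norm a + norm d)" and "\<rho>2 = 1 / (norm t + norm dt)"
  have \<rho>: "\<rho>1 > 0" "\<rho>2 > 0" using nz by (auto simp: \<rho>1_def \<rho>2_def intro!: divide_pos_pos add_pos_pos)
  note S1 = Spsi[OF p ad, folded \<rho>1_def]
  note S2 = Spsi[OF pd td[folded dt_def], folded \<rho>2_def]
  define f2 where "f2 = (\<lambda>(x, z). Spsi t bt ct dt a (z, x))"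
  have f2: "holomorphic2_on f2 (UNIV \<times> ball 0 \<rho>2)"
    unfolding f2_def by (rule holomorphic2_subset[OF holomorphic2_swap[OF S2(1)]]) auto
  define B where "B = ball (0::complex) \<rho>1 \<times> ball (0::complex) \<rho>2"
  have B: "open B" "convex B" "(0, 0) \<in> B" unfolding B_def using \<rho> by (auto intro: open_Times convex_Times)
  define G where "G = (\<lambda>w :: complex \<times> complex. Q (q * fst w * (snd w)\<^sup>2 / d) * Q (q * snd w * (fst w)\<^sup>2 / dt))"
  have eq: "Spsi a b c d t w - f2 w = 0" if "w \<in> B" for w
  proof (rule generic_identity[OF B(1) convex_connected[OF B(2)] B(3), of _ G])
    show "holomorphic2_on (\<lambda>w. Spsi a b c d t w - f2 w) B"
      by (intro holomorphic2_diff holomorphic2_subset[OF S1(1)] holomorphic2_subset[OF f2]) (auto simp: B_def)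
    show "continuous_on UNIV G" unfolding G_def by (intro continuous_intros) (use nz in auto)
    fix X Z assume XZ: "(X, Z) \<in> B" "G (X, Z) \<noteq> 0"
    have s1: "Spsi a b c d t (X, Z) * Q (q * X * Z\<^sup>2 / d) = Nser a b c d t (X, Z)"
      using S1(2)[of "(X, Z)"] XZ by (simp add: B_def)
    have s2: "f2 (X, Z) * Q (q * Z * X\<^sup>2 / dt) = Nser t bt ct dt a (Z, X)"
      using S2(2)[of "(Z, X)"] XZ by (simp add: B_def f2_def)
    have "Nser a b c d t (X, Z) * Q (q * Z * X\<^sup>2 / dt) = Nser t bt ct dt a (Z, X) * Q (q * X * Z\<^sup>2 / d)"
      unfolding bt_def ct_def dt_def
      by (rule Nser_dual[OF p]) (use XZ(1) small_disc[OF nz(1,2), of X] small_disc[OF nz(3,4), of Z] in \<open>auto simp: B_def \<rho>1_def \<rho>2_def dt_def\<close>)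
    then have "Spsi a b c d t (X, Z) * G (X, Z) = f2 (X, Z) * G (X, Z)"
      unfolding s1[symmetric] s2[symmetric] by (simp add: G_def mult_ac)
    then show "Spsi a b c d t (X, Z) - f2 (X, Z) = 0" using XZ(2) by simp
  qed (use that in \<open>auto simp: G_def\<close>)
  obtain F where F: "holomorphic2_on F UNIV" "\<And>x z. norm x < \<rho>1 \<Longrightarrow> F (x, z) = Spsi a b c d t (x, z)"
  proof (rule entire_extension[OF \<rho> S1(1) f2])
    show "Spsi a b c d t (x, z) = f2 (x, z)" if "norm x < \<rho>1" "norm z < \<rho>2" for x z
      using eq[of "(x, z)"] that by (simp add: B_def)
  qed blast
  have "F w * Q (q * fst w * (snd w)\<^sup>2 / d) - Nser a b c d t w = 0" if "norm (d * fst w) < 1" for w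
  proof (rule holomorphic2_identity_convex[where D = "{w. norm (d * fst w) < 1}" and V = "ball 0 \<rho>1 \<times> UNIV"])
    show "holomorphic2_on (\<lambda>w. F w * Q (q * fst w * (snd w)\<^sup>2 / d) - Nser a b c d t w) {w. norm (d * fst w) < 1}"
      by (intro holomorphic2_diff holomorphic2_mult holomorphic2_Q holomorphic2_intros Nser_holomorphic holomorphic2_subset[OF F(1)]) auto
    show "F v * Q (q * fst v * (snd v)\<^sup>2 / d) - Nser a b c d t v = 0" if "v \<in> ball 0 \<rho>1 \<times> UNIV" for v
      using S1(2)[OF that] F(2)[of "fst v" "snd v"] that by (auto simp: mem_Times_iff)
    show "ball (0::complex) \<rho>1 \<times> (UNIV::complex set) \<noteq> {}" using \<rho> by auto
    show "ball (0::complex) \<rho>1 \<times> (UNIV::complex set) \<subseteq> {w. norm (d * fst w) < 1}"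
      using small_disc[OF nz(1,2)] by (auto simp: \<rho>1_def)
  qed (use that in \<open>auto intro: open_disc_times convex_disc_times open_Times\<close>)
  then show thesis using that F(1) by auto
qed

text \<open>Multiplied by both denominators, the two functions agree near the origin by
  \<open>Nser_dual\<close>; the identity theorem extends this to all points.\<close>

lemma psi_entire_dual:
  assumes p: "par a b c d t"
    and F: "holomorphic2_on F UNIV" "\<And>w. norm (d * fst w) < 1 \<Longrightarrow> F w * Q (q * fst w * (snd w)\<^sup>2 / d) = Nser a b c d t w"
    and F': "holomorphic2_on F' UNIV" "\<And>w. norm (a * d / t * fst w) < 1 \<Longrightarrow> F' w * Q (q * fst w * (snd w)\<^sup>2 / (a * d / t)) = Nser t (a * b / t) (a * c / t) (a * d / t) a w"
  shows "F (x, z) = F' (z, x)"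
proof -
  define dt where "dt = a * d / t"
  have nz: "a \<noteq> 0" "d \<noteq> 0" "t \<noteq> 0" "dt \<noteq> 0" using p by (auto simp: par_def dt_def)
  define \<rho>1 \<rho>2 where "\<rho>1 = 1 / norm d" and "\<rho>2 = 1 / norm dt"
  have \<rho>: "\<rho>1 > 0" "\<rho>2 > 0" using nz by (auto simp: \<rho>1_def \<rho>2_def)
  define B where "B = ball (0::complex) \<rho>1 \<times> ball (0::complex) \<rho>2"
  have B: "open B" "convex B" "(0, 0) \<in> B" unfolding B_def using \<rho> by (auto intro: open_Times convex_Times)
  define G where "G = (\<lambda>w :: complex \<times> complex. Q (q * fst w * (snd w)\<^sup>2 / d) * Q (q * snd w * (fst w)\<^sup>2 / dt))"
  have "holomorphic2_on (\<lambda>(x, z). F' (z, x)) {(x, z). (z, x) \<in> UNIV}" by (rule holomorphic2_swap[OF F'(1)])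
  then have h: "holomorphic2_on (\<lambda>w. F w - (\<lambda>(x, z). F' (z, x)) w) UNIV"
    by (intro holomorphic2_diff F(1)) (simp add: case_prod_unfold)
  have eq: "F w - (\<lambda>(x, z). F' (z, x)) w = 0" if "w \<in> B" for w
  proof (rule generic_identity[OF B(1) convex_connected[OF B(2)] B(3), of _ G])
    show "continuous_on UNIV G" unfolding G_def by (intro continuous_intros) (use nz in auto)
    fix X Z assume XZ: "(X, Z) \<in> B" "G (X, Z) \<noteq> 0"
    have u: "norm (d * X) < 1" "norm (dt * Z) < 1" using XZ(1) nz by (auto simp: B_def \<rho>1_def \<rho>2_def norm_mult field_simps)
    have s1: "F (X, Z) * Q (q * X * Z\<^sup>2 / d) = Nser a b c d t (X, Z)"
      using F(2)[of "(X, Z)"] u by simp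
    have s2: "F' (Z, X) * Q (q * Z * X\<^sup>2 / dt) = Nser t (a * b / t) (a * c / t) (a * d / t) a (Z, X)"
      using F'(2)[of "(Z, X)"] u unfolding dt_def by simp
    have "Nser a b c d t (X, Z) * Q (q * Z * X\<^sup>2 / dt) = Nser t (a * b / t) (a * c / t) (a * d / t) a (Z, X) * Q (q * X * Z\<^sup>2 / d)"
      using Nser_dual[OF p u(1) u(2)[unfolded dt_def]] unfolding dt_def .
    then have "F (X, Z) * G (X, Z) = F' (Z, X) * G (X, Z)"
      unfolding s1[symmetric] s2[symmetric] by (simp add: G_def mult_ac)
    then show "F (X, Z) - (\<lambda>(x, z). F' (z, x)) (X, Z) = 0" using XZ(2) by simp
  qed (use that holomorphic2_subset[OF h] in \<open>auto simp: G_def\<close>)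
  have "F (x, z) - (\<lambda>(x, z). F' (z, x)) (x, z) = 0"
    by (rule holomorphic2_identity_convex[OF h open_UNIV convex_UNIV B(1) _ subset_UNIV eq]) (use B(3) in auto)
  then show ?thesis by simp
qed

end

section \<open>Askey--Wilson parameters\<close>

locale aw =
  fixes P :: aw_params
  assumes re_tau: "Re (tau P) = 0" and im_tau: "Im (tau P) > 0" and step_pos: "step P > 0"
begin

text \<open>The number \<open>q ^ r\<close> for real \<open>r\<close>, as a real number. All
  parameters are such numbers up to sign, and the sign decides several genericity
  conditions.\<close>

definition er :: "real \<Rightarrow> real"
  where "er r = exp (- (2 * pi * Im (tau P) * r))"

lemma er_pos [simp]: "er r > 0" "er r \<noteq> 0"
  by (simp_all add: er_def)

lemma er_add: "er (r + s) = er r * er s"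
  unfolding er_def exp_add[symmetric] by (simp add: algebra_simps)

lemma er_diff: "er (r - s) = er r / er s"
  unfolding er_def exp_diff[symmetric] by (simp add: algebra_simps)

lemma er_zero [simp]: "er 0 = 1"
  by (simp add: er_def)

lemma tau_eq: "tau P = \<i> * of_real (Im (tau P))"
  using re_tau by (simp add: complex_eq_iff)

lemma qpw_add: "qpw P (x + y) = qpw P x * qpw P y"
  unfolding qpw_def exp_add[symmetric] by (simp add: algebra_simps)

lemma qpw_minus: "qpw P (- x) = 1 / qpw P x"
  by (simp add: qpw_def exp_minus field_simps)

lemma qpw_diff: "qpw P (x - y) = qpw P x / qpw P y"
  unfolding qpw_def exp_diff[symmetric] by (simp add: algebra_simps)

lemma qpw_nonzero [simp]: "qpw P x \<noteq> 0"
  by (simp add: qpw_def)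

lemma qpw_double: "qpw P (2 * x) = (qpw P x)\<^sup>2"
  unfolding mult_2 qpw_add power2_eq_square ..

lemma qpw_arg: "2 * of_real pi * \<i> * tau P * x = of_real (- (2 * pi * Im (tau P))) * x"
  by (subst tau_eq) (simp add: mult_ac)

lemma qpw_of_real: "qpw P (of_real r) = of_real (er r)"
  unfolding qpw_def er_def qpw_arg by (simp flip: exp_of_real)

lemma norm_qpw: "norm (qpw P x) = er (Re x)"
  unfolding qpw_def er_def qpw_arg by simp

lemma er_lt_1: "r > 0 \<Longrightarrow> er r < 1"
  using im_tau by (simp add: er_def)

lemma er_mono: "er r < er s \<longleftrightarrow> s < r"
  using im_tau by (simp add: er_def)

sublocale qbase "base P"
proof
  show "norm (base P) < 1" unfolding norm_qpw using er_lt_1 step_pos by simp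
qed simp

lemma qpw_holomorphic2: "holomorphic2_on f D \<Longrightarrow> holomorphic2_on (\<lambda>w. qpw P (f w)) D"
  by (rule holomorphic2_entire) (auto simp: qpw_def intro!: holomorphic_intros)

lemma qpw_surj: "y \<noteq> 0 \<Longrightarrow> \<exists>x. qpw P x = y"
proof -
  assume "y \<noteq> 0"
  then obtain w where "exp w = y" using exp_Ln by blast
  then show ?thesis using im_tau unfolding qpw_def qpw_arg
    by (intro exI[of _ "w / of_real (- (2 * pi * Im (tau P)))"]) simp
qed

text \<open>The triple \<open>(k, i, j)\<close> encodes \<open>k * X ^ i * Z ^ j\<close> with
  \<open>X = q ^ x\<close> and \<open>Z = q ^ z\<close>. With exponents as data, one density lemma
  serves every finite list of genericity conditions.\<close>

definition laurent_monomial :: "complex \<times> int \<times> int \<Rightarrow> complex \<times> complex \<Rightarrow> complex"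
  where "laurent_monomial m w = fst m * qpw P (of_int (fst (snd m)) * fst w + of_int (snd (snd m)) * snd w)"

lemma qgen_Q: "qgen (base P) y \<longleftrightarrow> y \<noteq> 0 \<and> Q y \<noteq> 0 \<and> Q (base P / y) \<noteq> 0"
proof
  assume "qgen (base P) y"
  then show "y \<noteq> 0 \<and> Q y \<noteq> 0 \<and> Q (base P / y) \<noteq> 0"
    using qgen_over_mult[OF qgen_over_swap[of y 1]] by (auto simp: Q_nonzero qgen_qfree qgen_def[of _ y])
next
  assume *: "y \<noteq> 0 \<and> Q y \<noteq> 0 \<and> Q (base P / y) \<noteq> 0"
  have "y * base P ^ m \<noteq> base P ^ n" for m n
  proof
    assume eq: "y * base P ^ m = base P ^ n"
    show False
    proof (cases "n \<le> m")
      case True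
      then have "base P ^ m = base P ^ (m - n) * base P ^ n" by (simp flip: power_add)
      with eq have "y * base P ^ (m - n) = 1" by simp
      with * show False by (auto simp: Q_eq_0_iff qfree_def)
    next
      case False
      then have "n = (n - m - 1) + 1 + m" by simp
      then have "base P ^ n = base P ^ (n - m - 1) * base P * base P ^ m" by (metis power_add power_one_right)
      with eq have "y = base P ^ (n - m - 1) * base P" by simp
      then have "base P / y * base P ^ (n - m - 1) = 1" using * by (simp add: field_simps)
      with * show False by (auto simp: Q_eq_0_iff qfree_def)
    qed
  qed
  with * show "qgen (base P) y" by (simp add: qgen_def)
qed

definition generic_at :: "(complex \<times> int \<times> int) list \<Rightarrow> (complex \<times> complex) set"
  where "generic_at L = {w. \<forall>m\<in>set L. qgen (base P) (laurent_monomial m w)}"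

text \<open>Each condition is the non-vanishing of one entire function \<open>H\<close>. This
  function is not identically zero, because a non-constant monomial takes the value
  \<open>q ^ (s / 2)\<close>, which lies strictly between two powers of the base.\<close>

lemma generic_at_open_dense:
  assumes "\<And>k i j. (k, i, j) \<in> set L \<Longrightarrow> k \<noteq> 0 \<and> (i \<noteq> 0 \<or> j \<noteq> 0)"
  shows "open (generic_at L)" "closure (generic_at L) = UNIV"
proof -
  have "open (generic_at L) \<and> UNIV \<subseteq> closure (generic_at L)"
    using assms
  proof (induction L)
    case Nil
    then show ?case by (simp add: generic_at_def)
  next
    case (Cons m L)
    obtain k i j where m: "m = (k, i, j)" by (cases m) auto
    have k: "k \<noteq> 0" "i \<noteq> 0 \<or> j \<noteq> 0" using Cons.prems[of k i j] m by auto
    define H where "H = (\<lambda>w. Q (laurent_monomial m w) * Q (base P / k * qpw P (- (of_int i * fst w + of_int j * snd w))))"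
    have hH: "holomorphic2_on H UNIV" unfolding H_def laurent_monomial_def
      by (intro holomorphic2_mult holomorphic2_Q qpw_holomorphic2 holomorphic2_intros)
    have Hiff: "H w \<noteq> 0 \<longleftrightarrow> qgen (base P) (laurent_monomial m w)" for w
      using k unfolding H_def qgen_Q qpw_minus by (simp add: laurent_monomial_def m)
    obtain x where x: "qpw P x = of_real (er (step P / 2)) / k" using qpw_surj[of "of_real (er (step P / 2)) / k"] k by auto
    have "\<exists>w. of_int i * fst w + of_int j * snd w = x"
    proof (cases "i = 0")
      case True
      then show ?thesis using k by (intro exI[of _ "(0, x / of_int j)"]) simp
    next
      case False
      then show ?thesis by (intro exI[of _ "(x / of_int i, 0)"]) simp
    qed
    then obtain w where w: "of_int i * fst w + of_int j * snd w = x" by blast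
    have w: "laurent_monomial m w = of_real (er (step P / 2))" unfolding laurent_monomial_def m fst_conv snd_conv w x using k by simp
    have pw: "base P ^ n = of_real (er (real n * step P))" for n
    proof (induction n)
      case (Suc n)
      then show ?case by (simp add: qpw_of_real er_add distrib_right flip: of_real_mult)
    qed simp
    have "qgen (base P) (laurent_monomial m w)"
      unfolding qgen_def w
    proof (intro conjI allI notI)
      fix m n assume "complex_of_real (er (step P / 2)) * base P ^ m = base P ^ n"
      then have "er (step P / 2 + real m * step P) = er (real n * step P)"
        unfolding pw er_add by (metis of_real_eq_iff of_real_mult)
      then have "step P / 2 + real m * step P = real n * step P" using im_tau by (simp add: er_def)
      then have "(1 / 2 + real m) * step P = real n * step P" by (simp add: algebra_simps)
      then have "1 / 2 + real m = real n" using step_pos by simp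
      then have "1 + 2 * int m = 2 * int n" by linarith
      then show False by presburger
    qed simp
    then have "H w \<noteq> 0" using Hiff by blast
    then have "open {w\<in>UNIV. H w \<noteq> 0}" "UNIV \<subseteq> closure {w\<in>UNIV. H w \<noteq> 0}"
      using holomorphic2_nonzero_dense[OF hH open_UNIV connected_UNIV UNIV_I] by blast+
    moreover have "generic_at (m # L) = {w\<in>UNIV. H w \<noteq> 0} \<inter> generic_at L" by (auto simp: generic_at_def Hiff)
    moreover have "open (generic_at L)" "UNIV \<subseteq> closure (generic_at L)" using Cons.IH Cons.prems by auto
    ultimately show ?case using dense_Int[of "{w\<in>UNIV. H w \<noteq> 0}" "generic_at L" UNIV] by (metis open_Int subset_UNIV)
  qed
  then show "open (generic_at L)" "closure (generic_at L) = UNIV" by auto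
qed

end

lemma dense_open_Int:
  fixes D G :: "'a::topological_space set"
  assumes "open D" "closure G = UNIV"
  shows "D \<subseteq> closure (D \<inter> G)"
  using open_Int_closure_subset[OF assms(1), of G] assms(2) by simp

section \<open>Theta functions and relations between the parameters\<close>

lemma qpoch_inf_Nil [simp]: "qpoch_inf [] p = 1"
  by (simp add: qpoch_inf_def)

lemma qpoch_inf_Cons [simp]: "qpoch_inf (a # as) p = qinf p a * qpoch_inf as p"
  by (simp add: qpoch_inf_def qinf_def)

lemma dual_simps [simp]:
  "tau (dual P) = tau P" "step (dual P) = step P" "kap (dual P) = kap P" "lam (dual P) = ups P" "ups (dual P) = lam P"
  "vsig (dual P) = vsig P" "dual (dual P) = P"
  by (simp_all add: dual_def)

lemma qpw_dual [simp]: "qpw (dual P) = qpw P"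
  by (simp add: qpw_def fun_eq_iff)

context qbase
begin

definition th :: "complex \<Rightarrow> complex"
  where "th u = Q u * Q (q / u)"

lemma theta_Nil [simp]: "theta [] q = 1"
  by (simp add: theta_def)

lemma theta_Cons [simp]: "theta (u # us) q = th u * theta us q"
  by (simp add: theta_def th_def)

lemma th_swap:
  assumes "x * y = q"
  shows "th x = th y"
proof -
  have "x \<noteq> 0" "y \<noteq> 0" using assms q_nonzero by auto
  then have "q / x = y" "q / y = x" using assms by (metis nonzero_mult_div_cancel_left, metis nonzero_mult_div_cancel_right)
  then show ?thesis by (simp add: th_def)
qed

lemma th_mult:
  assumes "x \<noteq> 0"
  shows "th (x * q) = - th x / x"
proof -
  have "Q (1 / x) = (1 - 1 / x) * Q (q / x)" using Q_split1[of "1 / x"] by simp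
  moreover have "1 - x = - x * (1 - 1 / x)" using assms by (simp add: field_simps)
  moreover have "q / (x * q) = 1 / x" using q_nonzero by simp
  ultimately show ?thesis using assms unfolding th_def Q_split1[of x] by simp
qed

lemma th_inverse: "x \<noteq> 0 \<Longrightarrow> th (1 / x) = - th x / x"
  using th_mult[of x] th_swap[of "1 / x" "x * q"] by simp

lemma holomorphic2_th:
  assumes "holomorphic2_on f D" "\<And>w. w \<in> D \<Longrightarrow> f w \<noteq> 0"
  shows "holomorphic2_on (\<lambda>w. th (f w)) D"
  unfolding th_def by (intro holomorphic2_mult holomorphic2_Q holomorphic2_divide holomorphic2_const assms)

end

context aw
begin

lemma aw_dual: "aw (dual P)"
  using re_tau im_tau step_pos by unfold_locales auto

abbreviation "aa \<equiv> aw_a P"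
abbreviation "bb \<equiv> aw_b P"
abbreviation "cc \<equiv> aw_c P"
abbreviation "dd \<equiv> aw_d P"
abbreviation "tt \<equiv> aw_a (dual P)"
abbreviation "pp \<equiv> base P"

lemma er_half: "er (step P) = (er (step P / 2))\<^sup>2"
  unfolding power2_eq_square er_add[symmetric] by simp

lemma params: "aa = of_real (er (kap P) * er (lam P))" "bb = - of_real (er (kap P) / er (lam P))"
  "cc = of_real (er (step P / 2) * er (ups P) * er (vsig P))" "dd = - of_real (er (step P / 2) * er (ups P) / er (vsig P))"
  "tt = of_real (er (kap P) * er (ups P))" "pp = of_real ((er (step P / 2))\<^sup>2)"
  "aw_b (dual P) = - of_real (er (kap P) / er (ups P))"
  "aw_c (dual P) = of_real (er (step P / 2) * er (lam P) * er (vsig P))"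
  "aw_d (dual P) = - of_real (er (step P / 2) * er (lam P) / er (vsig P))"
  unfolding aw_a_def aw_b_def aw_c_def aw_d_def by (simp_all add: qpw_of_real er_add er_diff er_half del: of_real_add of_real_diff)

text \<open>The dual parameters in the shape required by \<open>par_dual\<close>, so that everything
  can be computed with \<open>aa, bb, cc, dd, tt\<close>.\<close>

lemma dual_params: "aw_b (dual P) = aa * bb / tt" "aw_c (dual P) = aa * cc / tt" "aw_d (dual P) = aa * dd / tt"
  unfolding params by (simp_all flip: of_real_mult of_real_divide)

lemma params_nz [simp]: "aa \<noteq> 0" "bb \<noteq> 0" "cc \<noteq> 0" "dd \<noteq> 0" "tt \<noteq> 0"
  unfolding params by simp_all

lemma par_aw: "par aa bb cc dd tt"
proof -
  have "aa * bb * cc * dd = pp * tt\<^sup>2"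
    unfolding params by (simp add: field_simps power2_eq_square)
  then show ?thesis by (simp add: par_def)
qed

lemma par_rel: "pp * tt\<^sup>2 = aa * bb * cc * dd"
  using par_aw by (simp add: par_def)

lemma base_pow: "pp ^ n = of_real (er (real n * step P))"
proof (induction n)
  case (Suc n)
  then show ?case by (simp add: qpw_of_real er_add distrib_right)
qed simp

lemma qgen_neg: "r < 0 \<Longrightarrow> qgen pp (of_real r)"
  unfolding qgen_def
proof (intro conjI allI notI)
  fix m n assume r: "r < 0" and "of_real r * pp ^ m = pp ^ n"
  then have "r * er (real m * step P) = er (real n * step P)" unfolding base_pow by (metis of_real_eq_iff of_real_mult)
  then show False using r er_pos mult_neg_pos[OF r] by (metis less_asym)
qed auto

lemma params_generic: "aa * pp ^ m \<noteq> dd * pp ^ n" "tt * pp ^ m \<noteq> aa * dd / tt * pp ^ n"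
proof -
  have "aa / dd = of_real (- (er (kap P) * er (lam P) / (er (step P / 2) * er (ups P) / er (vsig P))))"
    "tt / (aa * dd / tt) = of_real (- (er (kap P) * er (ups P) / (er (step P / 2) * er (lam P) / er (vsig P))))"
    unfolding dual_params[symmetric] params by simp_all
  then have "qgen pp (aa / dd)" "qgen pp (tt / (aa * dd / tt))"
    by (auto intro!: qgen_neg divide_pos_pos mult_pos_pos simp del: of_real_minus)
  then show "aa * pp ^ m \<noteq> dd * pp ^ n" "tt * pp ^ m \<noteq> aa * dd / tt * pp ^ n"
    by (auto simp: qgen_def field_simps)
qed

section \<open>Identification of \<open>Psi\<close> with an entire function of \<open>X\<close> and
  \<open>Z\<close>\<close>

definition psi :: "complex \<times> complex \<Rightarrow> complex"
  where "psi = (SOME F. holomorphic2_on F UNIV \<and>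
    (\<forall>w. norm (dd * fst w) < 1 \<longrightarrow> F w * Q (pp * fst w * (snd w)\<^sup>2 / dd) = Nser aa bb cc dd tt w))"

lemma psi: "holomorphic2_on psi UNIV" "norm (dd * fst w) < 1 \<Longrightarrow> psi w * Q (pp * fst w * (snd w)\<^sup>2 / dd) = Nser aa bb cc dd tt w"
proof -
  have "\<exists>F. holomorphic2_on F UNIV \<and> (\<forall>w. norm (dd * fst w) < 1 \<longrightarrow> F w * Q (pp * fst w * (snd w)\<^sup>2 / dd) = Nser aa bb cc dd tt w)"
    by (rule psi_entire[OF par_aw params_generic]) blast
  from someI_ex[OF this, folded psi_def]
  show "holomorphic2_on psi UNIV" "norm (dd * fst w) < 1 \<Longrightarrow> psi w * Q (pp * fst w * (snd w)\<^sup>2 / dd) = Nser aa bb cc dd tt w"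
    by blast+
qed

lemma psi_dual: "aw.psi (dual P) (z, x) = psi (x, z)"
proof (rule psi_entire_dual[OF par_aw psi, symmetric])
  note * = aw.psi[OF aw_dual, simplified dual_params qpw_dual dual_simps]
  show "holomorphic2_on (aw.psi (dual P)) UNIV" by (rule *(1))
  show "aw.psi (dual P) w * Q (pp * fst w * (snd w)\<^sup>2 / (aa * dd / tt)) = Nser tt (aa * bb / tt) (aa * cc / tt) (aa * dd / tt) aa w"
    if "norm (aa * dd / tt * fst w) < 1" for w using *(2)[OF that] .
qed

lemma generic_at_qgen:
  assumes "(x, z) \<in> generic_at L" "(k, i, j) \<in> set L" "y = k * (qpw P x powi i) * (qpw P z powi j)"
  shows "qgen pp y"
proof -
  have "qpw P (of_int i * u) = qpw P u powi i" for u i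
    unfolding qpw_def exp_power_int by (simp add: mult_ac)
  then have "laurent_monomial (k, i, j) (x, z) = y" by (simp add: laurent_monomial_def qpw_add assms(3))
  then show ?thesis using assms(1,2) by (force simp: generic_at_def)
qed

text \<open>The base parameter and the five lower parameters of the series in
  \<open>Psi_series\<close>, the quantities restricted in \<open>Nser_w8s\<close>.\<close>

definition psi_monomials :: "(complex \<times> int \<times> int) list"
  where "psi_monomials = [(pp / dd, 1, 2), (pp * tt / dd, 1, 1), (pp * aa / tt, 1, 1), (pp * cc / tt, 1, 1), (pp * bb / tt, 1, 1), (pp, 0, 2)]"

lemma Psi_series_psi:
  assumes u: "norm (dd * qpw P x) < 1" and g: "(x, z) \<in> generic_at psi_monomials"
  shows "Psi_series P x z = psi (qpw P x, qpw P z)"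
proof -
  define X Z where "X = qpw P x" and "Z = qpw P z"
  have nz: "X \<noteq> 0" "Z \<noteq> 0" by (simp_all add: X_def Z_def)
  have gg: "qgen pp (pp * X * Z\<^sup>2 / dd)" "qgen pp (pp * X * Z * tt / dd)" "qgen pp (pp * X * Z * aa / tt)"
    "qgen pp (pp * X * Z * cc / tt)" "qgen pp (pp * X * Z * bb / tt)" "qgen pp (pp * Z\<^sup>2)"
    by (rule generic_at_qgen[OF g, of "pp / dd" 1 2], simp add: psi_monomials_def, simp add: X_def Z_def)
       (rule generic_at_qgen[OF g, of "pp * tt / dd" 1 1], simp add: psi_monomials_def, simp add: X_def Z_def,
        rule generic_at_qgen[OF g, of "pp * aa / tt" 1 1], simp add: psi_monomials_def, simp add: X_def Z_def,
        rule generic_at_qgen[OF g, of "pp * cc / tt" 1 1], simp add: psi_monomials_def, simp add: X_def Z_def,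
        rule generic_at_qgen[OF g, of "pp * bb / tt" 1 1], simp add: psi_monomials_def, simp add: X_def Z_def,
        rule generic_at_qgen[OF g, of "pp" 0 2], simp add: psi_monomials_def, simp add: X_def Z_def)
  note fr = gg[THEN qgen_qfree]
  define \<alpha> where "\<alpha> = pp * X * Z\<^sup>2 / dd"
  have \<alpha>0: "\<alpha> \<noteq> 0" using nz by (simp add: \<alpha>_def)
  have Q0: "Q \<alpha> \<noteq> 0" using fr(1) by (simp add: Q_nonzero \<alpha>_def)
  have Q1: "Q \<alpha> = (1 - \<alpha>) * Q (pp * \<alpha>)" using Q_split1[of \<alpha>] by (simp add: mult_ac)
  define w where "w = w8s \<alpha> (pp * Z / tt) (pp * Z * tt / (aa * dd)) (aa * bb / tt * Z) (aa * cc / tt * Z) (pp * X / dd)"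
  have 1: "psi (X, Z) * Q \<alpha> = Q (dd * X) * ((1 - \<alpha>) * (Q (pp * X * Z * tt / dd) * Q (pp * X * Z * aa / tt) * Q (pp * X * Z * cc / tt) *
     Q (pp * X * Z * bb / tt) * Q (pp * Z\<^sup>2)) * w)"
    using psi(2)[of "(X, Z)"] Nser_w8s[OF par_aw nz _ fr] u by (simp add: \<alpha>_def w_def X_def)
  have uu: "dd * X = \<alpha>\<^sup>2 * pp\<^sup>2 / (pp * Z / tt * (pp * Z * tt / (aa * dd)) * (aa * bb / tt * Z) * (aa * cc / tt * Z) * (pp * X / dd))"
  proof -
    have "\<alpha>\<^sup>2 * pp\<^sup>2 / (pp * Z / tt * (pp * Z * tt / (aa * dd)) * (aa * bb / tt * Z) * (aa * cc / tt * Z) * (pp * X / dd))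
      = pp * tt\<^sup>2 * X / (aa * bb * cc)"
      using nz unfolding \<alpha>_def by (simp add: field_simps power2_eq_square)
    then show ?thesis unfolding par_rel by simp
  qed
  have W: "W87 \<alpha> [pp * Z / tt, pp * Z * tt / (aa * dd), aa * bb / tt * Z, aa * cc / tt * Z, pp * X / dd] pp (dd * X) = w"
    unfolding w_def by (rule W87_w8s[OF \<alpha>0 uu])
  have e: "qpw P (2 * of_real (step P) + x + 2 * z) / dd = pp * \<alpha>" "qpw P (of_real (step P) + x + 2 * z) / dd = \<alpha>"
    "qpw P (of_real (step P) + z) / tt = pp * Z / tt" "qpw P (of_real (step P) + z) / aw_d (dual P) = pp * Z * tt / (aa * dd)"
    "qpw P (of_real (step P) + x) / dd = pp * X / dd" "aw_b (dual P) * qpw P z = aa * bb / tt * Z" "aw_c (dual P) * qpw P z = aa * cc / tt * Z"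
    "dd * qpw P x = dd * X" "qpw P (of_real (step P) + x + z) * y / y' = pp * X * Z * y / y'"
    "qpw P (of_real (step P) + 2 * z) = pp * Z\<^sup>2" for y y'
    by (simp_all add: qpw_add qpw_double \<alpha>_def X_def Z_def dual_params power2_eq_square)
  have "Psi_series P x z = Q (pp * X * Z * aa / tt) * (Q (pp * X * Z * bb / tt) * (Q (pp * X * Z * cc / tt) *
     (Q (pp * X * Z * tt / dd) * (Q (pp * Z\<^sup>2) * Q (dd * X))))) / Q (pp * \<alpha>) * w"
    unfolding Psi_series_def Let_def e W by simp
  also have "\<dots> = psi (X, Z)"
  proof -
    have "1 - \<alpha> \<noteq> 0" "Q (pp * \<alpha>) \<noteq> 0" using Q0 Q1 by (metis mult_zero_left, metis mult_zero_right)
    have "(1 - \<alpha>) * (psi (X, Z) * Q (pp * \<alpha>)) = (1 - \<alpha>) * (Q (pp * X * Z * aa / tt) * (Q (pp * X * Z * bb / tt) * (Q (pp * X * Z * cc / tt) *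
     (Q (pp * X * Z * tt / dd) * (Q (pp * Z\<^sup>2) * Q (dd * X))))) * w)" using 1 unfolding Q1 by (simp only: mult_ac)
    then show ?thesis using \<open>1 - \<alpha> \<noteq> 0\<close> \<open>Q (pp * \<alpha>) \<noteq> 0\<close> by (simp only: mult_cancel_left) (simp add: divide_simps)
  qed
  finally show ?thesis by (simp add: X_def Z_def)
qed

lemma psi_monomials_dense: "open (generic_at psi_monomials)" "closure (generic_at psi_monomials) = UNIV"
  by (rule generic_at_open_dense; auto simp: psi_monomials_def)+

lemma psi_holomorphic: "holomorphic2_on f D \<Longrightarrow> holomorphic2_on g D \<Longrightarrow> holomorphic2_on (\<lambda>w. psi (f w, g w)) D"
  by (rule holomorphic2_pair[OF psi(1)]) auto

text \<open>The description in \<open>Psi\<close> has exactly one solution: two entire functions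
  that agree with the series on open dense subsets of the half-space agree on the intersection of
  these sets, which is non-empty and open.\<close>

lemma Psi_eq: "Psi P x z = psi (qpw P x, qpw P z)"
proof -
  define G where "G = (\<lambda>w. psi (qpw P (fst w), qpw P (snd w)))"
  let ?H = "{(x, z). norm (dd * qpw P x) < 1} :: (complex \<times> complex) set"
  let ?S = "\<lambda>(x, z). Psi_series P x z"
  have G: "holomorphic2_on G UNIV" unfolding G_def by (intro psi_holomorphic qpw_holomorphic2 holomorphic2_intros)
  have "continuous_on UNIV (\<lambda>w :: complex \<times> complex. norm (dd * qpw P (fst w)))"
    by (intro continuous_intros holomorphic2_imp_continuous qpw_holomorphic2 holomorphic2_intros)
  then have "open {w :: complex \<times> complex. norm (dd * qpw P (fst w)) < 1}" by (rule open_Collect_less[OF _ continuous_on_const])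
  then have H: "open ?H" by (simp add: case_prod_unfold)
  have H0: "?H \<noteq> {}"
  proof -
    obtain x where "qpw P x = 1 / (2 * dd)" using qpw_surj[of "1 / (2 * dd)"] by auto
    then have "(x, 0) \<in> ?H" by (simp add: norm_divide)
    then show ?thesis by blast
  qed
  have mG: "mero_eq_on ?H G ?S"
    unfolding mero_eq_on_def
  proof (rule exI[of _ "?H \<inter> generic_at psi_monomials"], intro conjI ballI)
    show "?H \<subseteq> closure (?H \<inter> generic_at psi_monomials)" by (rule dense_open_Int[OF H psi_monomials_dense(2)])
    show "G v = ?S v" if "v \<in> ?H \<inter> generic_at psi_monomials" for v
      using that Psi_series_psi[of "fst v" "snd v"] by (auto simp: G_def)
  qed (use H psi_monomials_dense in auto)
  have "(THE F. holomorphic2_on F UNIV \<and> mero_eq_on ?H F ?S) = G"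
  proof (rule the_equality)
    show "holomorphic2_on G UNIV \<and> mero_eq_on ?H G ?S" using G mG by blast
  next
    fix F assume F: "holomorphic2_on F UNIV \<and> mero_eq_on ?H F ?S"
    obtain V1 where V1: "open V1" "V1 \<subseteq> ?H" "?H \<subseteq> closure V1" "\<And>v. v \<in> V1 \<Longrightarrow> F v = ?S v" using F unfolding mero_eq_on_def by blast
    obtain V2 where V2: "open V2" "V2 \<subseteq> ?H" "?H \<subseteq> closure V2" "\<And>v. v \<in> V2 \<Longrightarrow> G v = ?S v" using mG unfolding mero_eq_on_def by blast
    have "?H \<subseteq> closure (V1 \<inter> V2)" by (rule dense_Int) fact+
    then have ne: "V1 \<inter> V2 \<noteq> {}" using H0 by auto
    have "F w - G w = 0" for w
      by (rule holomorphic2_identity_convex[where D = UNIV and V = "V1 \<inter> V2"])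
        (use F G V1 V2 ne in \<open>auto intro: holomorphic2_diff\<close>)
    then show "F = G" by (simp add: fun_eq_iff)
  qed
  then show ?thesis unfolding Psi_def by (simp add: G_def)
qed

definition st :: "complex \<Rightarrow> complex"
  where "st X = Q (pp * X / aa) * Q (pp * X / bb) * Q (pp * X / cc) * Q (pp * X / dd)"

definition st' :: "complex \<Rightarrow> complex"
  where "st' Z = Q (pp * Z / tt) * Q (pp * Z * tt / (aa * bb)) * Q (pp * Z * tt / (aa * cc)) * Q (pp * Z * tt / (aa * dd))"

text \<open>\<open>c_num / c_den\<close> is the c-function without its factor \<open>1 / W\<close>,
  which cancels against the \<open>W\<close> in \<open>Phi\<close>. So \<open>Phi_ren\<close> is a
  function of \<open>X\<close> and \<open>Z\<close> alone.\<close>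

definition c_num :: "complex \<Rightarrow> complex \<Rightarrow> complex"
  where "c_num X Z = th (tt / Z) * th (aa * bb / (tt * Z)) * th (aa * cc / (tt * Z)) * th (dd * X / (tt * Z))"

definition c_den :: "complex \<Rightarrow> complex \<Rightarrow> complex"
  where "c_den X Z = th (1 / Z\<^sup>2) * th (dd * X)"

lemma St_eq: "St P x = st (qpw P x)" "St (dual P) z = st' (qpw P z)"
  by (simp_all add: St_def st_def st'_def Let_def qpw_add dual_params mult_ac)

lemma W_fun_nonzero [simp]: "W_fun P x z \<noteq> 0"
  by (simp add: W_fun_def)

lemma W_fun_dual: "W_fun (dual P) z x = W_fun P x z"
  by (simp add: W_fun_def mult_ac)

lemma c_fun_eq: "c_fun P x z = c_num (qpw P x) (qpw P z) / (W_fun P x z * c_den (qpw P x) (qpw P z))"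
proof -
  have "qpw P (- 2 * z) = 1 / (qpw P z)\<^sup>2" "qpw P (- z) = 1 / qpw P z"
    using qpw_minus[of "2 * z"] qpw_double[of z] by (simp_all add: qpw_minus)
  then show ?thesis unfolding c_fun_def Let_def by (simp add: c_num_def c_den_def qpw_diff dual_params mult_ac)
qed

lemma Phi_ren_eq: "Phi_ren P x z = c_num (qpw P x) (qpw P z) * psi (qpw P x, qpw P z) /
    (c_den (qpw P x) (qpw P z) * (st (qpw P x) * st' (qpw P z)))"
  unfolding Phi_ren_def Phi_def c_fun_eq St_eq Psi_eq by (simp add: field_simps)

text \<open>\<open>W\<close>, the product \<open>St (dual P) z * St P x\<close> and
  \<open>psi\<close> are each preserved when the parameters are dualized and the variables
  exchanged. Self-duality of \<open>Phi_ren\<close> is therefore a matter of \<open>c_fun\<close>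
  alone.\<close>

lemma Phi_dual: "Phi (dual P) z x = Phi P x z"
  using aw.Psi_eq[OF aw_dual] by (simp add: Phi_def W_fun_dual Psi_eq psi_dual mult_ac)

section \<open>The three-term relation for Askey--Wilson parameters\<close>

text \<open>The non-vanishing conditions of the following computations, collected once.
  \<open>expansion_monomials\<close> encodes the same arguments in the same order, for the density
  statement.\<close>

definition generic :: "complex \<Rightarrow> complex \<Rightarrow> bool"
  where "generic X Z \<longleftrightarrow> X \<noteq> 0 \<and> Z \<noteq> 0 \<and>
    qgen pp (pp * X * Z\<^sup>2 / dd) \<and> qgen pp (Z\<^sup>2) \<and> qgen pp (X * Z * tt / dd) \<and> qgen pp (X * Z * aa / tt) \<and>
    qgen pp (X / aa) \<and> qgen pp (X * aa / pp) \<and> qgen pp (pp * Z / tt) \<and> qgen pp (pp * Z * tt / (aa * dd)) \<and>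
    qgen pp (aa * Z * tt / dd) \<and> qgen pp (X * dd / (pp * tt * Z)) \<and> qgen pp (aa * tt / (dd * Z)) \<and> qgen pp (tt * Z / pp) \<and>
    qgen pp (pp\<^sup>2 / (dd * X)) \<and> qgen pp (pp * aa * Z\<^sup>2 / dd) \<and> qgen pp (pp * X * Z * tt / dd) \<and> qgen pp (pp * X * Z * aa / tt) \<and>
    qgen pp (pp * X * Z * cc / tt) \<and> qgen pp (pp * X * Z * bb / tt) \<and> qgen pp (pp * Z\<^sup>2) \<and> qgen pp (aa * bb / (tt * Z)) \<and>
    qgen pp (aa * cc / (tt * Z)) \<and> qgen pp (dd * X) \<and> qgen pp (pp * Z * tt / (aa * bb)) \<and> qgen pp (pp * Z * tt / (aa * cc)) \<and>
    qgen pp (pp * X / aa) \<and> qgen pp (pp * X / bb) \<and> qgen pp (pp * X / cc) \<and> qgen pp (pp * X / dd) \<and>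
    qgen pp (pp * tt * Z / (dd * X)) \<and> qgen pp (tt / Z) \<and> qgen pp (dd * X / (tt * Z)) \<and> qgen pp (1 / Z\<^sup>2)"

definition expansion_monomials :: "(complex \<times> int \<times> int) list"
  where "expansion_monomials = [
    (pp / dd, 1, 2), (1, 0, 2), (tt / dd, 1, 1), (aa / tt, 1, 1), (1 / aa, 1, 0), (aa / pp, 1, 0),
    (pp / tt, 0, 1), (pp * tt / (aa * dd), 0, 1), (aa * tt / dd, 0, 1), (dd / (pp * tt), 1, -1), (aa * tt / dd, 0, -1), (tt / pp, 0, 1),
    (pp\<^sup>2 / dd, -1, 0), (pp * aa / dd, 0, 2), (pp * tt / dd, 1, 1), (pp * aa / tt, 1, 1), (pp * cc / tt, 1, 1), (pp * bb / tt, 1, 1),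
    (pp, 0, 2), (aa * bb / tt, 0, -1), (aa * cc / tt, 0, -1), (dd, 1, 0), (pp * tt / (aa * bb), 0, 1), (pp * tt / (aa * cc), 0, 1),
    (pp / aa, 1, 0), (pp / bb, 1, 0), (pp / cc, 1, 0), (pp / dd, 1, 0), (pp * tt / dd, -1, 1), (tt, 0, -1),
    (dd / tt, 1, -1), (1, 0, -2)]"

lemma generic_if_generic_at:
  assumes "(x, z) \<in> generic_at expansion_monomials"
  shows "generic (qpw P x) (qpw P z)"
proof -
  have *: "qgen pp (k * (qpw P x powi i) * (qpw P z powi j))" if "(k, i, j) \<in> set expansion_monomials" for k i j
    by (rule generic_at_qgen[OF assms that refl])
  have "\<forall>(k, i, j) \<in> set expansion_monomials. qgen pp (k * (qpw P x powi i) * (qpw P z powi j))"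
    using * by blast
  then show ?thesis unfolding generic_def expansion_monomials_def
    by (simp add: power_int_minus divide_inverse power_inverse mult_ac)
qed

lemma cc_eq: "cc = pp * tt\<^sup>2 / (aa * bb * dd)"
  unfolding par_rel by simp

lemma params_neg: "qgen pp (dd / (pp * aa))" "qgen pp (pp * aa / dd)" "qgen pp (aa * bb)"
proof -
  let ?r = "er (step P / 2) * er (ups P) / er (vsig P)"
  have "dd / (pp * aa) = of_real (- (?r / ((er (step P / 2))\<^sup>2 * (er (kap P) * er (lam P)))))"
    "pp * aa / dd = of_real (- ((er (step P / 2))\<^sup>2 * (er (kap P) * er (lam P)) / ?r))"
    "aa * bb = of_real (- ((er (kap P) * er (lam P)) * (er (kap P) / er (lam P))))"
    unfolding params by (simp_all del: er_pos add: divide_simps)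
  then show "qgen pp (dd / (pp * aa))" "qgen pp (pp * aa / dd)" "qgen pp (aa * bb)"
    by (auto intro!: qgen_neg divide_pos_pos mult_pos_pos zero_less_power simp del: of_real_minus)
qed

text \<open>Among the quotients in \<open>tt_gen\<close>,
  \<open>a / (b * F) = dd / (pp * aa)\<close> is a constant and is generic because it is negative;
  the others are listed in \<open>generic\<close>.\<close>

lemma generic_tt:
  assumes "generic X Z"
  shows "tt_gen (pp * X * Z\<^sup>2 / dd) (pp * X / dd) (pp * Z / tt) (pp * Z * tt / (aa * dd)) (pp * aa * Z\<^sup>2 / dd)"
proof -
  define a b c d F where "a = pp * X * Z\<^sup>2 / dd" and "b = pp * X / dd" and "c = pp * Z / tt" and "d = pp * Z * tt / (aa * dd)"
    and "F = pp * aa * Z\<^sup>2 / dd"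
  note g = assms[unfolded generic_def]
  have nz: "X \<noteq> 0" "Z \<noteq> 0" using g by auto
  note defs = a_def b_def c_def d_def F_def
  have e: "a / b = Z\<^sup>2" "a / c = X * Z * tt / dd" "a / d = X * Z * aa / tt" "a / F = X / aa" "a / (c * d) = X * aa / pp"
    "a / (b * F) = dd / (pp * aa)" "F / c = aa * Z * tt / dd" "a / (d * F) = X * dd / (pp * tt * Z)"
    using nz by (simp_all add: defs field_simps power2_eq_square)
  have "tt_gen a b c d F"
    unfolding tt_gen_def e using g params_neg nz by (auto simp: defs)
  then show ?thesis unfolding defs .
qed

text \<open>The left-hand side of the three-term relation under the specialization of
  \<open>expansion\<close>. Multiplied by the products in \<open>ren_coeff\<close> it is the
  renormalized eigenfunction (\<open>ren_quotient_series\<close>).\<close>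

definition ren_series :: "complex \<Rightarrow> complex \<Rightarrow> complex"
  where "ren_series X Z = ttL (pp * X * Z\<^sup>2 / dd) (pp * X / dd) (pp * Z / tt) (pp * Z * tt / (aa * dd)) (pp * aa * Z\<^sup>2 / dd) (aa * bb * Z / tt)"

definition ren_coeff :: "complex \<Rightarrow> complex \<Rightarrow> complex"
  where "ren_coeff X Z = Q (tt / Z) * Q (dd * X / (tt * Z)) * Q (pp * tt * Z / (dd * X)) * Q (pp * X * Z * tt / dd) * Q (pp * X * Z * aa / tt) /
    (Q (1 / Z\<^sup>2) * Q (pp / (dd * X)) * st X * Q (pp * Z * tt / (aa * dd)) * Q (pp * (pp * X * Z\<^sup>2 / dd)))"

lemma Q_generic: "qgen pp y \<Longrightarrow> Q y \<noteq> 0" "qgen pp y \<Longrightarrow> Q (pp / y) \<noteq> 0" "qgen pp y \<Longrightarrow> Q (pp * y) \<noteq> 0"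
  using qgen_mult1[of y] by (auto simp: qgen_Q mult_ac)

lemma st_nonzero: "generic X Z \<Longrightarrow> st X \<noteq> 0"
  unfolding generic_def st_def by (simp add: Q_generic)

lemma ren_series_psi:
  assumes g: "generic X Z" and u: "norm (dd * X) < 1"
  shows "ren_series X Z * (Q (dd * X) * Q (pp * X * Z * tt / dd) * Q (pp * X * Z * aa / tt) * Q (pp * Z\<^sup>2)) =
     Q (aa * bb / (tt * Z)) * Q (aa * cc / (tt * Z)) * psi (X, Z) * Q (pp * (pp * X * Z\<^sup>2 / dd))"
proof -
  define \<alpha> b c d e f where "\<alpha> = pp * X * Z\<^sup>2 / dd" and "b = pp * X / dd" and "c = pp * Z / tt" and "d = pp * Z * tt / (aa * dd)"
    and "e = aa * bb / tt * Z" and "f = aa * cc / tt * Z"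
  note defs = \<alpha>_def b_def c_def d_def e_def f_def
  have nz: "X \<noteq> 0" "Z \<noteq> 0" using g by (auto simp: generic_def)
  have gs: "qgen pp (pp * X * Z\<^sup>2 / dd)" "qgen pp (pp * X * Z * tt / dd)" "qgen pp (pp * X * Z * aa / tt)"
    "qgen pp (pp * X * Z * cc / tt)" "qgen pp (pp * X * Z * bb / tt)" "qgen pp (pp * Z\<^sup>2)"
    using g by (auto simp: generic_def)
  note fr = gs[THEN qgen_qfree]
  have eqs: "\<alpha> * pp / b = pp * Z\<^sup>2" "\<alpha> * pp / c = pp * X * Z * tt / dd" "\<alpha> * pp / d = pp * X * Z * aa / tt"
    using nz by (simp_all add: defs field_simps power2_eq_square)
  have eqs': "\<alpha> * pp / e = pp * X * Z * cc / tt" "\<alpha> * pp / f = pp * X * Z * bb / tt"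
    "\<alpha>\<^sup>2 * pp\<^sup>2 / (b * c * d * e * f) = dd * X"
    "b * (aa * bb * Z / tt) / \<alpha> = aa * bb / (tt * Z)" "b * (pp * aa * Z\<^sup>2 / dd) / (\<alpha> * (aa * bb * Z / tt)) = aa * cc / (tt * Z)"
    "pp * aa * Z\<^sup>2 / dd / (aa * bb * Z / tt) = f" "aa * bb * Z / tt = e"
    using nz unfolding defs cc_eq by (simp_all add: field_simps power2_eq_square)
  define w where "w = w8s \<alpha> c d e f b"
  have "wn \<alpha> b c d e f = Q (pp * X * Z * cc / tt) * Q (pp * X * Z * bb / tt) * (\<Sum>r. w8 \<alpha> b c d e f r)"
    unfolding eqs'(1,2)[symmetric]
    by (rule wn_w8) (use fr u in \<open>auto simp: eqs eqs'(1-3)\<close>)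
  moreover have "(\<Sum>r. w8 \<alpha> b c d e f r) = w"
    unfolding w_def w8s_def w8_def by (simp add: mult_ac)
  ultimately have wn: "wn \<alpha> b c d e f = Q (pp * X * Z * cc / tt) * Q (pp * X * Z * bb / tt) * w" by simp
  have L: "ren_series X Z = Q (aa * bb / (tt * Z)) * Q (aa * cc / (tt * Z)) * wn \<alpha> b c d e f"
    unfolding ren_series_def ttL_def \<alpha>_def[symmetric] b_def[symmetric] c_def[symmetric] d_def[symmetric] eqs'(4-6) unfolding eqs'(7) ..
  have ps: "psi (X, Z) * Q \<alpha> = Q (dd * X) * ((1 - \<alpha>) * (Q (pp * X * Z * tt / dd) * Q (pp * X * Z * aa / tt) * Q (pp * X * Z * cc / tt) *
     Q (pp * X * Z * bb / tt) * Q (pp * Z\<^sup>2)) * w)"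
    using psi(2)[of "(X, Z)"] Nser_w8s[OF par_aw nz u fr] u by (simp add: defs w_def)
  have Q\<alpha>: "Q \<alpha> = (1 - \<alpha>) * Q (pp * \<alpha>)" using Q_split1[of \<alpha>] by (simp add: mult_ac)
  have "1 - \<alpha> \<noteq> 0" using gs(1) qgen_qfree[of \<alpha>] by (auto simp: \<alpha>_def qfree_def dest: spec[of _ 0])
  moreover have "(1 - \<alpha>) * (psi (X, Z) * Q (pp * \<alpha>)) = (1 - \<alpha>) * (Q (dd * X) * (Q (pp * X * Z * tt / dd) * Q (pp * X * Z * aa / tt) * Q (pp * X * Z * cc / tt) *
     Q (pp * X * Z * bb / tt) * Q (pp * Z\<^sup>2)) * w)"
    using ps unfolding Q\<alpha> by (simp only: mult_ac)
  ultimately have 1: "psi (X, Z) * Q (pp * \<alpha>) = Q (dd * X) * (Q (pp * X * Z * tt / dd) * Q (pp * X * Z * aa / tt) * Q (pp * X * Z * cc / tt) *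
     Q (pp * X * Z * bb / tt) * Q (pp * Z\<^sup>2)) * w"
    by (metis mult_left_cancel)
  have "Q (aa * bb / (tt * Z)) * Q (aa * cc / (tt * Z)) * psi (X, Z) * Q (pp * \<alpha>) =
     Q (aa * bb / (tt * Z)) * Q (aa * cc / (tt * Z)) * (psi (X, Z) * Q (pp * \<alpha>))" by (simp only: mult.assoc)
  then show ?thesis unfolding 1 L wn \<alpha>_def[symmetric] by (simp only: mult_ac)
qed

lemma ren_quotient_series:
  assumes g: "generic X Z" and u: "norm (dd * X) < 1"
  shows "c_num X Z * psi (X, Z) / (c_den X Z * (st X * st' Z)) = ren_coeff X Z * ren_series X Z"
proof -
  have nz: "X \<noteq> 0" "Z \<noteq> 0" using g by (auto simp: generic_def)
  have args: "pp / (tt / Z) = pp * Z / tt" "pp / (aa * bb / (tt * Z)) = pp * Z * tt / (aa * bb)" "pp / (aa * cc / (tt * Z)) = pp * Z * tt / (aa * cc)"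
    "pp / (dd * X / (tt * Z)) = pp * tt * Z / (dd * X)" "pp / (1 / Z\<^sup>2) = pp * Z\<^sup>2"
    using nz by (simp_all add: field_simps)
  have alg: "(u1 * v5) * (v3 * v6) * (v4 * v7) * (u2 * u3) * s / ((u6 * v2) * (v1 * u7) * (S * (v5 * v6 * v7 * u8))) = u1 * u2 * u3 * u4 * u5 / (u6 * u7 * S * u8 * u9) * L"
    if eq: "L * (v1 * u4 * u5 * v2) = v3 * v4 * s * u9" and nz: "v1 \<noteq> 0" "v2 \<noteq> 0" "v5 \<noteq> 0" "v6 \<noteq> 0" "v7 \<noteq> 0" "u9 \<noteq> 0" "u6 \<noteq> 0" "u7 \<noteq> 0" "S \<noteq> 0" "u8 \<noteq> 0"
    for u1 u2 u3 u4 u5 u6 u7 u8 u9 v1 v2 v3 v4 v5 v6 v7 s S L :: complex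
  proof -
    have "(u1 * v5) * (v3 * v6) * (v4 * v7) * (u2 * u3) * s / ((u6 * v2) * (v1 * u7) * (S * (v5 * v6 * v7 * u8))) =
       u1 * u2 * u3 * (v3 * v4 * s * u9) / (u6 * v2 * v1 * u7 * S * u8 * u9)" using nz by (simp add: divide_simps)
    also have "\<dots> = u1 * u2 * u3 * u4 * u5 / (u6 * u7 * S * u8 * u9) * L" unfolding eq[symmetric] using nz by (simp add: divide_simps)
    finally show ?thesis .
  qed
  show ?thesis
    unfolding c_num_def c_den_def st'_def th_def args ren_coeff_def
    by (rule alg[OF ren_series_psi[OF g u]])
      (use g st_nonzero[OF g] Q_generic(3)[of "pp * X * Z\<^sup>2 / dd"] in \<open>simp_all add: generic_def Q_generic(1,2)\<close>)
qed

text \<open>The five products in the numerator of \<open>AW_series\<close> are exactly those that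
  \<open>vs\<close> contains, so \<open>aw_num\<close> is holomorphic wherever the series
  converges.\<close>

definition aw_num :: "complex \<Rightarrow> complex \<Rightarrow> complex"
  where "aw_num X Z = vs (aa * tt * Z / dd) (pp * tt / (aa * dd * Z)) (aa * X) (aa / X) (tt * Z) (aa * bb * Z / tt) (aa * cc * Z / tt)
     (pp * tt * Z / (dd * X)) (pp * X * Z * tt / dd) (pp * aa / dd) (aa * cc) (aa * bb)"

definition aw_den :: "complex \<Rightarrow> complex \<Rightarrow> complex"
  where "aw_den X Z = Q (aa * tt * Z / dd) * Q (pp * X / dd) * Q (pp / (dd * X)) * Q (pp * Z * tt / (aa * dd))"

lemma aw_num_w8s:
  assumes nz: "X \<noteq> 0" "Z \<noteq> 0" and g: "qgen pp (aa * tt * Z / dd)" "qgen pp (pp * tt * Z / (dd * X))" "qgen pp (pp * X * Z * tt / dd)"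
    and AC: "qgen pp (aa * cc)" and u: "norm (pp * tt / (aa * dd * Z)) < 1"
  shows "aw_num X Z = (1 - aa * tt * Z / dd) * (Q (pp * tt * Z / (dd * X)) * Q (pp * X * Z * tt / dd) * Q (pp * aa / dd) * Q (aa * cc) * Q (aa * bb)) *
     w8s (aa * tt * Z / dd) (aa * X) (aa / X) (tt * Z) (aa * bb * Z / tt) (aa * cc * Z / tt)"
  unfolding aw_num_def
proof (rule vs_w8s)
  show "aa * tt * Z / dd \<noteq> 1" using qgen_qfree[OF g(1)] by (auto simp: qfree_def dest: spec[of _ 0])
  show "pp * tt * Z / (dd * X) = aa * tt * Z / dd * pp / (aa * X)" "pp * X * Z * tt / dd = aa * tt * Z / dd * pp / (aa / X)"
    "pp * aa / dd = aa * tt * Z / dd * pp / (tt * Z)" "aa * cc = aa * tt * Z / dd * pp / (aa * bb * Z / tt)" "aa * bb = aa * tt * Z / dd * pp / (aa * cc * Z / tt)"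
    "pp * tt / (aa * dd * Z) = (aa * tt * Z / dd)\<^sup>2 * pp\<^sup>2 / (aa * X * (aa / X) * (tt * Z) * (aa * bb * Z / tt) * (aa * cc * Z / tt))"
    using nz unfolding cc_eq by (simp_all add: field_simps power2_eq_square)
qed (use g AC u params_neg in \<open>auto intro: qgen_qfree\<close>)

text \<open>Under the specialization of \<open>expansion\<close> the second series of the three-term
  relation has the base parameter \<open>F / c = aa * tt * Z / dd\<close> and is the Askey--Wilson
  series.\<close>

lemma ttR_aw_num:
  assumes g: "generic X Z" and AC: "qgen pp (aa * cc)" and u: "norm (pp * tt / (aa * dd * Z)) < 1"
  shows "ttR (pp * X * Z\<^sup>2 / dd) (pp * X / dd) (pp * Z / tt) (pp * Z * tt / (aa * dd)) (pp * aa * Z\<^sup>2 / dd) (aa * bb * Z / tt) *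
      ((1 - aa * tt * Z / dd) * Q (pp * tt * Z / (dd * X)) * Q (pp * X * Z * tt / dd) * Q (pp * aa / dd)) = Q (pp * X / bb) * Q (pp * X / cc) * aw_num X Z"
proof -
  define a b c d e F where "a = pp * X * Z\<^sup>2 / dd" and "b = pp * X / dd" and "c = pp * Z / tt" and "d = pp * Z * tt / (aa * dd)"
    and "e = aa * bb * Z / tt" and "F = pp * aa * Z\<^sup>2 / dd"
  note defs = a_def b_def c_def d_def e_def F_def
  have nz: "X \<noteq> 0" "Z \<noteq> 0" using g by (auto simp: generic_def)
  define \<beta> f where "\<beta> = aa * tt * Z / dd" and "f = aa * cc * Z / tt"
  have eqs: "a * pp / (d * e) = pp * X / bb" "a * pp * e / (d * F) = pp * X / cc" "F / c = \<beta>" "a * pp / (b * c) = tt * Z"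
    "a * pp / (c * d) = aa * X" "F / a = aa / X" "F / e = f"
    using nz unfolding defs \<beta>_def f_def cc_eq by (simp_all add: field_simps power2_eq_square)
  have eqs': "\<beta> * pp / (tt * Z) = pp * aa / dd" "\<beta> * pp / (aa * X) = pp * tt * Z / (dd * X)" "\<beta> * pp / (aa / X) = pp * X * Z * tt / dd"
    "\<beta> * pp / e = aa * cc" "\<beta> * pp / f = aa * bb" "\<beta>\<^sup>2 * pp\<^sup>2 / (tt * Z * (aa * X) * (aa / X) * e * f) = pp * tt / (aa * dd * Z)"
    using nz unfolding defs \<beta>_def f_def cc_eq by (simp_all add: field_simps power2_eq_square)
  have gs: "qgen pp (aa * tt * Z / dd)" "qgen pp (pp * tt * Z / (dd * X))" "qgen pp (pp * X * Z * tt / dd)"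
    using g by (auto simp: generic_def mult_ac)
  define w where "w = w8s \<beta> (aa * X) (aa / X) (tt * Z) e f"
  have "wn \<beta> (tt * Z) (aa * X) (aa / X) e f = Q (aa * cc) * Q (aa * bb) * (\<Sum>r. w8 \<beta> (tt * Z) (aa * X) (aa / X) e f r)"
    unfolding eqs'(4,5)[symmetric]
    by (rule wn_w8; unfold eqs') (use gs AC u params_neg in \<open>auto intro: qgen_qfree\<close>)
  moreover have "(\<Sum>r. w8 \<beta> (tt * Z) (aa * X) (aa / X) e f r) = w"
    unfolding w_def w8s_def w8_def by (simp add: mult_ac)
  ultimately have "ttR a b c d F e = Q (pp * X / bb) * Q (pp * X / cc) * (Q (aa * cc) * Q (aa * bb) * w)"
    unfolding ttR_def eqs by simp
  moreover have "aw_num X Z = (1 - \<beta>) * (Q (pp * tt * Z / (dd * X)) * Q (pp * X * Z * tt / dd) * Q (pp * aa / dd) * Q (aa * cc) * Q (aa * bb)) * w"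
    using aw_num_w8s[OF nz gs AC u] by (simp add: \<beta>_def w_def e_def f_def)
  ultimately show ?thesis unfolding defs[symmetric] \<beta>_def[symmetric] by (simp only: mult_ac)
qed

text \<open>
  The three-term transformation with \<open>a = p X Z^2 / dd\<close>, \<open>b = p X / dd\<close>, \<open>c = p Z / tt\<close>,
  \<open>d = p Z tt / (aa dd)\<close>: replacing \<open>Z\<close> by \<open>1/Z\<close> exchanges its first and third series.
\<close>

lemma expansion:
  assumes g: "generic X Z" "generic X (1 / Z)" and AC: "qgen pp (aa * cc)"
    and u: "norm (dd * X) < 1" "norm (dd * X * Z / tt) < 1" "norm (pp * X / aa) < 1" "norm (tt / Z) < 1" "norm (pp * tt / (aa * dd * Z)) < 1"
  shows "aw_num X Z / aw_den X Z = c_num X Z * psi (X, Z) / (c_den X Z * (st X * st' Z)) +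
     c_num X (1 / Z) * psi (X, 1 / Z) / (c_den X (1 / Z) * (st X * st' (1 / Z)))"
proof -
  define a b c d e F where "a = pp * X * Z\<^sup>2 / dd" and "b = pp * X / dd" and "c = pp * Z / tt" and "d = pp * Z * tt / (aa * dd)"
    and "e = aa * bb * Z / tt" and "F = pp * aa * Z\<^sup>2 / dd"
  note defs = a_def b_def c_def d_def e_def F_def
  have nz: "X \<noteq> 0" "Z \<noteq> 0" using g by (auto simp: generic_def)
  define C1 C2 R where "C1 = ttC1 a b c d F" and "C2 = ttC2 a b c d F" and "R = ttR a b c d F e"
  note g1 = g(1)[unfolded generic_def]
  have primes: "b\<^sup>2 / a = pp * X * (1 / Z)\<^sup>2 / dd" "b * c / a = pp * (1 / Z) / tt" "b * d / a = pp * (1 / Z) * tt / (aa * dd)"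
    "b\<^sup>2 * F / a\<^sup>2 = pp * aa * (1 / Z)\<^sup>2 / dd"
    using nz by (simp_all add: defs field_simps power2_eq_square)
  have primes': "b * (aa * bb * (1 / Z) / tt) / (pp * X * (1 / Z)\<^sup>2 / dd) = e" "b * (pp * aa * (1 / Z)\<^sup>2 / dd) / ((pp * X * (1 / Z)\<^sup>2 / dd) * (aa * bb * (1 / Z) / tt)) = F / e"
    "b * e / a = aa * bb * (1 / Z) / tt" "b * F / (a * e) = (pp * aa * (1 / Z)\<^sup>2 / dd) / (aa * bb * (1 / Z) / tt)"
    using nz by (simp_all add: defs field_simps power2_eq_square)
  have side: "b * F / (a * c) = aa * tt / (dd * Z)" "a / (b * c) = tt * Z / pp" "b * c * d * F / a\<^sup>2 = pp\<^sup>2 / (dd * X)"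
    "b\<^sup>2 * F / a\<^sup>2 = pp * aa * (1 / Z)\<^sup>2 / dd" "b * d / a = pp * tt / (aa * dd * Z)" "a\<^sup>2 * pp\<^sup>2 / (b * c * d * F) = dd * X"
    "a * pp / F = pp * X / aa" "pp / c = tt / Z" "a\<^sup>2 * pp / (b * d * F) = dd * X * Z / tt"
    using nz by (simp_all add: defs field_simps power2_eq_square)
  have "ren_series X Z = C1 * R + C2 * Q e * Q (F / e) * wn (b\<^sup>2 / a) b (b * c / a) (b * d / a) (b * e / a) (b * F / (a * e))"
    unfolding ren_series_def defs[symmetric] C1_def C2_def R_def
  proof (rule three_term)
    show "tt_gen a b c d F" unfolding defs by (rule generic_tt[OF g(1)])
    show "tt_gen (b\<^sup>2 / a) b (b * c / a) (b * d / a) (b\<^sup>2 * F / a\<^sup>2)" unfolding primes using generic_tt[OF g(2)] by (simp add: b_def)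
    show "qgen pp (b * F / (a * c))" "qgen pp (a / (b * c))" "qgen pp (b * c * d * F / a\<^sup>2)" "qgen pp F" unfolding side using g1 by (auto simp: F_def)
    show "qgen pp (b\<^sup>2 * F / a\<^sup>2)" unfolding side using g(2) by (simp add: generic_def)
    show "norm (b * d / a) < 1" "norm (a\<^sup>2 * pp\<^sup>2 / (b * c * d * F)) < 1" "norm (a * pp / F) < 1" "norm (pp / c) < 1" "norm (a\<^sup>2 * pp / (b * d * F)) < 1"
      unfolding side by (fact u)+
    show "e \<noteq> 0" using nz by (simp add: e_def)
  qed
  moreover have "ren_series X (1 / Z) = Q e * Q (F / e) * wn (b\<^sup>2 / a) b (b * c / a) (b * d / a) (b * e / a) (b * F / (a * e))"
    unfolding ren_series_def ttL_def b_def[symmetric] primes'(1,2) unfolding primes primes'(3,4) ..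
  ultimately have L: "ren_series X Z = C1 * R + C2 * ren_series X (1 / Z)" by (simp add: mult.assoc)
  have gq: "qgen pp (pp * X * Z\<^sup>2 / dd)" "qgen pp (aa * tt * Z / dd)" using g1 by (simp_all add: mult_ac)
  have nzs: "Q (tt / Z) \<noteq> 0" "Q (dd * X / (tt * Z)) \<noteq> 0" "Q (pp * tt * Z / (dd * X)) \<noteq> 0" "Q (pp * X * Z * tt / dd) \<noteq> 0"
    "Q (pp * X * Z * aa / tt) \<noteq> 0" "Q (1 / Z\<^sup>2) \<noteq> 0" "Q (pp / (dd * X)) \<noteq> 0" "st X \<noteq> 0" "Q (pp * Z * tt / (aa * dd)) \<noteq> 0"
    "Q (pp * (pp * X * Z\<^sup>2 / dd)) \<noteq> 0" "Q (pp * aa / dd) \<noteq> 0" "Q (aa * tt * Z / dd) \<noteq> 0" "Q (pp * X / aa) \<noteq> 0" "Q (pp * X / bb) \<noteq> 0"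
    "Q (pp * X / cc) \<noteq> 0" "Q (pp * X / dd) \<noteq> 0" "Q (pp * (aa * tt * Z / dd)) \<noteq> 0" "Q (pp * Z\<^sup>2) \<noteq> 0" "Q (Z\<^sup>2) \<noteq> 0"
    using g1 params_neg st_nonzero[OF g(1)] Q_generic(3)[OF gq(1)] Q_generic(3)[OF gq(2)]
    by (simp_all add: Q_generic(1,2) mult_ac)
  have nzs': "Q (pp * tt / (aa * dd * Z)) \<noteq> 0" "Q (pp * (pp * X / (dd * Z\<^sup>2))) \<noteq> 0"
    using g(2)[unfolded generic_def] Q_generic(3)[of "pp * X / (dd * Z\<^sup>2)"] by (simp_all add: Q_generic power_one_over mult_ac)
  define \<beta> where "\<beta> = aa * tt * Z / dd"
  have Q\<beta>: "Q \<beta> = (1 - \<beta>) * Q (pp * \<beta>)" using Q_split1[of \<beta>] by (simp add: mult_ac)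
  then have \<beta>1: "1 - \<beta> \<noteq> 0" using nzs(12) by (auto simp: \<beta>_def)
  have C1: "C1 = Q (pp * (pp * X * Z\<^sup>2 / dd)) * Q (pp * X / aa) * Q (1 / Z\<^sup>2) * Q (pp * aa / dd) /
     (Q (pp * X * Z * aa / tt) * Q (dd * X / (tt * Z)) * Q (tt / Z) * Q (pp * \<beta>))"
  proof -
    have "a * pp = pp * (pp * X * Z\<^sup>2 / dd)" "b / a = 1 / Z\<^sup>2" "b * F / a = pp * aa / dd" "a * pp / d = pp * X * Z * aa / tt"
      "a * pp / (d * F) = dd * X / (tt * Z)" "F * pp / c = pp * \<beta>"
      using nz by (simp_all add: defs \<beta>_def field_simps power2_eq_square)
    note r = this
    show ?thesis unfolding C1_def ttC1_def side(7,8) r(2-) unfolding r(1) ..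
  qed
  have C2: "C2 = 1 / Z\<^sup>2 * Q (pp * (pp * X * Z\<^sup>2 / dd)) * Q (pp / Z\<^sup>2) * Q (pp * X * tt / (dd * Z)) * Q (pp * X * aa / (tt * Z)) *
      Q (pp * Z * tt / (aa * dd)) * Q (tt * Z) * Q (pp * tt / (dd * X * Z)) * Q (dd * X * Z / tt) /
     (Q (pp * Z\<^sup>2) * Q (pp * X * Z * tt / dd) * Q (pp * X * Z * aa / tt) * Q (pp * tt / (aa * dd * Z)) * Q (pp * tt * Z / (dd * X)) *
      Q (dd * X / (tt * Z)) * Q (tt / Z) * Q (pp * (pp * X / (dd * Z\<^sup>2))))"
  proof -
    have "a * pp = pp * (pp * X * Z\<^sup>2 / dd)" "b / a = 1 / Z\<^sup>2" "b * pp / a = pp / Z\<^sup>2" "b * pp / c = pp * X * tt / (dd * Z)"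
      "b * pp / d = pp * X * aa / (tt * Z)" "a * pp / (b * c) = tt * Z" "b * d * F / a\<^sup>2 = pp * tt / (dd * X * Z)" "a * pp / b = pp * Z\<^sup>2"
      "a * pp / c = pp * X * Z * tt / dd" "a * pp / d = pp * X * Z * aa / tt" "d * F / a = pp * tt * Z / (dd * X)" "a * pp / (d * F) = dd * X / (tt * Z)"
      "b\<^sup>2 * pp / a = pp * (pp * X / (dd * Z\<^sup>2))"
      using nz by (simp_all add: defs field_simps power2_eq_square)
    note r = this
    show ?thesis unfolding C2_def ttC2_def side(5,8,9) r(2-) unfolding r(1) unfolding d_def ..
  qed
  have K': "ren_coeff X (1 / Z) = Q (tt * Z) * Q (dd * X * Z / tt) * Q (pp * tt / (dd * X * Z)) * Q (pp * X * tt / (dd * Z)) * Q (pp * X * aa / (tt * Z)) /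
    (Q (Z\<^sup>2) * Q (pp / (dd * X)) * st X * Q (pp * tt / (aa * dd * Z)) * Q (pp * (pp * X / (dd * Z\<^sup>2))))"
  proof -
    have "tt / (1 / Z) = tt * Z" "dd * X / (tt * (1 / Z)) = dd * X * Z / tt" "pp * tt * (1 / Z) / (dd * X) = pp * tt / (dd * X * Z)"
      "pp * X * (1 / Z) * tt / dd = pp * X * tt / (dd * Z)" "pp * X * (1 / Z) * aa / tt = pp * X * aa / (tt * Z)" "1 / (1 / Z)\<^sup>2 = Z\<^sup>2"
      "pp * (1 / Z) * tt / (aa * dd) = pp * tt / (aa * dd * Z)" "pp * X * (1 / Z)\<^sup>2 / dd = pp * X / (dd * Z\<^sup>2)"
      using nz by (simp_all add: field_simps power2_eq_square)
    note r = this
    show ?thesis unfolding ren_coeff_def r ..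
  qed
  \<comment> \<open>Theta inversion at the argument \<open>Z ^ 2\<close>; it supplies the minus sign
    in \<open>KC2\<close>.\<close>
  have th: "Q (1 / Z\<^sup>2) * Q (pp * Z\<^sup>2) * Z\<^sup>2 = - (Q (Z\<^sup>2) * Q (pp / Z\<^sup>2))"
    using th_inverse[of "Z\<^sup>2"] nz by (simp add: th_def field_simps)
  have alg2: "u1 * u2 * u3 * u4 * u5 / (u6 * u7 * S * u8 * u9) * (i * u9 * w1 * w2 * w3 * u8 * w4 * w5 * w6 / (w7 * u4 * u5 * w8 * u3 * u2 * u1 * w9)) =
     - (w4 * w6 * w5 * w2 * w3 / (w0 * u7 * S * w8 * w9))"
    if "u1 \<noteq> 0" "u2 \<noteq> 0" "u3 \<noteq> 0" "u4 \<noteq> 0" "u5 \<noteq> 0" "u6 \<noteq> 0" "u7 \<noteq> 0" "S \<noteq> 0" "u8 \<noteq> 0" "u9 \<noteq> 0" "w7 \<noteq> 0" "w8 \<noteq> 0" "w9 \<noteq> 0" "w0 \<noteq> 0"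
      and e: "i * w1 * w0 = - (u6 * w7)"
    for u1 u2 u3 u4 u5 u6 u7 u8 u9 w0 w1 w2 w3 w4 w5 w6 w7 w8 w9 S i :: complex
  proof -
    have "u1 * u2 * u3 * u4 * u5 / (u6 * u7 * S * u8 * u9) * (i * u9 * w1 * w2 * w3 * u8 * w4 * w5 * w6 / (w7 * u4 * u5 * w8 * u3 * u2 * u1 * w9)) =
      (i * w1 * w0) * (w2 * w3 * w4 * w5 * w6) / (u6 * w7 * u7 * S * w8 * w9 * w0)" using that(1-14) by (simp add: divide_simps)
    also have "\<dots> = - (w4 * w6 * w5 * w2 * w3 / (w0 * u7 * S * w8 * w9))" unfolding e using that(1-14) by (simp add: divide_simps)
    finally show ?thesis .
  qed
  \<comment> \<open>The coefficient of the third series becomes minus \<open>ren_coeff\<close> at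
    \<open>1 / Z\<close>, so on the other side of the equation that series is the renormalized
    eigenfunction at \<open>1 / Z\<close>.\<close>
  have KC2: "ren_coeff X Z * C2 = - ren_coeff X (1 / Z)"
    unfolding K' C2 unfolding ren_coeff_def by (rule alg2) (use nzs nzs' th nz in \<open>simp_all add: divide_simps mult_ac\<close>)
  have alg1: "u1 * u2 * u3 * u4 * u5 / (u6 * u7 * (s1 * s2 * s3 * s4) * u8 * u9) * (u9 * s1 * u6 * v1 / (u5 * u2 * u1 * v2)) * r = n / (v3 * v2 * s4 * u7 * u8)"
    if "u1 \<noteq> 0" "u2 \<noteq> 0" "u3 \<noteq> 0" "u4 \<noteq> 0" "u5 \<noteq> 0" "u6 \<noteq> 0" "u7 \<noteq> 0" "s1 \<noteq> 0" "s2 \<noteq> 0" "s3 \<noteq> 0" "s4 \<noteq> 0" "u8 \<noteq> 0" "u9 \<noteq> 0" "v1 \<noteq> 0" "v2 \<noteq> 0" "v3 \<noteq> 0"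
      and e: "r * (v3 * u3 * u4 * v1) = s2 * s3 * n"
    for u1 u2 u3 u4 u5 u6 u7 u8 u9 s1 s2 s3 s4 v1 v2 v3 r n :: complex
  proof -
    have "u1 * u2 * u3 * u4 * u5 / (u6 * u7 * (s1 * s2 * s3 * s4) * u8 * u9) * (u9 * s1 * u6 * v1 / (u5 * u2 * u1 * v2)) * r =
      (r * (v3 * u3 * u4 * v1)) / (u7 * s2 * s3 * s4 * u8 * v2 * v3)" using that(1-16) by (simp add: divide_simps)
    also have "\<dots> = n / (v3 * v2 * s4 * u7 * u8)" unfolding e using that(1-16) by (simp add: divide_simps)
    finally show ?thesis .
  qed
  have KC1: "ren_coeff X Z * C1 * R = aw_num X Z / aw_den X Z"
    unfolding C1 ren_coeff_def st_def aw_den_def \<beta>_def[symmetric] Q\<beta>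
    by (rule alg1) (use nzs \<beta>1 ttR_aw_num[OF g(1) AC u(5)] in \<open>simp_all add: R_def defs \<beta>_def\<close>)
  have "ren_coeff X Z * ren_series X Z = ren_coeff X Z * C1 * R + (ren_coeff X Z * C2) * ren_series X (1 / Z)" unfolding L by (simp add: algebra_simps)
  then have "ren_coeff X Z * ren_series X Z = aw_num X Z / aw_den X Z - ren_coeff X (1 / Z) * ren_series X (1 / Z)" unfolding KC1 KC2 by simp
  then show ?thesis unfolding ren_quotient_series[OF g(1) u(1)] ren_quotient_series[OF g(2) u(1)] by simp
qed

end

section \<open>Equality of meromorphic functions\<close>

text \<open>Two open dense sets intersect in an open dense set, so pointwise reasoning carries over
  to equality of meromorphic functions; transitivity is obtained in this way.\<close>

lemma mero_eq_on_combine: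
  assumes "mero_eq_on D f1 g1" "mero_eq_on D f2 g2" "\<And>w. w \<in> D \<Longrightarrow> f1 w = g1 w \<Longrightarrow> f2 w = g2 w \<Longrightarrow> f w = g w"
  shows "mero_eq_on D f g"
proof -
  obtain V1 where V1: "open V1" "V1 \<subseteq> D" "D \<subseteq> closure V1" "\<forall>v\<in>V1. f1 v = g1 v" using assms(1) unfolding mero_eq_on_def by blast
  obtain V2 where V2: "open V2" "V2 \<subseteq> D" "D \<subseteq> closure V2" "\<forall>v\<in>V2. f2 v = g2 v" using assms(2) unfolding mero_eq_on_def by blast
  show ?thesis unfolding mero_eq_on_def
    using V1 V2 assms(3) dense_Int[of V1 V2 D] by (intro exI[of _ "V1 \<inter> V2"]) blast
qed

lemma mero_eq_on_mono: "mero_eq_on D f1 g1 \<Longrightarrow> (\<And>w. w \<in> D \<Longrightarrow> f1 w = g1 w \<Longrightarrow> f w = g w) \<Longrightarrow> mero_eq_on D f g"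
  using mero_eq_on_combine[of D f1 g1 f1 g1 f g] by blast

lemma dense_involution:
  fixes \<sigma> :: "'a::topological_space \<Rightarrow> 'a"
  assumes \<sigma>: "continuous_on UNIV \<sigma>" "\<And>w. \<sigma> (\<sigma> w) = w" and V: "open V" "closure V = UNIV"
  shows "open (\<sigma> -` V)" "closure (\<sigma> -` V) = UNIV"
proof -
  show "open (\<sigma> -` V)" by (rule open_vimage[OF V(1) \<sigma>(1)])
  show "closure (\<sigma> -` V) = UNIV"
  proof (rule ccontr)
    assume "closure (\<sigma> -` V) \<noteq> UNIV"
    then obtain x where x: "x \<notin> closure (\<sigma> -` V)" by blast
    define U where "U = - closure (\<sigma> -` V)"
    have "open (\<sigma> -` U)" unfolding U_def by (intro open_vimage \<sigma>(1)) auto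
    moreover have "\<sigma> x \<in> \<sigma> -` U" using x \<sigma>(2) by (simp add: U_def)
    ultimately have "\<sigma> -` U \<inter> V \<noteq> {}" using V(2) open_Int_closure_eq_empty[of "\<sigma> -` U" V] by auto
    then obtain v where "v \<in> V" "\<sigma> v \<in> U" by blast
    then show False using \<sigma>(2) closure_subset[of "\<sigma> -` V"] by (auto simp: U_def)
  qed
qed

lemma mero_eq_involution:
  assumes "mero_eq f g" "continuous_on UNIV \<sigma>" "\<And>w. \<sigma> (\<sigma> w) = w"
  shows "mero_eq (\<lambda>w. f (\<sigma> w)) (\<lambda>w. g (\<sigma> w))"
proof -
  obtain V where V: "open V" "UNIV \<subseteq> closure V" "\<forall>v\<in>V. f v = g v" using assms(1) unfolding mero_eq_on_def by blast
  then show ?thesis unfolding mero_eq_on_def using dense_involution[OF assms(2,3), of V]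
    by (intro exI[of _ "\<sigma> -` V"]) auto
qed

definition flip1 :: "complex \<times> complex \<Rightarrow> complex \<times> complex"
  where "flip1 = (\<lambda>(x, z). (- x, z))"

definition flip2 :: "complex \<times> complex \<Rightarrow> complex \<times> complex"
  where "flip2 = (\<lambda>(x, z). (x, - z))"

lemma flips: "continuous_on UNIV flip1" "flip1 (flip1 w) = w" "continuous_on UNIV flip2" "flip2 (flip2 w) = w"
  "continuous_on UNIV (prod.swap :: complex \<times> complex \<Rightarrow> complex \<times> complex)"
  by (auto simp: flip1_def flip2_def case_prod_unfold continuous_on_swap intro!: continuous_intros)

lemma mero_eq_flip1: "mero_eq f g \<Longrightarrow> mero_eq (\<lambda>w. f (flip1 w)) (\<lambda>w. g (flip1 w))"
  by (rule mero_eq_involution) (use flips in auto)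

lemma mero_eq_flip2: "mero_eq f g \<Longrightarrow> mero_eq (\<lambda>w. f (flip2 w)) (\<lambda>w. g (flip2 w))"
  by (rule mero_eq_involution) (use flips in auto)

lemma mero_eq_swap: "mero_eq f g \<Longrightarrow> mero_eq (\<lambda>w. f (prod.swap w)) (\<lambda>w. g (prod.swap w))"
  by (rule mero_eq_involution) (use flips in auto)

text \<open>The interior of the set of agreement contains every local witness and serves as the
  global one.\<close>

lemma mero_eq_local:
  assumes "\<And>w. \<exists>U. w \<in> U \<and> mero_eq_on U f g"
  shows "mero_eq f g"
  unfolding mero_eq_on_def
proof (rule exI[of _ "interior {w. f w = g w}"], intro conjI ballI subsetI)
  fix w :: "complex \<times> complex"
  obtain U V where U: "w \<in> U" "open V" "U \<subseteq> closure V" "\<forall>v\<in>V. f v = g v" using assms[of w] unfolding mero_eq_on_def by blast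
  then have "V \<subseteq> interior {w. f w = g w}" by (intro interior_maximal) auto
  then show "w \<in> closure (interior {w. f w = g w})" using U closure_mono by blast
qed (use interior_subset in blast)+

lemma nonzero_dense_in:
  assumes "holomorphic2_on h U" "open U" "connected U" "\<exists>v\<in>U. h v \<noteq> 0"
  shows "open {w\<in>U. h w \<noteq> 0}" "U \<subseteq> closure {w\<in>U. h w \<noteq> 0}"
  using holomorphic2_nonzero_dense[OF assms(1-3)] assms(4) by blast+

text \<open>The set of points near which the two functions agree is open and closed.\<close>

lemma mero_unique:
  assumes G: "holomorphic2_on G UNIV" "holomorphic2_on K UNIV" "K w0 \<noteq> 0" "\<And>v. K v \<noteq> 0 \<Longrightarrow> E v = G v / K v"
    and F: "meromorphic2_on F UNIV" and H: "open H" "H \<noteq> {}" "mero_eq_on H F E"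
  shows "mero_eq F E"
proof -
  define A where "A = {w. \<exists>U. open U \<and> w \<in> U \<and> mero_eq_on U F E}"
  have "open A"
    unfolding open_subopen[of A]
  proof
    fix w assume "w \<in> A"
    then obtain U where U: "open U" "w \<in> U" "mero_eq_on U F E" by (auto simp: A_def)
    then have "U \<subseteq> A" by (auto simp: A_def)
    with U show "\<exists>T. open T \<and> w \<in> T \<and> T \<subseteq> A" by blast
  qed
  moreover have "open (- A)"
    unfolding open_subopen[of "- A"]
  proof
    fix w assume w: "w \<in> - A"
    obtain U g h where U: "open U" "connected U" "w \<in> U" "holomorphic2_on g U" "holomorphic2_on h U" "\<exists>v\<in>U. h v \<noteq> 0"
      "\<forall>v\<in>U. h v \<noteq> 0 \<longrightarrow> F v = g v / h v"
      using bspec[OF F[unfolded meromorphic2_on_def] UNIV_I[of w]] by - (elim exE conjE, rule that; assumption)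
    note dh = nonzero_dense_in[OF U(5,1,2,6)]
    note dK = nonzero_dense_in[OF G(2) open_UNIV connected_UNIV bexI[where P = "\<lambda>v. K v \<noteq> 0", OF G(3) UNIV_I]]
    have dK': "U \<subseteq> closure (U \<inter> {w\<in>UNIV. K w \<noteq> 0})" by (rule dense_open_Int[OF U(1)]) (use dK in auto)
    define V where "V = {w\<in>U. h w \<noteq> 0} \<inter> (U \<inter> {w\<in>UNIV. K w \<noteq> 0})"
    have V: "open V" "V \<subseteq> U" "U \<subseteq> closure V"
      unfolding V_def by (rule open_Int[OF dh(1) open_Int[OF U(1) dK(1)]], blast)
        (rule dense_Int[OF dh(1) open_Int[OF U(1) dK(1)] _ _ dh(2) dK'], auto)
    \<comment> \<open>If \<open>U\<close> met \<open>A\<close>, the holomorphic function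
      \<open>g * K - G * h\<close> would vanish on an open part of the connected set
      \<open>U\<close>, hence on all of \<open>U\<close>. Then \<open>w\<close> itself would lie in
      \<open>A\<close>.\<close>
    have "U \<inter> A = {}"
    proof (rule ccontr)
      assume "U \<inter> A \<noteq> {}"
      then obtain v U' where v: "v \<in> U" "open U'" "v \<in> U'" "mero_eq_on U' F E" by (auto simp: A_def)
      then obtain V' where V': "open V'" "U' \<subseteq> closure V'" "\<forall>v\<in>V'. F v = E v" unfolding mero_eq_on_def by blast
      have "U \<inter> U' \<inter> V' \<noteq> {}" using open_Int_closure_eq_empty[of "U \<inter> U'" V'] U(1) v V' by auto
      moreover have "open (U \<inter> U' \<inter> V')" by (intro open_Int U(1) v(2) V'(1))
      moreover have "U \<inter> U' \<inter> V' \<subseteq> closure V" using V(3) by blast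
      ultimately have "(U \<inter> U' \<inter> V') \<inter> V \<noteq> {}"
        using open_Int_closure_eq_empty[of "U \<inter> U' \<inter> V'" V] by (metis Int_absorb2)
      moreover have "open ((U \<inter> U' \<inter> V') \<inter> V)" using U(1) v V' V by blast
      moreover have "g y * K y - G y * h y = 0" if "y \<in> (U \<inter> U' \<inter> V') \<inter> V" for y
      proof -
        have "h y \<noteq> 0" "K y \<noteq> 0" "F y = E y" "y \<in> U" using that V'(3) by (auto simp: V_def)
        then have "g y / h y = G y / K y" using U(7) G(4) by metis
        then show ?thesis using \<open>h y \<noteq> 0\<close> \<open>K y \<noteq> 0\<close> by (simp add: field_simps)
      qed
      moreover have "holomorphic2_on (\<lambda>y. g y * K y - G y * h y) U"
        by (intro holomorphic2_diff holomorphic2_mult U holomorphic2_subset[OF G(1)] holomorphic2_subset[OF G(2)]) auto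
      ultimately have z: "g y * K y - G y * h y = 0" if "y \<in> U" for y
        using holomorphic2_identity[of "\<lambda>y. g y * K y - G y * h y" U "(U \<inter> U' \<inter> V') \<inter> V" y] U(1,2) that by blast
      have "mero_eq_on U F E"
        unfolding mero_eq_on_def
      proof (rule exI[of _ V], intro conjI V ballI)
        fix y assume y: "y \<in> V"
        then have "h y \<noteq> 0" "K y \<noteq> 0" "y \<in> U" by (auto simp: V_def)
        moreover from this have "g y / h y = G y / K y" using z[of y] by (simp add: field_simps)
        ultimately show "F y = E y" using U(7) G(4)[of y] by metis
      qed
      then show False using w U(1,3) by (auto simp: A_def)
    qed
    then show "\<exists>T. open T \<and> w \<in> T \<and> T \<subseteq> - A" using U(1,3) by blast
  qed
  moreover have "A \<noteq> {}" using H by (auto simp: A_def)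
  ultimately have "A = UNIV" using connected_clopen[of UNIV] connected_UNIV
    by (metis (no_types, lifting) clopen closed_def)
  then show ?thesis by (intro mero_eq_local) (auto simp: A_def)
qed

lemma meromorphic2_quotient:
  assumes "holomorphic2_on g UNIV" "holomorphic2_on h UNIV" "h w \<noteq> 0" "\<And>v. h v \<noteq> 0 \<Longrightarrow> f v = g v / h v"
  shows "meromorphic2_on f UNIV"
  unfolding meromorphic2_on_def
proof
  fix u :: "complex \<times> complex"
  show "\<exists>U g h. open U \<and> connected U \<and> u \<in> U \<and> U \<subseteq> UNIV \<and> holomorphic2_on g U \<and> holomorphic2_on h U \<and>
      (\<exists>v\<in>U. h v \<noteq> 0) \<and> (\<forall>v\<in>U. h v \<noteq> 0 \<longrightarrow> f v = g v / h v)"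
    by (rule exI[of _ UNIV], rule exI[of _ g], rule exI[of _ h])
      (use assms in \<open>auto simp del: split_paired_Ex split_paired_All\<close>)
qed

text \<open>Cross-multiplication turns equality on an open dense set into an identity of entire
  functions that holds at every point. \<open>self_dual_generic\<close> uses it at zeros of a
  denominator.\<close>

lemma mero_eq_cross:
  assumes "mero_eq f g" and hol: "holomorphic2_on g1 UNIV" "holomorphic2_on h1 UNIV" "holomorphic2_on g2 UNIV" "holomorphic2_on h2 UNIV"
    and nz: "h1 w1 \<noteq> 0" "h2 w2 \<noteq> 0" and eq: "\<And>v. h1 v \<noteq> 0 \<Longrightarrow> f v = g1 v / h1 v" "\<And>v. h2 v \<noteq> 0 \<Longrightarrow> g v = g2 v / h2 v"
  shows "g1 w * h2 w = g2 w * h1 w"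
proof -
  obtain V where V: "open V" "UNIV \<subseteq> closure V" "\<forall>v\<in>V. f v = g v" using assms(1) unfolding mero_eq_on_def by blast
  note d1 = nonzero_dense_in[OF hol(2) open_UNIV connected_UNIV bexI[where P = "\<lambda>v. h1 v \<noteq> 0", OF nz(1) UNIV_I]]
  note d2 = nonzero_dense_in[OF hol(4) open_UNIV connected_UNIV bexI[where P = "\<lambda>v. h2 v \<noteq> 0", OF nz(2) UNIV_I]]
  define V' where "V' = V \<inter> ({w\<in>UNIV. h1 w \<noteq> 0} \<inter> {w\<in>UNIV. h2 w \<noteq> 0})"
  have V': "open V'" "UNIV \<subseteq> closure V'"
    unfolding V'_def by (rule open_Int[OF V(1) open_Int[OF d1(1) d2(1)]])
      (rule dense_Int[OF V(1) open_Int[OF d1(1) d2(1)] subset_UNIV subset_UNIV V(2) dense_Int[OF d1(1) d2(1) subset_UNIV subset_UNIV d1(2) d2(2)]])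
  then have ne: "V' \<noteq> {}" by (metis UNIV_not_empty closure_empty top.extremum_uniqueI)
  have "g1 w * h2 w - g2 w * h1 w = 0"
  proof (rule holomorphic2_identity_convex[where D = UNIV and V = V'])
    show "holomorphic2_on (\<lambda>w. g1 w * h2 w - g2 w * h1 w) UNIV" by (intro holomorphic2_diff holomorphic2_mult hol)
    fix v assume "v \<in> V'"
    then have "h1 v \<noteq> 0" "h2 v \<noteq> 0" "f v = g v" using V(3) by (auto simp: V'_def)
    then have "g1 v / h1 v = g2 v / h2 v" using eq by metis
    then show "g1 v * h2 v - g2 v * h1 v = 0" using \<open>h1 v \<noteq> 0\<close> \<open>h2 v \<noteq> 0\<close> by (simp add: field_simps)
  qed (use V' ne in auto)
  then show ?thesis by simp
qed

context aw
begin

subsection \<open>Analytic continuation of the expansion\<close>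

definition half :: "(complex \<times> complex) set"
  where "half = {(x, z). norm (qpw P (of_real (step P) - z) / aw_d (dual P)) < 1}"

text \<open>The expansion involves both \<open>Z\<close> and \<open>1 / Z\<close>, so genericity is
  required at \<open>(x, z)\<close> and at \<open>(x, - z)\<close>.\<close>

definition generic_set :: "(complex \<times> complex) set"
  where "generic_set = generic_at expansion_monomials \<inter> flip2 -` generic_at expansion_monomials"

lemma expansion_monomials_dense: "open (generic_at expansion_monomials)" "closure (generic_at expansion_monomials) = UNIV"
  by (rule generic_at_open_dense; auto simp: expansion_monomials_def)+

lemma generic_set: "open generic_set" "closure generic_set = UNIV"
proof -
  note f = dense_involution[OF flips(3,4) expansion_monomials_dense]
  show "open generic_set" unfolding generic_set_def by (intro open_Int expansion_monomials_dense f)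
  show "closure generic_set = UNIV" unfolding generic_set_def
    using dense_Int[of "generic_at expansion_monomials" "flip2 -` generic_at expansion_monomials" UNIV] expansion_monomials_dense f by auto
qed

lemma generic_setD:
  assumes "(x, z) \<in> generic_set"
  shows "generic (qpw P x) (qpw P z)" "generic (qpw P x) (1 / qpw P z)"
  using assms generic_if_generic_at[of x z] generic_if_generic_at[of x "- z"] by (auto simp: generic_set_def flip2_def qpw_minus)

lemma half_eq: "half = {w. Re (snd w) < step P / 2 - lam P + vsig P}"
proof -
  have "norm (qpw P (of_real (step P) - z) / aw_d (dual P)) < 1 \<longleftrightarrow> Re z < step P / 2 - lam P + vsig P" for z
  proof -
    have "norm (qpw P (of_real (step P) - z) / aw_d (dual P)) = er ((step P - Re z) - (step P / 2 + lam P - vsig P))"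
      by (simp only: aw_d_def dual_simps qpw_dual norm_divide norm_minus_cancel norm_qpw er_diff minus_complex.simps Re_complex_of_real)
    also have "\<dots> < 1 \<longleftrightarrow> 0 < (step P - Re z) - (step P / 2 + lam P - vsig P)"
      using er_mono[of "(step P - Re z) - (step P / 2 + lam P - vsig P)" 0] by (simp only: er_zero)
    also have "\<dots> \<longleftrightarrow> Re z < step P / 2 - lam P + vsig P" by (rule iffI; linarith)
    finally show ?thesis .
  qed
  note * = this
  show ?thesis unfolding half_def case_prod_unfold * ..
qed

lemma half: "open half" "convex half" "half \<noteq> {}"
proof -
  show "open half" unfolding half_eq by (intro open_Collect_less continuous_intros)
  have "half = (\<lambda>w :: complex \<times> complex. Re (snd w)) -` {..<step P / 2 - lam P + vsig P}" by (auto simp: half_eq)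
  also have "convex \<dots>" by (intro convex_linear_vimage linearI) auto
  finally show "convex half" .
  have "(0, of_real (step P / 2 - lam P + vsig P - 1)) \<in> half" by (simp add: half_eq)
  then show "half \<noteq> {}" by blast
qed

lemma half_norm: "(x, z) \<in> half \<longleftrightarrow> norm (pp * tt / (aa * dd * qpw P z)) < 1"
proof -
  have "qpw P (of_real (step P) - z) / aw_d (dual P) = pp * tt / (aa * dd * qpw P z)"
    by (simp add: qpw_diff dual_params field_simps)
  then show ?thesis by (simp add: half_def)
qed

lemma AW_series_eq:
  assumes h: "(x, z) \<in> half" and g: "generic (qpw P x) (qpw P z)" and AC: "qgen pp (aa * cc)"
  shows "AW_series P x z = aw_num (qpw P x) (qpw P z) / aw_den (qpw P x) (qpw P z)"
proof -
  define X Z where "X = qpw P x" and "Z = qpw P z"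
  have nz: "X \<noteq> 0" "Z \<noteq> 0" by (simp_all add: X_def Z_def)
  note g1 = g[folded X_def Z_def, unfolded generic_def]
  define \<beta> where "\<beta> = aa * tt * Z / dd"
  have gs: "qgen pp \<beta>" "qgen pp (pp * tt * Z / (dd * X))" "qgen pp (pp * X * Z * tt / dd)"
    using g1 by (auto simp: \<beta>_def mult_ac)
  define w where "w = w8s \<beta> (aa * X) (aa / X) (tt * Z) (aa * bb * Z / tt) (aa * cc * Z / tt)"
  have aw_num: "aw_num X Z = (1 - \<beta>) * (Q (pp * tt * Z / (dd * X)) * Q (pp * X * Z * tt / dd) * Q (pp * aa / dd) * Q (aa * cc) * Q (aa * bb)) * w"
    unfolding w_def \<beta>_def by (rule aw_num_w8s[OF nz gs[unfolded \<beta>_def] AC]) (use h half_norm in \<open>simp add: Z_def\<close>)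
  have Q\<beta>: "Q \<beta> = (1 - \<beta>) * Q (pp * \<beta>)" using Q_split1[of \<beta>] by (simp add: mult_ac)
  have nzQ: "1 - \<beta> \<noteq> 0" using Q_generic(1)[OF gs(1)] Q\<beta> by auto
  have e1: "aw_a (dual P) * aw_b (dual P) * aw_c (dual P) * qpw P (- of_real (step P) + z) = \<beta>"
    "aw_a (dual P) * aw_b (dual P) * aw_c (dual P) * qpw P z = pp * \<beta>"
  proof -
    have m: "qpw P (- of_real (step P) + z) = Z / pp" using qpw_diff[of z "of_real (step P)"] by (simp add: Z_def)
    show "aw_a (dual P) * aw_b (dual P) * aw_c (dual P) * qpw P (- of_real (step P) + z) = \<beta>"
      "aw_a (dual P) * aw_b (dual P) * aw_c (dual P) * qpw P z = pp * \<beta>"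
      unfolding m dual_params \<beta>_def cc_eq Z_def[symmetric] by (simp_all add: field_simps power2_eq_square)
  qed
  have e2: "aa * qpw P x = aa * X" "aa * qpw P (- x) = aa / X" "tt * qpw P z = tt * Z" "aw_b (dual P) * qpw P z = aa * bb * Z / tt"
    "aw_c (dual P) * qpw P z = aa * cc * Z / tt" "qpw P (of_real (step P) - z) / aw_d (dual P) = pp * tt / (aa * dd * Z)"
    "tt * qpw P (of_real (step P) + z - x) / dd = pp * tt * Z / (dd * X)" "tt * qpw P (of_real (step P) + z + x) / dd = pp * X * Z * tt / dd"
    "qpw P (of_real (step P) + x) / dd = pp * X / dd" "qpw P (of_real (step P) - x) / dd = pp / (dd * X)"
    "qpw P (of_real (step P) + z) / aw_d (dual P) = pp * Z * tt / (aa * dd)"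
    by (simp_all add: X_def Z_def qpw_add qpw_diff qpw_minus dual_params mult_ac)
  have W: "W87 \<beta> [aa * X, aa / X, tt * Z, aa * bb * Z / tt, aa * cc * Z / tt] pp (pp * tt / (aa * dd * Z)) = w"
    unfolding w_def
  proof (rule W87_w8s)
    show "\<beta> \<noteq> 0" using nz by (simp add: \<beta>_def)
    show "pp * tt / (aa * dd * Z) = \<beta>\<^sup>2 * pp\<^sup>2 / (aa * X * (aa / X) * (tt * Z) * (aa * bb * Z / tt) * (aa * cc * Z / tt))"
      using nz unfolding \<beta>_def cc_eq by (simp add: field_simps power2_eq_square)
  qed
  have "AW_series P x z = Q (pp * tt * Z / (dd * X)) * (Q (pp * X * Z * tt / dd) * (Q (aa * bb) * (Q (aa * cc) * Q (pp * aa / dd)))) /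
    (Q (pp * X / dd) * (Q (pp / (dd * X)) * (Q (pp * Z * tt / (aa * dd)) * Q (pp * \<beta>)))) * w"
    unfolding AW_series_def Let_def e1 e2 W by simp
  also have "\<dots> = aw_num X Z / aw_den X Z"
    unfolding aw_num aw_den_def \<beta>_def[symmetric] Q\<beta> using nzQ by (simp add: divide_simps mult_ac)
  finally show ?thesis by (simp add: X_def Z_def)
qed

lemma AW_series_even: "AW_series P (- x) z = AW_series P x z"
  unfolding AW_series_def Let_def W87_def by (simp add: mult_ac)

definition ren_num :: "complex \<times> complex \<Rightarrow> complex"
  where "ren_num w = c_num (qpw P (fst w)) (qpw P (snd w)) * psi (qpw P (fst w), qpw P (snd w))"

definition ren_den :: "complex \<times> complex \<Rightarrow> complex"
  where "ren_den w = c_den (qpw P (fst w)) (qpw P (snd w)) * (st (qpw P (fst w)) * st' (qpw P (snd w)))"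

lemma Phi_ren_quot: "Phi_ren P x z = ren_num (x, z) / ren_den (x, z)"
  by (simp add: Phi_ren_eq ren_num_def ren_den_def)

lemma c_num_den_holomorphic:
  assumes "holomorphic2_on f D" "holomorphic2_on g D"
  shows "holomorphic2_on (\<lambda>w. c_num (qpw P (f w)) (qpw P (g w))) D" "holomorphic2_on (\<lambda>w. c_den (qpw P (f w)) (qpw P (g w))) D"
  unfolding c_num_def c_den_def
  by (intro holomorphic2_mult holomorphic2_th holomorphic2_divide holomorphic2_power qpw_holomorphic2 holomorphic2_const assms; simp)+

lemma ren_num_den_holomorphic:
  assumes "holomorphic2_on f D" "holomorphic2_on g D"
  shows "holomorphic2_on (\<lambda>w. ren_num (f w, g w)) D" "holomorphic2_on (\<lambda>w. ren_den (f w, g w)) D"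
  unfolding ren_num_def ren_den_def st_def st'_def fst_conv snd_conv
  by (intro holomorphic2_mult c_num_den_holomorphic psi_holomorphic holomorphic2_Q holomorphic2_divide_const qpw_holomorphic2 holomorphic2_const assms)+

lemma generic_nonzero:
  assumes "generic X Z"
  shows "c_den X Z * (st X * st' Z) \<noteq> 0" "aw_den X Z \<noteq> 0" "c_den X Z \<noteq> 0"
proof -
  have "st X \<noteq> 0" by (rule st_nonzero[OF assms])
  moreover have "qgen pp (aa * tt * Z / dd)" using assms by (simp add: generic_def mult_ac)
  ultimately show "c_den X Z * (st X * st' Z) \<noteq> 0" "aw_den X Z \<noteq> 0" "c_den X Z \<noteq> 0"
    using assms unfolding generic_def c_den_def st'_def aw_den_def th_def by (simp_all add: Q_generic(1,2))
qed

text \<open>The right-hand side of the expansion. It is even in \<open>z\<close> by its form;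
  evenness in \<open>x\<close> will come from the Askey--Wilson series.\<close>

definition even_sum :: "complex \<times> complex \<Rightarrow> complex"
  where "even_sum = (\<lambda>(x, z). Phi_ren P x z + Phi_ren P x (- z))"

definition even_num :: "complex \<times> complex \<Rightarrow> complex"
  where "even_num = (\<lambda>w. ren_num (fst w, snd w) * ren_den (fst w, - snd w) + ren_num (fst w, - snd w) * ren_den (fst w, snd w))"

definition even_den :: "complex \<times> complex \<Rightarrow> complex"
  where "even_den = (\<lambda>w. ren_den (fst w, snd w) * ren_den (fst w, - snd w))"

lemma even_num_den_holomorphic: "holomorphic2_on even_num D" "holomorphic2_on even_den D"
  unfolding even_num_def even_den_def by (intro holomorphic2_mult holomorphic2_add ren_num_den_holomorphic holomorphic2_intros)+

lemma even_sum_quotient: "even_den v \<noteq> 0 \<Longrightarrow> even_sum v = even_num v / even_den v"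
  by (cases v) (simp add: even_sum_def even_num_def even_den_def Phi_ren_quot field_simps)

lemma even_den_nonzero: "v \<in> generic_set \<Longrightarrow> even_den v \<noteq> 0"
  using generic_setD[of "fst v" "snd v"] generic_nonzero(1)[of "qpw P (fst v)"] by (simp add: even_den_def ren_den_def qpw_minus)

lemma generic_set_ex: obtains v where "v \<in> generic_set"
  using generic_set(2) by (metis closure_empty empty_iff ex_in_conv UNIV_I)

lemma even_sum_meromorphic: "meromorphic2_on even_sum UNIV"
proof -
  obtain v where "v \<in> generic_set" by (rule generic_set_ex)
  then have "even_den v \<noteq> 0" by (rule even_den_nonzero)
  then show ?thesis using even_num_den_holomorphic even_sum_quotient by (intro meromorphic2_quotient)
qed

text \<open>Here all series of the three-term transformation converge.\<close>

definition region :: "(complex \<times> complex) set"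
  where "region = {w. 0 < step P / 2 + ups P - vsig P + Re (fst w)} \<inter> {w. 0 < step P / 2 + ups P - vsig P + Re (fst w) + Re (snd w) - (kap P + ups P)} \<inter>
    {w. 0 < step P + Re (fst w) - (kap P + lam P)} \<inter> {w. 0 < kap P + ups P - Re (snd w)} \<inter> half"

lemma region: "open region" "region \<subseteq> half" "region \<noteq> {}"
proof -
  show "open region" unfolding region_def by (intro open_Int half open_Collect_less continuous_intros)
  \<comment> \<open>\<open>Re z = r\<close> is first placed below both of its upper bounds; after
    that, \<open>Re x = s\<close> only has to be large.\<close>
  define r where "r = min (kap P + ups P) (step P / 2 - lam P + vsig P) - 1"
  define s where "s = \<bar>step P / 2 + ups P - vsig P\<bar> + \<bar>kap P + ups P - r\<bar> + \<bar>step P - (kap P + lam P)\<bar> + 1"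
  have r: "r < kap P + ups P" "r < step P / 2 - lam P + vsig P" by (auto simp: r_def)
  have "0 < step P / 2 + ups P - vsig P + s" "0 < step P / 2 + ups P - vsig P + s + r - (kap P + ups P)" "0 < step P + s - (kap P + lam P)"
    unfolding s_def by linarith+
  then have "(of_real s, of_real r) \<in> region" using r by (simp add: region_def half_eq)
  then show "region \<noteq> {}" by blast
qed (auto simp: region_def)

lemma region_norm:
  assumes "(x, z) \<in> region"
  shows "norm (dd * qpw P x) < 1" "norm (dd * qpw P x * qpw P z / tt) < 1" "norm (pp * qpw P x / aa) < 1" "norm (tt / qpw P z) < 1"
    "norm (pp * tt / (aa * dd * qpw P z)) < 1"
proof -
  have n: "norm dd = er (step P / 2 + ups P - vsig P)" "norm tt = er (kap P + ups P)" "norm aa = er (kap P + lam P)" "norm pp = er (step P)"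
    unfolding aw_d_def aw_a_def by (simp_all only: norm_minus_cancel dual_simps qpw_dual norm_qpw Re_complex_of_real)
  show "norm (dd * qpw P x) < 1" "norm (dd * qpw P x * qpw P z / tt) < 1" "norm (pp * qpw P x / aa) < 1" "norm (tt / qpw P z) < 1"
    unfolding norm_mult norm_divide n norm_qpw er_add[symmetric] er_diff[symmetric] using assms by (auto simp: region_def intro!: er_lt_1)
  show "norm (pp * tt / (aa * dd * qpw P z)) < 1" using assms half_norm by (simp add: region_def)
qed

lemma aw_num_den_holomorphic:
  "holomorphic2_on (\<lambda>w. aw_num (qpw P (fst w)) (qpw P (snd w))) half" "holomorphic2_on (\<lambda>w. aw_den (qpw P (fst w)) (qpw P (snd w))) D"
proof -
  have h: "holomorphic2_on (\<lambda>w. qpw P (fst w)) D" "holomorphic2_on (\<lambda>w. qpw P (snd w)) D" for D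
    by (intro qpw_holomorphic2 holomorphic2_intros)+
  show "holomorphic2_on (\<lambda>w. aw_num (qpw P (fst w)) (qpw P (snd w))) half"
    unfolding aw_num_def
    by (intro vs_holomorphic2 half holomorphic2_divide holomorphic2_mult holomorphic2_const h) (use half_norm in auto)
  show "holomorphic2_on (\<lambda>w. aw_den (qpw P (fst w)) (qpw P (snd w))) D"
    unfolding aw_den_def by (intro holomorphic2_mult holomorphic2_Q holomorphic2_divide holomorphic2_const h) auto
qed

text \<open>Cross-multiplied, the expansion is an identity between functions holomorphic on the
  convex set \<open>half\<close>. It holds at the generic points of \<open>region\<close> and
  therefore on \<open>half\<close>; at generic points the denominators can be divided out
  again.\<close>

lemma even_sum_AW_series:
  assumes AC: "qgen pp (aa * cc)"
  shows "mero_eq_on half even_sum (\<lambda>(x, z). AW_series P x z)"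
proof -
  define aN aD where "aN = (\<lambda>w. aw_num (qpw P (fst w)) (qpw P (snd w)))" and "aD = (\<lambda>w. aw_den (qpw P (fst w)) (qpw P (snd w)))"
  note hol = aw_num_den_holomorphic[folded aN_def aD_def]
  have ne: "region \<inter> generic_set \<noteq> {}"
    using open_Int_closure_eq_empty[OF region(1), of generic_set] generic_set region(3) by auto
  have z: "aN w * even_den w - even_num w * aD w = 0" if w: "w \<in> half" for w
  proof (rule holomorphic2_identity_convex[where D = half and V = "region \<inter> generic_set"])
    show "holomorphic2_on (\<lambda>w. aN w * even_den w - even_num w * aD w) half"
      by (intro holomorphic2_diff holomorphic2_mult hol even_num_den_holomorphic)
    fix v assume v: "v \<in> region \<inter> generic_set"
    obtain x z where xz: "v = (x, z)" by (cases v)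
    have g: "generic (qpw P x) (qpw P z)" "generic (qpw P x) (1 / qpw P z)" using v generic_setD[of x z] by (auto simp: xz)
    have r: "(x, z) \<in> region" using v xz by simp
    have "aN v / aD v = even_sum v"
      using expansion[OF g AC region_norm[OF r]] by (simp add: even_sum_def xz Phi_ren_eq aN_def aD_def qpw_minus)
    then have "aN v / aD v = even_num v / even_den v" using even_sum_quotient even_den_nonzero v by auto
    moreover have "aD v \<noteq> 0" using generic_nonzero(2)[OF g(1)] by (simp add: aD_def xz)
    ultimately show "aN v * even_den v - even_num v * aD v = 0" using even_den_nonzero v by (simp add: field_simps)
  qed (use half region generic_set ne w in auto)
  show ?thesis
    unfolding mero_eq_on_def
  proof (rule exI[of _ "half \<inter> generic_set"], intro conjI ballI)
    show "half \<subseteq> closure (half \<inter> generic_set)" by (rule dense_open_Int[OF half(1) generic_set(2)])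
    fix v assume v: "v \<in> half \<inter> generic_set"
    obtain x z where xz: "v = (x, z)" by (cases v)
    have g: "generic (qpw P x) (qpw P z)" using v generic_setD[of x z] by (auto simp: xz)
    have "aD v \<noteq> 0" using generic_nonzero(2)[OF g] by (simp add: aD_def xz)
    moreover have "even_den v \<noteq> 0" using even_den_nonzero v by simp
    ultimately have "aN v / aD v = even_num v / even_den v" using z[of v] v by (simp add: field_simps)
    then have "aN v / aD v = even_sum v" using even_sum_quotient \<open>even_den v \<noteq> 0\<close> by simp
    then show "even_sum v = (\<lambda>(x, z). AW_series P x z) v"
      using AW_series_eq[OF _ g AC] v by (simp add: xz aN_def aD_def)
  qed (use half generic_set in auto)
qed

lemma mero_unique_even_sum:
  assumes AC: "qgen pp (aa * cc)" and F: "meromorphic2_on F UNIV" "mero_eq_on half F (\<lambda>(x, z). AW_series P x z)"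
  shows "mero_eq F even_sum"
proof -
  obtain v where "v \<in> generic_set" by (rule generic_set_ex)
  then have "even_den v \<noteq> 0" by (rule even_den_nonzero)
  moreover have "mero_eq_on half F even_sum" by (rule mero_eq_on_combine[OF F(2) even_sum_AW_series[OF AC]]) simp
  ultimately show ?thesis
    using mero_unique[OF even_num_den_holomorphic _ even_sum_quotient F(1) half(1,3)] by blast
qed

text \<open>\<open>even_sum\<close> satisfies the description of the Askey--Wilson function, so the
  choice in \<open>AW_fun\<close> has a witness, and by uniqueness any choice agrees with
  it.\<close>

lemma AW_fun_even_sum:
  assumes AC: "qgen pp (aa * cc)"
  shows "mero_eq (\<lambda>(x, z). AW_fun P x z) even_sum"
proof -
  let ?p = "\<lambda>F. meromorphic2_on F UNIV \<and> mero_eq_on half F (\<lambda>(x, z). AW_series P x z)"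
  have "?p even_sum" using even_sum_meromorphic even_sum_AW_series[OF AC] by blast
  then have "?p (SOME F. ?p F)" by (rule someI[of ?p])
  then have "mero_eq (SOME F. ?p F) even_sum" using mero_unique_even_sum[OF AC] by blast
  moreover have "(\<lambda>(x, z). AW_fun P x z) = (SOME F. ?p F)" by (simp add: AW_fun_def half_def fun_eq_iff)
  ultimately show ?thesis by simp
qed

text \<open>The condition defining \<open>half\<close> involves only \<open>z\<close>, and
  \<open>AW_series\<close> is even in \<open>x\<close>. So the reflected function satisfies the same
  description, and uniqueness applies.\<close>

lemma even_sum_even:
  assumes AC: "qgen pp (aa * cc)"
  shows "mero_eq (\<lambda>w. even_sum (flip1 w)) even_sum"
proof (rule mero_unique_even_sum[OF AC])
  obtain v where "v \<in> generic_set" by (rule generic_set_ex)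
  then have v: "even_den v \<noteq> 0" by (rule even_den_nonzero)
  have "holomorphic2_on (\<lambda>w. even_num (- fst w, snd w)) UNIV" "holomorphic2_on (\<lambda>w. even_den (- fst w, snd w)) UNIV"
    by (rule holomorphic2_pair[OF even_num_den_holomorphic(1)[of UNIV]], (intro holomorphic2_intros)+, simp)
       (rule holomorphic2_pair[OF even_num_den_holomorphic(2)[of UNIV]], (intro holomorphic2_intros)+, simp)
  moreover have "even_den (- fst (flip1 v), snd (flip1 v)) \<noteq> 0" using v by (simp add: flip1_def case_prod_unfold)
  moreover have "even_sum (flip1 w) = even_num (- fst w, snd w) / even_den (- fst w, snd w)" if "even_den (- fst w, snd w) \<noteq> 0" for w
    using even_sum_quotient[OF that] by (simp add: flip1_def case_prod_unfold)
  ultimately show "meromorphic2_on (\<lambda>w. even_sum (flip1 w)) UNIV" by (rule meromorphic2_quotient)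
  obtain V where V: "open V" "V \<subseteq> half" "half \<subseteq> closure V" "\<forall>v\<in>V. even_sum v = (\<lambda>(x, z). AW_series P x z) v"
    using even_sum_AW_series[OF AC] unfolding mero_eq_on_def by blast
  have hf: "flip1 w \<in> half \<longleftrightarrow> w \<in> half" for w by (simp add: half_eq flip1_def case_prod_unfold)
  show "mero_eq_on half (\<lambda>w. even_sum (flip1 w)) (\<lambda>(x, z). AW_series P x z)"
    unfolding mero_eq_on_def
  proof (rule exI[of _ "flip1 -` V"], intro conjI ballI)
    show "open (flip1 -` V)" by (rule open_vimage[OF V(1) flips(1)])
    show "flip1 -` V \<subseteq> half" using V(2) hf by (metis subsetD subsetI vimageD)
    show "half \<subseteq> closure (flip1 -` V)"
    proof
      fix w assume "w \<in> half"
      then have "flip1 w \<in> closure V" using V(3) hf by blast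
      then have "flip1 (flip1 w) \<in> flip1 ` closure V" by blast
      also have "flip1 ` closure V \<subseteq> closure (flip1 ` V)"
        by (rule image_closure_subset[OF continuous_on_subset[OF flips(1) subset_UNIV] closed_closure closure_subset])
      also have "closure (flip1 ` V) \<subseteq> closure (flip1 -` V)" by (rule closure_mono) (use flips(2) in auto)
      finally show "w \<in> closure (flip1 -` V)" by (simp only: flips(2))
    qed
    show "even_sum (flip1 v) = (\<lambda>(x, z). AW_series P x z) v" if "v \<in> flip1 -` V" for v
      using that V(4) by (auto simp: flip1_def case_prod_unfold AW_series_even)
  qed
qed

subsection \<open>Consequences of self-duality of the \<open>c\<close>-function\<close>

lemma qgen_er:
  assumes "\<And>n::int. u \<noteq> of_int n * step P"
  shows "qgen pp (of_real (er u))"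
  unfolding qgen_def
proof (intro conjI allI notI)
  fix m n assume "complex_of_real (er u) * pp ^ m = pp ^ n"
  then have "er (u + real m * step P) = er (real n * step P)"
    unfolding base_pow er_add by (metis of_real_eq_iff of_real_mult)
  then have "u + real m * step P = real n * step P" using im_tau by (simp add: er_def)
  then have "u = of_int (int n - int m) * step P" by (simp add: algebra_simps)
  then show False using assms by blast
qed simp

lemma th_nonzero: "qgen pp y \<Longrightarrow> th y \<noteq> 0"
  by (simp add: th_def Q_generic)

lemma th_er_zero: "th (of_real (er u)) = 0 \<Longrightarrow> \<exists>n::int. u = of_int n * step P"
  using qgen_er[of u] th_nonzero by blast

lemma dual_c_num_den:
  "aw.c_num (dual P) Z X = th (aa / X) * th (bb / X) * th (cc / X) * th (dd * Z / (tt * X))"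
  "aw.c_den (dual P) Z X = th (1 / X\<^sup>2) * th (aa * dd / tt * Z)"
  by (simp_all add: aw.c_num_def[OF aw_dual] aw.c_den_def[OF aw_dual] dual_params)

lemma c_fun_dual_eq: "c_fun (dual P) z x = aw.c_num (dual P) (qpw P z) (qpw P x) / (W_fun P x z * aw.c_den (dual P) (qpw P z) (qpw P x))"
  using aw.c_fun_eq[OF aw_dual, of z x] by (simp add: W_fun_dual)

text \<open>The factor \<open>W\<close> is common to both c-functions (\<open>W_fun_dual\<close>)
  and can be removed before cross-multiplying. The resulting identity holds at all non-zero
  \<open>X\<close>, \<open>Z\<close> because \<open>q ^ x\<close> takes every non-zero
  value.\<close>

lemma c_identity:
  assumes c: "mero_eq (\<lambda>(x, z). c_fun P x z) (\<lambda>(x, z). c_fun (dual P) z x)" and nz: "X \<noteq> 0" "Z \<noteq> 0"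
  shows "c_num X Z * aw.c_den (dual P) Z X = aw.c_num (dual P) Z X * c_den X Z"
proof -
  interpret d: aw "dual P" by (rule aw_dual)
  define W where "W = (\<lambda>w. W_fun P (fst w) (snd w))"
  have 1: "mero_eq (\<lambda>w. c_fun P (fst w) (snd w) * W w) (\<lambda>w. c_fun (dual P) (snd w) (fst w) * W w)"
    by (rule mero_eq_on_mono[OF c]) auto
  obtain x z where xz: "qpw P x = X" "qpw P z = Z" using qpw_surj nz by metis
  obtain v where v: "v \<in> generic_set" by (rule generic_set_ex)
  obtain v' where v': "v' \<in> d.generic_set" by (rule d.generic_set_ex)
  have n1: "c_den (qpw P (fst v)) (qpw P (snd v)) \<noteq> 0"
    using generic_setD[of "fst v" "snd v"] v generic_nonzero(3) by simp
  have n2: "d.c_den (qpw P (snd (prod.swap v'))) (qpw P (fst (prod.swap v'))) \<noteq> 0"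
    using d.generic_setD[of "fst v'" "snd v'"] v' d.generic_nonzero(3) by simp
  have "c_num (qpw P (fst (x, z))) (qpw P (snd (x, z))) * d.c_den (qpw P (snd (x, z))) (qpw P (fst (x, z))) =
      d.c_num (qpw P (snd (x, z))) (qpw P (fst (x, z))) * c_den (qpw P (fst (x, z))) (qpw P (snd (x, z)))"
  proof (rule mero_eq_cross[OF 1, where ?w1.0 = v and ?w2.0 = "prod.swap v'"])
    show "holomorphic2_on (\<lambda>w. c_num (qpw P (fst w)) (qpw P (snd w))) UNIV" "holomorphic2_on (\<lambda>w. c_den (qpw P (fst w)) (qpw P (snd w))) UNIV"
      by (intro c_num_den_holomorphic holomorphic2_intros)+
    show "holomorphic2_on (\<lambda>w. d.c_num (qpw P (snd w)) (qpw P (fst w))) UNIV" "holomorphic2_on (\<lambda>w. d.c_den (qpw P (snd w)) (qpw P (fst w))) UNIV"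
      using d.c_num_den_holomorphic[of snd UNIV fst] by (simp_all add: holomorphic2_intros)
    show "c_fun P (fst v) (snd v) * W v = c_num (qpw P (fst v)) (qpw P (snd v)) / c_den (qpw P (fst v)) (qpw P (snd v))" for v
      by (simp add: c_fun_eq W_def)
    show "c_fun (dual P) (snd v) (fst v) * W v = d.c_num (qpw P (snd v)) (qpw P (fst v)) / d.c_den (qpw P (snd v)) (qpw P (fst v))" for v
      by (simp add: c_fun_dual_eq W_def)
  qed (use n1 n2 in simp_all)
  then show ?thesis by (simp add: xz)
qed

text \<open>
  At \<open>X = 1\<close> and \<open>X = p^(1/2)\<close> the left-hand side of \<open>c_identity\<close> vanishes, so one of \<open>aa\<close>, \<open>cc\<close>
  is an even and one an odd power of \<open>p^(1/2)\<close>.  Hence the lower parameter \<open>aa * cc\<close> of the series for the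
  Askey--Wilson function is not an integral power of \<open>p\<close>.
\<close>

lemma self_dual_generic:
  assumes c: "mero_eq (\<lambda>(x, z). c_fun P x z) (\<lambda>(x, z). c_fun (dual P) z x)"
  shows "qgen pp (aa * cc)"
proof -
  define g where "g = er (step P / 2)"
  have g0: "g > 0" by (simp add: g_def)
  have pg: "pp = of_real g * of_real g" by (simp add: params g_def power2_eq_square)
  \<comment> \<open>\<open>Z = p ^ (1 / 4)\<close> makes \<open>1 / Z ^ 2\<close> a half-integral
    power of \<open>p\<close>, where the theta function does not vanish.\<close>
  define Z :: complex where "Z = of_real (er (step P / 4))"
  have Z: "Z \<noteq> 0" "th (1 / Z\<^sup>2) \<noteq> 0"
  proof -
    have "Z\<^sup>2 = of_real (er (step P / 2))"
      unfolding Z_def power2_eq_square of_real_mult[symmetric] er_add[symmetric] by simp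
    moreover have "qgen pp (of_real (er (step P / 2)))"
    proof (rule qgen_er)
      fix n :: int
      show "step P / 2 \<noteq> of_int n * step P"
      proof
        assume "step P / 2 = of_int n * step P"
        then have "1 = 2 * real_of_int n" using step_pos by (simp add: field_simps)
        then have "1 = 2 * n" by linarith
        then show False by presburger
      qed
    qed
    ultimately show "th (1 / Z\<^sup>2) \<noteq> 0" using th_nonzero qgen_inverse[of "Z\<^sup>2"] by simp
  qed (simp add: Z_def)
  have neg: "th y \<noteq> 0" if "y = of_real (- r)" "r > 0" for y r
    using that qgen_neg[of "- r"] th_nonzero by simp
  \<comment> \<open>A zero of \<open>th (1 / X ^ 2)\<close> kills the left-hand side of
    \<open>c_identity\<close>. On the right, the factors with \<open>bb\<close> or \<open>dd\<close>
    have negative arguments and cannot vanish, so one of those with \<open>aa\<close> and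
    \<open>cc\<close> must.\<close>
  have key: "th (aa / of_real r) = 0 \<or> th (cc / of_real r) = 0" if r: "r > 0" and z: "th (1 / (of_real r)\<^sup>2) = 0" for r
  proof -
    have "aw.c_num (dual P) Z (of_real r) * c_den (of_real r) Z = 0"
      using c_identity[OF c _ Z(1), of "of_real r"] r z by (simp add: dual_c_num_den)
    moreover have "th (bb / of_real r) \<noteq> 0"
      by (rule neg[of _ "er (kap P) / er (lam P) / r"]) (use r in \<open>simp_all add: params\<close>)
    moreover have "th (dd * Z / (tt * of_real r)) \<noteq> 0"
      by (rule neg[of _ "er (step P / 2) * er (ups P) / er (vsig P) * er (step P / 4) / (er (kap P) * er (ups P) * r)"]) (use r in \<open>simp_all add: params Z_def\<close>)
    moreover have "th (dd * of_real r) \<noteq> 0"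
      by (rule neg[of _ "er (step P / 2) * er (ups P) / er (vsig P) * r"]) (use r in \<open>simp_all add: params\<close>)
    ultimately show ?thesis using Z(2) by (simp add: dual_c_num_den c_den_def)
  qed
  define \<alpha> \<gamma> where "\<alpha> = kap P + lam P" and "\<gamma> = step P / 2 + ups P + vsig P"
  have ac: "aa / of_real g = of_real (er (\<alpha> - step P / 2))" "cc / of_real g = of_real (er (\<gamma> - step P / 2))" "aa = of_real (er \<alpha>)" "cc = of_real (er \<gamma>)"
    "aa * cc = of_real (er (\<alpha> + \<gamma>))"
    by (simp_all add: params \<alpha>_def \<gamma>_def er_add er_diff g_def)
  have "th (1 / (of_real 1)\<^sup>2) = 0" by (simp add: th_def Q_eq_0_iff qfree_def exI[of _ 0])
  from key[OF _ this] have "th (of_real (er \<alpha>)) = 0 \<or> th (of_real (er \<gamma>)) = 0" by (simp flip: ac)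
  then have 1: "(\<exists>n::int. \<alpha> = of_int n * step P) \<or> (\<exists>n::int. \<gamma> = of_int n * step P)" using th_er_zero by blast
  have "th (1 / (of_real g)\<^sup>2) = 0"
  proof -
    have "1 / (of_real g)\<^sup>2 * pp ^ 1 = 1" using g0 by (simp add: pg power2_eq_square)
    then have "Q (1 / (of_real g)\<^sup>2) = 0" unfolding Q_eq_0_iff qfree_def by blast
    then show ?thesis by (simp add: th_def)
  qed
  from key[OF g0 this] have "th (of_real (er (\<alpha> - step P / 2))) = 0 \<or> th (of_real (er (\<gamma> - step P / 2))) = 0" by (simp only: ac(1,2))
  then have 2: "(\<exists>n::int. \<alpha> - step P / 2 = of_int n * step P) \<or> (\<exists>n::int. \<gamma> - step P / 2 = of_int n * step P)" using th_er_zero by blast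
  have half_int: False if "step P / 2 = of_int n * step P" for n :: int
  proof -
    have "1 = 2 * real_of_int n" using that step_pos by (simp add: field_simps)
    then have "1 = 2 * n" by linarith
    then show False by presburger
  qed
  \<comment> \<open>The same exponent cannot be both an integral and a half-integral multiple of the
    step, so the alternatives \<open>1\<close> and \<open>2\<close> can only be satisfied
    crosswise.\<close>
  have no: "\<not> (u = of_int m * step P \<and> u - step P / 2 = of_int n * step P)" for u and m n :: int
  proof
    assume "u = of_int m * step P \<and> u - step P / 2 = of_int n * step P"
    then have "step P / 2 = of_int (m - n) * step P" by (simp add: algebra_simps)
    then show False by (rule half_int)
  qed
  have "\<exists>m n :: int. (\<alpha> = of_int m * step P \<and> \<gamma> - step P / 2 = of_int n * step P) \<or> (\<gamma> = of_int m * step P \<and> \<alpha> - step P / 2 = of_int n * step P)"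
    using 1 2 no by blast
  then obtain m n :: int where "\<alpha> + \<gamma> = of_int (m + n) * step P + step P / 2" by (auto simp: algebra_simps)
  then have "\<alpha> + \<gamma> \<noteq> of_int k * step P" for k :: int
    using half_int[of "k - m - n"] by (auto simp: algebra_simps)
  then show ?thesis unfolding ac(5) by (rule qgen_er)
qed

lemma self_dual_Phi_ren:
  assumes c: "mero_eq (\<lambda>(x, z). c_fun P x z) (\<lambda>(x, z). c_fun (dual P) z x)"
  shows "mero_eq (\<lambda>(x, z). Phi_ren P x z) (\<lambda>(x, z). Phi_ren (dual P) z x)"
  by (rule mero_eq_on_mono[OF c]) (auto simp: Phi_ren_def Phi_dual)

lemma self_dual_flip:
  assumes c: "mero_eq (\<lambda>(x, z). c_fun P x z) (\<lambda>(x, z). c_fun (dual P) z x)"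
  shows "mero_eq (\<lambda>(x, z). Phi_ren P (- x) z) (\<lambda>(x, z). Phi_ren P x (- z))"
proof -
  interpret d: aw "dual P" by (rule aw_dual)
  define f f' where "f = (\<lambda>(x, z). Phi_ren P x z)" and "f' = (\<lambda>(x, z). Phi_ren (dual P) z x)"
  have ff: "mero_eq f f'" unfolding f_def f'_def by (rule self_dual_Phi_ren[OF c])
  have "mero_eq (\<lambda>w. (\<lambda>(x, z). c_fun P x z) (prod.swap w)) (\<lambda>w. (\<lambda>(x, z). c_fun (dual P) z x) (prod.swap w))"
    by (rule mero_eq_swap[OF c])
  then have c': "mero_eq (\<lambda>(x, z). c_fun (dual P) x z) (\<lambda>(x, z). c_fun (dual (dual P)) z x)"
    by (rule mero_eq_on_mono) auto
  have 1: "mero_eq (\<lambda>w. even_sum (flip1 w)) even_sum" by (rule even_sum_even[OF self_dual_generic[OF c]])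
  have 2: "mero_eq (\<lambda>w. d.even_sum (flip1 (prod.swap w))) (\<lambda>w. d.even_sum (prod.swap w))"
    by (rule mero_eq_swap[OF d.even_sum_even[OF d.self_dual_generic[OF c']]])
  have 3: "mero_eq (\<lambda>w. f (flip1 w)) (\<lambda>w. f' (flip1 w))" by (rule mero_eq_flip1[OF ff])
  have 4: "mero_eq (\<lambda>w. f (flip2 w)) (\<lambda>w. f' (flip2 w))" by (rule mero_eq_flip2[OF ff])
  have 5: "mero_eq (\<lambda>w. f (flip1 (flip2 w))) (\<lambda>w. f' (flip1 (flip2 w)))" by (rule mero_eq_flip2[OF 3])
  have e1: "mero_eq (\<lambda>w. f w + f (flip1 w)) (\<lambda>w. f' w + f' (flip1 w))"
    by (rule mero_eq_on_combine[OF ff 3]) simp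
  have e2: "mero_eq (\<lambda>w. f (flip2 w) + f (flip1 (flip2 w))) (\<lambda>w. f' (flip2 w) + f' (flip1 (flip2 w)))"
    by (rule mero_eq_on_combine[OF 4 5]) simp
  have e3: "mero_eq (\<lambda>w. f' w + f' (flip1 w)) (\<lambda>w. f' (flip2 w) + f' (flip1 (flip2 w)))"
    by (rule mero_eq_on_mono[OF 2]) (auto simp: d.even_sum_def f'_def flip1_def flip2_def case_prod_unfold)
  have e4: "mero_eq (\<lambda>w. f w + f (flip1 w)) (\<lambda>w. f' (flip2 w) + f' (flip1 (flip2 w)))"
    by (rule mero_eq_on_combine[OF e1 e3]) simp
  have e5: "mero_eq (\<lambda>w. f w + f (flip1 w)) (\<lambda>w. f (flip2 w) + f (flip1 (flip2 w)))"
    by (rule mero_eq_on_combine[OF e2 e4]) simp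
  have e6: "mero_eq (\<lambda>w. f (flip1 w) + f (flip1 (flip2 w))) (\<lambda>w. f w + f (flip2 w))"
    by (rule mero_eq_on_mono[OF 1]) (auto simp: even_sum_def f_def flip1_def flip2_def case_prod_unfold)
  have "mero_eq (\<lambda>w. f (flip1 w)) (\<lambda>w. f (flip2 w))"
  proof (rule mero_eq_on_combine[OF e5 e6])
    fix w assume "f w + f (flip1 w) = f (flip2 w) + f (flip1 (flip2 w))" "f (flip1 w) + f (flip1 (flip2 w)) = f w + f (flip2 w)"
    \<comment> \<open>Adding the two equations cancels \<open>f w\<close> and
      \<open>f (flip1 (flip2 w))\<close>.\<close>
    then have "2 * f (flip1 w) = 2 * f (flip2 w)" by algebra
    then show "f (flip1 w) = f (flip2 w)" by simp
  qed
  then show ?thesis by (rule mero_eq_on_mono) (auto simp: f_def flip1_def flip2_def)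
qed

lemma self_dual_AW_fun:
  assumes c: "mero_eq (\<lambda>(x, z). c_fun P x z) (\<lambda>(x, z). c_fun (dual P) z x)"
  shows "mero_eq (\<lambda>(x, z). AW_fun P x z) (\<lambda>(x, z). Phi_ren P x z + Phi_ren P (- x) z)"
  by (rule mero_eq_on_combine[OF AW_fun_even_sum[OF self_dual_generic[OF c]] self_dual_flip[OF c]]) (auto simp: even_sum_def)

end

context qbase
begin

section \<open>Half-integral parameters\<close>

text \<open>Iteration of \<open>th (x * q) = - th x / x\<close> in both directions. For
  \<open>k \<ge> 0\<close> the exponents \<open>2 * i\<close> of \<open>g\<close> with
  \<open>i < k\<close> add up to \<open>k * (k - 1)\<close>.\<close>

lemma th_powi:
  assumes g: "g * g = q" and y: "y \<noteq> 0"
  shows "th (y * g powi (2 * k)) = (-1) powi k * g powi (- (k * (k - 1))) * y powi (- k) * th y"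
proof -
  have g0: "g \<noteq> 0" using g q_nonzero by auto
  define T where "T = (\<lambda>k. (-1) powi k * g powi (- (k * (k - 1))) * y powi (- k) * th y)"
  have step: "th (y * g powi (2 * (k + 1))) = T (k + 1) \<longleftrightarrow> th (y * g powi (2 * k)) = T k" for k
  proof -
    have "g powi (2 * (k + 1)) = g powi (2 * k) * (g * g)"
      using g0 by (simp add: distrib_left power_int_add power2_eq_square)
    then have "th (y * g powi (2 * (k + 1))) = - th (y * g powi (2 * k)) / (y * g powi (2 * k))"
      using th_mult[of "y * g powi (2 * k)"] g0 y by (simp add: g mult.assoc)
    moreover have "T (k + 1) = - T k / (y * g powi (2 * k))"
    proof -
      have "- ((k + 1) * (k + 1 - 1)) = - (k * (k - 1)) - 2 * k" by (simp add: algebra_simps)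
      then have 1: "g powi (- ((k + 1) * (k + 1 - 1))) = g powi (- (k * (k - 1))) / g powi (2 * k)"
        using power_int_diff[of g "- (k * (k - 1))" "2 * k"] g0 by simp
      have "- (k + 1) = - k - 1" by simp
      then have 2: "y powi (- (k + 1)) = y powi (- k) / y" using power_int_diff[of y "- k" 1] y by simp
      have 3: "(-1 :: complex) powi (k + 1) = - ((-1) powi k)" by (simp add: power_int_add)
      show ?thesis unfolding T_def 1 2 3 by simp
    qed
    ultimately show ?thesis using g0 y by simp
  qed
  have "th (y * g powi (2 * k)) = T k"
  proof (induction k rule: int_induct[where k = 0])
    case base
    show ?case by (simp add: T_def)
  next
    case (step1 i)
    then show ?case using step[of i] by simp
  next
    case (step2 i)
    then show ?case using step[of "i - 1"] by simp
  qed
  then show ?thesis by (simp add: T_def)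
qed

lemma th_pair_even:
  assumes g: "g * g = q" and w: "w \<noteq> 0"
  shows "th (w * g powi (2 * a)) * th (w * g powi (2 * c + 1)) =
    (-1) powi (a + c) * g powi (- (a * (a - 1) + c * c)) * w powi (- (a + c)) * (th w * th (w * g))"
proof -
  have g0: "g \<noteq> 0" using g q_nonzero by auto
  have wg: "w * g powi (2 * c + 1) = (w * g) * g powi (2 * c)" using g0 by (simp add: power_int_add)
  have 1: "th (w * g powi (2 * c + 1)) = (-1) powi c * g powi (- (c * (c - 1))) * (w * g) powi (- c) * th (w * g)"
    unfolding wg by (rule th_powi[OF g]) (use w g0 in simp)
  have 2: "g powi (- (a * (a - 1) + c * c)) = g powi (- (a * (a - 1))) * (g powi (- (c * (c - 1))) * g powi (- c))"
    using g0 by (simp add: algebra_simps flip: power_int_add)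
  have 3: "w powi (- (a + c)) = w powi (- a) * w powi (- c)" using w by (simp flip: power_int_add)
  have 4: "(-1 :: complex) powi (a + c) = (-1) powi a * (-1) powi c" by (simp add: power_int_add)
  show ?thesis unfolding th_powi[OF g w] 1 2 3 4 power_int_mult_distrib by (simp only: mult_ac)
qed

text \<open>\<open>A\<close> and \<open>C\<close> have opposite parity, so by \<open>th_powi\<close>
  one factor reduces to \<open>th w\<close> and the other to \<open>th (w * g)\<close>. Giving
  \<open>e\<close> through \<open>4 * e\<close> yields one formula, symmetric in \<open>A\<close>
  and \<open>C\<close>, for both cases.\<close>

lemma th_pair:
  assumes g: "g * g = q" and w: "w \<noteq> 0" and N: "A + C = 2 * N + 1"
  obtains e where "4 * e = A * A + C * C - 2 * A - 2 * C + 1"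
    "th (w * g powi A) * th (w * g powi C) = (-1) powi N * g powi (- e) * w powi (- N) * (th w * th (w * g))"
proof (cases "even A")
  case True
  then obtain a where a: "A = 2 * a" by blast
  have c: "C = 2 * (N - a) + 1" using N a by simp
  show thesis
    using that[of "a * (a - 1) + (N - a) * (N - a)"] th_pair_even[OF g w, of a "N - a"] by (simp add: a c algebra_simps)
next
  case False
  then obtain c where c: "A = 2 * c + 1" by (rule oddE)
  have a: "C = 2 * (N - c)" using N c by simp
  show thesis
    using that[of "(N - c) * (N - c - 1) + c * c"] th_pair_even[OF g w, of "N - c" c] by (simp add: a c algebra_simps)
qed

text \<open>In the product for \<open>Q (x ^ 2)\<close>, even indices give
  \<open>(1 - x * q ^ n) * (1 + x * q ^ n)\<close> and odd ones the same with \<open>x * g\<close>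
  in place of \<open>x\<close>. The subsequence of partial products of even length realizes
  this.\<close>

lemma th_square:
  assumes g: "g * g = q"
  shows "th (w\<^sup>2) = th w * th (w * g) * (th (- w) * th (- w * g))"
proof (cases "w = 0")
  case True
  then show ?thesis by (simp add: th_def)
next
  case False
  have g0: "g \<noteq> 0" using g q_nonzero by auto
  have Qsq: "Q (x\<^sup>2) = Q x * Q (x * g) * (Q (- x) * Q (- x * g))" for x
  proof (rule LIMSEQ_unique)
    have "P (x\<^sup>2) (2 * n) = P x n * P (x * g) n * (P (- x) n * P (- x * g) n)" for n
    proof (induction n)
      case (Suc n)
      have "q ^ Suc (2 * n) = g\<^sup>2 * (q ^ n)\<^sup>2" "q ^ (2 * n) = (q ^ n)\<^sup>2"
        by (simp_all add: power2_eq_square g mult_2 power_add)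
      then have "(1 - x\<^sup>2 * q ^ (2 * n)) * (1 - x\<^sup>2 * q ^ Suc (2 * n)) =
          (1 - x * q ^ n) * (1 - x * g * q ^ n) * ((1 - - x * q ^ n) * (1 - - x * g * q ^ n))"
        by (simp add: algebra_simps power2_eq_square)
      then show ?case using Suc by (simp add: qpoch_def mult_ac)
    qed (simp add: qpoch_def)
    moreover have "(\<lambda>n. P x n * P (x * g) n * (P (- x) n * P (- x * g) n)) \<longlonglongrightarrow> Q x * Q (x * g) * (Q (- x) * Q (- x * g))"
      by (intro tendsto_mult P_tendsto_Q)
    ultimately show "(\<lambda>n. P (x\<^sup>2) (2 * n)) \<longlonglongrightarrow> Q x * Q (x * g) * (Q (- x) * Q (- x * g))" by simp
    show "(\<lambda>n. P (x\<^sup>2) (2 * n)) \<longlonglongrightarrow> Q (x\<^sup>2)"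
      using LIMSEQ_subseq_LIMSEQ[OF P_tendsto_Q, of "\<lambda>n. 2 * n"] by (simp add: o_def strict_mono_def)
  qed
  have r: "q / w\<^sup>2 = (g / w)\<^sup>2" "q / w = g / w * g" "q / (w * g) = g / w" "q / (- w) = - (g / w) * g" "q / (- w * g) = - (g / w)"
    using False g0 by (simp_all add: g[symmetric] field_simps power2_eq_square)
  show ?thesis unfolding th_def r Qsq by (simp only: mult_ac)
qed

text \<open>The factors with the same sign of \<open>u\<close> have exponents of opposite parity and
  combine by \<open>th_pair\<close>; \<open>th_square\<close> joins the two pairs. The outcome
  depends on the \<open>k\<close>'s only through \<open>N\<close>, \<open>E\<close> and
  \<open>k1 + k4\<close>, all unchanged when \<open>k2\<close> and \<open>k3\<close> are
  exchanged.\<close>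

lemma th_quadruple:
  assumes g: "g * g = q" and u: "u \<noteq> 0" and N: "k1 + k2 + k3 + k4 = 2 * N" and E: "2 * E = k1 * k1 + k2 * k2 + k3 * k3 + k4 * k4 - 2 * k1"
  shows "th (u * g powi (k1 + k2)) * th (- u * g powi (k1 - k2)) * th (u * g powi (1 + k3 + k4)) * th (- u * g powi (1 - k3 + k4)) =
    (-1) powi N * g powi (- E) * u powi (- (k1 + k4)) * th (u\<^sup>2)"
proof -
  have g0: "g \<noteq> 0" using g q_nonzero by auto
  define M where "M = k1 + k4 - N"
  have "k1 + k2 + (1 + k3 + k4) = 2 * N + 1" "k1 - k2 + (1 - k3 + k4) = 2 * M + 1" using N by (auto simp: M_def)
  then obtain e1 e2 where e: "4 * e1 = (k1 + k2) * (k1 + k2) + (1 + k3 + k4) * (1 + k3 + k4) - 2 * (k1 + k2) - 2 * (1 + k3 + k4) + 1"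
      "4 * e2 = (k1 - k2) * (k1 - k2) + (1 - k3 + k4) * (1 - k3 + k4) - 2 * (k1 - k2) - 2 * (1 - k3 + k4) + 1"
    and 1: "th (u * g powi (k1 + k2)) * th (u * g powi (1 + k3 + k4)) = (-1) powi N * g powi (- e1) * u powi (- N) * (th u * th (u * g))"
    and 2: "th (- u * g powi (k1 - k2)) * th (- u * g powi (1 - k3 + k4)) = (-1) powi M * g powi (- e2) * (- u) powi (- M) * (th (- u) * th (- u * g))"
    using th_pair[OF g u, of "k1 + k2" "1 + k3 + k4" N] th_pair[OF g, of "- u" "k1 - k2" "1 - k3 + k4" M] u
    by (metis neg_equal_0_iff_equal)
  have "4 * e1 + 4 * e2 = 2 * (2 * E)" unfolding e E by (simp add: algebra_simps)
  then have E': "- E = - e1 + - e2" by simp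
  have u': "(- u) powi (- M) = (-1) powi (- M) * u powi (- M)" using power_int_mult_distrib[of "-1" u "- M"] by simp
  have m: "(-1 :: complex) powi M * (-1) powi (- M) = 1" using power_int_add[of "-1 :: complex" M "- M"] by simp
  have k: "- (k1 + k4) = - N + - M" by (simp add: M_def)
  have "th (u * g powi (k1 + k2)) * th (- u * g powi (k1 - k2)) * th (u * g powi (1 + k3 + k4)) * th (- u * g powi (1 - k3 + k4)) =
    (th (u * g powi (k1 + k2)) * th (u * g powi (1 + k3 + k4))) * (th (- u * g powi (k1 - k2)) * th (- u * g powi (1 - k3 + k4)))"
    by (simp only: mult_ac)
  also have "\<dots> = (-1) powi N * (g powi (- e1) * g powi (- e2)) * (u powi (- N) * u powi (- M)) * (th u * th (u * g) * (th (- u) * th (- u * g))) *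
     ((-1) powi M * (-1) powi (- M))"
    unfolding 1 2 u' by (simp only: mult_ac)
  also have "\<dots> = (-1) powi N * g powi (- E) * u powi (- (k1 + k4)) * th (u\<^sup>2)"
    unfolding m th_square[OF g, of u] k E' using power_int_add[of g "- e1" "- e2"] power_int_add[of u "- N" "- M"] g0 u by simp
  finally show ?thesis .
qed

end

context aw
begin

lemma qpw_powi: "qpw P (of_int n * u) = qpw P u powi n"
  unfolding qpw_def exp_power_int by (simp add: mult_ac)

text \<open>Each side contains a \<open>th_quadruple\<close>, in \<open>1 / Z\<close> on the left
  and in \<open>1 / X\<close> on the right, with \<open>k2\<close> and \<open>k3\<close> exchanged.
  Each quadruple yields the theta function of a square that the other side contains as well, and the
  monomials \<open>u powi (- M)\<close> and \<open>v powi (- M)\<close> are matched by the remaining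
  pair of theta factors through \<open>t3\<close>.\<close>

lemma half_integral_identity:
  assumes k: "kap P = of_int k1 * (step P / 2)" "lam P = of_int k2 * (step P / 2)" "ups P = of_int k3 * (step P / 2)" "vsig P = of_int k4 * (step P / 2)"
    and even: "even (k1 + k2 + k3 + k4)" and nz: "X \<noteq> 0" "Z \<noteq> 0"
  shows "c_num X Z * aw.c_den (dual P) Z X = aw.c_num (dual P) Z X * c_den X Z"
proof -
  define g where "g = qpw P (of_real (step P / 2))"
  have g0: "g \<noteq> 0" by (simp add: g_def)
  have gg: "g * g = pp" unfolding g_def qpw_add[symmetric] by (simp flip: of_real_add)
  have gp: "qpw P (of_real (of_int n * (step P / 2))) = g powi n" for n
    unfolding g_def of_real_mult of_real_of_int_eq by (rule qpw_powi)
  have params': "aa = g powi (k1 + k2)" "bb = - (g powi (k1 - k2))" "cc = g powi (1 + k3 + k4)" "dd = - (g powi (1 + k3 - k4))" "tt = g powi (k1 + k3)"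
    unfolding aw_a_def aw_b_def aw_c_def aw_d_def dual_simps qpw_dual gp[symmetric] k
    by (simp_all add: ring_distribs add_divide_distrib diff_divide_distrib)
  obtain N where N: "k1 + k2 + k3 + k4 = 2 * N" using even by blast
  have "even (k1 * k1 + k2 * k2 + k3 * k3 + k4 * k4 - 2 * k1)" using even by auto
  then obtain E where E: "2 * E = k1 * k1 + k2 * k2 + k3 * k3 + k4 * k4 - 2 * k1" by (metis dvd_def)
  define u v where "u = 1 / X" and "v = 1 / Z"
  have uv: "u \<noteq> 0" "v \<noteq> 0" using nz by (simp_all add: u_def v_def)
  define M where "M = k1 + k4"
  have add: "g powi i * g powi j = g powi (i + j)" and sub: "g powi i / g powi j = g powi (i - j)" for i j
    using g0 by (simp_all add: power_int_add power_int_diff)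
  have bt: "aa * bb / tt = - (g powi (k1 - k3))" "aa * cc / tt = g powi (1 + k2 + k4)" "aa * dd / tt = - (g powi (1 + k2 - k4))" "dd / tt = - (g powi (1 - M))"
    unfolding params' by (simp_all add: add sub M_def algebra_simps)
  have args: "aa / X = u * g powi (k1 + k2)" "bb / X = - u * g powi (k1 - k2)" "cc / X = u * g powi (1 + k3 + k4)"
    "tt / Z = v * g powi (k1 + k3)" "aa * bb / (tt * Z) = - v * g powi (k1 - k3)" "aa * cc / (tt * Z) = v * g powi (1 + k2 + k4)"
    "1 / X\<^sup>2 = u\<^sup>2" "1 / Z\<^sup>2 = v\<^sup>2"
    using bt params' by (simp_all add: u_def v_def power_one_over divide_divide_eq_left[symmetric] del: divide_divide_eq_left)
  define y where "y = dd * X / (tt * Z)"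
  have y: "y = - (g powi (1 - M)) * (v / u)" "y \<noteq> 0" using bt(4) nz g0 by (simp_all add: y_def u_def v_def field_simps)
  \<comment> \<open>The reflection of \<open>u\<close> to \<open>pp / u\<close> turns this factor of
    \<open>c_den\<close> into the missing fourth member of the quadruple in \<open>1 / X\<close>;
    \<open>t2\<close> does the same for \<open>1 / Z\<close>.\<close>
  have t1: "th (dd * X) = th (- u * g powi (1 - k3 + k4))"
  proof (rule th_swap)
    have "dd * X * (- u * g powi (1 - k3 + k4)) = g powi (1 + k3 - k4) * g powi (1 - k3 + k4)" using nz by (simp add: params' u_def)
    then show "dd * X * (- u * g powi (1 - k3 + k4)) = pp" unfolding add by (simp add: gg[symmetric] power2_eq_square)
  qed
  have t2: "th (aa * dd / tt * Z) = th (- v * g powi (1 - k2 + k4))"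
  proof (rule th_swap)
    have "aa * dd / tt * Z * (- v * g powi (1 - k2 + k4)) = g powi (1 + k2 - k4) * g powi (1 - k2 + k4)" using nz unfolding bt by (simp add: v_def)
    then show "aa * dd / tt * Z * (- v * g powi (1 - k2 + k4)) = pp" unfolding add by (simp add: gg[symmetric] power2_eq_square)
  qed
  \<comment> \<open>After the same reflection the factor is \<open>th\<close> at
    \<open>y * g powi (2 * M)\<close>, an even power of \<open>g\<close> away from the factor
    \<open>th y\<close> of the other side, so \<open>th_powi\<close> applies.\<close>
  have t3: "th (dd * Z / (tt * X)) = (u / v) powi M * th y"
  proof -
    have "dd * Z / (tt * X) * (y * g powi (2 * M)) = (dd / tt) * (dd / tt) * g powi (2 * M)" using nz by (simp add: y_def)
    also have "\<dots> = g powi (1 - M + (1 - M) + 2 * M)" unfolding bt by (simp only: minus_mult_minus add)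
    also have "\<dots> = pp" by (simp add: gg[symmetric] power2_eq_square)
    finally have "th (dd * Z / (tt * X)) = th (y * g powi (2 * M))" by (rule th_swap)
    also have "\<dots> = (-1) powi M * g powi (- (M * (M - 1))) * y powi (- M) * th y" by (rule th_powi[OF gg y(2)])
    also have "y powi (- M) = (-1) powi (- M) * g powi ((1 - M) * (- M)) * (u / v) powi M"
    proof -
      have "y = - 1 * g powi (1 - M) * (v / u)" using y(1) by simp
      then have "y powi (- M) = (- 1) powi (- M) * (g powi (1 - M)) powi (- M) * (v / u) powi (- M)"
        by (simp only: power_int_mult_distrib)
      moreover have "(v / u) powi (- M) = (u / v) powi M" by (simp add: power_int_minus power_int_divide_distrib)
      ultimately show ?thesis by (simp only: power_int_mult)
    qed
    also have "(-1) powi M * g powi (- (M * (M - 1))) * ((-1) powi (- M) * g powi ((1 - M) * (- M)) * (u / v) powi M) * th y =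
      ((-1) powi M * (-1) powi (- M)) * (g powi (- (M * (M - 1))) * g powi ((1 - M) * (- M))) * ((u / v) powi M * th y)"
      by (simp only: mult_ac)
    also have "(-1 :: complex) powi M * (-1) powi (- M) = 1" using power_int_add[of "-1 :: complex" M "- M"] by simp
    also have "g powi (- (M * (M - 1))) * g powi ((1 - M) * (- M)) = 1" unfolding add by (simp add: algebra_simps)
    finally show ?thesis by simp
  qed
  have E2: "2 * E = k1 * k1 + k3 * k3 + k2 * k2 + k4 * k4 - 2 * k1" and N2: "k1 + k3 + k2 + k4 = 2 * N" using E N by simp_all
  note 1 = th_quadruple[OF gg uv(1) N E, folded M_def] and 2 = th_quadruple[OF gg uv(2) N2 E2, folded M_def]
  have uvM: "u powi (- M) * (u / v) powi M = v powi (- M)"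
    using uv by (simp add: power_int_divide_distrib power_int_minus inverse_eq_divide)
  have "c_num X Z * aw.c_den (dual P) Z X = (th (v * g powi (k1 + k3)) * th (- v * g powi (k1 - k3)) * th (v * g powi (1 + k2 + k4)) * th (- v * g powi (1 - k2 + k4))) * (th y * th (u\<^sup>2))"
    unfolding c_num_def dual_c_num_den args t2 y_def[symmetric] by (simp only: mult_ac)
  also have "\<dots> = (-1) powi N * g powi (- E) * (u powi (- M) * (u / v) powi M) * th (v\<^sup>2) * (th y * th (u\<^sup>2))" unfolding 2 uvM ..
  also have "\<dots> = ((-1) powi N * g powi (- E) * u powi (- M) * th (u\<^sup>2)) * ((u / v) powi M * th y) * th (v\<^sup>2)" by (simp only: mult_ac)
  also have "\<dots> = aw.c_num (dual P) Z X * c_den X Z"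
    unfolding 1[symmetric] t3[symmetric] c_den_def dual_c_num_den args t1 by (simp only: mult_ac)
  finally show ?thesis .
qed

lemma half_integral_self_dual:
  assumes k: "kap P = of_int k1 * (step P / 2)" "lam P = of_int k2 * (step P / 2)" "ups P = of_int k3 * (step P / 2)" "vsig P = of_int k4 * (step P / 2)"
    and even: "even (k1 + k2 + k3 + k4)"
  shows "mero_eq (\<lambda>(x, z). c_fun P x z) (\<lambda>(x, z). c_fun (dual P) z x)"
proof -
  interpret d: aw "dual P" by (rule aw_dual)
  note ds = dense_involution[OF flips(5) swap_swap d.generic_set]
  show ?thesis
    unfolding mero_eq_on_def
  proof (rule exI[of _ "generic_set \<inter> prod.swap -` d.generic_set"], intro conjI ballI)
    show "open (generic_set \<inter> prod.swap -` d.generic_set)" by (intro open_Int generic_set ds)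
    show "UNIV \<subseteq> closure (generic_set \<inter> prod.swap -` d.generic_set)" by (rule dense_Int) (use generic_set ds in auto)
    fix w assume w: "w \<in> generic_set \<inter> prod.swap -` d.generic_set"
    obtain x z where xz: "w = (x, z)" by (cases w)
    have "c_den (qpw P x) (qpw P z) \<noteq> 0" using w generic_setD(1)[of x z] generic_nonzero(3) by (simp add: xz)
    moreover have "d.c_den (qpw P z) (qpw P x) \<noteq> 0" using w d.generic_setD(1)[of z x] d.generic_nonzero(3) by (simp add: xz)
    ultimately show "(\<lambda>(x, z). c_fun P x z) w = (\<lambda>(x, z). c_fun (dual P) z x) w"
      using half_integral_identity[OF k even, of "qpw P x" "qpw P z"]
      by (simp add: xz c_fun_eq c_fun_dual_eq field_simps)
  qed simp
qed

end

lemma half_of_int_in_Ints: "real_of_int n / 2 \<in> \<int> \<longleftrightarrow> even n"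
proof
  assume "real_of_int n / 2 \<in> \<int>"
  then obtain m where "real_of_int n / 2 = of_int m" by (auto elim: Ints_cases)
  then have "real_of_int n = of_int (2 * m)" by simp
  then have "n = 2 * m" by (simp only: of_int_eq_iff)
  then show "even n" by simp
qed (auto elim!: evenE)

theorem proposition3p1:
  fixes \<tau> :: complex and s \<kappa> lambda \<upsilon> varsigma :: real
  assumes "Re \<tau> = 0" and "Im \<tau> > 0" and "s \<in> \<rat>" and "s > 0"
  defines "P \<equiv> \<lparr>tau = \<tau>, step = s, kap = \<kappa>, lam = lambda, ups = \<upsilon>, vsig = varsigma\<rparr>"
  shows "((\<forall>t \<in> set [\<kappa>, lambda, \<upsilon>, varsigma]. \<exists>n::int. t / s = of_int n / 2) \<and>
          even (length (filter (\<lambda>t. t / s \<in> \<int>) [\<kappa>, lambda, \<upsilon>, varsigma])) \<longrightarrow>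
          mero_eq (\<lambda>(x, z). c_fun P x z) (\<lambda>(x, z). c_fun (dual P) z x)) \<and>
         (mero_eq (\<lambda>(x, z). c_fun P x z) (\<lambda>(x, z). c_fun (dual P) z x) \<longrightarrow>
          mero_eq (\<lambda>(x, z). Phi_ren P x z) (\<lambda>(x, z). Phi_ren (dual P) z x) \<and>
          mero_eq (\<lambda>(x, z). Phi_ren P (- x) z) (\<lambda>(x, z). Phi_ren P x (- z)) \<and>
          mero_eq (\<lambda>(x, z). AW_fun P x z) (\<lambda>(x, z). Phi_ren P x z + Phi_ren P (- x) z))"
proof -
  interpret aw P
    using assms by unfold_locales (simp_all add: P_def)
  have i: "mero_eq (\<lambda>(x, z). c_fun P x z) (\<lambda>(x, z). c_fun (dual P) z x)"
    if h: "\<forall>t \<in> set [\<kappa>, lambda, \<upsilon>, varsigma]. \<exists>n::int. t / s = of_int n / 2"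
      "even (length (filter (\<lambda>t. t / s \<in> \<int>) [\<kappa>, lambda, \<upsilon>, varsigma]))"
  proof -
    obtain k1 k2 k3 k4 :: int where k: "\<kappa> / s = of_int k1 / 2" "lambda / s = of_int k2 / 2" "\<upsilon> / s = of_int k3 / 2" "varsigma / s = of_int k4 / 2"
      using h(1) by auto
    \<comment> \<open>Integers among the quotients correspond to even \<open>k\<close>'s. Of four
      numbers an even number are even exactly if an even number are odd, that is, if the sum is
      even.\<close>
    have "even (k1 + k2 + k3 + k4)"
      using h(2) by (simp add: k half_of_int_in_Ints split: if_splits)
    moreover have "kap P = of_int k1 * (step P / 2)" "lam P = of_int k2 * (step P / 2)" "ups P = of_int k3 * (step P / 2)" "vsig P = of_int k4 * (step P / 2)"
      using k \<open>s > 0\<close> by (simp_all add: P_def field_simps)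
    ultimately show ?thesis by (intro half_integral_self_dual)
  qed
  show ?thesis using i self_dual_Phi_ren self_dual_flip self_dual_AW_fun by blast
qed

end
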